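(* Let $R$ be an $h$-local domain with field of fractions $Q$. Let $\Lambda$ be a locally semiperfect torsion-free $R$-algebra such that $\Lambda_Q=\Lambda\otimes_RQ$ is simple artinian. Let $\Phi\colon V^*(\Lambda)\to\prod_{\mathfrak m}V^*(\Lambda_{\mathfrak m})$, $\Phi([P])=([P_{\mathfrak m}])_{\mathfrak m}$, where $\mathfrak m$ runs over all maximal ideals of $R$. Then $\Phi(B(\Lambda))\subseteq\prod_{\mathfrak m}B(\Lambda_{\mathfrak m})$. Moreover, if $[P]$ and $[P']$ are two elements of $B(\Lambda)$, then $\Phi([P])=\Phi([P'])$ if and only if $[P]=[P']$.
   Context: Rings are associative with $1$; modules are right modules. A commutative domain $R$ is $h$-local if every non-zero element of $R$ is contained in only finitely many maximal ideals and every non-zero prime ideal of $R$ is contained in a unique maximal ideal. An $R$-algebra $\Lambda$ is torsion-free if it is torsion-free as an $R$-module; it is locally semiperfect if $\Lambda_{\mathfrak m}=\Lambda\otimes_R R_{\mathfrak m}$ is a semiperfect ring for every maximal ideal $\mathfrak m$ of $R$. For a $\Lambda$-module $P$, $P_{\mathfrak m}=P\otimes_RR_{\mathfrak m}$. For a ring $\Lambda$, $V^*(\Lambda)$ is the monoid of isomorphism classes $[P]$ of countably generated projective right $\Lambda$-modules under direct sum. The trace of a right $\Lambda$-module $M$ is $\mathrm{Tr}_\Lambda(M)=\sum_{f\in\mathrm{Hom}_\Lambda(M,\Lambda)}f(M)$. A countably generated projective right $\Lambda$-module $P$ is relatively big if there is a countably generated projective right $\Lambda$-module $P'$ with trace ideal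 $J$ such that $P\oplus P'^{(\omega)}\cong P$ and $P/PJ$ is finitely generated. $B(\Lambda)\subseteq V^*(\Lambda)$ is the set of isomorphism classes of relatively big projective modules that are not finitely generated. *)

theory Defs
  imports "HOL-Algebra.QuotRing" "HOL-Algebra.Module" "HOL-Algebra.Free_Abelian_Groups" "HOL-Library.Countable_Set"
begin

section \<open>Right modules over a ring\<close>

text \<open>As in \<open>HOL-Algebra.Module\<close>, a module is a ring record of which only the additive part is
  used; the multiplication and the unit of the record carry no meaning.\<close>

record ('a, 'm) rmodule = "'m ring" +
  ract :: "['m, 'a] \<Rightarrow> 'm" (infixl \<open>\<triangleleft>\<index>\<close> 70)

locale right_module = L?: ring L + M?: abelian_group M
  for L :: "('a, 'x) ring_scheme" (structure) and M :: "('a, 'm, 'y) rmodule_scheme" (structure) +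
  assumes ract_closed: "\<lbrakk>x \<in> carrier M; a \<in> carrier L\<rbrakk> \<Longrightarrow> x \<triangleleft>\<^bsub>M\<^esub> a \<in> carrier M"
    and ract_add_left: "\<lbrakk>x \<in> carrier M; y \<in> carrier M; a \<in> carrier L\<rbrakk> \<Longrightarrow>
      (x \<oplus>\<^bsub>M\<^esub> y) \<triangleleft>\<^bsub>M\<^esub> a = (x \<triangleleft>\<^bsub>M\<^esub> a) \<oplus>\<^bsub>M\<^esub> (y \<triangleleft>\<^bsub>M\<^esub> a)"
    and ract_add_right: "\<lbrakk>x \<in> carrier M; a \<in> carrier L; b \<in> carrier L\<rbrakk> \<Longrightarrow>
      x \<triangleleft>\<^bsub>M\<^esub> (a \<oplus>\<^bsub>L\<^esub> b) = (x \<triangleleft>\<^bsub>M\<^esub> a) \<oplus>\<^bsub>M\<^esub> (x \<triangleleft>\<^bsub>M\<^esub> b)"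
    and ract_mult: "\<lbrakk>x \<in> carrier M; a \<in> carrier L; b \<in> carrier L\<rbrakk> \<Longrightarrow>
      x \<triangleleft>\<^bsub>M\<^esub> (a \<otimes>\<^bsub>L\<^esub> b) = (x \<triangleleft>\<^bsub>M\<^esub> a) \<triangleleft>\<^bsub>M\<^esub> b"
    and ract_one: "x \<in> carrier M \<Longrightarrow> x \<triangleleft>\<^bsub>M\<^esub> \<one>\<^bsub>L\<^esub> = x"

definition rmod_hom ::
  "('a, 'x) ring_scheme \<Rightarrow> ('a, 'm, 'y) rmodule_scheme \<Rightarrow> ('a, 'n, 'z) rmodule_scheme \<Rightarrow> ('m \<Rightarrow> 'n) set"
  where "rmod_hom L M N = {f \<in> carrier M \<rightarrow> carrier N.
    (\<forall>x\<in>carrier M. \<forall>y\<in>carrier M. f (x \<oplus>\<^bsub>M\<^esub> y) = f x \<oplus>\<^bsub>N\<^esub> f y) \<and>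
    (\<forall>x\<in>carrier M. \<forall>a\<in>carrier L. f (x \<triangleleft>\<^bsub>M\<^esub> a) = f x \<triangleleft>\<^bsub>N\<^esub> a)}"

definition rmod_iso ::
  "('a, 'x) ring_scheme \<Rightarrow> ('a, 'm, 'y) rmodule_scheme \<Rightarrow> ('a, 'n, 'z) rmodule_scheme \<Rightarrow> bool"
  where "rmod_iso L M N \<longleftrightarrow> (\<exists>f\<in>rmod_hom L M N. bij_betw f (carrier M) (carrier N))"

definition rsubmodule :: "('a, 'x) ring_scheme \<Rightarrow> ('a, 'm, 'y) rmodule_scheme \<Rightarrow> 'm set \<Rightarrow> bool"
  where "rsubmodule L M N \<longleftrightarrow>
    additive_subgroup N M \<and> (\<forall>x\<in>N. \<forall>a\<in>carrier L. x \<triangleleft>\<^bsub>M\<^esub> a \<in> N)"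

definition rspan :: "('a, 'x) ring_scheme \<Rightarrow> ('a, 'm, 'y) rmodule_scheme \<Rightarrow> 'm set \<Rightarrow> 'm set"
  where "rspan L M X = \<Inter>{N. rsubmodule L M N \<and> X \<subseteq> N}"

definition finitely_generated :: "('a, 'x) ring_scheme \<Rightarrow> ('a, 'm, 'y) rmodule_scheme \<Rightarrow> bool"
  where "finitely_generated L M \<longleftrightarrow> (\<exists>X. finite X \<and> X \<subseteq> carrier M \<and> rspan L M X = carrier M)"

definition countably_generated :: "('a, 'x) ring_scheme \<Rightarrow> ('a, 'm, 'y) rmodule_scheme \<Rightarrow> bool"
  where "countably_generated L M \<longleftrightarrow> (\<exists>X. countable X \<and> X \<subseteq> carrier M \<and> rspan L M X = carrier M)"

definition direct_summand :: "('a, 'x) ring_scheme \<Rightarrow> ('a, 'm, 'y) rmodule_scheme \<Rightarrow> 'm set \<Rightarrow> bool"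
  where "direct_summand L M N \<longleftrightarrow> rsubmodule L M N \<and>
    (\<exists>N'. rsubmodule L M N' \<and> N \<inter> N' = {\<zero>\<^bsub>M\<^esub>} \<and> N <+>\<^bsub>M\<^esub> N' = carrier M)"

definition rquot :: "('a, 'm, 'y) rmodule_scheme \<Rightarrow> 'm set \<Rightarrow> ('a, 'm set) rmodule"
  where "rquot M N = \<lparr>carrier = a_rcosets\<^bsub>M\<^esub> N, monoid.mult = undefined, monoid.one = undefined,
    ring.zero = N, ring.add = set_add M, ract = (\<lambda>X a. \<Union>x\<in>X. N +>\<^bsub>M\<^esub> (x \<triangleleft>\<^bsub>M\<^esub> a))\<rparr>"

definition binary_sum ::
  "('a, 'm, 'y) rmodule_scheme \<Rightarrow> ('a, 'n, 'z) rmodule_scheme \<Rightarrow> ('a, 'm \<times> 'n) rmodule"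
  where "binary_sum M N = \<lparr>carrier = carrier M \<times> carrier N, monoid.mult = undefined, monoid.one = undefined,
    ring.zero = (\<zero>\<^bsub>M\<^esub>, \<zero>\<^bsub>N\<^esub>),
    ring.add = (\<lambda>(x, y) (x', y'). (x \<oplus>\<^bsub>M\<^esub> x', y \<oplus>\<^bsub>N\<^esub> y')),
    ract = (\<lambda>(x, y) a. (x \<triangleleft>\<^bsub>M\<^esub> a, y \<triangleleft>\<^bsub>N\<^esub> a))\<rparr>"

definition direct_sum ::
  "'i set \<Rightarrow> ('i \<Rightarrow> ('a, 'm, 'y) rmodule_scheme) \<Rightarrow> ('a, 'i \<Rightarrow> 'm) rmodule"
  where "direct_sum I M = \<lparr>
    carrier = {x \<in> \<Pi>\<^sub>E i\<in>I. carrier (M i). finite {i \<in> I. x i \<noteq> \<zero>\<^bsub>M i\<^esub>}},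
    monoid.mult = undefined, monoid.one = undefined,
    ring.zero = (\<lambda>i\<in>I. \<zero>\<^bsub>M i\<^esub>),
    ring.add = (\<lambda>x y. \<lambda>i\<in>I. x i \<oplus>\<^bsub>M i\<^esub> y i),
    ract = (\<lambda>x a. \<lambda>i\<in>I. x i \<triangleleft>\<^bsub>M i\<^esub> a)\<rparr>"

definition regular_module :: "('a, 'x) ring_scheme \<Rightarrow> ('a, 'a) rmodule"
  where "regular_module L = \<lparr>carrier = carrier L, monoid.mult = undefined, monoid.one = undefined,
    ring.zero = \<zero>\<^bsub>L\<^esub>, ring.add = add L, ract = monoid.mult L\<rparr>"

abbreviation right_ideal :: "('a, 'x) ring_scheme \<Rightarrow> 'a set \<Rightarrow> bool"
  where "right_ideal L I \<equiv> rsubmodule L (regular_module L) I"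

text \<open>Projective means isomorphic to a direct summand of a free module. Restricting the basis
  \<open>X\<close> to the element type of \<open>P\<close> loses nothing: if \<open>P\<close> is a summand of any free module, it is
  a summand of the free module on its own underlying set.\<close>

definition projective :: "('a, 'x) ring_scheme \<Rightarrow> ('a, 'm, 'y) rmodule_scheme \<Rightarrow> bool"
  where "projective L P \<longleftrightarrow> right_module L P \<and>
    (\<exists>(X :: 'm set) N. let F = direct_sum X (\<lambda>_. regular_module L) in
      direct_summand L F N \<and> rmod_iso L P (F\<lparr>carrier := N\<rparr>))"

definition cg_projective :: "('a, 'x) ring_scheme \<Rightarrow> ('a, 'm, 'y) rmodule_scheme \<Rightarrow> bool"
  where "cg_projective L P \<longleftrightarrow> countably_generated L P \<and> projective L P"


section \<open>Semiperfect rings and simple artinian rings\<close>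

definition maximal_right_ideal :: "('a, 'x) ring_scheme \<Rightarrow> 'a set \<Rightarrow> bool"
  where "maximal_right_ideal L I \<longleftrightarrow> right_ideal L I \<and> I \<noteq> carrier L \<and>
    (\<forall>J. right_ideal L J \<and> I \<subseteq> J \<longrightarrow> J = I \<or> J = carrier L)"

definition jacobson_radical :: "('a, 'x) ring_scheme \<Rightarrow> 'a set"
  where "jacobson_radical L = {x \<in> carrier L. \<forall>I. maximal_right_ideal L I \<longrightarrow> x \<in> I}"

definition semisimple_ring :: "('a, 'x) ring_scheme \<Rightarrow> bool"
  where "semisimple_ring L \<longleftrightarrow> ring L \<and>
    (\<forall>I. right_ideal L I \<longrightarrow> direct_summand L (regular_module L) I)"

definition idempotents_lift :: "('a, 'x) ring_scheme \<Rightarrow> 'a set \<Rightarrow> bool"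
  where "idempotents_lift L I \<longleftrightarrow>
    (\<forall>x\<in>carrier L. x \<otimes>\<^bsub>L\<^esub> x \<ominus>\<^bsub>L\<^esub> x \<in> I \<longrightarrow>
      (\<exists>e\<in>carrier L. e \<otimes>\<^bsub>L\<^esub> e = e \<and> e \<ominus>\<^bsub>L\<^esub> x \<in> I))"

definition semiperfect_ring :: "('a, 'x) ring_scheme \<Rightarrow> bool"
  where "semiperfect_ring L \<longleftrightarrow> ring L \<and>
    semisimple_ring (L Quot jacobson_radical L) \<and> idempotents_lift L (jacobson_radical L)"

definition right_artinian :: "('a, 'x) ring_scheme \<Rightarrow> bool"
  where "right_artinian L \<longleftrightarrow> (\<forall>I :: nat \<Rightarrow> 'a set.
    (\<forall>n. right_ideal L (I n)) \<and> (\<forall>n. I (Suc n) \<subseteq> I n) \<longrightarrow> (\<exists>n. \<forall>k\<ge>n. I k = I n))"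

definition simple_artinian :: "('a, 'x) ring_scheme \<Rightarrow> bool"
  where "simple_artinian L \<longleftrightarrow> ring L \<and> \<one>\<^bsub>L\<^esub> \<noteq> \<zero>\<^bsub>L\<^esub> \<and>
    (\<forall>I. ideal I L \<longrightarrow> I = {\<zero>\<^bsub>L\<^esub>} \<or> I = carrier L) \<and> right_artinian L"


section \<open>Relatively big projective modules\<close>

definition trace_ideal :: "('a, 'x) ring_scheme \<Rightarrow> ('a, 'm, 'y) rmodule_scheme \<Rightarrow> 'a set"
  where "trace_ideal L M =
    rspan L (regular_module L) (\<Union>f\<in>rmod_hom L M (regular_module L). f ` carrier M)"

definition module_ideal_mult ::
  "('a, 'x) ring_scheme \<Rightarrow> ('a, 'm, 'y) rmodule_scheme \<Rightarrow> 'a set \<Rightarrow> 'm set"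
  where "module_ideal_mult L M J = rspan L M {x \<triangleleft>\<^bsub>M\<^esub> j |x j. x \<in> carrier M \<and> j \<in> J}"

text \<open>Every countably generated projective \<open>L\<close>-module is isomorphic to a direct summand of the
  free module with basis \<open>\<nat>\<close>, and the elements of the latter are functions from \<open>nat\<close> to \<open>L\<close>.
  The element type \<open>nat \<Rightarrow> 'a\<close> below is therefore large enough for all such modules
  up to isomorphism.\<close>

definition relatively_big :: "('a, 'x) ring_scheme \<Rightarrow> ('a, 'm, 'y) rmodule_scheme \<Rightarrow> bool"
  where "relatively_big L P \<longleftrightarrow> cg_projective L P \<and>
    (\<exists>P' :: ('a, nat \<Rightarrow> 'a) rmodule. cg_projective L P' \<and>
      rmod_iso L (binary_sum P (direct_sum (UNIV :: nat set) (\<lambda>_. P'))) P \<and>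
      finitely_generated L (rquot P (module_ideal_mult L P (trace_ideal L P'))))"

text \<open>The isomorphism class of \<open>P\<close>, for \<open>P\<close> of any element type, is represented by the set of
  the modules isomorphic to \<open>P\<close> whose elements have type \<open>nat \<Rightarrow> 'a\<close>.\<close>

definition iso_class ::
  "('a, 'x) ring_scheme \<Rightarrow> ('a, 'm, 'y) rmodule_scheme \<Rightarrow> ('a, nat \<Rightarrow> 'a) rmodule set"
  where "iso_class L P = {X. right_module L X \<and> rmod_iso L X P}"

definition V_star :: "('a, 'x) ring_scheme \<Rightarrow> ('a, nat \<Rightarrow> 'a) rmodule set monoid"
  where "V_star L = \<lparr>
    carrier = {iso_class L P |P :: ('a, nat \<Rightarrow> 'a) rmodule. cg_projective L P},
    monoid.mult = (\<lambda>C D. \<Union>P\<in>C. \<Union>P'\<in>D. iso_class L (binary_sum P P')),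
    monoid.one = iso_class L ((regular_module L)\<lparr>carrier := {\<zero>\<^bsub>L\<^esub>}\<rparr>)\<rparr>"

definition B_set :: "('a, 'x) ring_scheme \<Rightarrow> ('a, nat \<Rightarrow> 'a) rmodule set set"
  where "B_set L = {C \<in> carrier (V_star L). \<exists>P\<in>C. relatively_big L P \<and> \<not> finitely_generated L P}"


section \<open>Algebras and tensor products over a commutative ring\<close>

text \<open>The locale \<open>algebra\<close> of \<open>HOL-Algebra.Module\<close> is restricted to commutative algebras.\<close>

definition assoc_algebra :: "('r, 'x) ring_scheme \<Rightarrow> ('r, 'a, 'y) module_scheme \<Rightarrow> bool"
  where "assoc_algebra R L \<longleftrightarrow> module R L \<and> ring L \<and>
    (\<forall>r\<in>carrier R. \<forall>x\<in>carrier L. \<forall>y\<in>carrier L.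
      r \<odot>\<^bsub>L\<^esub> (x \<otimes>\<^bsub>L\<^esub> y) = (r \<odot>\<^bsub>L\<^esub> x) \<otimes>\<^bsub>L\<^esub> y \<and>
      r \<odot>\<^bsub>L\<^esub> (x \<otimes>\<^bsub>L\<^esub> y) = x \<otimes>\<^bsub>L\<^esub> (r \<odot>\<^bsub>L\<^esub> y))"

definition torsion_free :: "('r, 'x) ring_scheme \<Rightarrow> ('r, 'a, 'y) module_scheme \<Rightarrow> bool"
  where "torsion_free R M \<longleftrightarrow>
    (\<forall>r\<in>carrier R. \<forall>x\<in>carrier M. r \<odot>\<^bsub>M\<^esub> x = \<zero>\<^bsub>M\<^esub> \<longrightarrow> r = \<zero>\<^bsub>R\<^esub> \<or> x = \<zero>\<^bsub>M\<^esub>)"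

definition restrict_scalars ::
  "('r, 'a, 'y) module_scheme \<Rightarrow> ('a, 'm, 'z) rmodule_scheme \<Rightarrow> ('r, 'm) module"
  where "restrict_scalars L M = \<lparr>carrier = carrier M, monoid.mult = undefined, monoid.one = undefined,
    ring.zero = \<zero>\<^bsub>M\<^esub>, ring.add = add M, smult = (\<lambda>r x. x \<triangleleft>\<^bsub>M\<^esub> (r \<odot>\<^bsub>L\<^esub> \<one>\<^bsub>L\<^esub>))\<rparr>"

text \<open>\<open>M \<otimes>\<^sub>R N\<close> is the free abelian group on the set of pairs \<open>(x, y)\<close> modulo the subgroup
  generated by the usual relations.\<close>

definition tensor_relations ::
  "('r, 'x) ring_scheme \<Rightarrow> ('r, 'm, 'y) module_scheme \<Rightarrow> ('r, 'n, 'z) module_scheme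
    \<Rightarrow> ('m \<times> 'n \<Rightarrow>\<^sub>0 int) set"
  where "tensor_relations R M N =
    {frag_of (x \<oplus>\<^bsub>M\<^esub> x', y) - frag_of (x, y) - frag_of (x', y) |x x' y.
      x \<in> carrier M \<and> x' \<in> carrier M \<and> y \<in> carrier N} \<union>
    {frag_of (x, y \<oplus>\<^bsub>N\<^esub> y') - frag_of (x, y) - frag_of (x, y') |x y y'.
      x \<in> carrier M \<and> y \<in> carrier N \<and> y' \<in> carrier N} \<union>
    {frag_of (r \<odot>\<^bsub>M\<^esub> x, y) - frag_of (x, r \<odot>\<^bsub>N\<^esub> y) |r x y.
      r \<in> carrier R \<and> x \<in> carrier M \<and> y \<in> carrier N}"

definition tensor_kernel ::
  "('r, 'x) ring_scheme \<Rightarrow> ('r, 'm, 'y) module_scheme \<Rightarrow> ('r, 'n, 'z) module_scheme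
    \<Rightarrow> ('m \<times> 'n \<Rightarrow>\<^sub>0 int) set"
  where "tensor_kernel R M N =
    generate (free_Abelian_group (carrier M \<times> carrier N)) (tensor_relations R M N)"

definition tensor_group ::
  "('r, 'x) ring_scheme \<Rightarrow> ('r, 'm, 'y) module_scheme \<Rightarrow> ('r, 'n, 'z) module_scheme
    \<Rightarrow> ('m \<times> 'n \<Rightarrow>\<^sub>0 int) set monoid"
  where "tensor_group R M N =
    free_Abelian_group (carrier M \<times> carrier N) Mod tensor_kernel R M N"

definition tensor_class ::
  "('r, 'x) ring_scheme \<Rightarrow> ('r, 'm, 'y) module_scheme \<Rightarrow> ('r, 'n, 'z) module_scheme
    \<Rightarrow> ('m \<times> 'n \<Rightarrow>\<^sub>0 int) \<Rightarrow> ('m \<times> 'n \<Rightarrow>\<^sub>0 int) set"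
  where "tensor_class R M N z =
    tensor_kernel R M N #>\<^bsub>free_Abelian_group (carrier M \<times> carrier N)\<^esub> z"

text \<open>For bilinear maps \<open>f\<close> into \<open>M\<close> and \<open>g\<close> into \<open>N\<close>, this is the induced biadditive map
  \<open>(x \<otimes> y, x' \<otimes> y') \<mapsto> f x x' \<otimes> g y y'\<close>. For maps balanced over \<open>R\<close> the terms of the union
  all coincide.\<close>

definition tensor_op ::
  "('r, 'x) ring_scheme \<Rightarrow> ('r, 'm, 'y) module_scheme \<Rightarrow> ('r, 'n, 'z) module_scheme
    \<Rightarrow> ('m1 \<Rightarrow> 'm2 \<Rightarrow> 'm) \<Rightarrow> ('n1 \<Rightarrow> 'n2 \<Rightarrow> 'n)
    \<Rightarrow> ('m1 \<times> 'n1 \<Rightarrow>\<^sub>0 int) set \<Rightarrow> ('m2 \<times> 'n2 \<Rightarrow>\<^sub>0 int) set \<Rightarrow> ('m \<times> 'n \<Rightarrow>\<^sub>0 int) set"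
  where "tensor_op R M N f g Z W = (\<Union>z\<in>Z. \<Union>w\<in>W. tensor_class R M N
    (frag_extend (\<lambda>(x, y). frag_extend (\<lambda>(x', y'). frag_of (f x x', g y y')) w) z))"

definition tensor_ring ::
  "('r, 'x) ring_scheme \<Rightarrow> ('r, 'a, 'y) module_scheme \<Rightarrow> ('r, 'b, 'z) module_scheme
    \<Rightarrow> ('a \<times> 'b \<Rightarrow>\<^sub>0 int) set ring"
  where "tensor_ring R A B = \<lparr>
    carrier = carrier (tensor_group R A B),
    monoid.mult = tensor_op R A B (monoid.mult A) (monoid.mult B),
    monoid.one = tensor_class R A B (frag_of (\<one>\<^bsub>A\<^esub>, \<one>\<^bsub>B\<^esub>)),
    ring.zero = \<one>\<^bsub>tensor_group R A B\<^esub>,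
    ring.add = monoid.mult (tensor_group R A B)\<rparr>"

text \<open>For a right \<open>A\<close>-module \<open>P\<close>, the right module \<open>P \<otimes>\<^sub>R B\<close> over \<open>A \<otimes>\<^sub>R B\<close>.\<close>

definition tensor_module ::
  "('r, 'x) ring_scheme \<Rightarrow> ('r, 'a, 'y) module_scheme \<Rightarrow> ('r, 'b, 'z) module_scheme
    \<Rightarrow> ('a, 'm, 'w) rmodule_scheme
    \<Rightarrow> (('a \<times> 'b \<Rightarrow>\<^sub>0 int) set, ('m \<times> 'b \<Rightarrow>\<^sub>0 int) set) rmodule"
  where "tensor_module R A B P = \<lparr>
    carrier = carrier (tensor_group R (restrict_scalars A P) B),
    monoid.mult = undefined, monoid.one = undefined,
    ring.zero = \<one>\<^bsub>tensor_group R (restrict_scalars A P) B\<^esub>,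
    ring.add = monoid.mult (tensor_group R (restrict_scalars A P) B),
    ract = tensor_op R (restrict_scalars A P) B (ract P) (monoid.mult B)\<rparr>"


section \<open>Localization\<close>

definition frac_rel :: "('r, 'x) ring_scheme \<Rightarrow> 'r set \<Rightarrow> (('r \<times> 'r) \<times> ('r \<times> 'r)) set"
  where "frac_rel R S = {((a, s), (b, t)). a \<in> carrier R \<and> s \<in> S \<and> b \<in> carrier R \<and> t \<in> S \<and>
    (\<exists>u\<in>S. u \<otimes>\<^bsub>R\<^esub> (a \<otimes>\<^bsub>R\<^esub> t) = u \<otimes>\<^bsub>R\<^esub> (b \<otimes>\<^bsub>R\<^esub> s))}"

abbreviation frac_class :: "('r, 'x) ring_scheme \<Rightarrow> 'r set \<Rightarrow> 'r \<Rightarrow> 'r \<Rightarrow> ('r \<times> 'r) set"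
  where "frac_class R S a s \<equiv> frac_rel R S `` {(a, s)}"

text \<open>The ring of fractions of \<open>R\<close> with denominators in the multiplicative set \<open>S\<close>, as an
  \<open>R\<close>-algebra.\<close>

definition fractions :: "('r, 'x) ring_scheme \<Rightarrow> 'r set \<Rightarrow> ('r, ('r \<times> 'r) set) module"
  where "fractions R S = \<lparr>
    carrier = (carrier R \<times> S) // frac_rel R S,
    monoid.mult = (\<lambda>X Y. \<Union>(a, s)\<in>X. \<Union>(b, t)\<in>Y. frac_class R S (a \<otimes>\<^bsub>R\<^esub> b) (s \<otimes>\<^bsub>R\<^esub> t)),
    monoid.one = frac_class R S \<one>\<^bsub>R\<^esub> \<one>\<^bsub>R\<^esub>,
    ring.zero = frac_class R S \<zero>\<^bsub>R\<^esub> \<one>\<^bsub>R\<^esub>,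
    ring.add = (\<lambda>X Y. \<Union>(a, s)\<in>X. \<Union>(b, t)\<in>Y.
      frac_class R S ((a \<otimes>\<^bsub>R\<^esub> t) \<oplus>\<^bsub>R\<^esub> (b \<otimes>\<^bsub>R\<^esub> s)) (s \<otimes>\<^bsub>R\<^esub> t)),
    smult = (\<lambda>r X. \<Union>(a, s)\<in>X. frac_class R S (r \<otimes>\<^bsub>R\<^esub> a) s)\<rparr>"

definition local_ring_at :: "('r, 'x) ring_scheme \<Rightarrow> 'r set \<Rightarrow> ('r, ('r \<times> 'r) set) module"
  where "local_ring_at R \<mm> = fractions R (carrier R - \<mm>)"

definition fraction_field :: "('r, 'x) ring_scheme \<Rightarrow> ('r, ('r \<times> 'r) set) module"
  where "fraction_field R = fractions R (carrier R - {\<zero>\<^bsub>R\<^esub>})"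

abbreviation localize_ring ::
  "('r, 'x) ring_scheme \<Rightarrow> ('r, 'a, 'y) module_scheme \<Rightarrow> 'r set
    \<Rightarrow> ('a \<times> ('r \<times> 'r) set \<Rightarrow>\<^sub>0 int) set ring"
  where "localize_ring R L \<mm> \<equiv> tensor_ring R L (local_ring_at R \<mm>)"

abbreviation localize_module ::
  "('r, 'x) ring_scheme \<Rightarrow> ('r, 'a, 'y) module_scheme \<Rightarrow> 'r set \<Rightarrow> ('a, 'm, 'w) rmodule_scheme
    \<Rightarrow> (('a \<times> ('r \<times> 'r) set \<Rightarrow>\<^sub>0 int) set, ('m \<times> ('r \<times> 'r) set \<Rightarrow>\<^sub>0 int) set) rmodule"
  where "localize_module R L \<mm> P \<equiv> tensor_module R L (local_ring_at R \<mm>) P"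

definition max_spec :: "('r, 'x) ring_scheme \<Rightarrow> 'r set set"
  where "max_spec R = {\<mm>. maximalideal \<mm> R}"

definition h_local_domain :: "('r, 'x) ring_scheme \<Rightarrow> bool"
  where "h_local_domain R \<longleftrightarrow> domain R \<and>
    (\<forall>r\<in>carrier R. r \<noteq> \<zero>\<^bsub>R\<^esub> \<longrightarrow> finite {\<mm> \<in> max_spec R. r \<in> \<mm>}) \<and>
    (\<forall>\<pp>. primeideal \<pp> R \<and> \<pp> \<noteq> {\<zero>\<^bsub>R\<^esub>} \<longrightarrow> (\<exists>!\<mm>. \<mm> \<in> max_spec R \<and> \<pp> \<subseteq> \<mm>))"

definition locally_semiperfect :: "('r, 'x) ring_scheme \<Rightarrow> ('r, 'a, 'y) module_scheme \<Rightarrow> bool"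
  where "locally_semiperfect R L \<longleftrightarrow> (\<forall>\<mm>\<in>max_spec R. semiperfect_ring (localize_ring R L \<mm>))"

text \<open>The union over the representatives \<open>P\<close> of the class \<open>C\<close> is a union of equal sets.\<close>

definition localization_map ::
  "('r, 'x) ring_scheme \<Rightarrow> ('r, 'a, 'y) module_scheme \<Rightarrow> ('a, nat \<Rightarrow> 'a) rmodule set \<Rightarrow> 'r set
    \<Rightarrow> (('a \<times> ('r \<times> 'r) set \<Rightarrow>\<^sub>0 int) set, nat \<Rightarrow> ('a \<times> ('r \<times> 'r) set \<Rightarrow>\<^sub>0 int) set) rmodule set"
  where "localization_map R L = (\<lambda>C\<in>carrier (V_star L). \<lambda>\<mm>\<in>max_spec R.
    \<Union>P\<in>C. iso_class (localize_ring R L \<mm>) (localize_module R L \<mm> P))"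

end

theory Submission
  imports Defs "HOL-Algebra.Ring_Divisibility"
begin

text \<open>
Write \<open>A\<^sup>\<omega>\<close> for the direct sum of countably many copies of \<open>A\<close>. A relatively big module is a
countably generated projective module \<open>P\<close> with \<open>P \<cong> P \<oplus> A\<^sup>\<omega>\<close> and \<open>P/PJ\<close> finitely generated, where
\<open>J\<close> is the trace ideal of some countably generated projective module \<open>A\<close>. Over any ring, such a module
is determined by \<open>J\<close> and \<open>P/PJ\<close>, and \<open>J\<close> is determined by \<open>P\<close>.

For the first claim (\<open>iso_of_iso_modulo_trace\<close>), let \<open>Q \<cong> Q \<oplus> B\<^sup>\<omega>\<close> have the same trace ideal and let
\<open>f : P \<rightarrow> Q\<close> be bijective modulo \<open>J\<close>. Every element of \<open>QJ\<close> comes from a homomorphism \<open>A\<^sup>\<omega> \<rightarrow> Q\<close>, so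
\<open>f\<close> extends to a surjection from \<open>P \<oplus> (A\<^sup>\<omega>)\<^sup>\<omega> \<cong> P\<close> onto \<open>Q\<close>. It splits, and its kernel \<open>X\<close> satisfies
\<open>X = XJ\<close>. Therefore \<open>X\<close> is a direct summand of \<open>B\<^sup>\<omega>\<close>, and the Eilenberg swindle (\<open>omega_sum_absorbs\<close>)
gives \<open>X \<oplus> B\<^sup>\<omega> \<cong> B\<^sup>\<omega>\<close>. Hence \<open>P \<cong> Q \<oplus> X \<cong> Q \<oplus> B\<^sup>\<omega> \<oplus> X \<cong> Q\<close>. For the second claim
(\<open>absorbed_eq_ideal_mult\<close>), if \<open>P/PI\<close> is finitely generated, its generators miss one of the copies of
\<open>A\<close> in \<open>P\<close>, so \<open>A = AI\<close> and \<open>Tr(A)\<close> is contained in \<open>I\<close>.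

All ingredients of relative bigness are preserved by localization (\<open>loc_module_relatively_big\<close>), which
shows that \<open>\<Phi>\<close> maps \<open>B(\<Lambda>)\<close> into the product of the \<open>B(\<Lambda>\<^sub>\<mm>)\<close>.

Now let \<open>P\<close> and \<open>Q\<close> be relatively big, not finitely generated and locally isomorphic. By the second claim
over each \<open>\<Lambda>\<^sub>\<mm>\<close>, their trace ideals agree locally, hence globally (\<open>trace_ideal_le_locally\<close>). The common
trace ideal \<open>J\<close> is not zero, and \<open>\<Lambda>\<^sub>Q\<close> is simple, so \<open>J\<close> contains a constant \<open>r \<noteq> 0\<close> of \<open>R\<close>
(\<open>ideal_contains_constant\<close>). Over an \<open>h\<close>-local domain, \<open>R/rR\<close> is the product of the rings \<open>R\<^sub>\<mm>/rR\<^sub>\<mm>\<close> for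
the finitely many \<open>\<mm>\<close> that contain \<open>r\<close>; \<open>local_inverse\<close> and \<open>local_idempotent\<close> say this in terms of elements.
It follows that the local isomorphisms can be approximated modulo \<open>J\<close>, at all these \<open>\<mm>\<close> at once, by
a single homomorphism \<open>f : P \<rightarrow> Q\<close> (\<open>simultaneous_approximation\<close>). Then \<open>f\<close> is bijective modulo \<open>J\<close>
because it is so locally, and the first claim gives \<open>P \<cong> Q\<close> (\<open>iso_of_locally_iso\<close>).
\<close>

section \<open>Right modules, homomorphisms and submodules\<close>

context right_module
begin

lemma zero_ract: "a \<in> carrier L \<Longrightarrow> \<zero>\<^bsub>M\<^esub> \<triangleleft>\<^bsub>M\<^esub> a = \<zero>\<^bsub>M\<^esub>"
proof -
  assume a: "a \<in> carrier L"
  have c: "\<zero>\<^bsub>M\<^esub> \<triangleleft>\<^bsub>M\<^esub> a \<in> carrier M" using a by (simp add: ract_closed)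
  have "\<zero>\<^bsub>M\<^esub> \<triangleleft>\<^bsub>M\<^esub> a \<oplus>\<^bsub>M\<^esub> \<zero>\<^bsub>M\<^esub> \<triangleleft>\<^bsub>M\<^esub> a = \<zero>\<^bsub>M\<^esub> \<triangleleft>\<^bsub>M\<^esub> a"
    using ract_add_left[of "\<zero>\<^bsub>M\<^esub>" "\<zero>\<^bsub>M\<^esub>" a] a by simp
  then show ?thesis using c M.add.r_cancel_one by blast
qed

lemma ract_zero: "x \<in> carrier M \<Longrightarrow> x \<triangleleft>\<^bsub>M\<^esub> \<zero>\<^bsub>L\<^esub> = \<zero>\<^bsub>M\<^esub>"
proof -
  assume x: "x \<in> carrier M"
  have c: "x \<triangleleft>\<^bsub>M\<^esub> \<zero>\<^bsub>L\<^esub> \<in> carrier M" using x by (simp add: ract_closed)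
  have "x \<triangleleft>\<^bsub>M\<^esub> \<zero>\<^bsub>L\<^esub> \<oplus>\<^bsub>M\<^esub> x \<triangleleft>\<^bsub>M\<^esub> \<zero>\<^bsub>L\<^esub> = x \<triangleleft>\<^bsub>M\<^esub> \<zero>\<^bsub>L\<^esub>"
    using ract_add_right[of x "\<zero>\<^bsub>L\<^esub>" "\<zero>\<^bsub>L\<^esub>"] x by simp
  then show ?thesis using c M.add.r_cancel_one by blast
qed

lemma ract_neg: "x \<in> carrier M \<Longrightarrow> a \<in> carrier L \<Longrightarrow> x \<triangleleft>\<^bsub>M\<^esub> (\<ominus>\<^bsub>L\<^esub> a) = \<ominus>\<^bsub>M\<^esub> (x \<triangleleft>\<^bsub>M\<^esub> a)"
proof -
  assume x: "x \<in> carrier M" and a: "a \<in> carrier L"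
  have "x \<triangleleft>\<^bsub>M\<^esub> (\<ominus>\<^bsub>L\<^esub> a) \<oplus>\<^bsub>M\<^esub> x \<triangleleft>\<^bsub>M\<^esub> a = x \<triangleleft>\<^bsub>M\<^esub> (\<ominus>\<^bsub>L\<^esub> a \<oplus>\<^bsub>L\<^esub> a)"
    using ract_add_right[of x "\<ominus>\<^bsub>L\<^esub> a" a] x a by simp
  also have "\<dots> = \<zero>\<^bsub>M\<^esub>" using x a by (simp add: L.l_neg ract_zero)
  finally show ?thesis using x a by (simp add: M.minus_equality ract_closed)
qed

lemma neg_ract: "x \<in> carrier M \<Longrightarrow> a \<in> carrier L \<Longrightarrow> (\<ominus>\<^bsub>M\<^esub> x) \<triangleleft>\<^bsub>M\<^esub> a = \<ominus>\<^bsub>M\<^esub> (x \<triangleleft>\<^bsub>M\<^esub> a)"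
proof -
  assume x: "x \<in> carrier M" and a: "a \<in> carrier L"
  have "(\<ominus>\<^bsub>M\<^esub> x) \<triangleleft>\<^bsub>M\<^esub> a \<oplus>\<^bsub>M\<^esub> x \<triangleleft>\<^bsub>M\<^esub> a = (\<ominus>\<^bsub>M\<^esub> x \<oplus>\<^bsub>M\<^esub> x) \<triangleleft>\<^bsub>M\<^esub> a"
    using ract_add_left[of "\<ominus>\<^bsub>M\<^esub> x" x a] x a by simp
  also have "\<dots> = \<zero>\<^bsub>M\<^esub>" using x a by (simp add: M.l_neg zero_ract)
  finally show ?thesis using x a by (simp add: M.minus_equality ract_closed)
qed

lemma ract_neg_one: "x \<in> carrier M \<Longrightarrow> x \<triangleleft>\<^bsub>M\<^esub> (\<ominus>\<^bsub>L\<^esub> \<one>\<^bsub>L\<^esub>) = \<ominus>\<^bsub>M\<^esub> x"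
  by (simp add: ract_neg ract_one)

lemma ract_minus_right: "x \<in> carrier M \<Longrightarrow> a \<in> carrier L \<Longrightarrow> b \<in> carrier L \<Longrightarrow>
    x \<triangleleft>\<^bsub>M\<^esub> (a \<ominus>\<^bsub>L\<^esub> b) = (x \<triangleleft>\<^bsub>M\<^esub> a) \<ominus>\<^bsub>M\<^esub> (x \<triangleleft>\<^bsub>M\<^esub> b)"
  by (simp add: a_minus_def ract_add_right ract_neg)

lemma ract_minus_left: "x \<in> carrier M \<Longrightarrow> y \<in> carrier M \<Longrightarrow> a \<in> carrier L \<Longrightarrow>
    (x \<ominus>\<^bsub>M\<^esub> y) \<triangleleft>\<^bsub>M\<^esub> a = (x \<triangleleft>\<^bsub>M\<^esub> a) \<ominus>\<^bsub>M\<^esub> (y \<triangleleft>\<^bsub>M\<^esub> a)"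
  by (simp add: a_minus_def ract_add_left neg_ract)

lemma minus_zero_right [simp]: "x \<in> carrier M \<Longrightarrow> x \<ominus>\<^bsub>M\<^esub> \<zero>\<^bsub>M\<^esub> = x"
  using M.minus_equality[of "\<zero>\<^bsub>M\<^esub>" "\<zero>\<^bsub>M\<^esub>"] by (simp add: a_minus_def)

lemma minus_add_right:
  assumes "x \<in> carrier M" "y \<in> carrier M" "z \<in> carrier M"
  shows "x \<ominus>\<^bsub>M\<^esub> (y \<oplus>\<^bsub>M\<^esub> z) = (x \<ominus>\<^bsub>M\<^esub> y) \<ominus>\<^bsub>M\<^esub> z"
  using assms by (simp add: a_minus_def M.minus_add M.a_ac)

lemma rsubmoduleI:
  assumes "N \<subseteq> carrier M" "\<zero>\<^bsub>M\<^esub> \<in> N"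
    and "\<And>x y. x \<in> N \<Longrightarrow> y \<in> N \<Longrightarrow> x \<oplus>\<^bsub>M\<^esub> y \<in> N"
    and "\<And>x a. x \<in> N \<Longrightarrow> a \<in> carrier L \<Longrightarrow> x \<triangleleft>\<^bsub>M\<^esub> a \<in> N"
  shows "rsubmodule L M N"
proof -
  have "\<ominus>\<^bsub>M\<^esub> x \<in> N" if "x \<in> N" for x
    using assms(4)[of x "\<ominus>\<^bsub>L\<^esub> \<one>\<^bsub>L\<^esub>"] that assms(1) by (auto simp: ract_neg_one)
  then have "subgroup N (add_monoid M)"
    using assms by (intro M.add.subgroupI) auto
  then show ?thesis
    unfolding rsubmodule_def using assms by (auto intro: additive_subgroupI)
qed

end

lemma rsubmoduleD:
  assumes "rsubmodule L M N"
  shows "N \<subseteq> carrier M" "\<zero>\<^bsub>M\<^esub> \<in> N"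
    "\<And>x y. x \<in> N \<Longrightarrow> y \<in> N \<Longrightarrow> x \<oplus>\<^bsub>M\<^esub> y \<in> N"
    "\<And>x a. x \<in> N \<Longrightarrow> a \<in> carrier L \<Longrightarrow> x \<triangleleft>\<^bsub>M\<^esub> a \<in> N"
  using assms unfolding rsubmodule_def
  by (auto simp: additive_subgroup.a_closed additive_subgroup.zero_closed
      dest: additive_subgroup.a_subset)

lemma rsubmodule_neg:
  assumes "right_module L M" "rsubmodule L M N" "x \<in> N"
  shows "\<ominus>\<^bsub>M\<^esub> x \<in> N"
proof -
  interpret right_module L M by fact
  show ?thesis
    using assms(2,3) unfolding rsubmodule_def
    by (meson M.abelian_group_axioms additive_subgroup.a_inv_closed)
qed

lemma rsubmodule_minus:
  assumes "right_module L M" "rsubmodule L M N" "x \<in> N" "y \<in> N"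
  shows "x \<ominus>\<^bsub>M\<^esub> y \<in> N"
  unfolding a_minus_def using assms rsubmodule_neg rsubmoduleD(3) by metis

lemma right_moduleI:
  assumes "ring L" "abelian_group M"
    "\<And>x a. x \<in> carrier M \<Longrightarrow> a \<in> carrier L \<Longrightarrow> x \<triangleleft>\<^bsub>M\<^esub> a \<in> carrier M"
    "\<And>x y a. x \<in> carrier M \<Longrightarrow> y \<in> carrier M \<Longrightarrow> a \<in> carrier L \<Longrightarrow>
      (x \<oplus>\<^bsub>M\<^esub> y) \<triangleleft>\<^bsub>M\<^esub> a = (x \<triangleleft>\<^bsub>M\<^esub> a) \<oplus>\<^bsub>M\<^esub> (y \<triangleleft>\<^bsub>M\<^esub> a)"
    "\<And>x a b. x \<in> carrier M \<Longrightarrow> a \<in> carrier L \<Longrightarrow> b \<in> carrier L \<Longrightarrow>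
      x \<triangleleft>\<^bsub>M\<^esub> (a \<oplus>\<^bsub>L\<^esub> b) = (x \<triangleleft>\<^bsub>M\<^esub> a) \<oplus>\<^bsub>M\<^esub> (x \<triangleleft>\<^bsub>M\<^esub> b)"
    "\<And>x a b. x \<in> carrier M \<Longrightarrow> a \<in> carrier L \<Longrightarrow> b \<in> carrier L \<Longrightarrow>
      x \<triangleleft>\<^bsub>M\<^esub> (a \<otimes>\<^bsub>L\<^esub> b) = (x \<triangleleft>\<^bsub>M\<^esub> a) \<triangleleft>\<^bsub>M\<^esub> b"
    "\<And>x. x \<in> carrier M \<Longrightarrow> x \<triangleleft>\<^bsub>M\<^esub> \<one>\<^bsub>L\<^esub> = x"
  shows "right_module L M"
  using assms unfolding right_module_def right_module_axioms_def by blast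

text \<open>Submodules and summands are the records with a smaller carrier, so they need no new type.\<close>

lemma right_module_submodule:
  assumes "right_module L M" "rsubmodule L M N"
  shows "right_module L (M\<lparr>carrier := N\<rparr>)"
proof -
  interpret right_module L M by fact
  note N = rsubmoduleD[OF assms(2)]
  have neg: "\<ominus>\<^bsub>M\<^esub> x \<in> N" if "x \<in> N" for x using rsubmodule_neg[OF assms that] .
  have "abelian_group (M\<lparr>carrier := N\<rparr>)"
  proof (rule abelian_groupI)
    fix x assume "x \<in> carrier (M\<lparr>carrier := N\<rparr>)"
    then show "\<exists>y\<in>carrier (M\<lparr>carrier := N\<rparr>). y \<oplus>\<^bsub>M\<lparr>carrier := N\<rparr>\<^esub> x = \<zero>\<^bsub>M\<lparr>carrier := N\<rparr>\<^esub>"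
      using neg[of x] N(1) by (auto intro!: bexI[of _ "\<ominus>\<^bsub>M\<^esub> x"] simp: M.l_neg subset_iff)
  qed (use N in \<open>auto simp: subset_iff M.a_ac\<close>)
  then show ?thesis
    using N by (intro right_moduleI)
      (auto simp: subset_iff ract_add_left ract_add_right ract_mult ract_one L.ring_axioms)
qed

lemma right_module_ring: "right_module L M \<Longrightarrow> ring L"
  by (simp add: right_module_def)

lemma right_module_regular:
  assumes "ring L" shows "right_module L (regular_module L)"
proof -
  interpret ring L by fact
  have "abelian_group (regular_module L)"
    by (rule abelian_groupI) (auto simp: regular_module_def a_ac intro!: l_neg add.l_inv_ex)
  then show ?thesis
    by (intro right_moduleI) (auto simp: regular_module_def l_distr r_distr m_assoc ring_axioms)
qed

lemma regular_module_simps [simp]: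
  "carrier (regular_module L) = carrier L" "\<zero>\<^bsub>regular_module L\<^esub> = \<zero>\<^bsub>L\<^esub>"
  "x \<oplus>\<^bsub>regular_module L\<^esub> y = x \<oplus>\<^bsub>L\<^esub> y" "x \<triangleleft>\<^bsub>regular_module L\<^esub> a = x \<otimes>\<^bsub>L\<^esub> a"
  by (auto simp: regular_module_def)

subsection \<open>Homomorphisms\<close>

lemma rmod_homI:
  assumes "\<And>x. x \<in> carrier M \<Longrightarrow> f x \<in> carrier N"
    "\<And>x y. x \<in> carrier M \<Longrightarrow> y \<in> carrier M \<Longrightarrow> f (x \<oplus>\<^bsub>M\<^esub> y) = f x \<oplus>\<^bsub>N\<^esub> f y"
    "\<And>x a. x \<in> carrier M \<Longrightarrow> a \<in> carrier L \<Longrightarrow> f (x \<triangleleft>\<^bsub>M\<^esub> a) = f x \<triangleleft>\<^bsub>N\<^esub> a"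
  shows "f \<in> rmod_hom L M N"
  using assms by (auto simp: rmod_hom_def)

lemma rmod_homD:
  assumes "f \<in> rmod_hom L M N"
  shows "\<And>x. x \<in> carrier M \<Longrightarrow> f x \<in> carrier N"
    "\<And>x y. x \<in> carrier M \<Longrightarrow> y \<in> carrier M \<Longrightarrow> f (x \<oplus>\<^bsub>M\<^esub> y) = f x \<oplus>\<^bsub>N\<^esub> f y"
    "\<And>x a. x \<in> carrier M \<Longrightarrow> a \<in> carrier L \<Longrightarrow> f (x \<triangleleft>\<^bsub>M\<^esub> a) = f x \<triangleleft>\<^bsub>N\<^esub> a"
  using assms by (auto simp: rmod_hom_def)

lemma rmod_hom_zero:
  assumes "right_module L M" "right_module L N" "f \<in> rmod_hom L M N"
  shows "f \<zero>\<^bsub>M\<^esub> = \<zero>\<^bsub>N\<^esub>"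
proof -
  interpret M: right_module L M by fact
  interpret N: right_module L N by fact
  have "f (\<zero>\<^bsub>M\<^esub> \<triangleleft>\<^bsub>M\<^esub> \<zero>\<^bsub>L\<^esub>) = f \<zero>\<^bsub>M\<^esub> \<triangleleft>\<^bsub>N\<^esub> \<zero>\<^bsub>L\<^esub>" using rmod_homD[OF assms(3)] by simp
  then show ?thesis using rmod_homD(1)[OF assms(3)] by (simp add: M.ract_zero N.ract_zero)
qed

lemma rmod_hom_neg:
  assumes "right_module L M" "right_module L N" "f \<in> rmod_hom L M N" "x \<in> carrier M"
  shows "f (\<ominus>\<^bsub>M\<^esub> x) = \<ominus>\<^bsub>N\<^esub> f x"
proof -
  interpret M: right_module L M by fact
  interpret N: right_module L N by fact
  have "f (x \<triangleleft>\<^bsub>M\<^esub> (\<ominus>\<^bsub>L\<^esub> \<one>\<^bsub>L\<^esub>)) = f x \<triangleleft>\<^bsub>N\<^esub> (\<ominus>\<^bsub>L\<^esub> \<one>\<^bsub>L\<^esub>)"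
    using rmod_homD[OF assms(3)] assms(4) by simp
  then show ?thesis using rmod_homD(1)[OF assms(3)] assms(4) by (simp add: M.ract_neg_one N.ract_neg_one)
qed

lemma rmod_hom_minus:
  assumes "right_module L M" "right_module L N" "f \<in> rmod_hom L M N" "x \<in> carrier M" "y \<in> carrier M"
  shows "f (x \<ominus>\<^bsub>M\<^esub> y) = f x \<ominus>\<^bsub>N\<^esub> f y"
proof -
  interpret M: right_module L M by fact
  show ?thesis unfolding a_minus_def
    using assms by (simp add: rmod_homD(2)[OF assms(3)] rmod_hom_neg)
qed

lemma rmod_hom_id: "(\<lambda>x. x) \<in> rmod_hom L M M"
  by (auto simp: rmod_hom_def)

lemma rmod_hom_comp:
  "f \<in> rmod_hom L M N \<Longrightarrow> g \<in> rmod_hom L N K \<Longrightarrow> (\<lambda>x. g (f x)) \<in> rmod_hom L M K"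
  by (auto simp: rmod_hom_def Pi_iff)

lemma rmod_hom_add:
  assumes "right_module L N" "f \<in> rmod_hom L M N" "g \<in> rmod_hom L M N"
  shows "(\<lambda>x. f x \<oplus>\<^bsub>N\<^esub> g x) \<in> rmod_hom L M N"
proof -
  interpret N: right_module L N by fact
  note f = rmod_homD[OF assms(2)] and g = rmod_homD[OF assms(3)]
  show ?thesis by (rule rmod_homI) (simp_all add: f g N.a_ac N.ract_add_left)
qed

lemma rmod_hom_neg_fun:
  assumes "right_module L N" "f \<in> rmod_hom L M N"
  shows "(\<lambda>x. \<ominus>\<^bsub>N\<^esub> f x) \<in> rmod_hom L M N"
proof -
  interpret N: right_module L N by fact
  note f = rmod_homD[OF assms(2)]
  show ?thesis by (rule rmod_homI) (simp_all add: f N.minus_add N.neg_ract)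
qed

lemma rmod_hom_minus_fun:
  assumes "right_module L N" "f \<in> rmod_hom L M N" "g \<in> rmod_hom L M N"
  shows "(\<lambda>x. f x \<ominus>\<^bsub>N\<^esub> g x) \<in> rmod_hom L M N"
  unfolding a_minus_def by (intro rmod_hom_add rmod_hom_neg_fun assms)

lemma rmod_hom_subcarrier:
  "f \<in> rmod_hom L M N \<Longrightarrow> (\<And>x. x \<in> carrier M \<Longrightarrow> f x \<in> K) \<Longrightarrow> f \<in> rmod_hom L M (N\<lparr>carrier := K\<rparr>)"
  by (auto simp: rmod_hom_def)

lemma rmod_hom_restrict:
  "f \<in> rmod_hom L M N \<Longrightarrow> K \<subseteq> carrier M \<Longrightarrow> f \<in> rmod_hom L (M\<lparr>carrier := K\<rparr>) N"
  by (auto simp: rmod_hom_def Pi_iff subset_iff)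

lemma rmod_isoI:
  assumes "f \<in> rmod_hom L M N" "g \<in> carrier N \<rightarrow> carrier M"
    "\<And>x. x \<in> carrier M \<Longrightarrow> g (f x) = x" "\<And>y. y \<in> carrier N \<Longrightarrow> f (g y) = y"
  shows "rmod_iso L M N"
  unfolding rmod_iso_def
  using assms by (intro bexI[of _ f] bij_betw_byWitness[of _ g]) (auto simp: rmod_hom_def)

lemma rmod_isoE:
  assumes "rmod_iso L M N" "right_module L M"
  obtains f g where "f \<in> rmod_hom L M N" "g \<in> rmod_hom L N M"
    "\<And>x. x \<in> carrier M \<Longrightarrow> g (f x) = x" "\<And>y. y \<in> carrier N \<Longrightarrow> f (g y) = y"
proof -
  interpret M: right_module L M by fact
  from assms(1) obtain f where f: "f \<in> rmod_hom L M N" "bij_betw f (carrier M) (carrier N)"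
    unfolding rmod_iso_def by blast
  define g where "g = inv_into (carrier M) f"
  have gc: "g y \<in> carrier M" "f (g y) = y" if "y \<in> carrier N" for y
    using f(2) that by (auto simp: g_def bij_betw_def inv_into_into f_inv_into_f)
  have gf: "g (f x) = x" if "x \<in> carrier M" for x
    using f(2) that by (auto simp: g_def bij_betw_def)
  have "g \<in> rmod_hom L N M"
  proof (rule rmod_homI)
    fix x y assume "x \<in> carrier N" "y \<in> carrier N"
    then have "x \<oplus>\<^bsub>N\<^esub> y = f (g x \<oplus>\<^bsub>M\<^esub> g y)" by (simp add: rmod_homD[OF f(1)] gc)
    then show "g (x \<oplus>\<^bsub>N\<^esub> y) = g x \<oplus>\<^bsub>M\<^esub> g y" using gf gc \<open>x \<in> carrier N\<close> \<open>y \<in> carrier N\<close> by simp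
  next
    fix x a assume "x \<in> carrier N" "a \<in> carrier L"
    then have "x \<triangleleft>\<^bsub>N\<^esub> a = f (g x \<triangleleft>\<^bsub>M\<^esub> a)" by (simp add: rmod_homD[OF f(1)] gc)
    then show "g (x \<triangleleft>\<^bsub>N\<^esub> a) = g x \<triangleleft>\<^bsub>M\<^esub> a"
      using gf gc \<open>x \<in> carrier N\<close> \<open>a \<in> carrier L\<close> by (simp add: M.ract_closed)
  qed (use gc in auto)
  then show thesis using that f(1) gf gc(2) by blast
qed

lemma rmod_iso_refl: "rmod_iso L M M"
  by (rule rmod_isoI[of "\<lambda>x. x" _ _ _ "\<lambda>x. x"]) (auto simp: rmod_hom_def)

lemma rmod_iso_sym: "rmod_iso L M N \<Longrightarrow> right_module L M \<Longrightarrow> rmod_iso L N M"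
  by (erule rmod_isoE, assumption) (rule rmod_isoI, auto simp: rmod_hom_def)

lemma rmod_iso_trans:
  assumes "rmod_iso L M N" "rmod_iso L N K" shows "rmod_iso L M K"
proof -
  from assms obtain f g where f: "f \<in> rmod_hom L M N" "bij_betw f (carrier M) (carrier N)"
    and g: "g \<in> rmod_hom L N K" "bij_betw g (carrier N) (carrier K)"
    unfolding rmod_iso_def by blast
  show ?thesis unfolding rmod_iso_def
    using rmod_hom_comp[OF f(1) g(1)] bij_betw_trans[OF f(2) g(2)] by (auto simp: comp_def)
qed

subsection \<open>Submodules\<close>

lemma rsubmodule_carrier: "right_module L M \<Longrightarrow> rsubmodule L M (carrier M)"
proof -
  assume "right_module L M"
  then interpret right_module L M .
  show ?thesis by (rule rsubmoduleI) (auto simp: ract_closed)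
qed

lemma rsubmodule_zero: "right_module L M \<Longrightarrow> rsubmodule L M {\<zero>\<^bsub>M\<^esub>}"
proof -
  assume "right_module L M"
  then interpret right_module L M .
  show ?thesis by (rule rsubmoduleI) (auto simp: zero_ract)
qed

lemma rsubmodule_vimage:
  assumes "right_module L M" "right_module L N" "f \<in> rmod_hom L M N" "rsubmodule L N K"
  shows "rsubmodule L M {x \<in> carrier M. f x \<in> K}"
proof -
  interpret M: right_module L M by fact
  interpret N: right_module L N by fact
  show ?thesis
    by (rule M.rsubmoduleI)
      (auto simp: rmod_homD[OF assms(3)] rmod_hom_zero[OF assms(1-3)] rsubmoduleD[OF assms(4)] M.ract_closed)
qed

lemma rsubmodule_image:
  assumes "right_module L M" "right_module L N" "f \<in> rmod_hom L M N" "rsubmodule L M K"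
  shows "rsubmodule L N (f ` K)"
proof -
  interpret M: right_module L M by fact
  interpret N: right_module L N by fact
  note K = rsubmoduleD[OF assms(4)] and f = rmod_homD[OF assms(3)]
  show ?thesis
  proof (rule N.rsubmoduleI)
    show "f ` K \<subseteq> carrier N" using K(1) f(1) by auto
    show "\<zero>\<^bsub>N\<^esub> \<in> f ` K" using K(2) rmod_hom_zero[OF assms(1-3)] by force
    fix x y assume "x \<in> f ` K" "y \<in> f ` K"
    then obtain u v where "u \<in> K" "v \<in> K" "x = f u" "y = f v" by blast
    moreover have "u \<in> carrier M" "v \<in> carrier M" using calculation K(1) by auto
    ultimately show "x \<oplus>\<^bsub>N\<^esub> y \<in> f ` K" using f(2)[of u v] K(3)[of u v] by (metis imageI)
  next
    fix x a assume "x \<in> f ` K" "a \<in> carrier L"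
    then obtain u where "u \<in> K" "x = f u" by blast
    moreover have "u \<in> carrier M" using calculation K(1) by auto
    ultimately show "x \<triangleleft>\<^bsub>N\<^esub> a \<in> f ` K" using f(3)[of u a] K(4)[of u a] \<open>a \<in> carrier L\<close> by (metis imageI)
  qed
qed

lemma rsubmodule_sum:
  assumes "right_module L M" "rsubmodule L M N" "rsubmodule L M K"
  shows "rsubmodule L M {x \<oplus>\<^bsub>M\<^esub> y |x y. x \<in> N \<and> y \<in> K}" (is "rsubmodule L M ?S")
proof -
  interpret M: right_module L M by fact
  note N = rsubmoduleD[OF assms(2)] and K = rsubmoduleD[OF assms(3)]
  show ?thesis
  proof (rule M.rsubmoduleI)
    show "?S \<subseteq> carrier M" using N(1) K(1) by auto
    show "\<zero>\<^bsub>M\<^esub> \<in> ?S" using N(2) K(2) by force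
    fix x y assume "x \<in> ?S" "y \<in> ?S"
    then obtain a b c d where "a \<in> N" "b \<in> K" "c \<in> N" "d \<in> K" "x = a \<oplus>\<^bsub>M\<^esub> b" "y = c \<oplus>\<^bsub>M\<^esub> d" by blast
    moreover have "a \<in> carrier M" "b \<in> carrier M" "c \<in> carrier M" "d \<in> carrier M"
      using calculation N(1) K(1) by auto
    ultimately have "x \<oplus>\<^bsub>M\<^esub> y = (a \<oplus>\<^bsub>M\<^esub> c) \<oplus>\<^bsub>M\<^esub> (b \<oplus>\<^bsub>M\<^esub> d)" by (simp add: M.a_ac)
    then show "x \<oplus>\<^bsub>M\<^esub> y \<in> ?S" using N(3)[OF \<open>a \<in> N\<close> \<open>c \<in> N\<close>] K(3)[OF \<open>b \<in> K\<close> \<open>d \<in> K\<close>] by blast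
  next
    fix x a assume "x \<in> ?S" "a \<in> carrier L"
    then obtain u v where "u \<in> N" "v \<in> K" "x = u \<oplus>\<^bsub>M\<^esub> v" by blast
    moreover have "u \<in> carrier M" "v \<in> carrier M" using calculation N(1) K(1) by auto
    ultimately have "x \<triangleleft>\<^bsub>M\<^esub> a = u \<triangleleft>\<^bsub>M\<^esub> a \<oplus>\<^bsub>M\<^esub> v \<triangleleft>\<^bsub>M\<^esub> a" using \<open>a \<in> carrier L\<close> by (simp add: M.ract_add_left)
    then show "x \<triangleleft>\<^bsub>M\<^esub> a \<in> ?S" using N(4)[OF \<open>u \<in> N\<close> \<open>a \<in> carrier L\<close>] K(4)[OF \<open>v \<in> K\<close> \<open>a \<in> carrier L\<close>] by blast
  qed
qed

lemma rsubmodule_Ball: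
  assumes M: "right_module L M" and "\<And>i. i \<in> F \<Longrightarrow> rsubmodule L M {x \<in> carrier M. p i x}"
  shows "rsubmodule L M {x \<in> carrier M. \<forall>i\<in>F. p i x}"
proof -
  interpret M: right_module L M by fact
  note s = rsubmoduleD[OF assms(2)]
  show ?thesis
  proof (rule M.rsubmoduleI)
    show "\<zero>\<^bsub>M\<^esub> \<in> {x \<in> carrier M. \<forall>i\<in>F. p i x}" using s(2) by auto
  next
    fix x y assume xy: "x \<in> {x \<in> carrier M. \<forall>i\<in>F. p i x}" "y \<in> {x \<in> carrier M. \<forall>i\<in>F. p i x}"
    have "p i (x \<oplus>\<^bsub>M\<^esub> y)" if "i \<in> F" for i using s(3)[OF that, of x y] xy that by auto
    then show "x \<oplus>\<^bsub>M\<^esub> y \<in> {x \<in> carrier M. \<forall>i\<in>F. p i x}" using xy by auto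
  next
    fix x a assume x: "x \<in> {x \<in> carrier M. \<forall>i\<in>F. p i x}" and a: "a \<in> carrier L"
    have "p i (x \<triangleleft>\<^bsub>M\<^esub> a)" if "i \<in> F" for i using s(4)[OF that _ a, of x] x that by auto
    then show "x \<triangleleft>\<^bsub>M\<^esub> a \<in> {x \<in> carrier M. \<forall>i\<in>F. p i x}" using x a by (auto simp: M.ract_closed)
  qed auto
qed

lemma rsubmodule_Inter:
  assumes "right_module L M" "\<And>N. N \<in> A \<Longrightarrow> rsubmodule L M N" "A \<noteq> {}"
  shows "rsubmodule L M (\<Inter>A)"
proof -
  interpret M: right_module L M by fact
  show ?thesis
  proof (rule M.rsubmoduleI)
    show "\<Inter>A \<subseteq> carrier M" using assms(2,3) rsubmoduleD(1) by blast
  qed (auto dest: assms(2) intro: rsubmoduleD)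
qed

lemma rsubmodule_rspan:
  assumes "right_module L M" "X \<subseteq> carrier M" shows "rsubmodule L M (rspan L M X)"
  unfolding rspan_def
  by (rule rsubmodule_Inter) (use assms rsubmodule_carrier in auto)

lemma rspan_superset: "X \<subseteq> rspan L M X"
  by (auto simp: rspan_def)

lemma rspan_minimal: "rsubmodule L M N \<Longrightarrow> X \<subseteq> N \<Longrightarrow> rspan L M X \<subseteq> N"
  by (auto simp: rspan_def)

lemma rspan_eq_carrier_iff:
  assumes "right_module L M" "X \<subseteq> carrier M"
  shows "rspan L M X = carrier M \<longleftrightarrow> (\<forall>N. rsubmodule L M N \<longrightarrow> X \<subseteq> N \<longrightarrow> N = carrier M)"
proof
  assume eq: "rspan L M X = carrier M"
  show "\<forall>N. rsubmodule L M N \<longrightarrow> X \<subseteq> N \<longrightarrow> N = carrier M"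
  proof (intro allI impI)
    fix N assume "rsubmodule L M N" "X \<subseteq> N"
    then show "N = carrier M" using rspan_minimal[of L M N X] rsubmoduleD(1)[of L M N] eq by auto
  qed
next
  assume "\<forall>N. rsubmodule L M N \<longrightarrow> X \<subseteq> N \<longrightarrow> N = carrier M"
  then show "rspan L M X = carrier M" using rsubmodule_rspan[OF assms] rspan_superset[of X L M] by simp
qed

section \<open>Direct sums\<close>

lemma binary_sum_simps [simp]:
  "carrier (binary_sum M N) = carrier M \<times> carrier N"
  "\<zero>\<^bsub>binary_sum M N\<^esub> = (\<zero>\<^bsub>M\<^esub>, \<zero>\<^bsub>N\<^esub>)"
  "(x, y) \<oplus>\<^bsub>binary_sum M N\<^esub> (x', y') = (x \<oplus>\<^bsub>M\<^esub> x', y \<oplus>\<^bsub>N\<^esub> y')"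
  "(x, y) \<triangleleft>\<^bsub>binary_sum M N\<^esub> a = (x \<triangleleft>\<^bsub>M\<^esub> a, y \<triangleleft>\<^bsub>N\<^esub> a)"
  by (auto simp: binary_sum_def)

lemma right_module_binary_sum:
  assumes "right_module L M" "right_module L N"
  shows "right_module L (binary_sum M N)"
proof -
  interpret M: right_module L M by fact
  interpret N: right_module L N by fact
  have "abelian_group (binary_sum M N)"
  proof (rule abelian_groupI)
    fix x assume "x \<in> carrier (binary_sum M N)"
    then show "\<exists>y\<in>carrier (binary_sum M N). y \<oplus>\<^bsub>binary_sum M N\<^esub> x = \<zero>\<^bsub>binary_sum M N\<^esub>"
      by (intro bexI[of _ "(\<ominus>\<^bsub>M\<^esub> fst x, \<ominus>\<^bsub>N\<^esub> snd x)"]) (auto simp: M.l_neg N.l_neg)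
  qed (auto simp: M.a_ac N.a_ac)
  then show ?thesis
    by (intro right_moduleI)
      (auto simp: M.ract_closed N.ract_closed M.ract_add_left N.ract_add_left M.ract_add_right
        N.ract_add_right M.ract_mult N.ract_mult M.ract_one N.ract_one M.L.ring_axioms)
qed

lemma rmod_hom_fst: "fst \<in> rmod_hom L (binary_sum M N) M"
  by (rule rmod_homI) auto

lemma rmod_hom_snd: "snd \<in> rmod_hom L (binary_sum M N) N"
  by (rule rmod_homI) auto

lemma rmod_hom_pair:
  "f \<in> rmod_hom L K M \<Longrightarrow> g \<in> rmod_hom L K N \<Longrightarrow> (\<lambda>x. (f x, g x)) \<in> rmod_hom L K (binary_sum M N)"
  by (rule rmod_homI) (auto simp: rmod_homD)

lemma rmod_hom_inl:
  assumes "right_module L N" shows "(\<lambda>x. (x, \<zero>\<^bsub>N\<^esub>)) \<in> rmod_hom L M (binary_sum M N)"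
proof -
  interpret N: right_module L N by fact
  show ?thesis by (rule rmod_homI) (auto simp: N.zero_ract)
qed

lemma rmod_hom_inr:
  assumes "right_module L M" shows "(\<lambda>x. (\<zero>\<^bsub>M\<^esub>, x)) \<in> rmod_hom L N (binary_sum M N)"
proof -
  interpret M: right_module L M by fact
  show ?thesis by (rule rmod_homI) (auto simp: M.zero_ract)
qed

lemma binary_sum_cong:
  assumes "rmod_iso L M M'" "rmod_iso L N N'" "right_module L M" "right_module L N"
  shows "rmod_iso L (binary_sum M N) (binary_sum M' N')"
proof -
  obtain f f' where f: "f \<in> rmod_hom L M M'" "f' \<in> rmod_hom L M' M"
    "\<And>x. x \<in> carrier M \<Longrightarrow> f' (f x) = x" "\<And>y. y \<in> carrier M' \<Longrightarrow> f (f' y) = y" using rmod_isoE[OF assms(1) assms(3)] by metis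
  obtain g g' where g: "g \<in> rmod_hom L N N'" "g' \<in> rmod_hom L N' N"
    "\<And>x. x \<in> carrier N \<Longrightarrow> g' (g x) = x" "\<And>y. y \<in> carrier N' \<Longrightarrow> g (g' y) = y" using rmod_isoE[OF assms(2) assms(4)] by metis
  show ?thesis
    by (rule rmod_isoI[of "\<lambda>x. (f (fst x), g (snd x))" _ _ _ "\<lambda>x. (f' (fst x), g' (snd x))"])
      (auto intro!: rmod_homI simp: rmod_homD[OF f(1)] rmod_homD[OF g(1)] rmod_homD[OF f(2)]
        rmod_homD[OF g(2)] f(3,4) g(3,4))
qed

lemma binary_sum_assoc:
  "rmod_iso L (binary_sum (binary_sum M N) K) (binary_sum M (binary_sum N K))"
  by (rule rmod_isoI[of "\<lambda>((x, y), z). (x, (y, z))" _ _ _ "\<lambda>(x, (y, z)). ((x, y), z)"])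
    (auto intro!: rmod_homI)

lemma binary_sum_comm: "rmod_iso L (binary_sum M N) (binary_sum N M)"
  by (rule rmod_isoI[of "\<lambda>(x, y). (y, x)" _ _ _ "\<lambda>(x, y). (y, x)"]) (auto intro!: rmod_homI)

lemma direct_sum_simps [simp]:
  "\<zero>\<^bsub>direct_sum I M\<^esub> = (\<lambda>i\<in>I. \<zero>\<^bsub>M i\<^esub>)"
  "x \<oplus>\<^bsub>direct_sum I M\<^esub> y = (\<lambda>i\<in>I. x i \<oplus>\<^bsub>M i\<^esub> y i)"
  "x \<triangleleft>\<^bsub>direct_sum I M\<^esub> a = (\<lambda>i\<in>I. x i \<triangleleft>\<^bsub>M i\<^esub> a)"
  by (auto simp: direct_sum_def)

lemma direct_sum_carrier:
  "x \<in> carrier (direct_sum I M) \<longleftrightarrow>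
    x \<in> (\<Pi>\<^sub>E i\<in>I. carrier (M i)) \<and> finite {i \<in> I. x i \<noteq> \<zero>\<^bsub>M i\<^esub>}"
  by (auto simp: direct_sum_def)

lemma right_module_direct_sum:
  assumes L: "ring L" and M: "\<And>i. i \<in> I \<Longrightarrow> right_module L (M i)"
  shows "right_module L (direct_sum I M)"
proof -
  have ag: "abelian_group (M i)" if "i \<in> I" for i using M[OF that] by (simp add: right_module_def)
  note am = abelian_group.axioms(1)[OF ag]
  have closed_add: "(\<lambda>i\<in>I. x i \<oplus>\<^bsub>M i\<^esub> y i) \<in> carrier (direct_sum I M)"
    if "x \<in> carrier (direct_sum I M)" "y \<in> carrier (direct_sum I M)" for x y
  proof -
    have "{i \<in> I. x i \<oplus>\<^bsub>M i\<^esub> y i \<noteq> \<zero>\<^bsub>M i\<^esub>}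
        \<subseteq> {i \<in> I. x i \<noteq> \<zero>\<^bsub>M i\<^esub>} \<union> {i \<in> I. y i \<noteq> \<zero>\<^bsub>M i\<^esub>}"
      using am by (auto simp: abelian_monoid.l_zero abelian_monoid.zero_closed)
    then have "finite {i \<in> I. x i \<oplus>\<^bsub>M i\<^esub> y i \<noteq> \<zero>\<^bsub>M i\<^esub>}"
      using that by (auto simp: direct_sum_carrier intro: finite_subset)
    then show ?thesis using that
      by (auto simp: direct_sum_carrier abelian_monoid.a_closed[OF am] PiE_iff cong: conj_cong)
  qed
  have closed_ract: "(\<lambda>i\<in>I. x i \<triangleleft>\<^bsub>M i\<^esub> a) \<in> carrier (direct_sum I M)"
    if "x \<in> carrier (direct_sum I M)" "a \<in> carrier L" for x a
  proof -
    have "{i \<in> I. x i \<triangleleft>\<^bsub>M i\<^esub> a \<noteq> \<zero>\<^bsub>M i\<^esub>} \<subseteq> {i \<in> I. x i \<noteq> \<zero>\<^bsub>M i\<^esub>}"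
      using that right_module.zero_ract[OF M] by auto
    then have "finite {i \<in> I. x i \<triangleleft>\<^bsub>M i\<^esub> a \<noteq> \<zero>\<^bsub>M i\<^esub>}"
      using that by (auto simp: direct_sum_carrier intro: finite_subset)
    then show ?thesis using that right_module.ract_closed[OF M]
      by (auto simp: direct_sum_carrier PiE_iff cong: conj_cong)
  qed
  have "abelian_group (direct_sum I M)"
  proof (rule abelian_groupI)
    fix x assume x: "x \<in> carrier (direct_sum I M)"
    have "(\<lambda>i\<in>I. x i \<triangleleft>\<^bsub>M i\<^esub> (\<ominus>\<^bsub>L\<^esub> \<one>\<^bsub>L\<^esub>)) \<oplus>\<^bsub>direct_sum I M\<^esub> x = \<zero>\<^bsub>direct_sum I M\<^esub>"
      using x M ag by (auto simp: direct_sum_carrier PiE_iff right_module.ract_neg_one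
          abelian_group.l_neg intro!: restrict_ext)
    then show "\<exists>y\<in>carrier (direct_sum I M). y \<oplus>\<^bsub>direct_sum I M\<^esub> x = \<zero>\<^bsub>direct_sum I M\<^esub>"
      using closed_ract[OF x] L by (meson ring.ring_simprules(3) ring.ring_simprules(6))
  next
    show "\<zero>\<^bsub>direct_sum I M\<^esub> \<in> carrier (direct_sum I M)"
      using am by (auto simp: direct_sum_carrier abelian_monoid.zero_closed)
  next
    fix x assume "x \<in> carrier (direct_sum I M)"
    then show "\<zero>\<^bsub>direct_sum I M\<^esub> \<oplus>\<^bsub>direct_sum I M\<^esub> x = x"
      using am by (auto simp: direct_sum_carrier PiE_iff abelian_monoid.l_zero extensional_def)
  qed (use closed_add am in \<open>auto simp: direct_sum_carrier PiE_iff abelian_monoid.a_assoc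
         abelian_monoid.a_comm intro!: restrict_ext\<close>)
  then show ?thesis
    using closed_ract
    by (intro right_moduleI)
      (auto simp: L direct_sum_carrier PiE_iff right_module.ract_add_left[OF M]
        right_module.ract_add_right[OF M] right_module.ract_mult[OF M] right_module.ract_one[OF M]
        extensional_def intro!: restrict_ext)
qed

definition insertion :: "'i set \<Rightarrow> ('i \<Rightarrow> ('a, 'm, 'y) rmodule_scheme) \<Rightarrow> 'i \<Rightarrow> 'm \<Rightarrow> 'i \<Rightarrow> 'm"
  where "insertion I M i c = (\<lambda>j\<in>I. if j = i then c else \<zero>\<^bsub>M j\<^esub>)"

lemma rmod_hom_insertion:
  assumes "\<And>i. i \<in> I \<Longrightarrow> right_module L (M i)" "i \<in> I"
  shows "insertion I M i \<in> rmod_hom L (M i) (direct_sum I M)"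
proof -
  have ag: "abelian_group (M i)" if "i \<in> I" for i using assms(1)[OF that] by (simp add: right_module_def)
  note am = abelian_group.axioms(1)[OF ag]
  have "finite {j \<in> I. insertion I M i c j \<noteq> \<zero>\<^bsub>M j\<^esub>}" for c
    by (rule finite_subset[of _ "{i}"]) (auto simp: insertion_def)
  then show ?thesis
    using assms am by (intro rmod_homI) (auto simp: direct_sum_carrier insertion_def
        abelian_monoid.zero_closed abelian_monoid.l_zero right_module.zero_ract[OF assms(1)] intro!: restrict_ext)
qed

lemma rmod_hom_component:
  "i \<in> I \<Longrightarrow> (\<lambda>x. x i) \<in> rmod_hom L (direct_sum I M) (M i)"
  by (rule rmod_homI) (auto simp: direct_sum_carrier)

text \<open>Every element of a direct sum is the finite sum of its components. As an induction principle
  for submodules, this fact replaces explicit finite sums in most of the arguments below.\<close>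

lemma direct_sum_induct:
  assumes M: "\<And>i. i \<in> I \<Longrightarrow> right_module L (M i)" and N: "rsubmodule L (direct_sum I M) N"
    and x: "x \<in> carrier (direct_sum I M)" and ins: "\<And>i. i \<in> I \<Longrightarrow> insertion I M i (x i) \<in> N"
  shows "x \<in> N"
proof -
  have ag: "abelian_group (M i)" if "i \<in> I" for i using M[OF that] by (simp add: right_module_def)
  note am = abelian_group.axioms(1)[OF ag]
  have xi: "x i \<in> carrier (M i)" if "i \<in> I" for i using x that by (auto simp: direct_sum_carrier)
  have "(\<lambda>i\<in>I. if i \<in> T then x i else \<zero>\<^bsub>M i\<^esub>) \<in> N" if "finite T" "T \<subseteq> I" for T
    using that
  proof (induction T rule: finite_induct)
    case empty
    then show ?case using rsubmoduleD(2)[OF N] by (simp add: restrict_def)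
  next
    case (insert k T)
    have "(\<lambda>i\<in>I. if i \<in> insert k T then x i else \<zero>\<^bsub>M i\<^esub>) =
        insertion I M k (x k) \<oplus>\<^bsub>direct_sum I M\<^esub> (\<lambda>i\<in>I. if i \<in> T then x i else \<zero>\<^bsub>M i\<^esub>)"
      using insert xi am by (auto simp: insertion_def abelian_monoid.l_zero abelian_monoid.r_zero
          abelian_monoid.zero_closed intro!: restrict_ext)
    moreover have "\<dots> \<in> N"
      by (rule rsubmoduleD(3)[OF N]) (use insert ins[of k] in \<open>auto simp: restrict_def\<close>)
    ultimately show ?case by (simp only:)
  qed
  from this[of "{i \<in> I. x i \<noteq> \<zero>\<^bsub>M i\<^esub>}"]
  have "(\<lambda>i\<in>I. if i \<in> {i \<in> I. x i \<noteq> \<zero>\<^bsub>M i\<^esub>} then x i else \<zero>\<^bsub>M i\<^esub>) \<in> N"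
    using x by (auto simp: direct_sum_carrier)
  also have "(\<lambda>i\<in>I. if i \<in> {i \<in> I. x i \<noteq> \<zero>\<^bsub>M i\<^esub>} then x i else \<zero>\<^bsub>M i\<^esub>) = x"
    using x by (auto simp: direct_sum_carrier PiE_iff extensional_def fun_eq_iff)
  finally show ?thesis .
qed

text \<open>The homomorphism out of a direct sum induced by a family of homomorphisms.\<close>

definition sum_hom :: "('a, 'n, 'z) rmodule_scheme \<Rightarrow> 'i set \<Rightarrow> ('i \<Rightarrow> ('a, 'm, 'y) rmodule_scheme)
    \<Rightarrow> ('i \<Rightarrow> 'm \<Rightarrow> 'n) \<Rightarrow> ('i \<Rightarrow> 'm) \<Rightarrow> 'n"
  where "sum_hom N I M h x = finsum N (\<lambda>i. h i (x i)) {i \<in> I. x i \<noteq> \<zero>\<^bsub>M i\<^esub>}"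

context
  fixes L :: "('a, 'x) ring_scheme" and N :: "('a, 'n, 'z) rmodule_scheme"
    and M :: "'i \<Rightarrow> ('a, 'm, 'y) rmodule_scheme" and I h
  assumes N: "right_module L N" and M: "\<And>i. i \<in> I \<Longrightarrow> right_module L (M i)"
    and h: "\<And>i. i \<in> I \<Longrightarrow> h i \<in> rmod_hom L (M i) N"
begin

interpretation N: right_module L N by (rule N)

lemma sum_hom_superset:
  assumes "finite T" "T \<subseteq> I" "{i \<in> I. x i \<noteq> \<zero>\<^bsub>M i\<^esub>} \<subseteq> T" "\<And>i. i \<in> I \<Longrightarrow> x i \<in> carrier (M i)"
  shows "sum_hom N I M h x = finsum N (\<lambda>i. h i (x i)) T"
  unfolding sum_hom_def
proof (rule N.add.finprod_mono_neutral_cong_left)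
  show "h i (x i) = \<zero>\<^bsub>N\<^esub>" if "i \<in> T - {i \<in> I. x i \<noteq> \<zero>\<^bsub>M i\<^esub>}" for i
    using that assms(2) rmod_hom_zero[OF M N h, of i] by auto
qed (use assms rmod_homD(1)[OF h] in \<open>auto simp: subset_iff\<close>)

lemma rmod_hom_sum_hom: "sum_hom N I M h \<in> rmod_hom L (direct_sum I M) N"
proof (rule rmod_homI)
  fix x assume "x \<in> carrier (direct_sum I M)"
  then show "sum_hom N I M h x \<in> carrier N"
    unfolding sum_hom_def
    by (intro N.finsum_closed) (auto simp: direct_sum_carrier intro!: rmod_homD(1)[OF h])
next
  fix x y assume xy: "x \<in> carrier (direct_sum I M)" "y \<in> carrier (direct_sum I M)"
  let ?T = "{i \<in> I. x i \<noteq> \<zero>\<^bsub>M i\<^esub>} \<union> {i \<in> I. y i \<noteq> \<zero>\<^bsub>M i\<^esub>}"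
  have ag: "abelian_group (M i)" if "i \<in> I" for i using M[OF that] by (simp add: right_module_def)
  note am = abelian_group.axioms(1)[OF ag]
  have c: "x i \<in> carrier (M i)" "y i \<in> carrier (M i)" if "i \<in> I" for i
    using xy that by (auto simp: direct_sum_carrier)
  have fT: "finite ?T" using xy by (auto simp: direct_sum_carrier)
  have "sum_hom N I M h (x \<oplus>\<^bsub>direct_sum I M\<^esub> y)
      = finsum N (\<lambda>i. h i ((x \<oplus>\<^bsub>direct_sum I M\<^esub> y) i)) ?T"
    by (rule sum_hom_superset)
      (use fT c am in \<open>auto simp: abelian_monoid.l_zero abelian_monoid.zero_closed abelian_monoid.a_closed\<close>)
  also have "\<dots> = finsum N (\<lambda>i. h i (x i) \<oplus>\<^bsub>N\<^esub> h i (y i)) ?T"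
    by (rule N.finsum_cong') (auto simp: c rmod_homD[OF h])
  also have "\<dots> = finsum N (\<lambda>i. h i (x i)) ?T \<oplus>\<^bsub>N\<^esub> finsum N (\<lambda>i. h i (y i)) ?T"
    by (rule N.finsum_addf) (auto simp: c rmod_homD[OF h])
  also have "finsum N (\<lambda>i. h i (x i)) ?T = sum_hom N I M h x"
    by (rule sum_hom_superset[symmetric]) (use fT c in auto)
  also have "finsum N (\<lambda>i. h i (y i)) ?T = sum_hom N I M h y"
    by (rule sum_hom_superset[symmetric]) (use fT c in auto)
  finally show "sum_hom N I M h (x \<oplus>\<^bsub>direct_sum I M\<^esub> y) = sum_hom N I M h x \<oplus>\<^bsub>N\<^esub> sum_hom N I M h y" .
next
  fix x a assume x: "x \<in> carrier (direct_sum I M)" and a: "a \<in> carrier L"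
  let ?T = "{i \<in> I. x i \<noteq> \<zero>\<^bsub>M i\<^esub>}"
  have c: "x i \<in> carrier (M i)" if "i \<in> I" for i using x that by (auto simp: direct_sum_carrier)
  have fT: "finite ?T" using x by (auto simp: direct_sum_carrier)
  have *: "finsum N (\<lambda>i. h i (x i \<triangleleft>\<^bsub>M i\<^esub> a)) T = finsum N (\<lambda>i. h i (x i)) T \<triangleleft>\<^bsub>N\<^esub> a"
    if "finite T" "T \<subseteq> I" for T
    using that
  proof (induction T rule: finite_induct)
    case (insert i T)
    then have "(\<lambda>i. h i (x i)) \<in> T \<rightarrow> carrier N" "(\<lambda>i. h i (x i \<triangleleft>\<^bsub>M i\<^esub> a)) \<in> T \<rightarrow> carrier N"
      using c a M by (auto intro!: rmod_homD(1)[OF h] right_module.ract_closed)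
    then show ?case using insert c a
      by (simp add: rmod_homD[OF h] N.ract_closed N.ract_add_left)
  qed (use a in \<open>simp add: N.zero_ract\<close>)
  have "sum_hom N I M h (x \<triangleleft>\<^bsub>direct_sum I M\<^esub> a)
      = finsum N (\<lambda>i. h i ((x \<triangleleft>\<^bsub>direct_sum I M\<^esub> a) i)) ?T"
    by (rule sum_hom_superset)
      (use fT c a right_module.ract_closed[OF M] right_module.zero_ract[OF M] in \<open>auto\<close>)
  also have "\<dots> = finsum N (\<lambda>i. h i (x i \<triangleleft>\<^bsub>M i\<^esub> a)) ?T"
    by (rule N.finsum_cong') (use c a in \<open>auto intro!: rmod_homD(1)[OF h] right_module.ract_closed[OF M]\<close>)
  also have "\<dots> = sum_hom N I M h x \<triangleleft>\<^bsub>N\<^esub> a" using *[OF fT] by (auto simp: sum_hom_def)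
  finally show "sum_hom N I M h (x \<triangleleft>\<^bsub>direct_sum I M\<^esub> a) = sum_hom N I M h x \<triangleleft>\<^bsub>N\<^esub> a" .
qed

lemma sum_hom_insertion:
  assumes "i \<in> I" "c \<in> carrier (M i)"
  shows "sum_hom N I M h (insertion I M i c) = h i c"
proof -
  have "sum_hom N I M h (insertion I M i c) = finsum N (\<lambda>j. h j (insertion I M i c j)) {i}"
    by (rule sum_hom_superset) (use assms M in \<open>auto simp: insertion_def right_module_def
        abelian_group.axioms(1) abelian_monoid.zero_closed\<close>)
  also have "\<dots> = h i c" using assms rmod_homD(1)[OF h[OF assms(1)] assms(2)]
    by (simp add: insertion_def)
  finally show ?thesis .
qed

end

subsection \<open>Countable powers\<close>

abbreviation omega_sum :: "('a, 'm, 'y) rmodule_scheme \<Rightarrow> ('a, nat \<Rightarrow> 'm) rmodule"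
  where "omega_sum M \<equiv> direct_sum (UNIV :: nat set) (\<lambda>_. M)"

lemma omega_sum_carrier:
  "x \<in> carrier (omega_sum M) \<longleftrightarrow> (\<forall>i. x i \<in> carrier M) \<and> finite {i. x i \<noteq> \<zero>\<^bsub>M\<^esub>}"
  by (auto simp: direct_sum_carrier)

lemma right_module_omega_sum: "right_module L M \<Longrightarrow> right_module L (omega_sum M)"
  by (intro right_module_direct_sum) (auto simp: right_module_def)

lemma omega_sum_hom:
  assumes "right_module L M" "right_module L N" "f \<in> rmod_hom L M N"
  shows "(\<lambda>x n. f (x n)) \<in> rmod_hom L (omega_sum M) (omega_sum N)"
proof (rule rmod_homI)
  fix x assume x: "x \<in> carrier (omega_sum M)"
  have "{i. f (x i) \<noteq> \<zero>\<^bsub>N\<^esub>} \<subseteq> {i. x i \<noteq> \<zero>\<^bsub>M\<^esub>}" using rmod_hom_zero[OF assms] by auto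
  then show "(\<lambda>n. f (x n)) \<in> carrier (omega_sum N)"
    using x rmod_homD(1)[OF assms(3)] by (auto simp: omega_sum_carrier elim: finite_subset)
qed (auto simp: omega_sum_carrier rmod_homD[OF assms(3)])

lemma omega_sum_cong:
  assumes "rmod_iso L M N" "right_module L M" "right_module L N"
  shows "rmod_iso L (omega_sum M) (omega_sum N)"
proof -
  obtain f f' where f: "f \<in> rmod_hom L M N" "f' \<in> rmod_hom L N M"
    "\<And>x. x \<in> carrier M \<Longrightarrow> f' (f x) = x" "\<And>y. y \<in> carrier N \<Longrightarrow> f (f' y) = y" using rmod_isoE[OF assms(1) assms(2)] by metis
  show ?thesis
    by (rule rmod_isoI[OF omega_sum_hom[OF assms(2,3) f(1)], of "\<lambda>x n. f' (x n)"])
      (use rmod_homD(1)[OF omega_sum_hom[OF assms(3,2) f(2)]] f in \<open>auto simp: omega_sum_carrier\<close>)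
qed

text \<open>A pairing function turns the two indices into one.\<close>

lemma omega_sum_omega_sum:
  assumes M: "right_module L M"
  shows "rmod_iso L (omega_sum (omega_sum M)) (omega_sum M)"
proof -
  let ?f = "\<lambda>x k. x (fst (prod_decode k)) (snd (prod_decode k))"
  let ?g = "\<lambda>x i j. x (prod_encode (i, j))"
  have f: "?f x \<in> carrier (omega_sum M)" if x: "x \<in> carrier (omega_sum (omega_sum M))" for x
  proof -
    have "{k. ?f x k \<noteq> \<zero>\<^bsub>M\<^esub>} \<subseteq> prod_encode `
        (SIGMA i:{i. x i \<noteq> \<zero>\<^bsub>omega_sum M\<^esub>}. {j. x i j \<noteq> \<zero>\<^bsub>M\<^esub>})"
    proof
      fix k assume k: "k \<in> {k. ?f x k \<noteq> \<zero>\<^bsub>M\<^esub>}"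
      have "prod_decode k \<in> (SIGMA i:{i. x i \<noteq> \<zero>\<^bsub>omega_sum M\<^esub>}. {j. x i j \<noteq> \<zero>\<^bsub>M\<^esub>})"
        using k by (cases "prod_decode k") auto
      then show "k \<in> prod_encode ` (SIGMA i:{i. x i \<noteq> \<zero>\<^bsub>omega_sum M\<^esub>}. {j. x i j \<noteq> \<zero>\<^bsub>M\<^esub>})"
        by (metis imageI prod_decode_inverse)
    qed
    moreover have "finite (SIGMA i:{i. x i \<noteq> \<zero>\<^bsub>omega_sum M\<^esub>}. {j. x i j \<noteq> \<zero>\<^bsub>M\<^esub>})"
      using x by (intro finite_SigmaI) (auto simp: omega_sum_carrier)
    ultimately show ?thesis using x by (auto simp: omega_sum_carrier intro: finite_subset)
  qed
  have g: "?g x \<in> carrier (omega_sum (omega_sum M))" if x: "x \<in> carrier (omega_sum M)" for x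
  proof -
    let ?K = "{k. x k \<noteq> \<zero>\<^bsub>M\<^esub>}"
    have K: "finite ?K" using x by (auto simp: omega_sum_carrier)
    have "{i. ?g x i \<noteq> \<zero>\<^bsub>omega_sum M\<^esub>} \<subseteq> (\<lambda>k. fst (prod_decode k)) ` ?K"
    proof
      fix i assume "i \<in> {i. ?g x i \<noteq> \<zero>\<^bsub>omega_sum M\<^esub>}"
      then obtain j where "x (prod_encode (i, j)) \<noteq> \<zero>\<^bsub>M\<^esub>" by (auto simp: fun_eq_iff)
      then show "i \<in> (\<lambda>k. fst (prod_decode k)) ` ?K"
        by (intro image_eqI[of _ _ "prod_encode (i, j)"]) auto
    qed
    moreover have "{j. ?g x i j \<noteq> \<zero>\<^bsub>M\<^esub>} \<subseteq> (\<lambda>k. snd (prod_decode k)) ` ?K" for i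
    proof
      fix j assume "j \<in> {j. ?g x i j \<noteq> \<zero>\<^bsub>M\<^esub>}"
      then show "j \<in> (\<lambda>k. snd (prod_decode k)) ` ?K"
        by (intro image_eqI[of _ _ "prod_encode (i, j)"]) auto
    qed
    ultimately have "finite {i. ?g x i \<noteq> \<zero>\<^bsub>omega_sum M\<^esub>}" "\<And>i. finite {j. ?g x i j \<noteq> \<zero>\<^bsub>M\<^esub>}"
      using K by (meson finite_imageI finite_subset)+
    then show ?thesis using x by (auto simp: omega_sum_carrier)
  qed
  show ?thesis
    by (rule rmod_isoI[of ?f _ _ _ ?g]) (use f g in \<open>auto intro!: rmod_homI\<close>)
qed

text \<open>The shift behind the Eilenberg swindle: the new summand \<open>X\<close> becomes the zeroth
  \<open>X\<close>-coordinate, all other \<open>X\<close>-coordinates move up by one, and the \<open>Y\<close>-coordinates stay.\<close>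

lemma omega_sum_binary_absorb:
  assumes X: "right_module L X" and Y: "right_module L Y"
  shows "rmod_iso L (binary_sum X (omega_sum (binary_sum X Y))) (omega_sum (binary_sum X Y))"
proof -
  interpret X: right_module L X by fact
  interpret Y: right_module L Y by fact
  let ?S = "binary_sum X Y"
  define g where "g z = (fst (z 0), \<lambda>n. (fst (z (Suc n)), snd (z n)))" for z :: "nat \<Rightarrow> 'c \<times> 'e"
  define f where "f p n = ((case n of 0 \<Rightarrow> fst p | Suc m \<Rightarrow> fst (snd p m)), snd (snd p n))"
    for p :: "'c \<times> (nat \<Rightarrow> 'c \<times> 'e)" and n
  have gc: "g z \<in> carrier (binary_sum X (omega_sum ?S))" if z: "z \<in> carrier (omega_sum ?S)" for z
  proof -
    have "{n. (fst (z (Suc n)), snd (z n)) \<noteq> (\<zero>\<^bsub>X\<^esub>, \<zero>\<^bsub>Y\<^esub>)} \<subseteq>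
        {n. z n \<noteq> (\<zero>\<^bsub>X\<^esub>, \<zero>\<^bsub>Y\<^esub>)} \<union> Suc -` {n. z n \<noteq> (\<zero>\<^bsub>X\<^esub>, \<zero>\<^bsub>Y\<^esub>)}"
      by (auto simp: prod_eq_iff)
    moreover have "finite ({n. z n \<noteq> (\<zero>\<^bsub>X\<^esub>, \<zero>\<^bsub>Y\<^esub>)} \<union> Suc -` {n. z n \<noteq> (\<zero>\<^bsub>X\<^esub>, \<zero>\<^bsub>Y\<^esub>)})"
      using z by (intro finite_UnI finite_vimageI) (auto simp: omega_sum_carrier)
    moreover have "fst (z n) \<in> carrier X" "snd (z n) \<in> carrier Y" for n
      using z by (auto simp: omega_sum_carrier mem_Times_iff)
    ultimately show ?thesis by (auto simp: g_def omega_sum_carrier intro: finite_subset)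
  qed
  have fc: "f p \<in> carrier (omega_sum ?S)" if p: "p \<in> carrier (binary_sum X (omega_sum ?S))" for p
  proof -
    obtain x z where [simp]: "p = (x, z)" by (cases p)
    have x: "x \<in> carrier X" and z: "z \<in> carrier (omega_sum ?S)" using p by auto
    have *: "fst (z n) \<in> carrier X" "snd (z n) \<in> carrier Y" for n
      using z by (auto simp: omega_sum_carrier mem_Times_iff)
    have "{n. f p n \<noteq> (\<zero>\<^bsub>X\<^esub>, \<zero>\<^bsub>Y\<^esub>)} \<subseteq>
        insert 0 ({n. z n \<noteq> (\<zero>\<^bsub>X\<^esub>, \<zero>\<^bsub>Y\<^esub>)} \<union> Suc ` {n. z n \<noteq> (\<zero>\<^bsub>X\<^esub>, \<zero>\<^bsub>Y\<^esub>)})"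
    proof
      fix n assume "n \<in> {n. f p n \<noteq> (\<zero>\<^bsub>X\<^esub>, \<zero>\<^bsub>Y\<^esub>)}"
      then show "n \<in> insert 0 ({n. z n \<noteq> (\<zero>\<^bsub>X\<^esub>, \<zero>\<^bsub>Y\<^esub>)} \<union> Suc ` {n. z n \<noteq> (\<zero>\<^bsub>X\<^esub>, \<zero>\<^bsub>Y\<^esub>)})"
        by (cases n) (auto simp: f_def image_iff prod_eq_iff)
    qed
    moreover have "finite (insert 0 ({n. z n \<noteq> (\<zero>\<^bsub>X\<^esub>, \<zero>\<^bsub>Y\<^esub>)} \<union> Suc ` {n. z n \<noteq> (\<zero>\<^bsub>X\<^esub>, \<zero>\<^bsub>Y\<^esub>)}))"
      using z by (auto simp: omega_sum_carrier)
    moreover have "f p n \<in> carrier ?S" for n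
      using x * by (cases n) (auto simp: f_def)
    ultimately show ?thesis by (auto simp: omega_sum_carrier intro: finite_subset)
  qed
  show ?thesis
  proof (rule rmod_isoI[of f _ _ _ g])
    show "f \<in> rmod_hom L (binary_sum X (omega_sum ?S)) (omega_sum ?S)"
    proof (rule rmod_homI)
      fix p q assume "p \<in> carrier (binary_sum X (omega_sum ?S))" "q \<in> carrier (binary_sum X (omega_sum ?S))"
      then show "f (p \<oplus>\<^bsub>binary_sum X (omega_sum ?S)\<^esub> q) = f p \<oplus>\<^bsub>omega_sum ?S\<^esub> f q"
        by (cases p; cases q) (auto simp: f_def fun_eq_iff binary_sum_def case_prod_beta split: nat.split)
    next
      fix p a assume "p \<in> carrier (binary_sum X (omega_sum ?S))" "a \<in> carrier L"
      then show "f (p \<triangleleft>\<^bsub>binary_sum X (omega_sum ?S)\<^esub> a) = f p \<triangleleft>\<^bsub>omega_sum ?S\<^esub> a"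
        by (cases p) (auto simp: f_def fun_eq_iff binary_sum_def case_prod_beta split: nat.split)
    qed (rule fc)
  next
    fix p assume "p \<in> carrier (binary_sum X (omega_sum ?S))"
    then show "g (f p) = p" by (cases p) (auto simp: f_def g_def fun_eq_iff)
  next
    fix y show "f (g y) = y" by (auto simp: f_def g_def fun_eq_iff split: nat.split)
  qed (use gc in blast)
qed

section \<open>Projective modules\<close>

abbreviation free_module :: "('a, 'x) ring_scheme \<Rightarrow> 'i set \<Rightarrow> ('a, 'i \<Rightarrow> 'a) rmodule"
  where "free_module L X \<equiv> direct_sum X (\<lambda>_. regular_module L)"

lemma right_module_free: "ring L \<Longrightarrow> right_module L (free_module L X)"
  by (simp add: right_module_direct_sum right_module_regular)

definition retract_of :: "('a, 'x) ring_scheme \<Rightarrow> ('a, 'm, 'y) rmodule_scheme \<Rightarrow> ('a, 'n, 'z) rmodule_scheme \<Rightarrow> bool"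
  where "retract_of L P M \<longleftrightarrow>
    (\<exists>\<sigma>\<in>rmod_hom L P M. \<exists>\<rho>\<in>rmod_hom L M P. \<forall>p\<in>carrier P. \<rho> (\<sigma> p) = p)"

lemma retract_of_trans: "retract_of L P M \<Longrightarrow> retract_of L M N \<Longrightarrow> retract_of L P N"
proof -
  assume "retract_of L P M" "retract_of L M N"
  then obtain s r s' r' where *: "s \<in> rmod_hom L P M" "r \<in> rmod_hom L M P" "\<forall>p\<in>carrier P. r (s p) = p"
     "s' \<in> rmod_hom L M N" "r' \<in> rmod_hom L N M" "\<forall>p\<in>carrier M. r' (s' p) = p"
    unfolding retract_of_def by blast
  show ?thesis unfolding retract_of_def
    by (intro bexI[OF _ rmod_hom_comp[OF *(1,4)]] bexI[OF _ rmod_hom_comp[OF *(5,2)]])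
      (use * rmod_homD(1)[OF *(1)] in auto)
qed

lemma iso_retract_of:
  assumes "rmod_iso L P M" "right_module L P" shows "retract_of L P M" "retract_of L M P"
proof -
  obtain f g where "f \<in> rmod_hom L P M" "g \<in> rmod_hom L M P"
    "\<And>x. x \<in> carrier P \<Longrightarrow> g (f x) = x" "\<And>y. y \<in> carrier M \<Longrightarrow> f (g y) = y"
    using rmod_isoE[OF assms] by metis
  then show "retract_of L P M" "retract_of L M P" unfolding retract_of_def by blast+
qed

lemma free_basis:
  assumes L: "ring L" and N: "right_module L N" and y: "\<And>i. i \<in> X \<Longrightarrow> y i \<in> carrier N"
  obtains h where "h \<in> rmod_hom L (free_module L X) N"
    "\<And>i. i \<in> X \<Longrightarrow> h (insertion X (\<lambda>_. regular_module L) i \<one>\<^bsub>L\<^esub>) = y i"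
proof -
  interpret N: right_module L N by fact
  have h: "(\<lambda>a. y i \<triangleleft>\<^bsub>N\<^esub> a) \<in> rmod_hom L (regular_module L) N" if "i \<in> X" for i
    by (rule rmod_homI) (auto simp: y[OF that] N.ract_closed N.ract_add_right N.ract_mult)
  let ?h = "sum_hom N X (\<lambda>_. regular_module L) (\<lambda>i a. y i \<triangleleft>\<^bsub>N\<^esub> a)"
  have "?h \<in> rmod_hom L (free_module L X) N"
    by (rule rmod_hom_sum_hom) (auto simp: N h L right_module_regular)
  moreover have "?h (insertion X (\<lambda>_. regular_module L) i \<one>\<^bsub>L\<^esub>) = y i" if "i \<in> X" for i
    using sum_hom_insertion[of L N X "\<lambda>_. regular_module L" "\<lambda>i a. y i \<triangleleft>\<^bsub>N\<^esub> a" i "\<one>\<^bsub>L\<^esub>"] that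
    by (simp add: N h L right_module_regular N.ract_one y)
  ultimately show thesis using that by blast
qed

lemma free_induct:
  assumes L: "ring L" and K: "rsubmodule L (free_module L X) K"
    and b: "\<And>i. i \<in> X \<Longrightarrow> insertion X (\<lambda>_. regular_module L) i \<one>\<^bsub>L\<^esub> \<in> K"
    and x: "x \<in> carrier (free_module L X)"
  shows "x \<in> K"
proof (rule direct_sum_induct[OF _ K x])
  interpret L: ring L by fact
  fix i assume i: "i \<in> X"
  have xi: "x i \<in> carrier L" using x i by (auto simp: direct_sum_carrier)
  \<comment> \<open>The insertion of \<open>x i\<close> is a multiple of the basis element, which lies in \<open>K\<close>.\<close>
  have "insertion X (\<lambda>_. regular_module L) i (x i)
      = insertion X (\<lambda>_. regular_module L) i \<one>\<^bsub>L\<^esub> \<triangleleft>\<^bsub>free_module L X\<^esub> x i"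
    using xi by (auto simp: insertion_def intro!: restrict_ext)
  then show "insertion X (\<lambda>_. regular_module L) i (x i) \<in> K"
    using rsubmoduleD(4)[OF K b[OF i] xi] by simp
qed (simp add: L right_module_regular)

lemma minus_zero_iff:
  assumes "right_module L M" "x \<in> carrier M" "y \<in> carrier M"
  shows "x \<ominus>\<^bsub>M\<^esub> y = \<zero>\<^bsub>M\<^esub> \<longleftrightarrow> x = y"
proof -
  interpret right_module L M by fact
  show ?thesis
  proof
    assume "x \<ominus>\<^bsub>M\<^esub> y = \<zero>\<^bsub>M\<^esub>"
    then have "\<ominus>\<^bsub>M\<^esub> (\<ominus>\<^bsub>M\<^esub> y) = x"
      unfolding a_minus_def using assms by (intro M.minus_equality) auto
    then show "x = y" using assms by simp
  qed (use assms in \<open>simp add: a_minus_def M.r_neg\<close>)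
qed

text \<open>The lifting property is proved for retracts of free modules on index sets of any type. This
  freedom is needed because projectivity is defined with a basis of the element type of \<open>P\<close>, while
  countably generated projective modules are handled as retracts of the free module on \<open>\<nat>\<close>.\<close>

lemma retract_lift:
  assumes P: "right_module L P" and ret: "retract_of L P (free_module L X)"
    and N: "right_module L N" and N': "right_module L N'"
    and \<iota>: "\<iota> \<in> rmod_hom L N N'" and \<phi>: "\<phi> \<in> rmod_hom L P N'"
    and ex: "\<And>p. p \<in> carrier P \<Longrightarrow> \<exists>y\<in>carrier N. \<iota> y = \<phi> p"
  obtains h where "h \<in> rmod_hom L P N" "\<And>p. p \<in> carrier P \<Longrightarrow> \<iota> (h p) = \<phi> p"
proof -
  have L: "ring L" using P by (rule right_module_ring)
  let ?F = "free_module L X" and ?b = "\<lambda>i. insertion X (\<lambda>_. regular_module L) i \<one>\<^bsub>L\<^esub>"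
  have F: "right_module L ?F" by (rule right_module_free[OF L])
  obtain \<sigma> \<rho> where s: "\<sigma> \<in> rmod_hom L P ?F" and r: "\<rho> \<in> rmod_hom L ?F P"
    and rs: "\<And>p. p \<in> carrier P \<Longrightarrow> \<rho> (\<sigma> p) = p"
    using ret unfolding retract_of_def by blast
  have b: "?b i \<in> carrier ?F" if "i \<in> X" for i
    using rmod_homD(1)[OF rmod_hom_insertion[of X L "\<lambda>_. regular_module L"], of i "\<one>\<^bsub>L\<^esub>"] that L
    by (simp add: right_module_regular ring.ring_simprules(6))
  have "\<exists>y\<in>carrier N. \<iota> y = \<phi> (\<rho> (?b i))" if "i \<in> X" for i
    by (rule ex[OF rmod_homD(1)[OF r b[OF that]]])
  then obtain y where y: "\<And>i. i \<in> X \<Longrightarrow> y i \<in> carrier N" "\<And>i. i \<in> X \<Longrightarrow> \<iota> (y i) = \<phi> (\<rho> (?b i))"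
    by metis
  obtain h where h: "h \<in> rmod_hom L ?F N" and hb: "\<And>i. i \<in> X \<Longrightarrow> h (?b i) = y i"
    using free_basis[OF L N, of X y] y(1) by metis
  let ?d = "\<lambda>x. \<phi> (\<rho> x) \<ominus>\<^bsub>N'\<^esub> \<iota> (h x)"
  have d: "?d \<in> rmod_hom L ?F N'"
    by (intro rmod_hom_minus_fun[OF N'] rmod_hom_comp[OF r \<phi>] rmod_hom_comp[OF h \<iota>])
  have "?d (?b i) = \<zero>\<^bsub>N'\<^esub>" if "i \<in> X" for i
    using minus_zero_iff[OF N'] hb[OF that] y[OF that] rmod_homD(1)[OF \<iota>] by metis
  then have d0: "?d x = \<zero>\<^bsub>N'\<^esub>" if "x \<in> carrier ?F" for x
    using free_induct[OF L rsubmodule_vimage[OF F N' d rsubmodule_zero[OF N']], of x] that b by auto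
  have "\<iota> (h (\<sigma> p)) = \<phi> p" if "p \<in> carrier P" for p
    using minus_zero_iff[OF N' rmod_homD(1)[OF \<phi> that] rmod_homD(1)[OF \<iota> rmod_homD(1)[OF h rmod_homD(1)[OF s that]]]]
      rs[OF that] d0[OF rmod_homD(1)[OF s that]] by simp
  then show thesis using that rmod_hom_comp[OF s h] by blast
qed

lemma direct_summand_projection:
  assumes M: "right_module L M" and "direct_summand L M N"
  obtains \<pi> where "\<pi> \<in> rmod_hom L M M" "\<And>x. x \<in> carrier M \<Longrightarrow> \<pi> x \<in> N" "\<And>x. x \<in> N \<Longrightarrow> \<pi> x = x"
proof -
  interpret M: right_module L M by fact
  obtain N' where N: "rsubmodule L M N" and N': "rsubmodule L M N'"
    and int: "N \<inter> N' = {\<zero>\<^bsub>M\<^esub>}" and sum: "N <+>\<^bsub>M\<^esub> N' = carrier M"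
    using assms(2) unfolding direct_summand_def by blast
  note n = rsubmoduleD[OF N] and n' = rsubmoduleD[OF N']
  have ex: "\<exists>u\<in>N. \<exists>v\<in>N'. x = u \<oplus>\<^bsub>M\<^esub> v" if "x \<in> carrier M" for x
  proof -
    from that have "x \<in> N <+>\<^bsub>M\<^esub> N'" using sum by simp
    then show ?thesis by (auto simp: set_add_def')
  qed
  have uniq: "u = u'" if "u \<in> N" "v \<in> N'" "u' \<in> N" "v' \<in> N'" "u \<oplus>\<^bsub>M\<^esub> v = u' \<oplus>\<^bsub>M\<^esub> v'" for u v u' v'
  proof -
    have c: "u \<in> carrier M" "v \<in> carrier M" "u' \<in> carrier M" "v' \<in> carrier M"
      using that n(1) n'(1) by auto
    have "u \<ominus>\<^bsub>M\<^esub> u' = ((u \<oplus>\<^bsub>M\<^esub> v) \<ominus>\<^bsub>M\<^esub> v) \<ominus>\<^bsub>M\<^esub> u'"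
      using c by (simp add: a_minus_def M.a_ac M.r_neg)
    also have "\<dots> = ((u' \<oplus>\<^bsub>M\<^esub> v') \<ominus>\<^bsub>M\<^esub> v) \<ominus>\<^bsub>M\<^esub> u'" using that by simp
    also have "\<dots> = v' \<ominus>\<^bsub>M\<^esub> v"
    proof -
      have "((u' \<oplus>\<^bsub>M\<^esub> v') \<ominus>\<^bsub>M\<^esub> v) \<ominus>\<^bsub>M\<^esub> u' = (v' \<ominus>\<^bsub>M\<^esub> v) \<oplus>\<^bsub>M\<^esub> (u' \<oplus>\<^bsub>M\<^esub> \<ominus>\<^bsub>M\<^esub> u')"
        using c by (simp add: a_minus_def M.a_ac)
      then show ?thesis using c by (simp add: M.r_neg)
    qed
    finally have "u \<ominus>\<^bsub>M\<^esub> u' \<in> N \<inter> N'"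
      using rsubmodule_minus[OF M N that(1,3)] rsubmodule_minus[OF M N' that(4,2)] by simp
    then show ?thesis using int minus_zero_iff[OF M c(1,3)] by simp
  qed
  define \<pi> where "\<pi> x = (THE u. u \<in> N \<and> (\<exists>v\<in>N'. x = u \<oplus>\<^bsub>M\<^esub> v))" for x
  have pi: "\<pi> (u \<oplus>\<^bsub>M\<^esub> v) = u" if "u \<in> N" "v \<in> N'" for u v
    unfolding \<pi>_def by (rule the_equality) (use that uniq in blast)+
  have "\<pi> \<in> rmod_hom L M M"
  proof (rule rmod_homI)
    fix x assume "x \<in> carrier M"
    then show "\<pi> x \<in> carrier M" using ex pi n(1) by fastforce
  next
    fix x y assume "x \<in> carrier M" "y \<in> carrier M"
    then obtain u v u' v' where *: "u \<in> N" "v \<in> N'" "u' \<in> N" "v' \<in> N'" "x = u \<oplus>\<^bsub>M\<^esub> v" "y = u' \<oplus>\<^bsub>M\<^esub> v'"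
      using ex by meson
    have c: "u \<in> carrier M" "v \<in> carrier M" "u' \<in> carrier M" "v' \<in> carrier M"
      using * n(1) n'(1) by auto
    have "x \<oplus>\<^bsub>M\<^esub> y = (u \<oplus>\<^bsub>M\<^esub> u') \<oplus>\<^bsub>M\<^esub> (v \<oplus>\<^bsub>M\<^esub> v')" using c * by (simp add: M.a_ac)
    then show "\<pi> (x \<oplus>\<^bsub>M\<^esub> y) = \<pi> x \<oplus>\<^bsub>M\<^esub> \<pi> y" using * pi n(3) n'(3) by simp
  next
    fix x a assume "x \<in> carrier M" and a: "a \<in> carrier L"
    then obtain u v where *: "u \<in> N" "v \<in> N'" "x = u \<oplus>\<^bsub>M\<^esub> v" using ex by meson
    have c: "u \<in> carrier M" "v \<in> carrier M" using * n(1) n'(1) by auto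
    have "x \<triangleleft>\<^bsub>M\<^esub> a = (u \<triangleleft>\<^bsub>M\<^esub> a) \<oplus>\<^bsub>M\<^esub> (v \<triangleleft>\<^bsub>M\<^esub> a)" using c a * by (simp add: M.ract_add_left)
    then show "\<pi> (x \<triangleleft>\<^bsub>M\<^esub> a) = \<pi> x \<triangleleft>\<^bsub>M\<^esub> a" using * pi n(4) n'(4) a by simp
  qed
  moreover have "\<pi> x \<in> N" if "x \<in> carrier M" for x using ex[OF that] pi by fastforce
  moreover have "\<pi> x = x" if "x \<in> N" for x
    using pi[OF that n'(2)] that n(1) by (simp add: subset_iff)
  ultimately show thesis using that by blast
qed

lemma projective_imp_retract:
  fixes P :: "('a, 'm, 'y) rmodule_scheme"
  assumes "projective L P"
  obtains X :: "'m set" where "retract_of L P (free_module L X)"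
proof -
  obtain X :: "'m set" and N where P: "right_module L P"
    and N: "direct_summand L (free_module L X) N" and iso: "rmod_iso L P ((free_module L X)\<lparr>carrier := N\<rparr>)"
    using assms unfolding projective_def Let_def by blast
  let ?F = "free_module L X"
  have F: "right_module L ?F" by (rule right_module_free[OF right_module_ring[OF P]])
  obtain \<pi> where pi: "\<pi> \<in> rmod_hom L ?F ?F" "\<And>x. x \<in> carrier ?F \<Longrightarrow> \<pi> x \<in> N" "\<And>x. x \<in> N \<Longrightarrow> \<pi> x = x"
    using direct_summand_projection[OF F N] by blast
  have Nc: "N \<subseteq> carrier ?F" using N rsubmoduleD(1) unfolding direct_summand_def by blast
  have "retract_of L (?F\<lparr>carrier := N\<rparr>) ?F"
    unfolding retract_of_def
    by (rule bexI[OF bexI[OF _ rmod_hom_subcarrier[OF pi(1,2)]] rmod_hom_restrict[OF rmod_hom_id Nc]])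
      (use pi(3) in auto)
  then show thesis using that retract_of_trans iso_retract_of(1)[OF iso P] by blast
qed

lemma projective_lift:
  assumes "projective L P" "right_module L N" "right_module L N'"
    "\<iota> \<in> rmod_hom L N N'" "\<phi> \<in> rmod_hom L P N'"
    "\<And>p. p \<in> carrier P \<Longrightarrow> \<exists>y\<in>carrier N. \<iota> y = \<phi> p"
  obtains h where "h \<in> rmod_hom L P N" "\<And>p. p \<in> carrier P \<Longrightarrow> \<iota> (h p) = \<phi> p"
  using projective_imp_retract[OF assms(1)] retract_lift[OF _ _ assms(2-)] assms(1)
  unfolding projective_def by metis

text \<open>Lift the identity of \<open>P\<close> along the projection \<open>W \<rightarrow> P\<close> of the linear relation \<open>W\<close>. In this form,
  lifting modulo several submodules at once needs no quotient modules.\<close>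

lemma projective_lift_relation:
  assumes P: "projective L P" and N: "right_module L N" and W: "rsubmodule L (binary_sum P N) W"
    and total: "\<And>p. p \<in> carrier P \<Longrightarrow> \<exists>y. (p, y) \<in> W"
  obtains h where "h \<in> rmod_hom L P N" "\<And>p. p \<in> carrier P \<Longrightarrow> (p, h p) \<in> W"
proof -
  have Pm: "right_module L P" using P by (simp add: projective_def)
  let ?S = "binary_sum P N" and ?W = "(binary_sum P N)\<lparr>carrier := W\<rparr>"
  have S: "right_module L ?S" by (rule right_module_binary_sum[OF Pm N])
  have Wm: "right_module L ?W" by (rule right_module_submodule[OF S W])
  have Wc: "W \<subseteq> carrier ?S" by (rule rsubmoduleD(1)[OF W])
  have "\<exists>w\<in>carrier ?W. fst w = p" if "p \<in> carrier P" for p using total[OF that] by force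
  then obtain g where g: "g \<in> rmod_hom L P ?W" "\<And>p. p \<in> carrier P \<Longrightarrow> fst (g p) = p"
    using projective_lift[OF P Wm Pm rmod_hom_restrict[OF rmod_hom_fst Wc] rmod_hom_id] by metis
  have "(p, snd (g p)) \<in> W" if "p \<in> carrier P" for p
    using rmod_homD(1)[OF g(1) that] g(2)[OF that] by (metis partial_object.select_convs(1) partial_object.surjective partial_object.update_convs(1) prod.collapse)
  then show thesis using that rmod_hom_comp[OF g(1) rmod_hom_restrict[OF rmod_hom_snd Wc]] by blast
qed

text \<open>The projection \<open>x - s (F x)\<close> onto the kernel is recorded explicitly because it carries elements of
  \<open>M J\<close> to elements of \<open>(ker F) J\<close>.\<close>

lemma split_surjection:
  assumes M: "right_module L M" and N: "right_module L N"
    and F: "F \<in> rmod_hom L M N" and s: "s \<in> rmod_hom L N M" and Fs: "\<forall>y\<in>carrier N. F (s y) = y"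
  defines "K \<equiv> {x \<in> carrier M. F x = \<zero>\<^bsub>N\<^esub>}"
  shows "rsubmodule L M K" "rmod_iso L M (binary_sum N (M\<lparr>carrier := K\<rparr>))"
    "(\<lambda>x. x \<ominus>\<^bsub>M\<^esub> s (F x)) \<in> rmod_hom L M (M\<lparr>carrier := K\<rparr>)"
    "\<And>x. x \<in> K \<Longrightarrow> x \<ominus>\<^bsub>M\<^esub> s (F x) = x" "retract_of L (M\<lparr>carrier := K\<rparr>) M"
proof -
  interpret M: right_module L M by fact
  interpret N: right_module L N by fact
  show K: "rsubmodule L M K"
    using rsubmodule_vimage[OF M N F rsubmodule_zero[OF N]] by (simp add: K_def)
  have s0: "s \<zero>\<^bsub>N\<^esub> = \<zero>\<^bsub>M\<^esub>" using rmod_hom_zero[OF N M s] .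
  show fix': "x \<ominus>\<^bsub>M\<^esub> s (F x) = x" if "x \<in> K" for x
    using that by (simp add: K_def s0 M.minus_eq)
  show hom: "(\<lambda>x. x \<ominus>\<^bsub>M\<^esub> s (F x)) \<in> rmod_hom L M (M\<lparr>carrier := K\<rparr>)"
  proof (rule rmod_hom_subcarrier)
    show "(\<lambda>x. x \<ominus>\<^bsub>M\<^esub> s (F x)) \<in> rmod_hom L M M"
      by (intro rmod_hom_minus_fun[OF M] rmod_hom_id rmod_hom_comp[OF F s])
    fix x assume x: "x \<in> carrier M"
    then have "F (x \<ominus>\<^bsub>M\<^esub> s (F x)) = \<zero>\<^bsub>N\<^esub>"
      by (simp add: rmod_hom_minus[OF M N F] rmod_homD[OF F] rmod_homD[OF s] Fs minus_zero_iff[OF N])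
    then show "x \<ominus>\<^bsub>M\<^esub> s (F x) \<in> K" using x by (simp add: K_def rmod_homD[OF F] rmod_homD[OF s])
  qed
  have Kc: "K \<subseteq> carrier M" by (auto simp: K_def)
  show "retract_of L (M\<lparr>carrier := K\<rparr>) M" unfolding retract_of_def
    by (rule bexI[OF bexI[OF _ hom] rmod_hom_restrict[OF rmod_hom_id Kc]]) (use fix' in auto)
  let ?f = "\<lambda>x. (F x, x \<ominus>\<^bsub>M\<^esub> s (F x))" and ?g = "\<lambda>p. s (fst p) \<oplus>\<^bsub>M\<^esub> snd p"
  show "rmod_iso L M (binary_sum N (M\<lparr>carrier := K\<rparr>))"
  proof (rule rmod_isoI[of ?f _ _ _ ?g])
    show "?f \<in> rmod_hom L M (binary_sum N (M\<lparr>carrier := K\<rparr>))" by (rule rmod_hom_pair[OF F hom])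
    show "?g \<in> carrier (binary_sum N (M\<lparr>carrier := K\<rparr>)) \<rightarrow> carrier M"
      by (auto simp: K_def rmod_homD[OF s])
    fix x assume x: "x \<in> carrier M"
    then have c: "s (F x) \<in> carrier M" by (simp add: rmod_homD[OF F] rmod_homD[OF s])
    then show "?g (?f x) = x" using x by (simp add: a_minus_def M.a_ac M.r_neg)
  next
    fix p assume "p \<in> carrier (binary_sum N (M\<lparr>carrier := K\<rparr>))"
    then obtain y k where [simp]: "p = (y, k)" and y: "y \<in> carrier N" and k: "k \<in> carrier M" "F k = \<zero>\<^bsub>N\<^esub>"
      by (auto simp: K_def)
    have c: "s y \<in> carrier M" using y by (simp add: rmod_homD[OF s])
    have "F (s y \<oplus>\<^bsub>M\<^esub> k) = y" using c k y by (simp add: rmod_homD[OF F] Fs)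
    then show "?f (?g p) = p" using c k by (simp add: a_minus_def M.a_ac M.r_neg)
  qed
qed

text \<open>By the lifting property, a retract of any free module is also a retract of the free module on
  its own elements, along the map that sends each basis element to itself.\<close>

lemma retract_imp_projective:
  fixes P :: "('a, 'm, 'y) rmodule_scheme"
  assumes P: "right_module L P" and ret: "retract_of L P (free_module L X)"
  shows "projective L P"
proof -
  interpret P: right_module L P by fact
  have L: "ring L" using P by (rule right_module_ring)
  let ?F = "free_module L (carrier P)"
  have F: "right_module L ?F" by (rule right_module_free[OF L])
  obtain \<rho> where r: "\<rho> \<in> rmod_hom L ?F P"
    "\<And>x. x \<in> carrier P \<Longrightarrow> \<rho> (insertion (carrier P) (\<lambda>_. regular_module L) x \<one>\<^bsub>L\<^esub>) = x"
    using free_basis[OF L P, of "carrier P" "\<lambda>x. x"] by auto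
  have b: "insertion (carrier P) (\<lambda>_. regular_module L) i \<one>\<^bsub>L\<^esub> \<in> carrier ?F" if "i \<in> carrier P" for i
    using rmod_homD(1)[OF rmod_hom_insertion[of "carrier P" L "\<lambda>_. regular_module L"], of i "\<one>\<^bsub>L\<^esub>"] that L
    by (simp add: right_module_regular)
  obtain \<sigma> where s: "\<sigma> \<in> rmod_hom L P ?F" "\<And>x. x \<in> carrier P \<Longrightarrow> \<rho> (\<sigma> x) = x"
    by (rule retract_lift[OF P ret F P r(1) rmod_hom_id]) (use b r in blast)+
  let ?N = "\<sigma> ` carrier P" and ?K = "{x \<in> carrier ?F. \<rho> x = \<zero>\<^bsub>P\<^esub>}"
  have N: "rsubmodule L ?F ?N" using rsubmodule_image[OF P F s(1) rsubmodule_carrier[OF P]] .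
  have s0: "\<sigma> \<zero>\<^bsub>P\<^esub> = \<zero>\<^bsub>?F\<^esub>" using rmod_hom_zero[OF P F s(1)] .
  have "\<forall>x\<in>carrier P. \<rho> (\<sigma> x) = x" using s(2) by blast
  note split = split_surjection[where F = \<rho> and s = \<sigma>, OF F P r(1) s(1) this]
  have "direct_summand L ?F ?N"
    unfolding direct_summand_def
  proof (intro conjI N exI[of _ ?K])
    show "rsubmodule L ?F ?K" by (rule split(1))
    show "?N \<inter> ?K = {\<zero>\<^bsub>?F\<^esub>}"
      using s s0 rsubmoduleD(2)[OF N] rsubmoduleD(2)[OF split(1)] by auto
    interpret F: right_module L ?F by fact
    show "?N <+>\<^bsub>?F\<^esub> ?K = carrier ?F"
    proof (intro subset_antisym subsetI)
      fix x assume "x \<in> ?N <+>\<^bsub>?F\<^esub> ?K"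
      then obtain u v where "u \<in> ?N" "v \<in> ?K" "x = u \<oplus>\<^bsub>?F\<^esub> v"
        unfolding set_add_def' by blast
      then show "x \<in> carrier ?F" using rsubmoduleD(1)[OF N] by blast
    next
      fix x assume x: "x \<in> carrier ?F"
      have sx: "\<sigma> (\<rho> x) \<in> carrier ?F" using x by (simp add: rmod_homD(1)[OF s(1)] rmod_homD(1)[OF r(1)])
      have "x \<ominus>\<^bsub>?F\<^esub> \<sigma> (\<rho> x) \<in> ?K" using rmod_homD(1)[OF split(3) x] by simp
      moreover have "x = \<sigma> (\<rho> x) \<oplus>\<^bsub>?F\<^esub> (x \<ominus>\<^bsub>?F\<^esub> \<sigma> (\<rho> x))"
        unfolding a_minus_def using x sx F.M.a_assoc F.M.a_comm F.M.r_neg F.M.r_zero F.M.a_inv_closed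
        by metis
      moreover have "\<sigma> (\<rho> x) \<in> ?N" using x by (simp add: rmod_homD(1)[OF r(1)])
      ultimately show "x \<in> ?N <+>\<^bsub>?F\<^esub> ?K" unfolding set_add_def' by blast
    qed
  qed
  moreover have "rmod_iso L P (?F\<lparr>carrier := ?N\<rparr>)"
    by (rule rmod_isoI[of \<sigma> _ _ _ \<rho>]) (use s in \<open>auto intro!: rmod_hom_subcarrier\<close>)
  ultimately show ?thesis unfolding projective_def Let_def using P by blast
qed

lemma projective_right_module: "projective L P \<Longrightarrow> right_module L P"
  by (simp add: projective_def)

lemma cg_projective_right_module: "cg_projective L P \<Longrightarrow> right_module L P"
  by (simp add: cg_projective_def projective_def)

lemma countably_generated_sequence:
  fixes M :: "('a, 'm, 'y) rmodule_scheme"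
  assumes M: "right_module L M" and "countably_generated L M"
  obtains e :: "nat \<Rightarrow> 'm" where "range e \<subseteq> carrier M"
    "\<forall>N. rsubmodule L M N \<longrightarrow> range e \<subseteq> N \<longrightarrow> N = carrier M"
proof -
  obtain Y where Y: "countable Y" "Y \<subseteq> carrier M" "rspan L M Y = carrier M"
    using assms(2) unfolding countably_generated_def by blast
  \<comment> \<open>The added zero makes the generating set non-empty, hence the range of a sequence.\<close>
  define e where "e = from_nat_into (insert \<zero>\<^bsub>M\<^esub> Y)"
  have e: "range e = insert \<zero>\<^bsub>M\<^esub> Y" unfolding e_def using Y(1) by (intro range_from_nat_into) auto
  have "range e \<subseteq> carrier M"
    using Y(2) rsubmoduleD(2)[OF rsubmodule_carrier[OF M]] unfolding e by simp
  moreover have "\<forall>N. rsubmodule L M N \<longrightarrow> range e \<subseteq> N \<longrightarrow> N = carrier M"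
    using Y(3) rspan_eq_carrier_iff[OF M Y(2)] unfolding e by simp
  ultimately show thesis by (rule that)
qed

text \<open>Unlike the definition, this description does not refer to the type of the elements.\<close>

lemma cg_projective_iff:
  fixes P :: "('a, 'm, 'y) rmodule_scheme"
  shows "cg_projective L P \<longleftrightarrow> right_module L P \<and> retract_of L P (omega_sum (regular_module L))"
proof (intro iffI conjI)
  assume cg: "cg_projective L P"
  then show P: "right_module L P" by (rule cg_projective_right_module)
  then interpret P: right_module L P .
  have L: "ring L" using P by (rule right_module_ring)
  have "countably_generated L P" using cg by (simp add: cg_projective_def)
  then obtain e :: "nat \<Rightarrow> 'm" where er: "range e \<subseteq> carrier P"
    and gen: "\<forall>N. rsubmodule L P N \<longrightarrow> range e \<subseteq> N \<longrightarrow> N = carrier P"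
    by (rule countably_generated_sequence[OF P])
  have ec: "e n \<in> carrier P" for n using er by auto
  let ?F = "omega_sum (regular_module L)"
  have F: "right_module L ?F" by (rule right_module_free[OF L])
  obtain \<rho> where r: "\<rho> \<in> rmod_hom L ?F P"
    "\<And>n. \<rho> (insertion UNIV (\<lambda>_. regular_module L) n \<one>\<^bsub>L\<^esub>) = e n"
    using free_basis[OF L P, of UNIV e] ec by auto
  have b: "insertion UNIV (\<lambda>_. regular_module L) i \<one>\<^bsub>L\<^esub> \<in> carrier ?F" for i :: nat
    using rmod_homD(1)[OF rmod_hom_insertion[of UNIV L "\<lambda>_. regular_module L"], of i "\<one>\<^bsub>L\<^esub>"] L
    by (simp add: right_module_regular)
  have im: "rsubmodule L P (\<rho> ` carrier ?F)"
    by (rule rsubmodule_image[OF F P r(1) rsubmodule_carrier[OF F]])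
  moreover have "e n \<in> \<rho> ` carrier ?F" for n using r(2)[of n] b[of n] by (metis imageI)
  ultimately have surj: "\<rho> ` carrier ?F = carrier P" using gen by (simp add: image_subset_iff)
  have "\<exists>y\<in>carrier ?F. \<rho> y = p" if "p \<in> carrier P" for p
  proof -
    have "p \<in> \<rho> ` carrier ?F" using that by (simp only: surj)
    then show ?thesis by blast
  qed
  then obtain \<sigma> where "\<sigma> \<in> rmod_hom L P ?F" "\<And>p. p \<in> carrier P \<Longrightarrow> \<rho> (\<sigma> p) = p"
    using projective_lift[OF _ F P r(1) rmod_hom_id] cg unfolding cg_projective_def by metis
  then show "retract_of L P ?F" unfolding retract_of_def using r(1) by blast
next
  let ?F = "omega_sum (regular_module L)" and ?b = "\<lambda>i::nat. insertion UNIV (\<lambda>_. regular_module L) i \<one>\<^bsub>L\<^esub>"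
  assume "right_module L P \<and> retract_of L P ?F"
  then have P: "right_module L P" and ret: "retract_of L P ?F" by auto
  have L: "ring L" using P by (rule right_module_ring)
  have F: "right_module L ?F" by (rule right_module_free[OF L])
  obtain \<sigma> \<rho> where s: "\<sigma> \<in> rmod_hom L P ?F" and r: "\<rho> \<in> rmod_hom L ?F P"
    and rs: "\<And>p. p \<in> carrier P \<Longrightarrow> \<rho> (\<sigma> p) = p"
    using ret unfolding retract_of_def by blast
  have b: "?b i \<in> carrier ?F" for i :: nat
    using rmod_homD(1)[OF rmod_hom_insertion[of UNIV L "\<lambda>_. regular_module L"], of i "\<one>\<^bsub>L\<^esub>"] L
    by (simp add: right_module_regular ring.ring_simprules(6))
  let ?Y = "range (\<lambda>i. \<rho> (?b i))"
  have Yc: "?Y \<subseteq> carrier P" using b rmod_homD(1)[OF r] by auto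
  have "N = carrier P" if N: "rsubmodule L P N" "?Y \<subseteq> N" for N
  proof
    show "carrier P \<subseteq> N"
    proof
      fix p assume p: "p \<in> carrier P"
      have "\<sigma> p \<in> {x \<in> carrier ?F. \<rho> x \<in> N}"
        by (rule free_induct[OF L rsubmodule_vimage[OF F P r N(1)]])
          (use N(2) b rmod_homD(1)[OF s p] in auto)
      then show "p \<in> N" using rs[OF p] by simp
    qed
  qed (rule rsubmoduleD(1)[OF N(1)])
  then have "rspan L P ?Y = carrier P" using rspan_eq_carrier_iff[OF P Yc] by simp
  then have "countably_generated L P" unfolding countably_generated_def using Yc by (intro exI[of _ ?Y]) simp
  then show "cg_projective L P" unfolding cg_projective_def
    using retract_imp_projective[OF P ret] by simp
qed

lemma cg_projective_retract:
  assumes "cg_projective L P" "right_module L X" "retract_of L X P" shows "cg_projective L X"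
  using assms(1,2) retract_of_trans[OF assms(3)] unfolding cg_projective_iff by blast

lemma cg_projective_iso:
  assumes "cg_projective L P" "rmod_iso L P X" "right_module L X" shows "cg_projective L X"
  using cg_projective_retract[OF assms(1,3) iso_retract_of(2)[OF assms(2) cg_projective_right_module[OF assms(1)]]] .

text \<open>The image of \<open>P\<close> in the free module on \<open>\<nat>\<close> is a copy of \<open>P\<close> in the element type that
  isomorphism classes and relative bigness refer to.\<close>

lemma cg_projective_copy:
  fixes P :: "('a, 'm, 'y) rmodule_scheme"
  assumes "cg_projective L P"
  obtains X :: "('a, nat \<Rightarrow> 'a) rmodule" where "cg_projective L X" "rmod_iso L P X"
proof -
  let ?F = "omega_sum (regular_module L)"
  have P: "right_module L P" using assms by (rule cg_projective_right_module)
  have F: "right_module L ?F" by (rule right_module_free[OF right_module_ring[OF P]])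
  obtain \<sigma> \<rho> where s: "\<sigma> \<in> rmod_hom L P ?F" and r: "\<rho> \<in> rmod_hom L ?F P"
    and rs: "\<And>p. p \<in> carrier P \<Longrightarrow> \<rho> (\<sigma> p) = p"
    using assms unfolding cg_projective_iff retract_of_def by blast
  let ?X = "?F\<lparr>carrier := \<sigma> ` carrier P\<rparr>"
  have X: "right_module L ?X"
    by (rule right_module_submodule[OF F rsubmodule_image[OF P F s rsubmodule_carrier[OF P]]])
  have iso: "rmod_iso L P ?X"
    by (rule rmod_isoI[of \<sigma> _ _ _ \<rho>]) (use s rs in \<open>auto intro!: rmod_hom_subcarrier\<close>)
  show thesis using that cg_projective_iso[OF assms iso X] iso by blast
qed

subsection \<open>Trace ideals and products with ideals\<close>

lemma module_ideal_mult_submodule: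
  assumes "right_module L M" "J \<subseteq> carrier L" shows "rsubmodule L M (module_ideal_mult L M J)"
proof -
  interpret right_module L M by fact
  show ?thesis unfolding module_ideal_mult_def
    by (rule rsubmodule_rspan[OF assms(1)]) (use assms(2) ract_closed in auto)
qed

lemma module_ideal_multI: "x \<in> carrier M \<Longrightarrow> j \<in> J \<Longrightarrow> x \<triangleleft>\<^bsub>M\<^esub> j \<in> module_ideal_mult L M J"
  unfolding module_ideal_mult_def using rspan_superset by fast

lemma module_ideal_mult_minimal:
  assumes "rsubmodule L M N" "\<And>x j. x \<in> carrier M \<Longrightarrow> j \<in> J \<Longrightarrow> x \<triangleleft>\<^bsub>M\<^esub> j \<in> N"
  shows "module_ideal_mult L M J \<subseteq> N"
  unfolding module_ideal_mult_def by (rule rspan_minimal) (use assms in auto)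

lemma module_ideal_mult_mono:
  assumes "right_module L M" "J \<subseteq> K" "K \<subseteq> carrier L"
  shows "module_ideal_mult L M J \<subseteq> module_ideal_mult L M K"
proof (rule module_ideal_mult_minimal[OF module_ideal_mult_submodule[OF assms(1,3)]])
  fix x j assume "x \<in> carrier M" "j \<in> J"
  then show "x \<triangleleft>\<^bsub>M\<^esub> j \<in> module_ideal_mult L M K" using assms(2) by (intro module_ideal_multI) auto
qed

lemma module_ideal_mult_hom:
  assumes "right_module L M" "right_module L N" "f \<in> rmod_hom L M N" "J \<subseteq> carrier L"
    and "x \<in> module_ideal_mult L M J"
  shows "f x \<in> module_ideal_mult L N J"
proof -
  have "module_ideal_mult L M J \<subseteq> {x \<in> carrier M. f x \<in> module_ideal_mult L N J}"
  proof (rule module_ideal_mult_minimal[OF rsubmodule_vimage[OF assms(1-3)]])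
    show "rsubmodule L N (module_ideal_mult L N J)" by (rule module_ideal_mult_submodule[OF assms(2,4)])
    fix x j assume "x \<in> carrier M" "j \<in> J"
    then show "x \<triangleleft>\<^bsub>M\<^esub> j \<in> {x \<in> carrier M. f x \<in> module_ideal_mult L N J}"
      using assms(4) rmod_homD[OF assms(3)] module_ideal_multI[of "f x" N j J L]
        right_module.ract_closed[OF assms(1)] by auto
  qed
  then show ?thesis using assms(5) by auto
qed

lemma module_ideal_mult_zero:
  "right_module L M \<Longrightarrow> module_ideal_mult L M {\<zero>\<^bsub>L\<^esub>} \<subseteq> {\<zero>\<^bsub>M\<^esub>}"
  by (rule module_ideal_mult_minimal[OF rsubmodule_zero]) (simp_all add: right_module.ract_zero)

lemma trace_idealI: "f \<in> rmod_hom L M (regular_module L) \<Longrightarrow> x \<in> carrier M \<Longrightarrow> f x \<in> trace_ideal L M"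
  unfolding trace_ideal_def using rspan_superset by fast

lemma trace_ideal_submodule:
  assumes "ring L" shows "right_ideal L (trace_ideal L M)"
  unfolding trace_ideal_def
  by (rule rsubmodule_rspan[OF right_module_regular[OF assms]]) (auto dest: rmod_homD(1))

lemma trace_ideal_subset: "ring L \<Longrightarrow> trace_ideal L M \<subseteq> carrier L"
  using rsubmoduleD(1)[OF trace_ideal_submodule] by simp

lemma trace_ideal_minimal:
  assumes "right_ideal L I"
    "\<And>f x. f \<in> rmod_hom L M (regular_module L) \<Longrightarrow> x \<in> carrier M \<Longrightarrow> f x \<in> I"
  shows "trace_ideal L M \<subseteq> I"
  unfolding trace_ideal_def by (rule rspan_minimal) (use assms in auto)

lemma rmod_hom_left_mult:
  assumes "ring L" "a \<in> carrier L"
  shows "(\<lambda>x. a \<otimes>\<^bsub>L\<^esub> x) \<in> rmod_hom L (regular_module L) (regular_module L)"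
proof -
  interpret ring L by fact
  show ?thesis by (rule rmod_homI) (auto simp: assms(2) r_distr m_assoc)
qed

text \<open>The trace is generated as a right ideal, but composing a functional with a left multiplication
  gives a functional, so it is a two-sided ideal.\<close>

lemma trace_ideal_left:
  assumes L: "ring L" and "a \<in> carrier L" "x \<in> trace_ideal L M"
  shows "a \<otimes>\<^bsub>L\<^esub> x \<in> trace_ideal L M"
proof -
  have R: "right_module L (regular_module L)" by (rule right_module_regular[OF L])
  have "trace_ideal L M \<subseteq> {x \<in> carrier (regular_module L). a \<otimes>\<^bsub>L\<^esub> x \<in> trace_ideal L M}"
  proof (rule trace_ideal_minimal)
    show "right_ideal L {x \<in> carrier (regular_module L). a \<otimes>\<^bsub>L\<^esub> x \<in> trace_ideal L M}"
      by (rule rsubmodule_vimage[OF R R rmod_hom_left_mult[OF assms(1,2)] trace_ideal_submodule[OF L]])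
    fix f x assume f: "f \<in> rmod_hom L M (regular_module L)" and x: "x \<in> carrier M"
    show "f x \<in> {x \<in> carrier (regular_module L). a \<otimes>\<^bsub>L\<^esub> x \<in> trace_ideal L M}"
      using trace_idealI[OF rmod_hom_comp[OF f rmod_hom_left_mult[OF assms(1,2)]] x] rmod_homD(1)[OF f x] by simp
  qed
  then show ?thesis using assms(3) by auto
qed

text \<open>The coordinates of an element with respect to a dual basis are values of functionals, so they lie in
  the trace ideal.\<close>

lemma projective_trace:
  fixes P :: "('a, 'm, 'y) rmodule_scheme"
  assumes "projective L P" "p \<in> carrier P"
  shows "p \<in> module_ideal_mult L P (trace_ideal L P)"
proof -
  have P: "right_module L P" using assms(1) by (rule projective_right_module)
  have L: "ring L" using P by (rule right_module_ring)
  interpret P: right_module L P by fact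
  interpret L: ring L by fact
  let ?J = "trace_ideal L P"
  obtain X :: "'m set" where "retract_of L P (free_module L X)" by (rule projective_imp_retract[OF assms(1)])
  then obtain \<sigma> \<rho> where s: "\<sigma> \<in> rmod_hom L P (free_module L X)" and r: "\<rho> \<in> rmod_hom L (free_module L X) P"
    and rs: "\<And>p. p \<in> carrier P \<Longrightarrow> \<rho> (\<sigma> p) = p"
    unfolding retract_of_def by blast
  let ?F = "free_module L X" and ?i = "insertion X (\<lambda>_. regular_module L)"
  have F: "right_module L ?F" by (rule right_module_free[OF L])
  have PJ: "rsubmodule L P (module_ideal_mult L P ?J)"
    by (rule module_ideal_mult_submodule[OF P trace_ideal_subset[OF L]])
  have sp: "\<sigma> p \<in> carrier ?F" using rmod_homD(1)[OF s assms(2)] .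
  have "\<sigma> p \<in> {x \<in> carrier ?F. \<rho> x \<in> module_ideal_mult L P ?J}"
  proof (rule direct_sum_induct[OF _ rsubmodule_vimage[OF F P r PJ] sp])
    fix i assume i: "i \<in> X"
    have ins: "?i i \<in> rmod_hom L (regular_module L) ?F"
      by (rule rmod_hom_insertion[OF _ i]) (rule right_module_regular[OF L])
    have J: "\<sigma> p i \<in> ?J"
      using trace_idealI[OF rmod_hom_comp[OF s rmod_hom_component[OF i]] assms(2)] .
    then have c: "\<sigma> p i \<in> carrier L" using trace_ideal_subset[OF L] by blast
    have "?i i (\<sigma> p i) = ?i i \<one>\<^bsub>L\<^esub> \<triangleleft>\<^bsub>?F\<^esub> \<sigma> p i"
      using rmod_homD(3)[OF ins, of "\<one>\<^bsub>L\<^esub>" "\<sigma> p i"] c by simp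
    then have "\<rho> (?i i (\<sigma> p i)) = \<rho> (?i i \<one>\<^bsub>L\<^esub>) \<triangleleft>\<^bsub>P\<^esub> \<sigma> p i"
      using rmod_homD(3)[OF r _ c] rmod_homD(1)[OF ins, of "\<one>\<^bsub>L\<^esub>"] by simp
    also have "\<dots> \<in> module_ideal_mult L P ?J"
      by (rule module_ideal_multI[OF rmod_homD(1)[OF r rmod_homD(1)[OF ins]] J]) simp
    finally show "?i i (\<sigma> p i) \<in> {x \<in> carrier ?F. \<rho> x \<in> module_ideal_mult L P ?J}"
      using rmod_homD(1)[OF ins] c by simp
  qed (rule right_module_regular[OF L])
  then show ?thesis using rs[OF assms(2)] by simp
qed

text \<open>Values of functionals on \<open>P K\<close> lie in the two-sided ideal \<open>K\<close>. Together with \<open>projective_trace\<close>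
  this characterises the trace of a projective module as the least ideal with \<open>P = P K\<close>.\<close>

lemma trace_ideal_subset_ideal:
  assumes P: "right_module L P" and K: "right_ideal L K"
    and left: "\<And>a k. a \<in> carrier L \<Longrightarrow> k \<in> K \<Longrightarrow> a \<otimes>\<^bsub>L\<^esub> k \<in> K"
    and PK: "\<And>p. p \<in> carrier P \<Longrightarrow> p \<in> module_ideal_mult L P K"
  shows "trace_ideal L P \<subseteq> K"
proof (rule trace_ideal_minimal[OF K])
  have L: "ring L" using P by (rule right_module_ring)
  have R: "right_module L (regular_module L)" by (rule right_module_regular[OF L])
  have Kc: "K \<subseteq> carrier L" using rsubmoduleD(1)[OF K] by simp
  fix f x assume f: "f \<in> rmod_hom L P (regular_module L)" and x: "x \<in> carrier P"
  have "f x \<in> module_ideal_mult L (regular_module L) K"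
    by (rule module_ideal_mult_hom[OF P R f Kc PK[OF x]])
  also have "\<dots> \<subseteq> K" by (rule module_ideal_mult_minimal[OF K]) (use left in auto)
  finally show "f x \<in> K" .
qed

section \<open>Finite generation modulo a submodule\<close>

lemma right_module_image:
  assumes M: "right_module L M" and c: "carrier Q = \<pi> ` carrier M" and z: "\<pi> \<zero>\<^bsub>M\<^esub> = \<zero>\<^bsub>Q\<^esub>"
    and add: "\<And>x y. x \<in> carrier M \<Longrightarrow> y \<in> carrier M \<Longrightarrow> \<pi> (x \<oplus>\<^bsub>M\<^esub> y) = \<pi> x \<oplus>\<^bsub>Q\<^esub> \<pi> y"
    and act: "\<And>x a. x \<in> carrier M \<Longrightarrow> a \<in> carrier L \<Longrightarrow> \<pi> (x \<triangleleft>\<^bsub>M\<^esub> a) = \<pi> x \<triangleleft>\<^bsub>Q\<^esub> a"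
  shows "right_module L Q"
proof -
  interpret right_module L M by fact
  note add' = add[symmetric] and act' = act[symmetric] and z' = z[symmetric]
  have "abelian_group Q"
  proof (rule abelian_groupI)
    fix x assume "x \<in> carrier Q"
    then obtain u where "u \<in> carrier M" "x = \<pi> u" using c by auto
    then show "\<exists>y\<in>carrier Q. y \<oplus>\<^bsub>Q\<^esub> x = \<zero>\<^bsub>Q\<^esub>"
      by (intro bexI[of _ "\<pi> (\<ominus>\<^bsub>M\<^esub> u)"]) (auto simp: c add' z' M.l_neg)
  qed (auto simp: c add' z' M.a_ac)
  then show ?thesis
    by (intro right_moduleI)
      (auto simp: c add' act' L.ring_axioms ract_closed ract_add_left ract_add_right ract_mult ract_one)
qed

context
  fixes L :: "('a, 'x) ring_scheme" and M :: "('a, 'm, 'y) rmodule_scheme" and N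
  assumes M: "right_module L M" and N: "rsubmodule L M N"
begin

interpretation right_module L M by (rule M)

interpretation N: abelian_subgroup N M
  using N M.abelian_group_axioms unfolding rsubmodule_def
  by (meson abelian_subgroupI3)

lemma rquot_coset_eq_iff:
  assumes "x \<in> carrier M" "y \<in> carrier M"
  shows "N +>\<^bsub>M\<^esub> x = N +>\<^bsub>M\<^esub> y \<longleftrightarrow> x \<ominus>\<^bsub>M\<^esub> y \<in> N"
proof
  assume "N +>\<^bsub>M\<^esub> x = N +>\<^bsub>M\<^esub> y"
  then have "x \<in> N +>\<^bsub>M\<^esub> y" using N.a_rcos_self[OF assms(1)] by simp
  then show "x \<ominus>\<^bsub>M\<^esub> y \<in> N" using N.a_rcos_module_imp[OF assms(2)] by (simp add: a_minus_def)
next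
  assume "x \<ominus>\<^bsub>M\<^esub> y \<in> N"
  then have "x \<in> N +>\<^bsub>M\<^esub> y" using N.a_rcos_module_rev[OF assms(2,1)] by (simp add: a_minus_def)
  then show "N +>\<^bsub>M\<^esub> x = N +>\<^bsub>M\<^esub> y" using N.a_repr_independence'[OF _ assms(2)] by simp
qed

lemma rquot_hom:
  shows "(\<lambda>x. N +>\<^bsub>M\<^esub> x) \<in> rmod_hom L M (rquot M N)" "carrier (rquot M N) = (\<lambda>x. N +>\<^bsub>M\<^esub> x) ` carrier M"
    "right_module L (rquot M N)"
proof -
  note n = rsubmoduleD[OF N]
  show c: "carrier (rquot M N) = (\<lambda>x. N +>\<^bsub>M\<^esub> x) ` carrier M"
    by (auto simp: rquot_def A_RCOSETS_def')
  have add: "N +>\<^bsub>M\<^esub> (x \<oplus>\<^bsub>M\<^esub> y) = (N +>\<^bsub>M\<^esub> x) \<oplus>\<^bsub>rquot M N\<^esub> (N +>\<^bsub>M\<^esub> y)"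
    if "x \<in> carrier M" "y \<in> carrier M" for x y
    using N.a_rcos_sum[OF that] by (simp add: rquot_def)
  have act: "N +>\<^bsub>M\<^esub> (x \<triangleleft>\<^bsub>M\<^esub> a) = (N +>\<^bsub>M\<^esub> x) \<triangleleft>\<^bsub>rquot M N\<^esub> a"
    if x: "x \<in> carrier M" and a: "a \<in> carrier L" for x a
  proof -
    have "N +>\<^bsub>M\<^esub> (u \<triangleleft>\<^bsub>M\<^esub> a) = N +>\<^bsub>M\<^esub> (x \<triangleleft>\<^bsub>M\<^esub> a)" if u: "u \<in> N +>\<^bsub>M\<^esub> x" for u
    proof -
      obtain k where k: "k \<in> N" "u = k \<oplus>\<^bsub>M\<^esub> x" using u by (auto simp: a_r_coset_def')
      have kc: "k \<in> carrier M" using k n(1) by auto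
      have "(u \<triangleleft>\<^bsub>M\<^esub> a) \<ominus>\<^bsub>M\<^esub> (x \<triangleleft>\<^bsub>M\<^esub> a) = k \<triangleleft>\<^bsub>M\<^esub> a"
        using k kc x a by (simp add: a_minus_def ract_add_left ract_closed M.a_assoc M.r_neg)
      then show ?thesis
        using rquot_coset_eq_iff[of "u \<triangleleft>\<^bsub>M\<^esub> a" "x \<triangleleft>\<^bsub>M\<^esub> a"] k kc x a n(4) by (simp add: ract_closed)
    qed
    moreover have "x \<in> N +>\<^bsub>M\<^esub> x" by (rule N.a_rcos_self[OF x])
    ultimately have "(\<Union>u\<in>N +>\<^bsub>M\<^esub> x. N +>\<^bsub>M\<^esub> (u \<triangleleft>\<^bsub>M\<^esub> a)) = N +>\<^bsub>M\<^esub> (x \<triangleleft>\<^bsub>M\<^esub> a)" by blast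
    then show ?thesis by (simp add: rquot_def)
  qed
  have z: "N +>\<^bsub>M\<^esub> \<zero>\<^bsub>M\<^esub> = \<zero>\<^bsub>rquot M N\<^esub>"
    using n(1) by (simp add: rquot_def M.a_coset_add_zero)
  show "(\<lambda>x. N +>\<^bsub>M\<^esub> x) \<in> rmod_hom L M (rquot M N)"
    by (rule rmod_homI) (use add act c in auto)
  show "right_module L (rquot M N)"
    by (rule right_module_image[OF M, of _ "\<lambda>x. N +>\<^bsub>M\<^esub> x"]) (use add act c z in auto)
qed

text \<open>With finite generation of a quotient expressed without the quotient, generating sets can be
  moved along homomorphisms and localizations with no comparison of quotient modules.\<close>

lemma finitely_generated_rquot_iff:
  "finitely_generated L (rquot M N) \<longleftrightarrow>
    (\<exists>X. finite X \<and> X \<subseteq> carrier M \<and>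
      (\<forall>K. rsubmodule L M K \<longrightarrow> X \<subseteq> K \<longrightarrow> N \<subseteq> K \<longrightarrow> K = carrier M))"
proof
  let ?\<pi> = "\<lambda>x. N +>\<^bsub>M\<^esub> x"
  note q = rquot_hom and n = rsubmoduleD[OF N]
  assume "finitely_generated L (rquot M N)"
  then obtain Y where Y: "finite Y" "Y \<subseteq> ?\<pi> ` carrier M" "rspan L (rquot M N) Y = carrier (rquot M N)"
    unfolding finitely_generated_def q(2) by blast
  obtain X where X: "X \<subseteq> carrier M" "finite X" "Y = ?\<pi> ` X"
    using finite_subset_image[OF Y(1,2)] by blast
  have "K = carrier M" if K: "rsubmodule L M K" "X \<subseteq> K" "N \<subseteq> K" for K
  proof
    note k = rsubmoduleD[OF K(1)]
    show "K \<subseteq> carrier M" by (rule k(1))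
    have Yc: "Y \<subseteq> carrier (rquot M N)" using Y(2) q(2) by simp
    have "rsubmodule L (rquot M N) (?\<pi> ` K)" by (rule rsubmodule_image[OF M q(3,1) K(1)])
    moreover have "Y \<subseteq> ?\<pi> ` K" using X(3) K(2) by auto
    ultimately have eq: "?\<pi> ` K = carrier (rquot M N)"
      using Y(3) rspan_eq_carrier_iff[OF q(3) Yc] by simp
    show "carrier M \<subseteq> K"
    proof
      fix x assume x: "x \<in> carrier M"
      then have "?\<pi> x \<in> ?\<pi> ` K" unfolding eq q(2) by simp
      then obtain y where y: "y \<in> K" "?\<pi> x = ?\<pi> y" by blast
      have yc: "y \<in> carrier M" using y k(1) by auto
      have "x \<ominus>\<^bsub>M\<^esub> y \<in> K" using y K(3) rquot_coset_eq_iff[OF x yc] by auto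
      then have "(x \<ominus>\<^bsub>M\<^esub> y) \<oplus>\<^bsub>M\<^esub> y \<in> K" using k(3) y by blast
      then show "x \<in> K" using x yc by (simp add: a_minus_def M.a_assoc M.l_neg)
    qed
  qed
  then show "\<exists>X. finite X \<and> X \<subseteq> carrier M \<and>
      (\<forall>K. rsubmodule L M K \<longrightarrow> X \<subseteq> K \<longrightarrow> N \<subseteq> K \<longrightarrow> K = carrier M)" using X by blast
next
  let ?\<pi> = "\<lambda>x. N +>\<^bsub>M\<^esub> x"
  note q = rquot_hom and n = rsubmoduleD[OF N]
  assume "\<exists>X. finite X \<and> X \<subseteq> carrier M \<and>
      (\<forall>K. rsubmodule L M K \<longrightarrow> X \<subseteq> K \<longrightarrow> N \<subseteq> K \<longrightarrow> K = carrier M)"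
  then obtain X where X: "finite X" "X \<subseteq> carrier M"
    and gen: "\<And>K. rsubmodule L M K \<Longrightarrow> X \<subseteq> K \<Longrightarrow> N \<subseteq> K \<Longrightarrow> K = carrier M" by blast
  have Xc: "?\<pi> ` X \<subseteq> carrier (rquot M N)" using X q(2) by auto
  have "T = carrier (rquot M N)" if T: "rsubmodule L (rquot M N) T" "?\<pi> ` X \<subseteq> T" for T
  proof
    show "T \<subseteq> carrier (rquot M N)" by (rule rsubmoduleD(1)[OF T(1)])
    have "N \<subseteq> {x \<in> carrier M. ?\<pi> x \<in> T}"
    proof
      fix x assume x: "x \<in> N"
      then have xc: "x \<in> carrier M" using n(1) by auto
      then have "?\<pi> x = ?\<pi> \<zero>\<^bsub>M\<^esub>" using x rquot_coset_eq_iff[OF xc M.zero_closed] by (simp add: M.minus_eq)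
      also have "\<dots> = \<zero>\<^bsub>rquot M N\<^esub>" using rmod_hom_zero[OF M q(3,1)] .
      finally show "x \<in> {x \<in> carrier M. ?\<pi> x \<in> T}" using rsubmoduleD(2)[OF T(1)] xc by simp
    qed
    then have "{x \<in> carrier M. ?\<pi> x \<in> T} = carrier M"
      using X T(2) by (intro gen rsubmodule_vimage[OF M q(3,1) T(1)]) auto
    then show "carrier (rquot M N) \<subseteq> T" unfolding q(2) by blast
  qed
  then have "rspan L (rquot M N) (?\<pi> ` X) = carrier (rquot M N)"
    using rspan_eq_carrier_iff[OF q(3) Xc] by simp
  then show "finitely_generated L (rquot M N)"
    unfolding finitely_generated_def using X(1) Xc by (intro exI[of _ "?\<pi> ` X"]) simp
qed

end

lemma finitely_generated_iff:
  assumes M: "right_module L M"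
  shows "finitely_generated L M \<longleftrightarrow>
    (\<exists>X. finite X \<and> X \<subseteq> carrier M \<and> (\<forall>K. rsubmodule L M K \<longrightarrow> X \<subseteq> K \<longrightarrow> K = carrier M))"
  unfolding finitely_generated_def using rspan_eq_carrier_iff[OF M] by metis

section \<open>Absorbing projective modules and their trace ideals\<close>

lemma rmod_hom_const_zero: "right_module L N \<Longrightarrow> (\<lambda>_. \<zero>\<^bsub>N\<^esub>) \<in> rmod_hom L M N"
proof -
  assume "right_module L N"
  then interpret N: right_module L N .
  show ?thesis by (rule rmod_homI) (auto simp: N.zero_ract)
qed

lemma rmod_hom_omega_component: "(\<lambda>x. x n) \<in> rmod_hom L (omega_sum M) M"
  using rmod_hom_component[of n UNIV L "\<lambda>_. M"] by simp

lemma omega_sum_reindex_hom: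
  assumes "inj \<theta>" shows "(\<lambda>c n. c (\<theta> n)) \<in> rmod_hom L (omega_sum A) (omega_sum A)"
proof (rule rmod_homI)
  fix c assume c: "c \<in> carrier (omega_sum A)"
  have "finite (\<theta> -` {n. c n \<noteq> \<zero>\<^bsub>A\<^esub>})"
    by (rule finite_vimageI) (use c assms in \<open>auto simp: omega_sum_carrier\<close>)
  then show "(\<lambda>n. c (\<theta> n)) \<in> carrier (omega_sum A)" using c by (auto simp: omega_sum_carrier vimage_def)
qed auto

text \<open>An element of \<open>M Tr(A)\<close> is a finite sum of values of homomorphisms \<open>A \<rightarrow> M\<close>, hence one value
  of one homomorphism on \<open>A\<^sup>\<omega>\<close>; sums are realised by interleaving coordinates.\<close>

lemma trace_omega_image:
  assumes A: "right_module L A" and M: "right_module L M"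
    and z: "z \<in> module_ideal_mult L M (trace_ideal L A)"
  obtains h c where "h \<in> rmod_hom L (omega_sum A) M" "c \<in> carrier (omega_sum A)" "h c = z"
proof -
  interpret A: right_module L A by fact
  interpret M: right_module L M by fact
  have L: "ring L" using A by (rule right_module_ring)
  let ?C = "omega_sum A"
  have C: "right_module L ?C" by (rule right_module_omega_sum[OF A])
  define U where "U = {h c |h c. h \<in> rmod_hom L ?C M \<and> c \<in> carrier ?C}"
  have U: "rsubmodule L M U"
  proof (rule M.rsubmoduleI)
    show "U \<subseteq> carrier M" by (auto simp: U_def dest: rmod_homD(1))
    have "\<zero>\<^bsub>?C\<^esub> \<in> carrier ?C" using rsubmoduleD(2)[OF rsubmodule_carrier[OF C]] .
    then show "\<zero>\<^bsub>M\<^esub> \<in> U" unfolding U_def using rmod_hom_const_zero[OF M, of ?C]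
      by (intro CollectI exI[of _ "\<lambda>_. \<zero>\<^bsub>M\<^esub>"] exI[of _ "\<zero>\<^bsub>?C\<^esub>"] conjI) (rule refl)
  next
    fix x a assume "x \<in> U" "a \<in> carrier L"
    then obtain h c where hc: "h \<in> rmod_hom L ?C M" "c \<in> carrier ?C" "x = h c" unfolding U_def by blast
    have "x \<triangleleft>\<^bsub>M\<^esub> a = h (c \<triangleleft>\<^bsub>?C\<^esub> a)"
      using rmod_homD(3)[OF hc(1,2) \<open>a \<in> carrier L\<close>] hc(3) by (simp only:)
    moreover have "c \<triangleleft>\<^bsub>?C\<^esub> a \<in> carrier ?C"
      using right_module.ract_closed[OF C hc(2) \<open>a \<in> carrier L\<close>] .
    ultimately show "x \<triangleleft>\<^bsub>M\<^esub> a \<in> U" unfolding U_def using hc(1) by blast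
  next
    fix x y assume "x \<in> U" "y \<in> U"
    then obtain h c k d where hc: "h \<in> rmod_hom L ?C M" "c \<in> carrier ?C" "x = h c"
      and kd: "k \<in> rmod_hom L ?C M" "d \<in> carrier ?C" "y = k d" unfolding U_def by blast
    define g where "g b = h (\<lambda>n. b (2 * n)) \<oplus>\<^bsub>M\<^esub> k (\<lambda>n. b (Suc (2 * n)))" for b :: "nat \<Rightarrow> _"
    define e where "e n = (if even n then c (n div 2) else d (n div 2))" for n
    have inj: "inj (\<lambda>n::nat. 2 * n)" "inj (\<lambda>n::nat. Suc (2 * n))" by (auto simp: inj_def)
    have g: "g \<in> rmod_hom L ?C M" unfolding g_def
      by (intro rmod_hom_add[OF M] rmod_hom_comp[OF omega_sum_reindex_hom[OF inj(1)] hc(1)]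
          rmod_hom_comp[OF omega_sum_reindex_hom[OF inj(2)] kd(1)])
    have "{n. e n \<noteq> \<zero>\<^bsub>A\<^esub>} \<subseteq> (\<lambda>n. 2 * n) ` {n. c n \<noteq> \<zero>\<^bsub>A\<^esub>} \<union> (\<lambda>n. Suc (2 * n)) ` {n. d n \<noteq> \<zero>\<^bsub>A\<^esub>}"
    proof
      fix n assume "n \<in> {n. e n \<noteq> \<zero>\<^bsub>A\<^esub>}"
      then show "n \<in> (\<lambda>n. 2 * n) ` {n. c n \<noteq> \<zero>\<^bsub>A\<^esub>} \<union> (\<lambda>n. Suc (2 * n)) ` {n. d n \<noteq> \<zero>\<^bsub>A\<^esub>}"
        by (cases "even n") (auto simp: e_def elim!: evenE oddE)
    qed
    moreover have "finite ((\<lambda>n. 2 * n) ` {n. c n \<noteq> \<zero>\<^bsub>A\<^esub>} \<union> (\<lambda>n. Suc (2 * n)) ` {n. d n \<noteq> \<zero>\<^bsub>A\<^esub>})"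
      using hc(2) kd(2) by (auto simp: omega_sum_carrier)
    ultimately have "finite {n. e n \<noteq> \<zero>\<^bsub>A\<^esub>}" by (rule finite_subset)
    then have e: "e \<in> carrier ?C" using hc(2) kd(2) by (auto simp: omega_sum_carrier e_def)
    have "g e = x \<oplus>\<^bsub>M\<^esub> y" by (simp add: g_def e_def hc(3) kd(3))
    then show "x \<oplus>\<^bsub>M\<^esub> y \<in> U" unfolding U_def using g e by (intro CollectI exI[of _ g] exI[of _ e] conjI) simp_all
  qed
  have "module_ideal_mult L M (trace_ideal L A) \<subseteq> U"
  proof (rule module_ideal_mult_minimal[OF U])
    fix q j assume q: "q \<in> carrier M" and j: "j \<in> trace_ideal L A"
    have R: "right_module L (regular_module L)" by (rule right_module_regular[OF L])
    have qh: "(\<lambda>a. q \<triangleleft>\<^bsub>M\<^esub> a) \<in> rmod_hom L (regular_module L) M"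
      by (rule rmod_homI) (auto simp: q M.ract_closed M.ract_add_right M.ract_mult)
    have "trace_ideal L A \<subseteq> {a \<in> carrier (regular_module L). q \<triangleleft>\<^bsub>M\<^esub> a \<in> U}"
    proof (rule trace_ideal_minimal[OF rsubmodule_vimage[OF R M qh U]])
      fix f a assume f: "f \<in> rmod_hom L A (regular_module L)" and a: "a \<in> carrier A"
      let ?h = "\<lambda>c. q \<triangleleft>\<^bsub>M\<^esub> f (c (0::nat))"
      have "?h \<in> rmod_hom L ?C M"
        using rmod_hom_comp[OF rmod_hom_comp[OF rmod_hom_omega_component f] qh] .
      moreover have "insertion UNIV (\<lambda>_. A) 0 a \<in> carrier ?C"
        by (rule rmod_homD(1)[OF rmod_hom_insertion[OF A UNIV_I] a])
      moreover have "?h (insertion UNIV (\<lambda>_. A) 0 a) = q \<triangleleft>\<^bsub>M\<^esub> f a" by (simp add: insertion_def)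
      ultimately have "q \<triangleleft>\<^bsub>M\<^esub> f a \<in> U" unfolding U_def mem_Collect_eq by metis
      then show "f a \<in> {a \<in> carrier (regular_module L). q \<triangleleft>\<^bsub>M\<^esub> a \<in> U}"
        using rmod_homD(1)[OF f a] by simp
    qed
    then show "q \<triangleleft>\<^bsub>M\<^esub> j \<in> U" using j by blast
  qed
  then show thesis using z that unfolding U_def by blast
qed

text \<open>Each member of a countable generating sequence of \<open>M\<close> is in the image of \<open>f\<close> up to an element of
  \<open>M Tr(A)\<close>, which is a value of one homomorphism \<open>A\<^sup>\<omega> \<rightarrow> M\<close>; the map \<open>g\<close> collects these
  homomorphisms.\<close>

lemma surjection_from_omega_sum:
  fixes M :: "('a, 'm, 'y) rmodule_scheme"
  assumes A: "right_module L A" and P: "right_module L P" and M: "right_module L M"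
    and cg: "countably_generated L M" and f: "f \<in> rmod_hom L P M"
    and onto: "\<And>y. y \<in> carrier M \<Longrightarrow> \<exists>p\<in>carrier P. y \<ominus>\<^bsub>M\<^esub> f p \<in> module_ideal_mult L M (trace_ideal L A)"
  obtains g where "g \<in> rmod_hom L (omega_sum (omega_sum A)) M"
    "\<And>y. y \<in> carrier M \<Longrightarrow> \<exists>p\<in>carrier P. \<exists>c\<in>carrier (omega_sum (omega_sum A)). f p \<oplus>\<^bsub>M\<^esub> g c = y"
proof -
  interpret M: right_module L M by fact
  let ?C = "omega_sum A"
  have C: "right_module L ?C" by (rule right_module_omega_sum[OF A])
  have CC: "right_module L (omega_sum ?C)" by (rule right_module_omega_sum[OF C])
  obtain e :: "nat \<Rightarrow> 'm" where er: "range e \<subseteq> carrier M"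
    and gen: "\<forall>N. rsubmodule L M N \<longrightarrow> range e \<subseteq> N \<longrightarrow> N = carrier M"
    by (rule countably_generated_sequence[OF M cg])
  have ec: "e n \<in> carrier M" for n using er by auto
  have "\<exists>p h c. p \<in> carrier P \<and> h \<in> rmod_hom L ?C M \<and> c \<in> carrier ?C \<and> h c = e n \<ominus>\<^bsub>M\<^esub> f p" for n
    using onto[OF ec[of n]] trace_omega_image[OF A M] by metis
  then obtain p h c where p: "\<And>n. p n \<in> carrier P" and h: "\<And>n. h n \<in> rmod_hom L ?C M"
    and c: "\<And>n. c n \<in> carrier ?C" and hc: "\<And>n. h n (c n) = e n \<ominus>\<^bsub>M\<^esub> f (p n)" by metis
  define g where "g = sum_hom M UNIV (\<lambda>_::nat. ?C) h"
  have g: "g \<in> rmod_hom L (omega_sum ?C) M"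
    unfolding g_def by (rule rmod_hom_sum_hom[OF M C h])
  let ?F = "\<lambda>z. f (fst z) \<oplus>\<^bsub>M\<^esub> g (snd z)" and ?T = "binary_sum P (omega_sum ?C)"
  have F: "?F \<in> rmod_hom L ?T M"
    by (intro rmod_hom_add[OF M] rmod_hom_comp[OF rmod_hom_fst f] rmod_hom_comp[OF rmod_hom_snd g])
  have T: "right_module L ?T" by (rule right_module_binary_sum[OF P CC])
  have im: "rsubmodule L M (?F ` carrier ?T)"
    by (rule rsubmodule_image[OF T M F rsubmodule_carrier[OF T]])
  have "e n \<in> ?F ` carrier ?T" for n
  proof -
    let ?z = "(p n, insertion UNIV (\<lambda>_. ?C) n (c n))"
    have "insertion UNIV (\<lambda>_. ?C) n (c n) \<in> carrier (omega_sum ?C)"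
      by (rule rmod_homD(1)[OF rmod_hom_insertion[OF C UNIV_I] c])
    then have "?z \<in> carrier ?T" using p by simp
    moreover have "?F ?z = f (p n) \<oplus>\<^bsub>M\<^esub> (e n \<ominus>\<^bsub>M\<^esub> f (p n))"
      unfolding g_def using sum_hom_insertion[of L M UNIV "\<lambda>_. ?C" h n "c n", OF M C h UNIV_I c] hc by simp
    moreover have "\<dots> = e n" using ec[of n] rmod_homD(1)[OF f p[of n]]
      by (simp add: a_minus_def M.M.a_ac M.M.r_neg)
    ultimately show ?thesis by (metis (no_types, lifting) imageI)
  qed
  then have "range e \<subseteq> ?F ` carrier ?T" by (simp only: image_subset_iff ball_simps) blast
  then have im': "?F ` carrier ?T = carrier M" using gen im by blast
  have "\<exists>p\<in>carrier P. \<exists>c\<in>carrier (omega_sum ?C). f p \<oplus>\<^bsub>M\<^esub> g c = y" if "y \<in> carrier M" for y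
  proof -
    have "y \<in> ?F ` carrier ?T" using that by (simp only: im')
    then obtain z where z: "z \<in> carrier ?T" "y = ?F z" by blast
    then have "fst z \<in> carrier P" "snd z \<in> carrier (omega_sum ?C)" by auto
    then show ?thesis using z(2) by blast
  qed
  then show thesis using that g by blast
qed

text \<open>The Eilenberg swindle: a countable power of \<open>B\<^sup>\<omega>\<close> maps onto \<open>X\<close>, so \<open>B\<^sup>\<omega> \<cong> X \<oplus> Y\<close> for some \<open>Y\<close>, and
  \<open>B\<^sup>\<omega> \<cong> (X \<oplus> Y)\<^sup>\<omega>\<close> has room for another copy of \<open>X\<close>.\<close>

lemma omega_sum_absorbs:
  assumes B: "right_module L B" and X: "cg_projective L X"
    and XJ: "\<And>x. x \<in> carrier X \<Longrightarrow> x \<in> module_ideal_mult L X (trace_ideal L B)"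
  shows "rmod_iso L (binary_sum X (omega_sum B)) (omega_sum B)"
proof -
  have Xm: "right_module L X" using X by (rule cg_projective_right_module)
  interpret X: right_module L X by fact
  \<comment> \<open>\<open>E \<cong> B\<^sup>\<omega>\<close> maps onto \<open>X\<close>, which needs no further generators: the map from \<open>X\<close> itself is zero.\<close>
  let ?D = "omega_sum B" and ?E = "omega_sum (omega_sum B)"
  have D: "right_module L ?D" by (rule right_module_omega_sum[OF B])
  have E: "right_module L ?E" by (rule right_module_omega_sum[OF D])
  have EE: "right_module L (omega_sum ?E)" by (rule right_module_omega_sum[OF E])
  have pr: "projective L X" and cg: "countably_generated L X" using X by (auto simp: cg_projective_def)
  have "\<exists>p\<in>carrier X. y \<ominus>\<^bsub>X\<^esub> (\<lambda>_. \<zero>\<^bsub>X\<^esub>) p \<in> module_ideal_mult L X (trace_ideal L B)"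
    if "y \<in> carrier X" for y using XJ[OF that] that by auto
  then obtain g where g: "g \<in> rmod_hom L ?E X"
    and onto: "\<And>y. y \<in> carrier X \<Longrightarrow> \<exists>p\<in>carrier X. \<exists>c\<in>carrier ?E. \<zero>\<^bsub>X\<^esub> \<oplus>\<^bsub>X\<^esub> g c = y"
    using surjection_from_omega_sum[OF B Xm Xm cg rmod_hom_const_zero[OF Xm]] by metis
  have "\<exists>c\<in>carrier ?E. g c = y" if y: "y \<in> carrier X" for y
  proof -
    obtain c where "c \<in> carrier ?E" "\<zero>\<^bsub>X\<^esub> \<oplus>\<^bsub>X\<^esub> g c = y" using onto[OF y] by blast
    then show ?thesis using rmod_homD(1)[OF g] by (intro bexI[of _ c]) auto
  qed
  then obtain s where s: "s \<in> rmod_hom L X ?E" "\<And>x. x \<in> carrier X \<Longrightarrow> g (s x) = x"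
    using projective_lift[OF pr E Xm g rmod_hom_id] by metis
  let ?Y = "?E\<lparr>carrier := {x \<in> carrier ?E. g x = \<zero>\<^bsub>X\<^esub>}\<rparr>"
  have gs: "\<forall>x\<in>carrier X. g (s x) = x" using s(2) by blast
  note split = split_surjection[where F = g and s = s, OF E Xm g s(1) gs]
  have Y: "right_module L ?Y" by (rule right_module_submodule[OF E split(1)])
  have S: "right_module L (binary_sum X ?Y)" by (rule right_module_binary_sum[OF Xm Y])
  have 1: "rmod_iso L (omega_sum ?E) (omega_sum (binary_sum X ?Y))"
    by (rule omega_sum_cong[OF split(2) E S])
  have 2: "rmod_iso L (omega_sum ?E) ?D"
    by (rule rmod_iso_trans[OF omega_sum_cong[OF omega_sum_omega_sum[OF B] E D] omega_sum_omega_sum[OF B]])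
  have 3: "rmod_iso L (binary_sum X ?D) (binary_sum X (omega_sum ?E))"
    by (rule binary_sum_cong[OF rmod_iso_refl rmod_iso_sym[OF 2 EE] Xm D])
  have "rmod_iso L (binary_sum X (omega_sum ?E)) (binary_sum X (omega_sum (binary_sum X ?Y)))"
    by (rule binary_sum_cong[OF rmod_iso_refl 1 Xm EE])
  from rmod_iso_trans[OF 3 this] omega_sum_binary_absorb[OF Xm Y]
  have "rmod_iso L (binary_sum X ?D) (omega_sum (binary_sum X ?Y))" by (rule rmod_iso_trans)
  from this rmod_iso_sym[OF 1 EE] have "rmod_iso L (binary_sum X ?D) (omega_sum ?E)"
    by (rule rmod_iso_trans)
  from this 2 show ?thesis by (rule rmod_iso_trans)
qed

text \<open>Elements of the power are sums of insertions, and insertions are homomorphisms.\<close>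

lemma omega_sum_ideal_mult:
  assumes A: "right_module L A" and J: "J \<subseteq> carrier L"
    and AJ: "\<And>a. a \<in> carrier A \<Longrightarrow> a \<in> module_ideal_mult L A J"
    and c: "c \<in> carrier (omega_sum A)"
  shows "c \<in> module_ideal_mult L (omega_sum A) J"
proof (rule direct_sum_induct[OF A _ c])
  have C: "right_module L (omega_sum A)" by (rule right_module_omega_sum[OF A])
  show "rsubmodule L (omega_sum A) (module_ideal_mult L (omega_sum A) J)"
    by (rule module_ideal_mult_submodule[OF C J])
  fix i :: nat
  have ins: "insertion UNIV (\<lambda>_. A) i \<in> rmod_hom L A (omega_sum A)"
    by (rule rmod_hom_insertion[OF A UNIV_I])
  show "insertion UNIV (\<lambda>_. A) i (c i) \<in> module_ideal_mult L (omega_sum A) J"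
    by (rule module_ideal_mult_hom[OF A C ins J AJ]) (use c in \<open>simp add: omega_sum_carrier\<close>)
qed

text \<open>Enlarged by copies of \<open>A\<close>, the map \<open>f\<close> becomes a split surjection from \<open>P \<oplus> (A\<^sup>\<omega>)\<^sup>\<omega> \<cong> P\<close> onto \<open>Q\<close>.
  Its kernel \<open>X\<close> satisfies \<open>X = X J\<close>, for the common trace ideal \<open>J\<close>, because \<open>f\<close> is injective
  modulo \<open>J\<close>. So \<open>X\<close> is absorbed by \<open>B\<^sup>\<omega>\<close> and hence by \<open>Q\<close>.\<close>

theorem iso_of_iso_modulo_trace:
  assumes P: "cg_projective L P" and Q: "cg_projective L Q"
    and A: "projective L A" and B: "right_module L B" and tr: "trace_ideal L A = trace_ideal L B"
    and PA: "rmod_iso L (binary_sum P (omega_sum A)) P"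
    and QB: "rmod_iso L (binary_sum Q (omega_sum B)) Q"
    and f: "f \<in> rmod_hom L P Q"
    and inj: "\<And>p. p \<in> carrier P \<Longrightarrow> f p \<in> module_ideal_mult L Q (trace_ideal L A) \<Longrightarrow>
      p \<in> module_ideal_mult L P (trace_ideal L A)"
    and onto: "\<And>q. q \<in> carrier Q \<Longrightarrow> \<exists>p\<in>carrier P. q \<ominus>\<^bsub>Q\<^esub> f p \<in> module_ideal_mult L Q (trace_ideal L A)"
  shows "rmod_iso L P Q"
proof -
  let ?J = "trace_ideal L A"
  have Pm: "right_module L P" and Qm: "right_module L Q" and Am: "right_module L A"
    using P Q A by (auto intro: cg_projective_right_module projective_right_module)
  interpret P: right_module L P by fact
  interpret Q: right_module L Q by fact
  have L: "ring L" using Pm by (rule right_module_ring)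
  have Jc: "?J \<subseteq> carrier L" by (rule trace_ideal_subset[OF L])
  let ?C = "omega_sum A" and ?E = "omega_sum (omega_sum A)" and ?D = "omega_sum B"
  have C: "right_module L ?C" by (rule right_module_omega_sum[OF Am])
  have D: "right_module L ?D" by (rule right_module_omega_sum[OF B])
  have E: "right_module L ?E" by (rule right_module_omega_sum[OF C])
  let ?T = "binary_sum P ?E"
  have T: "right_module L ?T" by (rule right_module_binary_sum[OF Pm E])
  have "rmod_iso L ?T (binary_sum P ?C)"
    by (rule binary_sum_cong[OF rmod_iso_refl omega_sum_omega_sum[OF Am] Pm E])
  from this PA have TP: "rmod_iso L ?T P" by (rule rmod_iso_trans)
  have prQ: "projective L Q" and cgQ: "countably_generated L Q" using Q by (auto simp: cg_projective_def)
  obtain g where g: "g \<in> rmod_hom L ?E Q"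
    and gonto: "\<And>y. y \<in> carrier Q \<Longrightarrow> \<exists>p\<in>carrier P. \<exists>c\<in>carrier ?E. f p \<oplus>\<^bsub>Q\<^esub> g c = y"
    by (rule surjection_from_omega_sum[OF Am Pm Qm cgQ f]) (rule onto, blast+)
  define F where "F z = f (fst z) \<oplus>\<^bsub>Q\<^esub> g (snd z)" for z
  have F: "F \<in> rmod_hom L ?T Q"
    unfolding F_def
    by (intro rmod_hom_add[OF Qm] rmod_hom_comp[OF rmod_hom_fst f] rmod_hom_comp[OF rmod_hom_snd g])
  have "\<exists>z\<in>carrier ?T. F z = y" if y: "y \<in> carrier Q" for y
  proof -
    obtain p c where "p \<in> carrier P" "c \<in> carrier ?E" "f p \<oplus>\<^bsub>Q\<^esub> g c = y" using gonto[OF y] by blast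
    then show ?thesis by (intro bexI[of _ "(p, c)"]) (simp_all add: F_def)
  qed
  then obtain s where s: "s \<in> rmod_hom L Q ?T" "\<And>y. y \<in> carrier Q \<Longrightarrow> F (s y) = y"
    using projective_lift[OF prQ T Qm F rmod_hom_id] by metis
  let ?K = "{z \<in> carrier ?T. F z = \<zero>\<^bsub>Q\<^esub>}"
  let ?X = "?T\<lparr>carrier := ?K\<rparr>"
  have Fs: "\<forall>y\<in>carrier Q. F (s y) = y" using s(2) by blast
  note split = split_surjection[where F = F and s = s, OF T Qm F s(1) Fs]
  have X: "right_module L ?X" by (rule right_module_submodule[OF T split(1)])
  have cgX: "cg_projective L ?X"
    by (rule cg_projective_retract[OF P X retract_of_trans[OF split(5) iso_retract_of(1)[OF TP T]]])
  have "x \<in> module_ideal_mult L ?X (trace_ideal L B)" if x: "x \<in> carrier ?X" for x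
  proof -
    obtain p c where [simp]: "x = (p, c)" by (cases x)
    have p: "p \<in> carrier P" and c: "c \<in> carrier ?E" and Fx: "f p \<oplus>\<^bsub>Q\<^esub> g c = \<zero>\<^bsub>Q\<^esub>"
      using x by (auto simp: F_def)
    have QJ: "rsubmodule L Q (module_ideal_mult L Q ?J)" by (rule module_ideal_mult_submodule[OF Qm Jc])
    have cJ: "c \<in> module_ideal_mult L ?E ?J"
      by (intro omega_sum_ideal_mult[OF C Jc] omega_sum_ideal_mult[OF Am Jc] projective_trace[OF A] c)
    have "f p = \<ominus>\<^bsub>Q\<^esub> g c"
      using Fx p c by (simp add: Q.M.minus_equality rmod_homD(1)[OF f] rmod_homD(1)[OF g])
    then have "f p \<in> module_ideal_mult L Q ?J"
      using rsubmodule_neg[OF Qm QJ module_ideal_mult_hom[OF E Qm g Jc cJ]] by simp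
    then have pJ: "p \<in> module_ideal_mult L P ?J" by (rule inj[OF p])
    have TJ: "rsubmodule L ?T (module_ideal_mult L ?T ?J)" by (rule module_ideal_mult_submodule[OF T Jc])
    have "(p, \<zero>\<^bsub>?E\<^esub>) \<oplus>\<^bsub>?T\<^esub> (\<zero>\<^bsub>P\<^esub>, c) \<in> module_ideal_mult L ?T ?J"
      by (rule rsubmoduleD(3)[OF TJ module_ideal_mult_hom[OF Pm T rmod_hom_inl[OF E] Jc pJ]
            module_ideal_mult_hom[OF E T rmod_hom_inr[OF Pm] Jc cJ]])
    moreover have "(p, \<zero>\<^bsub>?E\<^esub>) \<oplus>\<^bsub>?T\<^esub> (\<zero>\<^bsub>P\<^esub>, c) = x"
    proof -
      interpret E: right_module L ?E by (rule E)
      show ?thesis using p E.M.l_zero[OF c] by (simp del: direct_sum_simps)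
    qed
    ultimately have "x \<in> module_ideal_mult L ?T ?J" by (simp only:)
    then have "x \<ominus>\<^bsub>?T\<^esub> s (F x) \<in> module_ideal_mult L ?X ?J"
      by (rule module_ideal_mult_hom[OF T X split(3) Jc])
    then show ?thesis using split(4)[of x] x tr by simp
  qed
  from omega_sum_absorbs[OF B cgX this]
  have XD: "rmod_iso L (binary_sum ?X ?D) ?D" .
  have QX: "right_module L (binary_sum Q ?D)" by (rule right_module_binary_sum[OF Qm D])
  have "rmod_iso L P (binary_sum Q ?X)" by (rule rmod_iso_trans[OF rmod_iso_sym[OF TP T] split(2)])
  moreover have "rmod_iso L (binary_sum Q ?X) (binary_sum (binary_sum Q ?D) ?X)"
    by (rule binary_sum_cong[OF rmod_iso_sym[OF QB QX] rmod_iso_refl Qm X])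
  moreover have "rmod_iso L (binary_sum (binary_sum Q ?D) ?X) (binary_sum Q (binary_sum ?D ?X))"
    by (rule binary_sum_assoc)
  moreover have "rmod_iso L (binary_sum Q (binary_sum ?D ?X)) (binary_sum Q ?D)"
    by (rule binary_sum_cong[OF rmod_iso_refl rmod_iso_trans[OF binary_sum_comm XD] Qm
          right_module_binary_sum[OF D X]])
  ultimately show ?thesis using QB rmod_iso_trans by meson
qed

text \<open>Finitely many elements of \<open>P \<cong> P \<oplus> A\<^sup>\<omega>\<close> vanish in all but finitely many of the copies of \<open>A\<close>.
  Projecting to one of the other copies shows that finite generation of \<open>P\<close> modulo \<open>P I\<close>
  forces \<open>A = A I\<close>. This makes the trace ideal of \<open>A\<close> an invariant of \<open>P\<close>.\<close>

lemma absorbed_eq_ideal_mult: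
  assumes Pm: "right_module L P" and A: "right_module L A"
    and PA: "rmod_iso L (binary_sum P (omega_sum A)) P" and I: "I \<subseteq> carrier L"
    and X: "finite X" "X \<subseteq> carrier P"
    and gen: "\<And>K. rsubmodule L P K \<Longrightarrow> X \<subseteq> K \<Longrightarrow> module_ideal_mult L P I \<subseteq> K \<Longrightarrow> K = carrier P"
    and a: "a \<in> carrier A"
  shows "a \<in> module_ideal_mult L A I"
proof -
  let ?C = "omega_sum A"
  let ?S = "binary_sum P ?C"
  have C: "right_module L ?C" by (rule right_module_omega_sum[OF A])
  have S: "right_module L ?S" by (rule right_module_binary_sum[OF Pm C])
  interpret P: right_module L P by fact
  obtain \<psi> \<phi> where psi: "\<psi> \<in> rmod_hom L ?S P" and phi: "\<phi> \<in> rmod_hom L P ?S"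
    and inv: "\<And>x. x \<in> carrier ?S \<Longrightarrow> \<phi> (\<psi> x) = x"
    using rmod_isoE[OF PA S] by metis
  have fin: "finite {n. snd (\<phi> x) n \<noteq> \<zero>\<^bsub>A\<^esub>}" if "x \<in> X" for x
  proof -
    have "\<phi> x \<in> carrier P \<times> carrier ?C" using rmod_homD(1)[OF phi] that X(2) by auto
    then have "snd (\<phi> x) \<in> carrier ?C" by (auto simp: mem_Times_iff)
    then show ?thesis unfolding omega_sum_carrier by blast
  qed
  have "finite (\<Union>x\<in>X. {n. snd (\<phi> x) n \<noteq> \<zero>\<^bsub>A\<^esub>})" using X(1) fin by blast
  then obtain n where n: "n \<notin> (\<Union>x\<in>X. {n. snd (\<phi> x) n \<noteq> \<zero>\<^bsub>A\<^esub>})" using ex_new_if_finite[OF infinite_UNIV_nat] by blast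
  let ?\<pi> = "\<lambda>p. snd (\<phi> p) n"
  have pi: "?\<pi> \<in> rmod_hom L P A"
    using rmod_hom_comp[OF rmod_hom_comp[OF phi rmod_hom_snd] rmod_hom_omega_component] .
  have AI: "rsubmodule L A (module_ideal_mult L A I)" by (rule module_ideal_mult_submodule[OF A I])
  have PI: "module_ideal_mult L P I \<subseteq> carrier P" using rsubmoduleD(1)[OF module_ideal_mult_submodule[OF Pm I]] .
  have "{p \<in> carrier P. ?\<pi> p \<in> module_ideal_mult L A I} = carrier P"
  proof (rule gen[OF rsubmodule_vimage[OF Pm A pi AI]])
    show "X \<subseteq> {p \<in> carrier P. ?\<pi> p \<in> module_ideal_mult L A I}"
      using X(2) n rsubmoduleD(2)[OF AI] by auto
    show "module_ideal_mult L P I \<subseteq> {p \<in> carrier P. ?\<pi> p \<in> module_ideal_mult L A I}"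
      using module_ideal_mult_hom[OF Pm A pi I] PI by auto
  qed
  moreover have "(\<zero>\<^bsub>P\<^esub>, insertion UNIV (\<lambda>_. A) n a) \<in> carrier ?S"
    using rmod_homD(1)[OF rmod_hom_insertion[OF A UNIV_I] a] by simp
  ultimately have "?\<pi> (\<psi> (\<zero>\<^bsub>P\<^esub>, insertion UNIV (\<lambda>_. A) n a)) \<in> module_ideal_mult L A I"
    using rmod_homD(1)[OF psi] by blast
  then show ?thesis
    using inv[OF \<open>(\<zero>\<^bsub>P\<^esub>, insertion UNIV (\<lambda>_. A) n a) \<in> carrier ?S\<close>] by (simp add: insertion_def)
qed

section \<open>Localization at central denominators\<close>

text \<open>The localization of \<open>L\<close> at the central multiplicative set \<open>S\<close>, and below that of a module, are
  described by their maps \<open>j\<close> and \<open>\<iota>\<close> from the original object: every element becomes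
  an image after multiplication by a denominator, and the map is injective. This characterises
  localizations of torsion-free objects up to isomorphism. Tensor products with rings of fractions
  satisfy it, and so do direct sums and isomorphic copies of localized modules, so that
  localization can be compared with these constructions by checking the characterisation.\<close>

locale central_localization = L: ring L + L': ring L'
  for L :: "('a, 'x) ring_scheme" and L' :: "('b, 'z) ring_scheme" +
  fixes S :: "'a set" and j :: "'a \<Rightarrow> 'b"
  assumes j_hom: "j \<in> ring_hom L L'" and S_subset: "S \<subseteq> carrier L" and S_one: "\<one>\<^bsub>L\<^esub> \<in> S"
    and S_mult: "\<lbrakk>s \<in> S; t \<in> S\<rbrakk> \<Longrightarrow> s \<otimes>\<^bsub>L\<^esub> t \<in> S"
    and S_central: "\<lbrakk>s \<in> S; a \<in> carrier L\<rbrakk> \<Longrightarrow> a \<otimes>\<^bsub>L\<^esub> s = s \<otimes>\<^bsub>L\<^esub> a"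
    and j_unit: "s \<in> S \<Longrightarrow> j s \<in> Units L'"
    and j_denominator: "y \<in> carrier L' \<Longrightarrow> \<exists>s\<in>S. \<exists>a\<in>carrier L. y \<otimes>\<^bsub>L'\<^esub> j s = j a"
    and j_inj: "\<lbrakk>a \<in> carrier L; j a = \<zero>\<^bsub>L'\<^esub>\<rbrakk> \<Longrightarrow> a = \<zero>\<^bsub>L\<^esub>"
begin

lemma S_carrier: "s \<in> S \<Longrightarrow> s \<in> carrier L" using S_subset by auto

context
  notes [simp] = S_carrier
begin

lemma j_closed [simp]: "a \<in> carrier L \<Longrightarrow> j a \<in> carrier L'" using j_hom by (rule ring_hom_closed)

lemma j_mult: "a \<in> carrier L \<Longrightarrow> b \<in> carrier L \<Longrightarrow> j (a \<otimes>\<^bsub>L\<^esub> b) = j a \<otimes>\<^bsub>L'\<^esub> j b"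
  using j_hom by (rule ring_hom_mult)

lemma j_add: "a \<in> carrier L \<Longrightarrow> b \<in> carrier L \<Longrightarrow> j (a \<oplus>\<^bsub>L\<^esub> b) = j a \<oplus>\<^bsub>L'\<^esub> j b"
  using j_hom by (rule ring_hom_add)

definition loc_module :: "('a, 'm, 'u) rmodule_scheme \<Rightarrow> ('b, 'n, 'v) rmodule_scheme \<Rightarrow> ('m \<Rightarrow> 'n) \<Rightarrow> bool"
  where "loc_module M M' \<iota> \<longleftrightarrow> right_module L M \<and> right_module L' M' \<and>
    (\<forall>x\<in>carrier M. \<iota> x \<in> carrier M') \<and>
    (\<forall>x\<in>carrier M. \<forall>y\<in>carrier M. \<iota> (x \<oplus>\<^bsub>M\<^esub> y) = \<iota> x \<oplus>\<^bsub>M'\<^esub> \<iota> y) \<and>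
    (\<forall>x\<in>carrier M. \<forall>a\<in>carrier L. \<iota> (x \<triangleleft>\<^bsub>M\<^esub> a) = \<iota> x \<triangleleft>\<^bsub>M'\<^esub> j a) \<and>
    (\<forall>x\<in>carrier M. \<iota> x = \<zero>\<^bsub>M'\<^esub> \<longrightarrow> x = \<zero>\<^bsub>M\<^esub>) \<and>
    (\<forall>y\<in>carrier M'. \<exists>s\<in>S. \<exists>x\<in>carrier M. y \<triangleleft>\<^bsub>M'\<^esub> j s = \<iota> x)"

lemma loc_moduleD:
  assumes "loc_module M M' \<iota>"
  shows "right_module L M" "right_module L' M'"
    "\<And>x. x \<in> carrier M \<Longrightarrow> \<iota> x \<in> carrier M'"
    "\<And>x y. x \<in> carrier M \<Longrightarrow> y \<in> carrier M \<Longrightarrow> \<iota> (x \<oplus>\<^bsub>M\<^esub> y) = \<iota> x \<oplus>\<^bsub>M'\<^esub> \<iota> y"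
    "\<And>x a. x \<in> carrier M \<Longrightarrow> a \<in> carrier L \<Longrightarrow> \<iota> (x \<triangleleft>\<^bsub>M\<^esub> a) = \<iota> x \<triangleleft>\<^bsub>M'\<^esub> j a"
    "\<And>x. x \<in> carrier M \<Longrightarrow> \<iota> x = \<zero>\<^bsub>M'\<^esub> \<Longrightarrow> x = \<zero>\<^bsub>M\<^esub>"
  using assms unfolding loc_module_def by blast+

lemma loc_moduleE:
  assumes "loc_module M M' \<iota>" "y \<in> carrier M'"
  obtains s x where "s \<in> S" "x \<in> carrier M" "y \<triangleleft>\<^bsub>M'\<^esub> j s = \<iota> x"
  using assms unfolding loc_module_def by blast

text \<open>The localized module as a module over the original ring. With it, \<open>\<iota>\<close> is a homomorphism
  and the results on homomorphisms apply.\<close>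

definition restrict_ring :: "('b, 'n, 'v) rmodule_scheme \<Rightarrow> ('a, 'n) rmodule"
  where "restrict_ring M = \<lparr>carrier = carrier M, monoid.mult = undefined, monoid.one = undefined,
    ring.zero = \<zero>\<^bsub>M\<^esub>, ring.add = add M, ract = (\<lambda>x a. x \<triangleleft>\<^bsub>M\<^esub> j a)\<rparr>"

lemma restrict_ring_simps [simp]:
  "carrier (restrict_ring M) = carrier M" "\<zero>\<^bsub>restrict_ring M\<^esub> = \<zero>\<^bsub>M\<^esub>"
  "x \<oplus>\<^bsub>restrict_ring M\<^esub> y = x \<oplus>\<^bsub>M\<^esub> y" "x \<triangleleft>\<^bsub>restrict_ring M\<^esub> a = x \<triangleleft>\<^bsub>M\<^esub> j a"
  by (auto simp: restrict_ring_def)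

lemma restrict_ring_minus [simp]: "x \<ominus>\<^bsub>restrict_ring M\<^esub> y = x \<ominus>\<^bsub>M\<^esub> y"
  by (simp add: a_minus_def a_inv_def m_inv_def)

lemma right_module_restrict_ring:
  assumes "right_module L' M" shows "right_module L (restrict_ring M)"
proof -
  interpret M: right_module L' M by fact
  have "abelian_group (restrict_ring M)"
  proof (rule abelian_groupI)
    fix x assume "x \<in> carrier (restrict_ring M)"
    then show "\<exists>y\<in>carrier (restrict_ring M). y \<oplus>\<^bsub>restrict_ring M\<^esub> x = \<zero>\<^bsub>restrict_ring M\<^esub>"
      by (intro bexI[of _ "\<ominus>\<^bsub>M\<^esub> x"]) (auto simp: M.l_neg)
  qed (auto simp: M.a_ac)
  then show ?thesis
    using ring_hom_one[OF j_hom]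
    by (intro right_moduleI)
      (auto simp: L.ring_axioms M.ract_closed M.ract_add_left M.ract_add_right M.ract_mult M.ract_one j_add j_mult)
qed

lemma loc_module_hom: "loc_module M M' \<iota> \<Longrightarrow> \<iota> \<in> rmod_hom L M (restrict_ring M')"
  by (rule rmod_homI) (auto dest: loc_moduleD)

lemma rsubmodule_restrict_ring:
  assumes "right_module L' M" "rsubmodule L' M K" shows "rsubmodule L (restrict_ring M) K"
proof -
  interpret R: right_module L "restrict_ring M" by (rule right_module_restrict_ring[OF assms(1)])
  show ?thesis by (rule R.rsubmoduleI) (use rsubmoduleD[OF assms(2)] in auto)
qed

lemma rmod_hom_restrict_ring: "f \<in> rmod_hom L' M N \<Longrightarrow> f \<in> rmod_hom L (restrict_ring M) (restrict_ring N)"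
  by (rule rmod_homI) (auto simp: rmod_homD)

lemma rsubmodule_preimage:
  assumes "loc_module M M' \<iota>" "rsubmodule L' M' K" shows "rsubmodule L M {x \<in> carrier M. \<iota> x \<in> K}"
  by (rule rsubmodule_vimage[OF loc_moduleD(1)[OF assms(1)] right_module_restrict_ring
        loc_module_hom[OF assms(1)] rsubmodule_restrict_ring])
    (use loc_moduleD[OF assms(1)] assms(2) in auto)

lemma loc_module_minus:
  assumes "loc_module M M' \<iota>" "x \<in> carrier M" "y \<in> carrier M"
  shows "\<iota> (x \<ominus>\<^bsub>M\<^esub> y) = \<iota> x \<ominus>\<^bsub>M'\<^esub> \<iota> y"
  using rmod_hom_minus[OF loc_moduleD(1)[OF assms(1)] right_module_restrict_ring loc_module_hom[OF assms(1)] assms(2,3)]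
    loc_moduleD(2)[OF assms(1)] by simp

lemma loc_module_zero:
  assumes "loc_module M M' \<iota>" shows "\<iota> \<zero>\<^bsub>M\<^esub> = \<zero>\<^bsub>M'\<^esub>"
  using rmod_hom_zero[OF loc_moduleD(1)[OF assms] right_module_restrict_ring loc_module_hom[OF assms]]
    loc_moduleD(2)[OF assms] by simp

lemma loc_module_eq:
  assumes "loc_module M M' \<iota>" "x \<in> carrier M" "y \<in> carrier M" "\<iota> x = \<iota> y" shows "x = y"
proof -
  have c: "x \<ominus>\<^bsub>M\<^esub> y \<in> carrier M"
    using rsubmodule_minus[OF loc_moduleD(1)[OF assms(1)] rsubmodule_carrier[OF loc_moduleD(1)[OF assms(1)]] assms(2,3)] .
  have "\<iota> (x \<ominus>\<^bsub>M\<^esub> y) = \<zero>\<^bsub>M'\<^esub>"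
    unfolding loc_module_minus[OF assms(1-3)]
    using minus_zero_iff[OF loc_moduleD(2)[OF assms(1)] loc_moduleD(3)[OF assms(1,2)] loc_moduleD(3)[OF assms(1,3)]]
      assms(4) by (simp only:)
  then have "x \<ominus>\<^bsub>M\<^esub> y = \<zero>\<^bsub>M\<^esub>" by (rule loc_moduleD(6)[OF assms(1) c])
  then show ?thesis using minus_zero_iff[OF loc_moduleD(1)[OF assms(1)] assms(2,3)] by simp
qed

lemma denominator_cancel:
  assumes M: "right_module L' M" and "y \<in> carrier M" "z \<in> carrier M" "s \<in> S" "y \<triangleleft>\<^bsub>M\<^esub> j s = z \<triangleleft>\<^bsub>M\<^esub> j s"
  shows "y = z"
proof -
  interpret M: right_module L' M by fact
  have *: "x \<triangleleft>\<^bsub>M\<^esub> j s \<triangleleft>\<^bsub>M\<^esub> inv\<^bsub>L'\<^esub> j s = x" if "x \<in> carrier M" for x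
    using that j_unit[OF assms(4)] assms(4) by (simp add: M.ract_mult[symmetric] L'.Units_r_inv M.ract_one)
  show ?thesis using *[OF assms(2)] *[OF assms(3)] unfolding assms(5) by (rule trans[OF sym])
qed

lemma denominator_divide:
  assumes M: "right_module L' M" and "y \<in> carrier M" "s \<in> S"
  obtains z where "z \<in> carrier M" "z \<triangleleft>\<^bsub>M\<^esub> j s = y"
proof -
  interpret M: right_module L' M by fact
  have "y \<triangleleft>\<^bsub>M\<^esub> inv\<^bsub>L'\<^esub> j s \<triangleleft>\<^bsub>M\<^esub> j s = y"
    using assms j_unit[OF assms(3)] by (simp add: M.ract_mult[symmetric] L'.Units_l_inv M.ract_one)
  then show thesis using that[of "y \<triangleleft>\<^bsub>M\<^esub> inv\<^bsub>L'\<^esub> j s"] assms j_unit[OF assms(3)] by (simp add: M.ract_closed)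
qed

lemma denominator_commute:
  assumes M: "right_module L' M" and "y \<in> carrier M" "s \<in> S" "a \<in> carrier L"
  shows "y \<triangleleft>\<^bsub>M\<^esub> j s \<triangleleft>\<^bsub>M\<^esub> j a = y \<triangleleft>\<^bsub>M\<^esub> j a \<triangleleft>\<^bsub>M\<^esub> j s"
proof -
  interpret M: right_module L' M by fact
  show ?thesis using assms S_central[OF assms(3,4)] j_mult[of s a] j_mult[of a s]
    by (simp add: M.ract_mult[symmetric])
qed

lemma ract_j_mult:
  assumes M: "right_module L' M" and "y \<in> carrier M" "a \<in> carrier L" "b \<in> carrier L"
  shows "y \<triangleleft>\<^bsub>M\<^esub> j (a \<otimes>\<^bsub>L\<^esub> b) = y \<triangleleft>\<^bsub>M\<^esub> j a \<triangleleft>\<^bsub>M\<^esub> j b"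
  using assms by (simp add: j_mult right_module.ract_mult[OF M])

lemma loc_module_ract:
  assumes loc: "loc_module M M' \<iota>" and y: "y \<in> carrier M'" and s: "s \<in> S" and x: "x \<in> carrier M"
    and ys: "y \<triangleleft>\<^bsub>M'\<^esub> j s = \<iota> x" and b: "b \<in> carrier L'" and t: "t \<in> S" and c: "c \<in> carrier L"
    and bt: "b \<otimes>\<^bsub>L'\<^esub> j t = j c"
  shows "(y \<triangleleft>\<^bsub>M'\<^esub> b) \<triangleleft>\<^bsub>M'\<^esub> j (t \<otimes>\<^bsub>L\<^esub> s) = \<iota> (x \<triangleleft>\<^bsub>M\<^esub> c)"
proof -
  note l = loc_moduleD[OF loc]
  interpret M': right_module L' M' by (rule l(2))
  have "(y \<triangleleft>\<^bsub>M'\<^esub> b) \<triangleleft>\<^bsub>M'\<^esub> j (t \<otimes>\<^bsub>L\<^esub> s) = (y \<triangleleft>\<^bsub>M'\<^esub> b) \<triangleleft>\<^bsub>M'\<^esub> j t \<triangleleft>\<^bsub>M'\<^esub> j s"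
    using y b s t by (simp add: ract_j_mult[OF l(2)] M'.ract_closed)
  also have "\<dots> = y \<triangleleft>\<^bsub>M'\<^esub> j c \<triangleleft>\<^bsub>M'\<^esub> j s" using y b t bt by (simp add: M'.ract_mult[symmetric])
  also have "\<dots> = y \<triangleleft>\<^bsub>M'\<^esub> j s \<triangleleft>\<^bsub>M'\<^esub> j c" by (rule denominator_commute[OF l(2) y s c, symmetric])
  also have "\<dots> = \<iota> (x \<triangleleft>\<^bsub>M\<^esub> c)" using ys l(5)[OF x c] by simp
  finally show ?thesis .
qed

text \<open>The extension sends \<open>\<iota> x / t\<close> to \<open>\<kappa> (h x) / t\<close>; this does not depend on the representation as a
  fraction because \<open>\<iota>\<close> is injective. Since extensions are also unique, localization
  is a functor on modules.\<close>

lemma loc_module_extend: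
  assumes M: "loc_module M M' \<iota>" and N: "loc_module N N' \<kappa>" and h: "h \<in> rmod_hom L M N"
  obtains h' where "h' \<in> rmod_hom L' M' N'" "\<And>x. x \<in> carrier M \<Longrightarrow> h' (\<iota> x) = \<kappa> (h x)"
proof -
  note m = loc_moduleD[OF M] and n = loc_moduleD[OF N] and hD = rmod_homD[OF h]
  interpret M: right_module L M by (rule m(1))
  interpret M': right_module L' M' by (rule m(2))
  interpret N: right_module L N by (rule n(1))
  interpret N': right_module L' N' by (rule n(2))
  have "\<exists>w\<in>carrier N'. \<forall>t\<in>S. \<forall>x\<in>carrier M. y \<triangleleft>\<^bsub>M'\<^esub> j t = \<iota> x \<longrightarrow> w \<triangleleft>\<^bsub>N'\<^esub> j t = \<kappa> (h x)"
    if y: "y \<in> carrier M'" for y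
  proof -
    obtain s x where s: "s \<in> S" and x: "x \<in> carrier M" and ys: "y \<triangleleft>\<^bsub>M'\<^esub> j s = \<iota> x"
      using loc_moduleE[OF M y] .
    obtain w where w: "w \<in> carrier N'" "w \<triangleleft>\<^bsub>N'\<^esub> j s = \<kappa> (h x)"
      by (rule denominator_divide[OF n(2) n(3)[OF hD(1)[OF x]] s])
    have "w \<triangleleft>\<^bsub>N'\<^esub> j t = \<kappa> (h x')" if t: "t \<in> S" and x': "x' \<in> carrier M" and yt: "y \<triangleleft>\<^bsub>M'\<^esub> j t = \<iota> x'" for t x'
    proof (rule denominator_cancel[OF n(2) _ _ s])
      have "\<iota> (x \<triangleleft>\<^bsub>M\<^esub> t) = \<iota> (x' \<triangleleft>\<^bsub>M\<^esub> s)"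
        using denominator_commute[OF m(2) y s S_carrier[OF t]] s t x x' ys yt by (simp add: m(5))
      then have "x \<triangleleft>\<^bsub>M\<^esub> t = x' \<triangleleft>\<^bsub>M\<^esub> s"
        using loc_module_eq[OF M] x x' s t by (simp add: M.ract_closed)
      then have "h x \<triangleleft>\<^bsub>N\<^esub> t = h x' \<triangleleft>\<^bsub>N\<^esub> s" using hD(3) x x' s t by (metis S_carrier)
      then have "\<kappa> (h x) \<triangleleft>\<^bsub>N'\<^esub> j t = \<kappa> (h x') \<triangleleft>\<^bsub>N'\<^esub> j s" using n(5) hD(1) x x' s t by (metis S_carrier)
      then show "w \<triangleleft>\<^bsub>N'\<^esub> j t \<triangleleft>\<^bsub>N'\<^esub> j s = \<kappa> (h x') \<triangleleft>\<^bsub>N'\<^esub> j s"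
        using denominator_commute[OF n(2) w(1) s S_carrier[OF t]] w(2) by simp
    qed (use w t x' n(3) hD(1) in \<open>auto simp: N'.ract_closed\<close>)
    then show ?thesis using w(1) by blast
  qed
  then obtain h' where h'c: "\<And>y. y \<in> carrier M' \<Longrightarrow> h' y \<in> carrier N'"
    and h': "\<And>y t x. y \<in> carrier M' \<Longrightarrow> t \<in> S \<Longrightarrow> x \<in> carrier M \<Longrightarrow> y \<triangleleft>\<^bsub>M'\<^esub> j t = \<iota> x \<Longrightarrow> h' y \<triangleleft>\<^bsub>N'\<^esub> j t = \<kappa> (h x)"
    by metis
  have "h' \<in> rmod_hom L' M' N'"
  proof (rule rmod_homI)
    fix y z assume y: "y \<in> carrier M'" and z: "z \<in> carrier M'"
    obtain s x where s: "s \<in> S" and x: "x \<in> carrier M" and ys: "y \<triangleleft>\<^bsub>M'\<^esub> j s = \<iota> x"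
      using loc_moduleE[OF M y] .
    obtain t u where t: "t \<in> S" and u: "u \<in> carrier M" and zt: "z \<triangleleft>\<^bsub>M'\<^esub> j t = \<iota> u"
      using loc_moduleE[OF M z] .
    have yst: "y \<triangleleft>\<^bsub>M'\<^esub> j (s \<otimes>\<^bsub>L\<^esub> t) = \<iota> (x \<triangleleft>\<^bsub>M\<^esub> t)"
      using y s t x by (simp add: ract_j_mult[OF m(2)] ys m(5))
    have zst: "z \<triangleleft>\<^bsub>M'\<^esub> j (s \<otimes>\<^bsub>L\<^esub> t) = \<iota> (u \<triangleleft>\<^bsub>M\<^esub> s)"
      using z s t u by (simp add: ract_j_mult[OF m(2)] denominator_commute[OF m(2) z s S_carrier[OF t]] zt m(5))
    have c: "x \<triangleleft>\<^bsub>M\<^esub> t \<in> carrier M" "u \<triangleleft>\<^bsub>M\<^esub> s \<in> carrier M" using x u s t by (auto simp: M.ract_closed)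
    have st: "s \<otimes>\<^bsub>L\<^esub> t \<in> S" using s t by (rule S_mult)
    have "(y \<oplus>\<^bsub>M'\<^esub> z) \<triangleleft>\<^bsub>M'\<^esub> j (s \<otimes>\<^bsub>L\<^esub> t) = \<iota> (x \<triangleleft>\<^bsub>M\<^esub> t \<oplus>\<^bsub>M\<^esub> u \<triangleleft>\<^bsub>M\<^esub> s)"
      using y z c st by (simp add: M'.ract_add_left yst zst m(4))
    then have "h' (y \<oplus>\<^bsub>M'\<^esub> z) \<triangleleft>\<^bsub>N'\<^esub> j (s \<otimes>\<^bsub>L\<^esub> t) = \<kappa> (h (x \<triangleleft>\<^bsub>M\<^esub> t \<oplus>\<^bsub>M\<^esub> u \<triangleleft>\<^bsub>M\<^esub> s))"
      using y z c st by (intro h') auto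
    also have "\<dots> = \<kappa> (h (x \<triangleleft>\<^bsub>M\<^esub> t)) \<oplus>\<^bsub>N'\<^esub> \<kappa> (h (u \<triangleleft>\<^bsub>M\<^esub> s))"
      using c by (simp add: hD(1,2) n(4))
    also have "\<dots> = (h' y \<oplus>\<^bsub>N'\<^esub> h' z) \<triangleleft>\<^bsub>N'\<^esub> j (s \<otimes>\<^bsub>L\<^esub> t)"
      using h'[OF y st c(1) yst] h'[OF z st c(2) zst] y z st by (simp add: N'.ract_add_left h'c)
    finally show "h' (y \<oplus>\<^bsub>M'\<^esub> z) = h' y \<oplus>\<^bsub>N'\<^esub> h' z"
      using denominator_cancel[OF n(2) _ _ st] y z by (simp add: h'c)
  next
    fix y b assume y: "y \<in> carrier M'" and b: "b \<in> carrier L'"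
    obtain s x where s: "s \<in> S" and x: "x \<in> carrier M" and ys: "y \<triangleleft>\<^bsub>M'\<^esub> j s = \<iota> x"
      using loc_moduleE[OF M y] .
    obtain t c where t: "t \<in> S" and c: "c \<in> carrier L" and bt: "b \<otimes>\<^bsub>L'\<^esub> j t = j c"
      using j_denominator[OF b] by blast
    have ts: "t \<otimes>\<^bsub>L\<^esub> s \<in> S" using t s by (rule S_mult)
    have "h' (y \<triangleleft>\<^bsub>M'\<^esub> b) \<triangleleft>\<^bsub>N'\<^esub> j (t \<otimes>\<^bsub>L\<^esub> s) = \<kappa> (h (x \<triangleleft>\<^bsub>M\<^esub> c))"
      using loc_module_ract[OF M y s x ys b t c bt] ts x y b c by (intro h') (auto simp: M.ract_closed M'.ract_closed)
    also have "\<dots> = \<kappa> (h x \<triangleleft>\<^bsub>N\<^esub> c)" using x c by (simp add: hD(3))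
    also have "\<dots> = (h' y \<triangleleft>\<^bsub>N'\<^esub> b) \<triangleleft>\<^bsub>N'\<^esub> j (t \<otimes>\<^bsub>L\<^esub> s)"
      by (rule loc_module_ract[OF N h'c[OF y] s hD(1)[OF x] h'[OF y s x ys] b t c bt, symmetric])
    finally show "h' (y \<triangleleft>\<^bsub>M'\<^esub> b) = h' y \<triangleleft>\<^bsub>N'\<^esub> b"
      using denominator_cancel[OF n(2) _ _ ts] y b by (simp add: h'c M'.ract_closed N'.ract_closed)
  qed (rule h'c)
  moreover have "h' (\<iota> x) = \<kappa> (h x)" if x: "x \<in> carrier M" for x
  proof (rule denominator_cancel[OF n(2) _ _ S_one])
    have "h' (\<iota> x) \<triangleleft>\<^bsub>N'\<^esub> j \<one>\<^bsub>L\<^esub> = \<kappa> (h (x \<triangleleft>\<^bsub>M\<^esub> \<one>\<^bsub>L\<^esub>))"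
      using x S_one by (intro h') (auto simp: m(3,5) M.ract_closed)
    also have "\<dots> = \<kappa> (h x) \<triangleleft>\<^bsub>N'\<^esub> j \<one>\<^bsub>L\<^esub>" using x by (simp add: hD(1,3) n(5))
    finally show "h' (\<iota> x) \<triangleleft>\<^bsub>N'\<^esub> j \<one>\<^bsub>L\<^esub> = \<kappa> (h x) \<triangleleft>\<^bsub>N'\<^esub> j \<one>\<^bsub>L\<^esub>" .
  qed (use x in \<open>auto simp: h'c m(3) n(3) hD(1)\<close>)
  ultimately show thesis using that by blast
qed

lemma loc_module_hom_unique:
  assumes M: "loc_module M M' \<iota>" and N: "right_module L' N"
    and "f \<in> rmod_hom L' M' N" "g \<in> rmod_hom L' M' N" "\<And>x. x \<in> carrier M \<Longrightarrow> f (\<iota> x) = g (\<iota> x)"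
    and y: "y \<in> carrier M'"
  shows "f y = g y"
proof -
  obtain s x where s: "s \<in> S" and x: "x \<in> carrier M" and ys: "y \<triangleleft>\<^bsub>M'\<^esub> j s = \<iota> x"
    using loc_moduleE[OF M y] .
  have "f y \<triangleleft>\<^bsub>N\<^esub> j s = f (\<iota> x)" "g y \<triangleleft>\<^bsub>N\<^esub> j s = g (\<iota> x)"
    using rmod_homD(3)[OF assms(3) y] rmod_homD(3)[OF assms(4) y] s ys by (metis j_closed S_carrier)+
  then show ?thesis
    using denominator_cancel[OF N _ _ s] assms(5)[OF x] rmod_homD(1)[OF assms(3) y] rmod_homD(1)[OF assms(4) y] by simp
qed

lemma loc_module_retraction:
  assumes M: "loc_module M M' \<iota>" and N: "loc_module N N' \<kappa>"
    and f: "f \<in> rmod_hom L M N" "f' \<in> rmod_hom L' M' N'" "\<And>x. x \<in> carrier M \<Longrightarrow> f' (\<iota> x) = \<kappa> (f x)"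
    and g: "g \<in> rmod_hom L N M" "g' \<in> rmod_hom L' N' M'" "\<And>x. x \<in> carrier N \<Longrightarrow> g' (\<kappa> x) = \<iota> (g x)"
    and gf: "\<And>x. x \<in> carrier M \<Longrightarrow> g (f x) = x" and y: "y \<in> carrier M'"
  shows "g' (f' y) = y"
  by (rule loc_module_hom_unique[OF M loc_moduleD(2)[OF M] rmod_hom_comp[OF f(2) g(2)] rmod_hom_id _ y])
    (simp add: f(3) g(3) gf rmod_homD(1)[OF f(1)])

lemma loc_module_retract_of:
  assumes M: "loc_module M M' \<iota>" and N: "loc_module N N' \<kappa>" and "retract_of L M N"
  shows "retract_of L' M' N'"
proof -
  obtain f g where f: "f \<in> rmod_hom L M N" and g: "g \<in> rmod_hom L N M" and gf: "\<And>x. x \<in> carrier M \<Longrightarrow> g (f x) = x"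
    using assms(3) unfolding retract_of_def by blast
  obtain f' where f': "f' \<in> rmod_hom L' M' N'" "\<And>x. x \<in> carrier M \<Longrightarrow> f' (\<iota> x) = \<kappa> (f x)"
    using loc_module_extend[OF M N f] by metis
  obtain g' where g': "g' \<in> rmod_hom L' N' M'" "\<And>x. x \<in> carrier N \<Longrightarrow> g' (\<kappa> x) = \<iota> (g x)"
    using loc_module_extend[OF N M g] by metis
  show ?thesis unfolding retract_of_def
    using f'(1) g'(1) loc_module_retraction[OF M N f f' g g' gf] by blast
qed

lemma loc_module_iso:
  assumes M: "loc_module M M' \<iota>" and N: "loc_module N N' \<kappa>" and "rmod_iso L M N"
  shows "rmod_iso L' M' N'"
proof -
  obtain f g where f: "f \<in> rmod_hom L M N" and g: "g \<in> rmod_hom L N M"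
    and gf: "\<And>x. x \<in> carrier M \<Longrightarrow> g (f x) = x" and fg: "\<And>x. x \<in> carrier N \<Longrightarrow> f (g x) = x"
    using rmod_isoE[OF assms(3) loc_moduleD(1)[OF M]] by metis
  obtain f' where f': "f' \<in> rmod_hom L' M' N'" "\<And>x. x \<in> carrier M \<Longrightarrow> f' (\<iota> x) = \<kappa> (f x)"
    using loc_module_extend[OF M N f] by metis
  obtain g' where g': "g' \<in> rmod_hom L' N' M'" "\<And>x. x \<in> carrier N \<Longrightarrow> g' (\<kappa> x) = \<iota> (g x)"
    using loc_module_extend[OF N M g] by metis
  show ?thesis
    by (rule rmod_isoI[OF f'(1), of g'])
      (use rmod_homD(1)[OF g'(1)] loc_module_retraction[OF M N f f' g g' gf]
        loc_module_retraction[OF N M g g' f f' fg] in auto)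
qed

lemma loc_module_compose_iso:
  assumes M: "loc_module M M' \<iota>" and N: "right_module L' N" and iso: "rmod_iso L' M' N"
  obtains \<kappa> where "loc_module M N \<kappa>"
proof -
  note m = loc_moduleD[OF M]
  obtain f g where f: "f \<in> rmod_hom L' M' N" and g: "g \<in> rmod_hom L' N M'"
    and gf: "\<And>x. x \<in> carrier M' \<Longrightarrow> g (f x) = x" and fg: "\<And>x. x \<in> carrier N \<Longrightarrow> f (g x) = x"
    using rmod_isoE[OF iso m(2)] by metis
  have "loc_module M N (\<lambda>x. f (\<iota> x))"
    unfolding loc_module_def
  proof (intro conjI ballI impI)
    fix x assume x: "x \<in> carrier M" "f (\<iota> x) = \<zero>\<^bsub>N\<^esub>"
    then have "\<iota> x = g \<zero>\<^bsub>N\<^esub>" using gf m(3) by metis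
    then show "x = \<zero>\<^bsub>M\<^esub>" using m(6) x rmod_hom_zero[OF N m(2) g] by simp
  next
    fix y assume y: "y \<in> carrier N"
    obtain s x where "s \<in> S" "x \<in> carrier M" "g y \<triangleleft>\<^bsub>M'\<^esub> j s = \<iota> x"
      using loc_moduleE[OF M rmod_homD(1)[OF g y]] .
    then show "\<exists>s\<in>S. \<exists>x\<in>carrier M. y \<triangleleft>\<^bsub>N\<^esub> j s = f (\<iota> x)"
      using rmod_homD(3)[OF f rmod_homD(1)[OF g y], of "j s"] fg[OF y] by (metis S_carrier j_closed)
  qed (use m N rmod_homD[OF f] in auto)
  then show thesis by (rule that)
qed

lemma loc_module_regular: "loc_module (regular_module L) (regular_module L') j"
  unfolding loc_module_def
  using j_inj j_denominator by (auto simp: right_module_regular L.ring_axioms L'.ring_axioms j_add j_mult)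

lemma loc_module_binary_sum:
  assumes M: "loc_module M M' \<iota>" and N: "loc_module N N' \<kappa>"
  shows "loc_module (binary_sum M N) (binary_sum M' N') (\<lambda>(x, y). (\<iota> x, \<kappa> y))"
  unfolding loc_module_def
proof (intro conjI ballI impI)
  note m = loc_moduleD[OF M] and n = loc_moduleD[OF N]
  fix p assume "p \<in> carrier (binary_sum M' N')"
  then obtain y z where p: "p = (y, z)" and y: "y \<in> carrier M'" and z: "z \<in> carrier N'" by auto
  obtain s x where s: "s \<in> S" and x: "x \<in> carrier M" and ys: "y \<triangleleft>\<^bsub>M'\<^esub> j s = \<iota> x"
    using loc_moduleE[OF M y] .
  obtain t u where t: "t \<in> S" and u: "u \<in> carrier N" and zt: "z \<triangleleft>\<^bsub>N'\<^esub> j t = \<kappa> u"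
    using loc_moduleE[OF N z] .
  have "y \<triangleleft>\<^bsub>M'\<^esub> j (s \<otimes>\<^bsub>L\<^esub> t) = \<iota> (x \<triangleleft>\<^bsub>M\<^esub> t)"
    using y s t x by (simp add: ract_j_mult[OF m(2)] ys m(5))
  moreover have "z \<triangleleft>\<^bsub>N'\<^esub> j (s \<otimes>\<^bsub>L\<^esub> t) = \<kappa> (u \<triangleleft>\<^bsub>N\<^esub> s)"
    using z s t u by (simp add: ract_j_mult[OF n(2)] denominator_commute[OF n(2) z s S_carrier[OF t]] zt n(5))
  ultimately show "\<exists>s\<in>S. \<exists>x\<in>carrier (binary_sum M N). p \<triangleleft>\<^bsub>binary_sum M' N'\<^esub> j s = (\<lambda>(x, y). (\<iota> x, \<kappa> y)) x"
    using p s t x u right_module.ract_closed[OF m(1) x S_carrier[OF t]] right_module.ract_closed[OF n(1) u S_carrier[OF s]]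
    by (intro bexI[of _ "s \<otimes>\<^bsub>L\<^esub> t"] bexI[of _ "(x \<triangleleft>\<^bsub>M\<^esub> t, u \<triangleleft>\<^bsub>N\<^esub> s)"]) (auto simp: S_mult)
qed (use loc_moduleD[OF M] loc_moduleD[OF N] in \<open>auto simp: right_module_binary_sum\<close>)

text \<open>The finitely many non-zero coordinates of an element have a common denominator.\<close>

lemma loc_module_omega_sum:
  assumes M: "loc_module M M' \<iota>"
  shows "loc_module (omega_sum M) (omega_sum M') (\<lambda>x n. \<iota> (x n))"
proof -
  note m = loc_moduleD[OF M]
  have hom: "(\<lambda>x n. \<iota> (x n)) \<in> rmod_hom L (omega_sum M) (omega_sum (restrict_ring M'))"
    by (rule omega_sum_hom[OF m(1) right_module_restrict_ring[OF m(2)] loc_module_hom[OF M]])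
  have "\<exists>s\<in>S. \<exists>x\<in>carrier (omega_sum M). z \<triangleleft>\<^bsub>omega_sum M'\<^esub> j s = (\<lambda>n. \<iota> (x n))"
    if z: "z \<in> carrier (omega_sum M')" for z
  proof -
    have zc: "z n \<in> carrier M'" for n using z by (simp add: omega_sum_carrier)
    have "\<exists>s\<in>S. \<forall>n\<in>T. \<exists>x\<in>carrier M. z n \<triangleleft>\<^bsub>M'\<^esub> j s = \<iota> x" if "finite T" for T
      using that
    proof (induction T rule: finite_induct)
      case empty
      then show ?case using S_one by blast
    next
      case (insert k T)
      obtain s where s: "s \<in> S" and sT: "\<forall>n\<in>T. \<exists>x\<in>carrier M. z n \<triangleleft>\<^bsub>M'\<^esub> j s = \<iota> x" using insert by blast
      obtain t u where t: "t \<in> S" and u: "u \<in> carrier M" and zt: "z k \<triangleleft>\<^bsub>M'\<^esub> j t = \<iota> u"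
        using loc_moduleE[OF M zc] .
      have "\<exists>x\<in>carrier M. z n \<triangleleft>\<^bsub>M'\<^esub> j (s \<otimes>\<^bsub>L\<^esub> t) = \<iota> x" if n: "n \<in> insert k T" for n
      proof (cases "n = k")
        case True
        have "z k \<triangleleft>\<^bsub>M'\<^esub> j (s \<otimes>\<^bsub>L\<^esub> t) = \<iota> (u \<triangleleft>\<^bsub>M\<^esub> s)"
          using zc s t u by (simp add: ract_j_mult[OF m(2)] denominator_commute[OF m(2) zc s S_carrier[OF t]] zt m(5))
        then show ?thesis using True right_module.ract_closed[OF m(1) u S_carrier[OF s]] by blast
      next
        case False
        then obtain x where x: "x \<in> carrier M" "z n \<triangleleft>\<^bsub>M'\<^esub> j s = \<iota> x" using sT n by blast
        then have "z n \<triangleleft>\<^bsub>M'\<^esub> j (s \<otimes>\<^bsub>L\<^esub> t) = \<iota> (x \<triangleleft>\<^bsub>M\<^esub> t)"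
          using zc s t by (simp add: ract_j_mult[OF m(2)] m(5))
        then show ?thesis using right_module.ract_closed[OF m(1) x(1) S_carrier[OF t]] by blast
      qed
      then show ?case using S_mult[OF s t] by blast
    qed
    from this[of "{n. z n \<noteq> \<zero>\<^bsub>M'\<^esub>}"] obtain s where s: "s \<in> S"
      and sT: "\<forall>n\<in>{n. z n \<noteq> \<zero>\<^bsub>M'\<^esub>}. \<exists>x\<in>carrier M. z n \<triangleleft>\<^bsub>M'\<^esub> j s = \<iota> x"
      using z unfolding omega_sum_carrier by blast
    have z0: "z n \<triangleleft>\<^bsub>M'\<^esub> j s = \<iota> \<zero>\<^bsub>M\<^esub>" if "z n = \<zero>\<^bsub>M'\<^esub>" for n
      using right_module.zero_ract[OF m(2)] s that loc_module_zero[OF M] by simp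
    have zero: "\<zero>\<^bsub>M\<^esub> \<in> carrier M" using rsubmoduleD(2)[OF rsubmodule_carrier[OF m(1)]] .
    have "\<exists>x\<in>carrier M. z n \<triangleleft>\<^bsub>M'\<^esub> j s = \<iota> x" for n
      using sT z0 zero by (cases "z n = \<zero>\<^bsub>M'\<^esub>") auto
    then obtain x where x: "\<And>n. x n \<in> carrier M" "\<And>n. z n \<triangleleft>\<^bsub>M'\<^esub> j s = \<iota> (x n)" by metis
    have "x n = \<zero>\<^bsub>M\<^esub>" if "z n = \<zero>\<^bsub>M'\<^esub>" for n
      using z0[OF that] x(2)[of n] loc_module_eq[OF M x(1) zero] by simp
    then have "{n. x n \<noteq> \<zero>\<^bsub>M\<^esub>} \<subseteq> {n. z n \<noteq> \<zero>\<^bsub>M'\<^esub>}" by blast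
    then have "x \<in> carrier (omega_sum M)"
      using x(1) z unfolding omega_sum_carrier by (auto intro: finite_subset)
    then show ?thesis using s x(2) by (intro bexI[of _ s] bexI[of _ x]) auto
  qed
  then show ?thesis
    unfolding loc_module_def
    using right_module_omega_sum[OF m(1)] right_module_omega_sum[OF m(2)] rmod_homD[OF hom] m
    by (auto simp: omega_sum_carrier fun_eq_iff)
qed

lemma loc_module_cg_projective:
  assumes M: "loc_module M M' \<iota>" and "cg_projective L M" shows "cg_projective L' M'"
  unfolding cg_projective_iff
  using loc_moduleD(2)[OF M] loc_module_retract_of[OF M loc_module_omega_sum[OF loc_module_regular]] assms(2)
  unfolding cg_projective_iff by blast

text \<open>Functionals extend to the localization.\<close>

lemma loc_module_trace:
  assumes M: "loc_module M M' \<iota>" and a: "a \<in> trace_ideal L M" shows "j a \<in> trace_ideal L' M'"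
proof -
  have R: "rsubmodule L (regular_module L) {x \<in> carrier (regular_module L). j x \<in> trace_ideal L' M'}"
    by (rule rsubmodule_preimage[OF loc_module_regular trace_ideal_submodule[OF L'.ring_axioms]])
  have "trace_ideal L M \<subseteq> {x \<in> carrier (regular_module L). j x \<in> trace_ideal L' M'}"
  proof (rule trace_ideal_minimal[OF R])
    fix f x assume f: "f \<in> rmod_hom L M (regular_module L)" and x: "x \<in> carrier M"
    obtain f' where f': "f' \<in> rmod_hom L' M' (regular_module L')" "\<And>x. x \<in> carrier M \<Longrightarrow> f' (\<iota> x) = j (f x)"
      using loc_module_extend[OF M loc_module_regular f] by metis
    have "f' (\<iota> x) \<in> trace_ideal L' M'" by (rule trace_idealI[OF f'(1) loc_moduleD(3)[OF M x]])
    then show "f x \<in> {x \<in> carrier (regular_module L). j x \<in> trace_ideal L' M'}"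
      using f'(2)[OF x] rmod_homD(1)[OF f x] by simp
  qed
  then show ?thesis using a by blast
qed

lemma loc_module_generate:
  assumes M: "loc_module M M' \<iota>" and K: "rsubmodule L' M' K" and "\<And>x. x \<in> carrier M \<Longrightarrow> \<iota> x \<in> K"
  shows "K = carrier M'"
proof
  show "K \<subseteq> carrier M'" by (rule rsubmoduleD(1)[OF K])
  show "carrier M' \<subseteq> K"
  proof
    interpret M': right_module L' M' by (rule loc_moduleD(2)[OF M])
    fix y assume y: "y \<in> carrier M'"
    obtain s x where s: "s \<in> S" and x: "x \<in> carrier M" and ys: "y \<triangleleft>\<^bsub>M'\<^esub> j s = \<iota> x"
      using loc_moduleE[OF M y] .
    have "\<iota> x \<triangleleft>\<^bsub>M'\<^esub> inv\<^bsub>L'\<^esub> j s \<in> K" using rsubmoduleD(4)[OF K assms(3)[OF x]] j_unit[OF s] by blast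
    moreover have "\<iota> x \<triangleleft>\<^bsub>M'\<^esub> inv\<^bsub>L'\<^esub> j s = y"
      unfolding ys[symmetric] using y s j_unit[OF s] by (simp add: M'.ract_mult[symmetric] L'.Units_r_inv M'.ract_one)
    ultimately show "y \<in> K" by simp
  qed
qed

lemma loc_module_generate_modulo:
  assumes M: "loc_module M M' \<iota>" and K: "rsubmodule L' M' K" and J: "J \<subseteq> carrier L" and X: "X \<subseteq> carrier M"
    and gen: "\<And>N. rsubmodule L M N \<Longrightarrow> X \<subseteq> N \<Longrightarrow> module_ideal_mult L M J \<subseteq> N \<Longrightarrow> N = carrier M"
    and XK: "\<iota> ` X \<subseteq> K" and JK: "\<And>x l. x \<in> carrier M \<Longrightarrow> l \<in> J \<Longrightarrow> \<iota> x \<triangleleft>\<^bsub>M'\<^esub> j l \<in> K"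
  shows "K = carrier M'"
proof (rule loc_module_generate[OF M K])
  note m = loc_moduleD[OF M]
  have "module_ideal_mult L M J \<subseteq> {x \<in> carrier M. \<iota> x \<in> K}"
  proof (rule module_ideal_mult_minimal[OF rsubmodule_preimage[OF M K]])
    fix x l assume x: "x \<in> carrier M" and l: "l \<in> J"
    have lc: "l \<in> carrier L" using l J by auto
    show "x \<triangleleft>\<^bsub>M\<^esub> l \<in> {x \<in> carrier M. \<iota> x \<in> K}"
      using m(5)[OF x lc] JK[OF x l] right_module.ract_closed[OF m(1) x lc] by simp
  qed
  then have "{x \<in> carrier M. \<iota> x \<in> K} = carrier M"
    using X XK by (intro gen rsubmodule_preimage[OF M K]) auto
  then show "\<iota> x \<in> K" if "x \<in> carrier M" for x using that by blast
qed

text \<open>The localization of a submodule \<open>N\<close>, as a submodule of the localized module.\<close>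

definition loc_sub :: "('b, 'n, 'v) rmodule_scheme \<Rightarrow> ('m \<Rightarrow> 'n) \<Rightarrow> 'm set \<Rightarrow> 'n set"
  where "loc_sub M' \<iota> N = {y \<in> carrier M'. \<exists>s\<in>S. \<exists>x\<in>N. y \<triangleleft>\<^bsub>M'\<^esub> j s = \<iota> x}"

lemma loc_subE:
  assumes "y \<in> loc_sub M' \<iota> N"
  obtains s x where "y \<in> carrier M'" "s \<in> S" "x \<in> N" "y \<triangleleft>\<^bsub>M'\<^esub> j s = \<iota> x"
  using assms unfolding loc_sub_def by blast

lemma loc_sub_submodule:
  assumes M: "loc_module M M' \<iota>" and N: "rsubmodule L M N" shows "rsubmodule L' M' (loc_sub M' \<iota> N)"
proof -
  note m = loc_moduleD[OF M] and n = rsubmoduleD[OF N]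
  interpret M': right_module L' M' by (rule m(2))
  interpret M: right_module L M by (rule m(1))
  have nc: "x \<in> carrier M" if "x \<in> N" for x using n(1) that by auto
  show ?thesis
  proof (rule M'.rsubmoduleI)
    show "loc_sub M' \<iota> N \<subseteq> carrier M'" by (auto simp: loc_sub_def)
    show "\<zero>\<^bsub>M'\<^esub> \<in> loc_sub M' \<iota> N"
      unfolding loc_sub_def using S_one n(2) loc_module_zero[OF M] by (auto simp: M'.zero_ract intro!: bexI)
  next
    fix y z assume "y \<in> loc_sub M' \<iota> N" "z \<in> loc_sub M' \<iota> N"
    then obtain s x t u where y: "y \<in> carrier M'" and z: "z \<in> carrier M'"
      and s: "s \<in> S" and x: "x \<in> N" and ys: "y \<triangleleft>\<^bsub>M'\<^esub> j s = \<iota> x"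
      and t: "t \<in> S" and u: "u \<in> N" and zt: "z \<triangleleft>\<^bsub>M'\<^esub> j t = \<iota> u"
      unfolding loc_sub_def by blast
    have yst: "y \<triangleleft>\<^bsub>M'\<^esub> j (s \<otimes>\<^bsub>L\<^esub> t) = \<iota> (x \<triangleleft>\<^bsub>M\<^esub> t)"
      using y s t x by (simp add: ract_j_mult[OF m(2)] ys m(5) nc)
    have zst: "z \<triangleleft>\<^bsub>M'\<^esub> j (s \<otimes>\<^bsub>L\<^esub> t) = \<iota> (u \<triangleleft>\<^bsub>M\<^esub> s)"
      using z s t u by (simp add: ract_j_mult[OF m(2)] denominator_commute[OF m(2) z s S_carrier[OF t]] zt m(5) nc)
    have c: "x \<triangleleft>\<^bsub>M\<^esub> t \<in> N" "u \<triangleleft>\<^bsub>M\<^esub> s \<in> N" using x u s t n(4) by auto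
    have "(y \<oplus>\<^bsub>M'\<^esub> z) \<triangleleft>\<^bsub>M'\<^esub> j (s \<otimes>\<^bsub>L\<^esub> t) = \<iota> (x \<triangleleft>\<^bsub>M\<^esub> t \<oplus>\<^bsub>M\<^esub> u \<triangleleft>\<^bsub>M\<^esub> s)"
      using y z c s t by (simp add: M'.ract_add_left yst zst m(4) nc)
    then show "y \<oplus>\<^bsub>M'\<^esub> z \<in> loc_sub M' \<iota> N"
      unfolding loc_sub_def using y z S_mult[OF s t] n(3)[OF c] by auto
  next
    fix y b assume "y \<in> loc_sub M' \<iota> N" and b: "b \<in> carrier L'"
    then obtain s x where y: "y \<in> carrier M'" and s: "s \<in> S" and x: "x \<in> N" and ys: "y \<triangleleft>\<^bsub>M'\<^esub> j s = \<iota> x"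
      unfolding loc_sub_def by blast
    obtain t c where t: "t \<in> S" and c: "c \<in> carrier L" and bt: "b \<otimes>\<^bsub>L'\<^esub> j t = j c"
      using j_denominator[OF b] by blast
    show "y \<triangleleft>\<^bsub>M'\<^esub> b \<in> loc_sub M' \<iota> N"
      unfolding loc_sub_def
      using loc_module_ract[OF M y s nc[OF x] ys b t c bt] y b S_mult[OF t s] n(4)[OF x c]
      by (auto simp: M'.ract_closed)
  qed
qed

lemma loc_sub_iff:
  assumes M: "loc_module M M' \<iota>" and N: "N \<subseteq> carrier M" and x: "x \<in> carrier M"
  shows "\<iota> x \<in> loc_sub M' \<iota> N \<longleftrightarrow> (\<exists>s\<in>S. x \<triangleleft>\<^bsub>M\<^esub> s \<in> N)"
proof -
  note m = loc_moduleD[OF M]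
  have *: "\<iota> x \<triangleleft>\<^bsub>M'\<^esub> j s = \<iota> u \<longleftrightarrow> x \<triangleleft>\<^bsub>M\<^esub> s = u" if "s \<in> S" "u \<in> N" for s u
    using loc_module_eq[OF M right_module.ract_closed[OF m(1) x S_carrier[OF that(1)]], of u] that N m(5)[OF x S_carrier[OF that(1)]]
    by auto
  show ?thesis unfolding loc_sub_def using m(3)[OF x] * by fastforce
qed

lemma loc_sub_image:
  assumes M: "loc_module M M' \<iota>" and N: "rsubmodule L M N" and x: "x \<in> N"
  shows "\<iota> x \<in> loc_sub M' \<iota> N"
  using loc_sub_iff[OF M rsubmoduleD(1)[OF N] subsetD[OF rsubmoduleD(1)[OF N] x]]
    rsubmoduleD(4)[OF N x L.one_closed] S_one by blast

lemma loc_sub_divide: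
  assumes M: "loc_module M M' \<iota>" and N: "rsubmodule L M N" and "y \<in> carrier M'" "s \<in> S"
    "y \<triangleleft>\<^bsub>M'\<^esub> j s \<in> loc_sub M' \<iota> N"
  shows "y \<in> loc_sub M' \<iota> N"
proof -
  note m = loc_moduleD[OF M]
  obtain t x where "t \<in> S" "x \<in> N" "y \<triangleleft>\<^bsub>M'\<^esub> j s \<triangleleft>\<^bsub>M'\<^esub> j t = \<iota> x"
    using assms(5) unfolding loc_sub_def by blast
  then show ?thesis unfolding loc_sub_def
    using assms ract_j_mult[OF m(2) assms(3), of s t] S_mult[OF assms(4), of t] by auto
qed

text \<open>Clearing the denominators of both factors gives \<open>(M J)\<^sub>S = M\<^sub>S J\<^sub>S\<close>.\<close>

lemma loc_sub_ideal_mult: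
  assumes M: "loc_module M M' \<iota>" and J: "right_ideal L J"
  shows "loc_sub M' \<iota> (module_ideal_mult L M J) = module_ideal_mult L' M' (loc_sub (regular_module L') j J)"
    (is "?A = ?B")
proof
  note m = loc_moduleD[OF M]
  interpret M': right_module L' M' by (rule m(2))
  interpret M: right_module L M by (rule m(1))
  have Jc: "J \<subseteq> carrier L" using rsubmoduleD(1)[OF J] by simp
  let ?J = "loc_sub (regular_module L') j J"
  have J': "?J \<subseteq> carrier L'" by (auto simp: loc_sub_def)
  have MJ: "rsubmodule L M (module_ideal_mult L M J)" by (rule module_ideal_mult_submodule[OF m(1) Jc])
  have B: "rsubmodule L' M' ?B" by (rule module_ideal_mult_submodule[OF m(2) J'])
  show "?B \<subseteq> ?A"
  proof (rule module_ideal_mult_minimal[OF loc_sub_submodule[OF M MJ]])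
    fix y k assume y: "y \<in> carrier M'" and k: "k \<in> ?J"
    obtain s x where s: "s \<in> S" and x: "x \<in> carrier M" and ys: "y \<triangleleft>\<^bsub>M'\<^esub> j s = \<iota> x"
      using loc_moduleE[OF M y] .
    obtain t l where kc: "k \<in> carrier L'" and t: "t \<in> S" and l: "l \<in> J" and kt: "k \<otimes>\<^bsub>L'\<^esub> j t = j l"
      using k unfolding loc_sub_def by auto
    show "y \<triangleleft>\<^bsub>M'\<^esub> k \<in> ?A"
      unfolding loc_sub_def
      using loc_module_ract[OF M y s x ys kc t _ kt] l Jc y kc S_mult[OF t s] module_ideal_multI[OF x l]
      by (auto simp: M'.ract_closed)
  qed
  have jJ: "j l \<in> ?J" if "l \<in> J" for l by (rule loc_sub_image[OF loc_module_regular J that])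
  have "module_ideal_mult L M J \<subseteq> {x \<in> carrier M. \<iota> x \<in> ?B}"
  proof (rule module_ideal_mult_minimal[OF rsubmodule_preimage[OF M B]])
    fix x l assume x: "x \<in> carrier M" and l: "l \<in> J"
    have lc: "l \<in> carrier L" using l Jc by auto
    show "x \<triangleleft>\<^bsub>M\<^esub> l \<in> {x \<in> carrier M. \<iota> x \<in> ?B}"
      using m(5)[OF x lc] module_ideal_multI[where L = L' and M = M', OF m(3)[OF x] jJ[OF l]] M.ract_closed[OF x lc] by simp
  qed
  then show "?A \<subseteq> ?B"
  proof (intro subsetI)
    fix y assume sub: "module_ideal_mult L M J \<subseteq> {x \<in> carrier M. \<iota> x \<in> ?B}" and "y \<in> ?A"
    then obtain s x where y: "y \<in> carrier M'" and s: "s \<in> S" and x: "x \<in> module_ideal_mult L M J"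
      and ys: "y \<triangleleft>\<^bsub>M'\<^esub> j s = \<iota> x" unfolding loc_sub_def by blast
    have "\<iota> x \<triangleleft>\<^bsub>M'\<^esub> inv\<^bsub>L'\<^esub> j s \<in> ?B" using rsubmoduleD(4)[OF B, of "\<iota> x"] sub x j_unit[OF s] by blast
    moreover have "\<iota> x \<triangleleft>\<^bsub>M'\<^esub> inv\<^bsub>L'\<^esub> j s = y"
      unfolding ys[symmetric] using y s j_unit[OF s] by (simp add: M'.ract_mult[symmetric] L'.Units_r_inv M'.ract_one)
    ultimately show "y \<in> ?B" by simp
  qed
qed

text \<open>For the regular module, \<open>loc_sub_ideal_mult\<close> reads \<open>(L J)\<^sub>S = L\<^sub>S J\<^sub>S\<close>, and \<open>L J = J\<close> for a left ideal.\<close>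

lemma loc_sub_left_ideal:
  assumes J: "right_ideal L J" and left: "\<And>a x. a \<in> carrier L \<Longrightarrow> x \<in> J \<Longrightarrow> a \<otimes>\<^bsub>L\<^esub> x \<in> J"
    and "b \<in> carrier L'" "y \<in> loc_sub (regular_module L') j J"
  shows "b \<otimes>\<^bsub>L'\<^esub> y \<in> loc_sub (regular_module L') j J"
proof -
  have Jc: "J \<subseteq> carrier L" using rsubmoduleD(1)[OF J] by simp
  have "b \<otimes>\<^bsub>L'\<^esub> y \<in> module_ideal_mult L' (regular_module L') (loc_sub (regular_module L') j J)"
    using module_ideal_multI[where L = L' and M = "regular_module L'", of b y] assms(3,4) by simp
  also have "\<dots> = loc_sub (regular_module L') j (module_ideal_mult L (regular_module L) J)"
    by (rule loc_sub_ideal_mult[OF loc_module_regular J, symmetric])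
  also have "\<dots> \<subseteq> loc_sub (regular_module L') j J"
    using module_ideal_mult_minimal[OF J, of J] left by (auto simp: loc_sub_def)
  finally show ?thesis .
qed

text \<open>A finite generating set of \<open>P\<close> modulo \<open>P Tr(A)\<close> also works for \<open>P'\<close> because the trace of \<open>A\<close> is
  mapped into the trace of \<open>A'\<close>. If \<open>P'\<close> were finitely generated, \<open>absorbed_eq_ideal_mult\<close> for the zero
  ideal would give \<open>A' = 0\<close>, hence \<open>A = 0\<close> and \<open>Tr(A) = 0\<close>, and \<open>P\<close> would be finitely generated.\<close>

lemma loc_module_relatively_big:
  assumes P: "cg_projective L P" and A: "cg_projective L A"
    and PA: "rmod_iso L (binary_sum P (omega_sum A)) P"
    and fg: "finitely_generated L (rquot P (module_ideal_mult L P (trace_ideal L A)))"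
    and locP: "loc_module P P' \<iota>" and locA: "loc_module A A' \<kappa>"
  shows "cg_projective L' P'" "cg_projective L' A'" "rmod_iso L' (binary_sum P' (omega_sum A')) P'"
    "finitely_generated L' (rquot P' (module_ideal_mult L' P' (trace_ideal L' A')))"
    "finitely_generated L' P' \<Longrightarrow> finitely_generated L P"
proof -
  note p = loc_moduleD[OF locP] and a = loc_moduleD[OF locA]
  show "cg_projective L' P'" by (rule loc_module_cg_projective[OF locP P])
  show "cg_projective L' A'" by (rule loc_module_cg_projective[OF locA A])
  show iso: "rmod_iso L' (binary_sum P' (omega_sum A')) P'"
    by (rule loc_module_iso[OF loc_module_binary_sum[OF locP loc_module_omega_sum[OF locA]] locP PA])
  let ?J = "trace_ideal L A" and ?J' = "trace_ideal L' A'"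
  have Jc: "?J \<subseteq> carrier L" by (rule trace_ideal_subset[OF L.ring_axioms])
  have J'c: "?J' \<subseteq> carrier L'" by (rule trace_ideal_subset[OF L'.ring_axioms])
  have PJ: "rsubmodule L P (module_ideal_mult L P ?J)" by (rule module_ideal_mult_submodule[OF p(1) Jc])
  have P'J: "rsubmodule L' P' (module_ideal_mult L' P' ?J')" by (rule module_ideal_mult_submodule[OF p(2) J'c])
  obtain X where X: "finite X" "X \<subseteq> carrier P"
    and gen: "\<And>K. rsubmodule L P K \<Longrightarrow> X \<subseteq> K \<Longrightarrow> module_ideal_mult L P ?J \<subseteq> K \<Longrightarrow> K = carrier P"
    using fg unfolding finitely_generated_rquot_iff[OF p(1) PJ] by blast
  have "K = carrier P'" if K: "rsubmodule L' P' K" "\<iota> ` X \<subseteq> K" "module_ideal_mult L' P' ?J' \<subseteq> K" for K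
  proof (rule loc_module_generate_modulo[OF locP K(1) Jc X(2) gen K(2)])
    fix x l assume x: "x \<in> carrier P" and l: "l \<in> ?J"
    show "\<iota> x \<triangleleft>\<^bsub>P'\<^esub> j l \<in> K"
      using module_ideal_multI[where L = L' and M = P', OF p(3)[OF x] loc_module_trace[OF locA l]] K(3) by auto
  qed
  moreover have "finite (\<iota> ` X)" "\<iota> ` X \<subseteq> carrier P'" using X p(3) by auto
  ultimately show "finitely_generated L' (rquot P' (module_ideal_mult L' P' ?J'))"
    unfolding finitely_generated_rquot_iff[OF p(2) P'J] by blast
  assume "finitely_generated L' P'"
  then obtain Y where Y: "finite Y" "Y \<subseteq> carrier P'"
    and genY: "\<And>K. rsubmodule L' P' K \<Longrightarrow> Y \<subseteq> K \<Longrightarrow> K = carrier P'"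
    unfolding finitely_generated_iff[OF p(2)] by blast
  have A'0: "y = \<zero>\<^bsub>A'\<^esub>" if "y \<in> carrier A'" for y
    using absorbed_eq_ideal_mult[OF p(2) a(2) iso _ Y _ that, of "{\<zero>\<^bsub>L'\<^esub>}"] genY module_ideal_mult_zero[OF a(2)] by auto
  have A0: "x = \<zero>\<^bsub>A\<^esub>" if "x \<in> carrier A" for x
    using a(6)[OF that A'0[OF a(3)[OF that]]] .
  have "?J \<subseteq> {\<zero>\<^bsub>L\<^esub>}"
  proof (rule trace_ideal_minimal)
    show "right_ideal L {\<zero>\<^bsub>L\<^esub>}" using rsubmodule_zero[OF right_module_regular[OF L.ring_axioms]] by simp
    fix f x assume f: "f \<in> rmod_hom L A (regular_module L)" and "x \<in> carrier A"
    then show "f x \<in> {\<zero>\<^bsub>L\<^esub>}"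
      using A0 rmod_hom_zero[OF a(1) right_module_regular[OF L.ring_axioms] f] by fastforce
  qed
  then have "module_ideal_mult L P ?J \<subseteq> module_ideal_mult L P {\<zero>\<^bsub>L\<^esub>}"
    by (intro module_ideal_mult_mono[OF p(1)]) auto
  also have "\<dots> \<subseteq> {\<zero>\<^bsub>P\<^esub>}" by (rule module_ideal_mult_zero[OF p(1)])
  finally have "K = carrier P" if "rsubmodule L P K" "X \<subseteq> K" for K
    using gen[OF that] rsubmoduleD(2)[OF that(1)] by blast
  then show "finitely_generated L P" unfolding finitely_generated_iff[OF p(1)] using X by blast
qed

end

end

section \<open>Tensor products with rings of fractions\<close>

locale domain_fractions = R: domain R for R :: "('r, 'x) ring_scheme" +
  fixes D :: "'r set"
  assumes D_subset: "D \<subseteq> carrier R" and D_one: "\<one>\<^bsub>R\<^esub> \<in> D"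
    and D_mult: "\<lbrakk>s \<in> D; t \<in> D\<rbrakk> \<Longrightarrow> s \<otimes>\<^bsub>R\<^esub> t \<in> D" and D_zero: "\<zero>\<^bsub>R\<^esub> \<notin> D"
begin

lemma D_carrier: "s \<in> D \<Longrightarrow> s \<in> carrier R" using D_subset by auto

lemma D_nonzero: "s \<in> D \<Longrightarrow> s \<noteq> \<zero>\<^bsub>R\<^esub>" using D_zero by auto

context
  notes [simp] = D_carrier D_nonzero D_one D_mult
begin

lemma frac_rel_iff:
  "((a, s), (b, t)) \<in> frac_rel R D \<longleftrightarrow>
    a \<in> carrier R \<and> s \<in> D \<and> b \<in> carrier R \<and> t \<in> D \<and> a \<otimes>\<^bsub>R\<^esub> t = b \<otimes>\<^bsub>R\<^esub> s"
  unfolding frac_rel_def using R.m_lcancel by (auto 0 3 intro: bexI[of _ "\<one>\<^bsub>R\<^esub>"])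

lemma frac_rel_equiv: "equiv (carrier R \<times> D) (frac_rel R D)"
proof (rule equivI)
  show "frac_rel R D \<subseteq> (carrier R \<times> D) \<times> carrier R \<times> D" by (auto simp: frac_rel_iff)
  show "refl_on (carrier R \<times> D) (frac_rel R D)" by (auto simp: refl_on_def frac_rel_iff)
  show "sym (frac_rel R D)" by (auto simp: sym_def frac_rel_iff)
  show "trans (frac_rel R D)"
  proof (rule transI, clarify)
    fix a s b t c u
    assume 1: "((a, s), (b, t)) \<in> frac_rel R D" and 2: "((b, t), (c, u)) \<in> frac_rel R D"
    then have c: "a \<in> carrier R" "s \<in> D" "b \<in> carrier R" "t \<in> D" "c \<in> carrier R" "u \<in> D"
      and e: "a \<otimes>\<^bsub>R\<^esub> t = b \<otimes>\<^bsub>R\<^esub> s" "b \<otimes>\<^bsub>R\<^esub> u = c \<otimes>\<^bsub>R\<^esub> t" by (auto simp: frac_rel_iff)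
    have "t \<otimes>\<^bsub>R\<^esub> (a \<otimes>\<^bsub>R\<^esub> u) = (a \<otimes>\<^bsub>R\<^esub> t) \<otimes>\<^bsub>R\<^esub> u" using c by (simp add: R.m_ac)
    also have "\<dots> = (b \<otimes>\<^bsub>R\<^esub> u) \<otimes>\<^bsub>R\<^esub> s" unfolding e(1) using c by (simp add: R.m_ac)
    also have "\<dots> = t \<otimes>\<^bsub>R\<^esub> (c \<otimes>\<^bsub>R\<^esub> s)" unfolding e(2) using c by (simp add: R.m_ac)
    finally have "a \<otimes>\<^bsub>R\<^esub> u = c \<otimes>\<^bsub>R\<^esub> s" using c R.m_lcancel by simp
    then show "((a, s), (c, u)) \<in> frac_rel R D" using c by (simp add: frac_rel_iff)
  qed
qed

abbreviation fr :: "'r \<Rightarrow> 'r \<Rightarrow> ('r \<times> 'r) set" where "fr a s \<equiv> frac_class R D a s"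

abbreviation B :: "('r, ('r \<times> 'r) set) module" where "B \<equiv> fractions R D"

lemma fr_eq_iff:
  "a \<in> carrier R \<Longrightarrow> s \<in> D \<Longrightarrow> b \<in> carrier R \<Longrightarrow> t \<in> D \<Longrightarrow> fr a s = fr b t \<longleftrightarrow> a \<otimes>\<^bsub>R\<^esub> t = b \<otimes>\<^bsub>R\<^esub> s"
  using eq_equiv_class_iff[OF frac_rel_equiv, of "(a, s)" "(b, t)"] by (simp add: frac_rel_iff)

lemma fr_mem_iff: "(b, t) \<in> fr a s \<longleftrightarrow>
    a \<in> carrier R \<and> s \<in> D \<and> b \<in> carrier R \<and> t \<in> D \<and> a \<otimes>\<^bsub>R\<^esub> t = b \<otimes>\<^bsub>R\<^esub> s"
  by (simp add: Image_singleton_iff frac_rel_iff)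

lemma fr_closed [simp]: "a \<in> carrier R \<Longrightarrow> s \<in> D \<Longrightarrow> fr a s \<in> carrier B"
  by (auto simp: fractions_def quotient_def)

lemma frE:
  assumes "q \<in> carrier B" obtains a s where "a \<in> carrier R" "s \<in> D" "q = fr a s"
  using assms by (auto simp: fractions_def quotient_def)

text \<open>The operations on fractions are unions over representatives; this evaluates such a union when the
  representatives agree.\<close>

lemma fr_UN:
  assumes "a \<in> carrier R" "s \<in> D"
    and "\<And>b t. b \<in> carrier R \<Longrightarrow> t \<in> D \<Longrightarrow> a \<otimes>\<^bsub>R\<^esub> t = b \<otimes>\<^bsub>R\<^esub> s \<Longrightarrow> f b t = f a s"
  shows "(\<Union>(b, t)\<in>fr a s. f b t) = f a s"
proof -
  have "(a, s) \<in> fr a s" using assms(1,2) by (simp add: frac_rel_iff)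
  moreover have "f b t = f a s" if "(b, t) \<in> fr a s" for b t using that assms(3) unfolding fr_mem_iff by blast
  ultimately show ?thesis by blast
qed

lemma B_one: "\<one>\<^bsub>B\<^esub> = fr \<one>\<^bsub>R\<^esub> \<one>\<^bsub>R\<^esub>" and B_zero: "\<zero>\<^bsub>B\<^esub> = fr \<zero>\<^bsub>R\<^esub> \<one>\<^bsub>R\<^esub>"
  by (simp_all add: fractions_def)

lemma fr_smult:
  assumes "r \<in> carrier R" "a \<in> carrier R" "s \<in> D" shows "r \<odot>\<^bsub>B\<^esub> fr a s = fr (r \<otimes>\<^bsub>R\<^esub> a) s"
proof -
  have "(\<Union>(b, t)\<in>fr a s. fr (r \<otimes>\<^bsub>R\<^esub> b) t) = fr (r \<otimes>\<^bsub>R\<^esub> a) s"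
    by (rule fr_UN) (use assms in \<open>auto simp: fr_eq_iff R.m_assoc\<close>)
  then show ?thesis by (simp add: fractions_def)
qed

lemma fr_mult:
  assumes "a \<in> carrier R" "s \<in> D" "b \<in> carrier R" "t \<in> D"
  shows "fr a s \<otimes>\<^bsub>B\<^esub> fr b t = fr (a \<otimes>\<^bsub>R\<^esub> b) (s \<otimes>\<^bsub>R\<^esub> t)"
proof -
  have inner: "(\<Union>(b', t')\<in>fr b t. fr (a' \<otimes>\<^bsub>R\<^esub> b') (s' \<otimes>\<^bsub>R\<^esub> t')) = fr (a' \<otimes>\<^bsub>R\<^esub> b) (s' \<otimes>\<^bsub>R\<^esub> t)"
    if "a' \<in> carrier R" "s' \<in> D" for a' s'
  proof (rule fr_UN)
    fix b' t' assume c: "b' \<in> carrier R" "t' \<in> D" and e: "b \<otimes>\<^bsub>R\<^esub> t' = b' \<otimes>\<^bsub>R\<^esub> t"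
    have "(a' \<otimes>\<^bsub>R\<^esub> b') \<otimes>\<^bsub>R\<^esub> (s' \<otimes>\<^bsub>R\<^esub> t) = (a' \<otimes>\<^bsub>R\<^esub> s') \<otimes>\<^bsub>R\<^esub> (b' \<otimes>\<^bsub>R\<^esub> t)" using assms that c by (simp add: R.m_ac)
    also have "\<dots> = (a' \<otimes>\<^bsub>R\<^esub> b) \<otimes>\<^bsub>R\<^esub> (s' \<otimes>\<^bsub>R\<^esub> t')" unfolding e[symmetric] using assms that c by (simp add: R.m_ac)
    finally show "fr (a' \<otimes>\<^bsub>R\<^esub> b') (s' \<otimes>\<^bsub>R\<^esub> t') = fr (a' \<otimes>\<^bsub>R\<^esub> b) (s' \<otimes>\<^bsub>R\<^esub> t)"
      using assms that c by (simp add: fr_eq_iff)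
  qed (use assms in auto)
  have "(\<Union>(a', s')\<in>fr a s. \<Union>(b', t')\<in>fr b t. fr (a' \<otimes>\<^bsub>R\<^esub> b') (s' \<otimes>\<^bsub>R\<^esub> t'))
      = (\<Union>(b', t')\<in>fr b t. fr (a \<otimes>\<^bsub>R\<^esub> b') (s \<otimes>\<^bsub>R\<^esub> t'))"
  proof (rule fr_UN)
    fix a' s' assume c: "a' \<in> carrier R" "s' \<in> D" and e: "a \<otimes>\<^bsub>R\<^esub> s' = a' \<otimes>\<^bsub>R\<^esub> s"
    have "(a' \<otimes>\<^bsub>R\<^esub> b) \<otimes>\<^bsub>R\<^esub> (s \<otimes>\<^bsub>R\<^esub> t) = (a' \<otimes>\<^bsub>R\<^esub> s) \<otimes>\<^bsub>R\<^esub> (b \<otimes>\<^bsub>R\<^esub> t)" using assms c by (simp add: R.m_ac)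
    also have "\<dots> = (a \<otimes>\<^bsub>R\<^esub> b) \<otimes>\<^bsub>R\<^esub> (s' \<otimes>\<^bsub>R\<^esub> t)" unfolding e[symmetric] using assms c by (simp add: R.m_ac)
    finally show "(\<Union>(b', t')\<in>fr b t. fr (a' \<otimes>\<^bsub>R\<^esub> b') (s' \<otimes>\<^bsub>R\<^esub> t')) = (\<Union>(b', t')\<in>fr b t. fr (a \<otimes>\<^bsub>R\<^esub> b') (s \<otimes>\<^bsub>R\<^esub> t'))"
      unfolding inner[OF c] inner[OF assms(1,2)] using assms c by (simp add: fr_eq_iff)
  qed (use assms in auto)
  then show ?thesis unfolding inner[OF assms(1,2)] by (simp add: fractions_def)
qed

lemma fr_add:
  assumes "a \<in> carrier R" "s \<in> D" "b \<in> carrier R" "t \<in> D"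
  shows "fr a s \<oplus>\<^bsub>B\<^esub> fr b t = fr (a \<otimes>\<^bsub>R\<^esub> t \<oplus>\<^bsub>R\<^esub> b \<otimes>\<^bsub>R\<^esub> s) (s \<otimes>\<^bsub>R\<^esub> t)"
proof -
  have inner: "(\<Union>(b', t')\<in>fr b t. fr (a' \<otimes>\<^bsub>R\<^esub> t' \<oplus>\<^bsub>R\<^esub> b' \<otimes>\<^bsub>R\<^esub> s') (s' \<otimes>\<^bsub>R\<^esub> t'))
      = fr (a' \<otimes>\<^bsub>R\<^esub> t \<oplus>\<^bsub>R\<^esub> b \<otimes>\<^bsub>R\<^esub> s') (s' \<otimes>\<^bsub>R\<^esub> t)"
    if "a' \<in> carrier R" "s' \<in> D" for a' s'
  proof (rule fr_UN)
    fix b' t' assume c: "b' \<in> carrier R" "t' \<in> D" and e: "b \<otimes>\<^bsub>R\<^esub> t' = b' \<otimes>\<^bsub>R\<^esub> t"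
    have "(a' \<otimes>\<^bsub>R\<^esub> t' \<oplus>\<^bsub>R\<^esub> b' \<otimes>\<^bsub>R\<^esub> s') \<otimes>\<^bsub>R\<^esub> (s' \<otimes>\<^bsub>R\<^esub> t)
        = a' \<otimes>\<^bsub>R\<^esub> t' \<otimes>\<^bsub>R\<^esub> (s' \<otimes>\<^bsub>R\<^esub> t) \<oplus>\<^bsub>R\<^esub> s' \<otimes>\<^bsub>R\<^esub> s' \<otimes>\<^bsub>R\<^esub> (b' \<otimes>\<^bsub>R\<^esub> t)"
      using assms that c by (simp add: R.l_distr R.r_distr R.m_ac)
    also have "\<dots> = (a' \<otimes>\<^bsub>R\<^esub> t \<oplus>\<^bsub>R\<^esub> b \<otimes>\<^bsub>R\<^esub> s') \<otimes>\<^bsub>R\<^esub> (s' \<otimes>\<^bsub>R\<^esub> t')"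
      unfolding e[symmetric] using assms that c by (simp add: R.l_distr R.r_distr R.m_ac)
    finally show "fr (a' \<otimes>\<^bsub>R\<^esub> t' \<oplus>\<^bsub>R\<^esub> b' \<otimes>\<^bsub>R\<^esub> s') (s' \<otimes>\<^bsub>R\<^esub> t') = fr (a' \<otimes>\<^bsub>R\<^esub> t \<oplus>\<^bsub>R\<^esub> b \<otimes>\<^bsub>R\<^esub> s') (s' \<otimes>\<^bsub>R\<^esub> t)"
      using assms that c by (simp add: fr_eq_iff)
  qed (use assms in auto)
  have "(\<Union>(a', s')\<in>fr a s. \<Union>(b', t')\<in>fr b t. fr (a' \<otimes>\<^bsub>R\<^esub> t' \<oplus>\<^bsub>R\<^esub> b' \<otimes>\<^bsub>R\<^esub> s') (s' \<otimes>\<^bsub>R\<^esub> t'))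
      = (\<Union>(b', t')\<in>fr b t. fr (a \<otimes>\<^bsub>R\<^esub> t' \<oplus>\<^bsub>R\<^esub> b' \<otimes>\<^bsub>R\<^esub> s) (s \<otimes>\<^bsub>R\<^esub> t'))"
  proof (rule fr_UN)
    fix a' s' assume c: "a' \<in> carrier R" "s' \<in> D" and e: "a \<otimes>\<^bsub>R\<^esub> s' = a' \<otimes>\<^bsub>R\<^esub> s"
    have "(a' \<otimes>\<^bsub>R\<^esub> t \<oplus>\<^bsub>R\<^esub> b \<otimes>\<^bsub>R\<^esub> s') \<otimes>\<^bsub>R\<^esub> (s \<otimes>\<^bsub>R\<^esub> t)
        = (a' \<otimes>\<^bsub>R\<^esub> s) \<otimes>\<^bsub>R\<^esub> (t \<otimes>\<^bsub>R\<^esub> t) \<oplus>\<^bsub>R\<^esub> b \<otimes>\<^bsub>R\<^esub> s' \<otimes>\<^bsub>R\<^esub> (s \<otimes>\<^bsub>R\<^esub> t)"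
      using assms c by (simp add: R.l_distr R.r_distr R.m_ac)
    also have "\<dots> = (a \<otimes>\<^bsub>R\<^esub> t \<oplus>\<^bsub>R\<^esub> b \<otimes>\<^bsub>R\<^esub> s) \<otimes>\<^bsub>R\<^esub> (s' \<otimes>\<^bsub>R\<^esub> t)"
      unfolding e[symmetric] using assms c by (simp add: R.l_distr R.r_distr R.m_ac)
    finally show "(\<Union>(b', t')\<in>fr b t. fr (a' \<otimes>\<^bsub>R\<^esub> t' \<oplus>\<^bsub>R\<^esub> b' \<otimes>\<^bsub>R\<^esub> s') (s' \<otimes>\<^bsub>R\<^esub> t'))
        = (\<Union>(b', t')\<in>fr b t. fr (a \<otimes>\<^bsub>R\<^esub> t' \<oplus>\<^bsub>R\<^esub> b' \<otimes>\<^bsub>R\<^esub> s) (s \<otimes>\<^bsub>R\<^esub> t'))"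
      unfolding inner[OF c] inner[OF assms(1,2)] using assms c by (simp add: fr_eq_iff)
  qed (use assms in auto)
  then show ?thesis unfolding inner[OF assms(1,2)] by (simp add: fractions_def)
qed

lemma fr_add_same:
  assumes "a \<in> carrier R" "b \<in> carrier R" "s \<in> D"
  shows "fr a s \<oplus>\<^bsub>B\<^esub> fr b s = fr (a \<oplus>\<^bsub>R\<^esub> b) s"
  using assms by (simp add: fr_add fr_eq_iff R.l_distr R.r_distr R.m_ac)

lemma common_denominator:
  assumes "q \<in> carrier B" "q' \<in> carrier B"
  obtains a b s where "a \<in> carrier R" "b \<in> carrier R" "s \<in> D" "q = fr a s" "q' = fr b s"
proof -
  obtain a s b t where *: "a \<in> carrier R" "s \<in> D" "q = fr a s" "b \<in> carrier R" "t \<in> D" "q' = fr b t"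
    using frE[OF assms(1)] frE[OF assms(2)] by metis
  then have "q = fr (a \<otimes>\<^bsub>R\<^esub> t) (s \<otimes>\<^bsub>R\<^esub> t)" "q' = fr (b \<otimes>\<^bsub>R\<^esub> s) (s \<otimes>\<^bsub>R\<^esub> t)"
    by (simp_all add: fr_eq_iff R.m_ac)
  then show thesis using that[of "a \<otimes>\<^bsub>R\<^esub> t" "b \<otimes>\<^bsub>R\<^esub> s" "s \<otimes>\<^bsub>R\<^esub> t"] * by simp
qed

lemma B_closed:
  "q \<in> carrier B \<Longrightarrow> q' \<in> carrier B \<Longrightarrow> q \<otimes>\<^bsub>B\<^esub> q' \<in> carrier B"
  "q \<in> carrier B \<Longrightarrow> q' \<in> carrier B \<Longrightarrow> q \<oplus>\<^bsub>B\<^esub> q' \<in> carrier B"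
  "r \<in> carrier R \<Longrightarrow> q \<in> carrier B \<Longrightarrow> r \<odot>\<^bsub>B\<^esub> q \<in> carrier B"
  by (auto elim!: frE simp: fr_mult fr_add fr_smult)

lemma B_bilinear:
  assumes "q \<in> carrier B" "q' \<in> carrier B" "v \<in> carrier B" "r \<in> carrier R"
  shows "(q \<oplus>\<^bsub>B\<^esub> q') \<otimes>\<^bsub>B\<^esub> v = q \<otimes>\<^bsub>B\<^esub> v \<oplus>\<^bsub>B\<^esub> q' \<otimes>\<^bsub>B\<^esub> v"
    "v \<otimes>\<^bsub>B\<^esub> (q \<oplus>\<^bsub>B\<^esub> q') = v \<otimes>\<^bsub>B\<^esub> q \<oplus>\<^bsub>B\<^esub> v \<otimes>\<^bsub>B\<^esub> q'"
    "(r \<odot>\<^bsub>B\<^esub> q) \<otimes>\<^bsub>B\<^esub> v = r \<odot>\<^bsub>B\<^esub> (q \<otimes>\<^bsub>B\<^esub> v)" "v \<otimes>\<^bsub>B\<^esub> (r \<odot>\<^bsub>B\<^esub> q) = r \<odot>\<^bsub>B\<^esub> (v \<otimes>\<^bsub>B\<^esub> q)"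
proof -
  obtain a b s where q: "a \<in> carrier R" "b \<in> carrier R" "s \<in> D" "q = fr a s" "q' = fr b s"
    using common_denominator[OF assms(1,2)] .
  obtain c t where v: "c \<in> carrier R" "t \<in> D" "v = fr c t" using frE[OF assms(3)] .
  show "(q \<oplus>\<^bsub>B\<^esub> q') \<otimes>\<^bsub>B\<^esub> v = q \<otimes>\<^bsub>B\<^esub> v \<oplus>\<^bsub>B\<^esub> q' \<otimes>\<^bsub>B\<^esub> v"
    "v \<otimes>\<^bsub>B\<^esub> (q \<oplus>\<^bsub>B\<^esub> q') = v \<otimes>\<^bsub>B\<^esub> q \<oplus>\<^bsub>B\<^esub> v \<otimes>\<^bsub>B\<^esub> q'"
    "(r \<odot>\<^bsub>B\<^esub> q) \<otimes>\<^bsub>B\<^esub> v = r \<odot>\<^bsub>B\<^esub> (q \<otimes>\<^bsub>B\<^esub> v)" "v \<otimes>\<^bsub>B\<^esub> (r \<odot>\<^bsub>B\<^esub> q) = r \<odot>\<^bsub>B\<^esub> (v \<otimes>\<^bsub>B\<^esub> q)"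
    using q v assms(4) by (simp_all add: fr_add_same fr_mult fr_smult R.l_distr R.r_distr R.m_ac)
qed

subsection \<open>The group \<open>M \<otimes> B\<close>\<close>

abbreviation K :: "('r, 'm, 'y) module_scheme \<Rightarrow> ('m \<times> ('r \<times> 'r) set \<Rightarrow>\<^sub>0 int) set"
  where "K M \<equiv> tensor_kernel R M B"

abbreviation G :: "('r, 'm, 'y) module_scheme \<Rightarrow> ('m \<times> ('r \<times> 'r) set \<Rightarrow>\<^sub>0 int) monoid"
  where "G M \<equiv> free_Abelian_group (carrier M \<times> carrier B)"

abbreviation T :: "('r, 'm, 'y) module_scheme \<Rightarrow> ('m \<times> ('r \<times> 'r) set \<Rightarrow>\<^sub>0 int) set monoid"
  where "T M \<equiv> tensor_group R M B"

abbreviation cl :: "('r, 'm, 'y) module_scheme \<Rightarrow> ('m \<times> ('r \<times> 'r) set \<Rightarrow>\<^sub>0 int) \<Rightarrow> _"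
  where "cl M \<equiv> tensor_class R M B"

definition pure :: "('r, 'm, 'y) module_scheme \<Rightarrow> 'm \<Rightarrow> ('r \<times> 'r) set \<Rightarrow> ('m \<times> ('r \<times> 'r) set \<Rightarrow>\<^sub>0 int) set"
  where "pure M x q = cl M (frag_of (x, q))"

definition mk :: "('r, 'm, 'y) module_scheme \<Rightarrow> 'm \<Rightarrow> 'r \<Rightarrow> ('m \<times> ('r \<times> 'r) set \<Rightarrow>\<^sub>0 int) set"
  where "mk M x s = pure M x (fr \<one>\<^bsub>R\<^esub> s)"

lemma tensor_relation_cases:
  assumes "\<rho> \<in> tensor_relations R M B"
    and "\<And>x x' q. \<rho> = frag_of (x \<oplus>\<^bsub>M\<^esub> x', q) - frag_of (x, q) - frag_of (x', q) \<Longrightarrow>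
        x \<in> carrier M \<Longrightarrow> x' \<in> carrier M \<Longrightarrow> q \<in> carrier B \<Longrightarrow> thesis"
    and "\<And>x q q'. \<rho> = frag_of (x, q \<oplus>\<^bsub>B\<^esub> q') - frag_of (x, q) - frag_of (x, q') \<Longrightarrow>
        x \<in> carrier M \<Longrightarrow> q \<in> carrier B \<Longrightarrow> q' \<in> carrier B \<Longrightarrow> thesis"
    and "\<And>r x q. \<rho> = frag_of (r \<odot>\<^bsub>M\<^esub> x, q) - frag_of (x, r \<odot>\<^bsub>B\<^esub> q) \<Longrightarrow>
        r \<in> carrier R \<Longrightarrow> x \<in> carrier M \<Longrightarrow> q \<in> carrier B \<Longrightarrow> thesis"
  shows thesis
  using assms unfolding tensor_relations_def by blast

context
  fixes M :: "('r, 'm, 'y) module_scheme"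
  assumes M: "Module.module R M"
begin

interpretation M: Module.module R M by (rule M)

lemma relations_subset: "tensor_relations R M B \<subseteq> carrier (G M)"
proof -
  have keys: "Poly_Mapping.keys (a - b) \<subseteq> X"
    if "Poly_Mapping.keys a \<subseteq> X" "Poly_Mapping.keys b \<subseteq> X"
    for a b :: "('m \<times> ('r \<times> 'r) set) \<Rightarrow>\<^sub>0 int" and X
    using keys_diff[of a b] that by blast
  show ?thesis
  proof
    fix z assume "z \<in> tensor_relations R M B"
    then have "Poly_Mapping.keys z \<subseteq> carrier M \<times> carrier B"
    proof (rule tensor_relation_cases)
      fix x x' q
      assume z: "z = frag_of (x \<oplus>\<^bsub>M\<^esub> x', q) - frag_of (x, q) - frag_of (x', q)"
        and c: "x \<in> carrier M" "x' \<in> carrier M" "q \<in> carrier B"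
      show ?thesis unfolding z by (intro keys) (use c in auto)
    next
      fix x q q'
      assume z: "z = frag_of (x, q \<oplus>\<^bsub>B\<^esub> q') - frag_of (x, q) - frag_of (x, q')"
        and c: "x \<in> carrier M" "q \<in> carrier B" "q' \<in> carrier B"
      show ?thesis unfolding z by (intro keys) (use c B_closed(2)[OF c(2,3)] in auto)
    next
      fix r x q
      assume z: "z = frag_of (r \<odot>\<^bsub>M\<^esub> x, q) - frag_of (x, r \<odot>\<^bsub>B\<^esub> q)"
        and c: "r \<in> carrier R" "x \<in> carrier M" "q \<in> carrier B"
      show ?thesis unfolding z by (intro keys) (use c B_closed(3)[OF c(1,3)] in auto)
    qed
    then show "z \<in> carrier (G M)" by (simp only: carrier_free_Abelian_group_iff)
  qed
qed

lemma kernel_subgroup: "subgroup (K M) (G M)"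
  unfolding tensor_kernel_def by (rule group.generate_is_subgroup[OF group_free_Abelian_group relations_subset])

lemma kernel_carrier: "z \<in> K M \<Longrightarrow> Poly_Mapping.keys z \<subseteq> carrier M \<times> carrier B"
  using subsetD[OF subgroup.subset[OF kernel_subgroup], of z] by (simp only: carrier_free_Abelian_group_iff)

lemma kernel_closed:
  "0 \<in> K M" "z \<in> K M \<Longrightarrow> w \<in> K M \<Longrightarrow> z + w \<in> K M" "z \<in> K M \<Longrightarrow> - z \<in> K M"
  "z \<in> K M \<Longrightarrow> w \<in> K M \<Longrightarrow> z - w \<in> K M"
proof -
  show 0: "0 \<in> K M" using subgroup.one_closed[OF kernel_subgroup] by simp
  show add: "z + w \<in> K M" if "z \<in> K M" "w \<in> K M" for z w
    using subgroup.m_closed[OF kernel_subgroup that] by simp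
  show neg: "- z \<in> K M" if "z \<in> K M" for z
    using subgroup.m_inv_closed[OF kernel_subgroup that] kernel_carrier[OF that] by simp
  show "z - w \<in> K M" if "z \<in> K M" "w \<in> K M"
    using add[OF that(1) neg[OF that(2)]] by simp
qed

lemma kernel_relations:
  "x \<in> carrier M \<Longrightarrow> x' \<in> carrier M \<Longrightarrow> q \<in> carrier B \<Longrightarrow>
    frag_of (x \<oplus>\<^bsub>M\<^esub> x', q) - frag_of (x, q) - frag_of (x', q) \<in> K M"
  "x \<in> carrier M \<Longrightarrow> q \<in> carrier B \<Longrightarrow> q' \<in> carrier B \<Longrightarrow>
    frag_of (x, q \<oplus>\<^bsub>B\<^esub> q') - frag_of (x, q) - frag_of (x, q') \<in> K M"
  "r \<in> carrier R \<Longrightarrow> x \<in> carrier M \<Longrightarrow> q \<in> carrier B \<Longrightarrow>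
    frag_of (r \<odot>\<^bsub>M\<^esub> x, q) - frag_of (x, r \<odot>\<^bsub>B\<^esub> q) \<in> K M"
  unfolding tensor_kernel_def tensor_relations_def by (blast intro: generate.incl)+

lemma cl_eq: "cl M z = (\<lambda>k. k + z) ` K M"
  by (auto simp: tensor_class_def r_coset_def)

lemma cl_eq_iff: "cl M z = cl M w \<longleftrightarrow> z - w \<in> K M"
proof
  assume "cl M z = cl M w"
  moreover have "z \<in> cl M z" unfolding cl_eq using kernel_closed(1) by (metis add_0 imageI)
  ultimately obtain k where "k \<in> K M" "z = k + w" unfolding cl_eq by blast
  then show "z - w \<in> K M" by simp
next
  assume zw: "z - w \<in> K M"
  have "k + z \<in> cl M w" if "k \<in> K M" for k
    unfolding cl_eq using kernel_closed(2)[OF that zw] by (intro image_eqI[of _ _ "k + (z - w)"]) auto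
  moreover have "k + w \<in> cl M z" if "k \<in> K M" for k
    unfolding cl_eq using kernel_closed(4)[OF that zw] by (intro image_eqI[of _ _ "k - (z - w)"]) auto
  ultimately show "cl M z = cl M w" unfolding cl_eq by blast
qed

lemma T_carrier: "carrier (T M) = cl M ` carrier (G M)"
  by (auto simp: tensor_group_def FactGroup_def RCOSETS_def tensor_class_def)

lemma T_comm_group: "comm_group (T M)"
  unfolding tensor_group_def
  by (rule comm_group.abelian_FactGroup[OF abelian_free_Abelian_group kernel_subgroup])

lemma T_mult: "cl M z \<otimes>\<^bsub>T M\<^esub> cl M w = cl M (z + w)"
proof -
  have "cl M z \<otimes>\<^bsub>T M\<^esub> cl M w = (\<Union>h\<in>cl M z. \<Union>k\<in>cl M w. {h + k})"
    by (simp add: tensor_group_def FactGroup_def set_mult_def)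
  also have "\<dots> = cl M (z + w)"
  proof (intro equalityI subsetI)
    fix v assume "v \<in> (\<Union>h\<in>cl M z. \<Union>k\<in>cl M w. {h + k})"
    then obtain a b where "a \<in> K M" "b \<in> K M" "v = (a + z) + (b + w)" unfolding cl_eq by blast
    then show "v \<in> cl M (z + w)"
      unfolding cl_eq using kernel_closed(2) by (intro image_eqI[of _ _ "a + b"]) auto
  next
    fix v assume "v \<in> cl M (z + w)"
    then obtain k where "k \<in> K M" "v = (k + z) + (0 + w)" unfolding cl_eq by auto
    then show "v \<in> (\<Union>h\<in>cl M z. \<Union>k\<in>cl M w. {h + k})"
      unfolding cl_eq using kernel_closed(1) by blast
  qed
  finally show ?thesis .
qed

lemma T_one: "\<one>\<^bsub>T M\<^esub> = cl M 0"
  by (simp add: cl_eq tensor_group_def FactGroup_def)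

lemma pure_closed: "x \<in> carrier M \<Longrightarrow> q \<in> carrier B \<Longrightarrow> pure M x q \<in> carrier (T M)"
  unfolding pure_def T_carrier by (rule imageI) simp

lemma pure_add_left:
  "x \<in> carrier M \<Longrightarrow> x' \<in> carrier M \<Longrightarrow> q \<in> carrier B \<Longrightarrow>
    pure M (x \<oplus>\<^bsub>M\<^esub> x') q = pure M x q \<otimes>\<^bsub>T M\<^esub> pure M x' q"
  unfolding pure_def T_mult cl_eq_iff using kernel_relations(1) by (simp add: diff_diff_eq)

lemma pure_smult:
  "r \<in> carrier R \<Longrightarrow> x \<in> carrier M \<Longrightarrow> q \<in> carrier B \<Longrightarrow> pure M (r \<odot>\<^bsub>M\<^esub> x) q = pure M x (r \<odot>\<^bsub>B\<^esub> q)"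
  unfolding pure_def cl_eq_iff by (rule kernel_relations(3))

lemma mk_closed: "x \<in> carrier M \<Longrightarrow> s \<in> D \<Longrightarrow> mk M x s \<in> carrier (T M)"
  unfolding mk_def by (rule pure_closed) auto

lemma pure_eq_mk: "x \<in> carrier M \<Longrightarrow> a \<in> carrier R \<Longrightarrow> s \<in> D \<Longrightarrow> pure M x (fr a s) = mk M (a \<odot>\<^bsub>M\<^esub> x) s"
  unfolding mk_def by (simp add: pure_smult fr_smult)

lemma mk_expand: "x \<in> carrier M \<Longrightarrow> s \<in> D \<Longrightarrow> t \<in> D \<Longrightarrow> mk M x s = mk M (t \<odot>\<^bsub>M\<^esub> x) (s \<otimes>\<^bsub>R\<^esub> t)"
proof -
  assume *: "x \<in> carrier M" "s \<in> D" "t \<in> D"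
  then have "fr \<one>\<^bsub>R\<^esub> s = fr t (s \<otimes>\<^bsub>R\<^esub> t)" by (simp add: fr_eq_iff R.m_comm)
  then show ?thesis unfolding mk_def using * by (simp add: pure_smult fr_smult)
qed

lemma mk_add: "x \<in> carrier M \<Longrightarrow> x' \<in> carrier M \<Longrightarrow> s \<in> D \<Longrightarrow> mk M x s \<otimes>\<^bsub>T M\<^esub> mk M x' s = mk M (x \<oplus>\<^bsub>M\<^esub> x') s"
  unfolding mk_def by (simp add: pure_add_left)

lemma mk_zero: "s \<in> D \<Longrightarrow> mk M \<zero>\<^bsub>M\<^esub> s = \<one>\<^bsub>T M\<^esub>"
proof -
  assume s: "s \<in> D"
  have "frag_of (\<zero>\<^bsub>M\<^esub> \<oplus>\<^bsub>M\<^esub> \<zero>\<^bsub>M\<^esub>, fr \<one>\<^bsub>R\<^esub> s) - frag_of (\<zero>\<^bsub>M\<^esub>, fr \<one>\<^bsub>R\<^esub> s) - frag_of (\<zero>\<^bsub>M\<^esub>, fr \<one>\<^bsub>R\<^esub> s) \<in> K M"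
    using s by (intro kernel_relations(1)) auto
  then have "- frag_of (\<zero>\<^bsub>M\<^esub>, fr \<one>\<^bsub>R\<^esub> s) \<in> K M" by simp
  then have "frag_of (\<zero>\<^bsub>M\<^esub>, fr \<one>\<^bsub>R\<^esub> s) - 0 \<in> K M" using kernel_closed(3) by fastforce
  then show ?thesis unfolding mk_def pure_def T_one cl_eq_iff .
qed

text \<open>Elements of \<open>M \<otimes> B\<close> are single tensors \<open>x \<otimes> 1/s\<close>, since sums can be brought over a common
  denominator. All later computations in \<open>M \<otimes> B\<close> are computations with such pairs.\<close>

lemma mkE:
  assumes "y \<in> carrier (T M)" obtains x s where "x \<in> carrier M" "s \<in> D" "y = mk M x s"
proof -
  obtain z where z: "Poly_Mapping.keys z \<subseteq> carrier M \<times> carrier B" and y: "y = cl M z"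
    using assms unfolding T_carrier by auto
  have "\<exists>x\<in>carrier M. \<exists>s\<in>D. cl M z = mk M x s"
  proof (rule free_Abelian_group_induct[OF z])
    show "\<exists>x\<in>carrier M. \<exists>s\<in>D. cl M 0 = mk M x s"
      using mk_zero[OF D_one] T_one by (intro bexI[of _ "\<zero>\<^bsub>M\<^esub>"] bexI[of _ "\<one>\<^bsub>R\<^esub>"]) auto
  next
    fix z w :: "'m \<times> ('r \<times> 'r) set \<Rightarrow>\<^sub>0 int"
    assume "\<exists>x\<in>carrier M. \<exists>s\<in>D. cl M z = mk M x s" "\<exists>x\<in>carrier M. \<exists>s\<in>D. cl M w = mk M x s"
    then obtain x s u t where x: "x \<in> carrier M" "s \<in> D" "cl M z = mk M x s"
      and u: "u \<in> carrier M" "t \<in> D" "cl M w = mk M u t" by blast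
    have z': "cl M z = mk M (t \<odot>\<^bsub>M\<^esub> x) (s \<otimes>\<^bsub>R\<^esub> t)" using mk_expand[OF x(1,2) u(2)] x(3) by simp
    have w': "cl M w = mk M (s \<odot>\<^bsub>M\<^esub> u) (s \<otimes>\<^bsub>R\<^esub> t)" using mk_expand[OF u(1,2) x(2)] u(3) R.m_comm[of t s] x(2) u(2) by simp
    let ?x = "t \<odot>\<^bsub>M\<^esub> x" and ?u = "s \<odot>\<^bsub>M\<^esub> u" and ?s = "s \<otimes>\<^bsub>R\<^esub> t"
    have c: "?x \<in> carrier M" "?u \<in> carrier M" "?s \<in> D" using x u by auto
    have "mk M (?x \<ominus>\<^bsub>M\<^esub> ?u) ?s \<otimes>\<^bsub>T M\<^esub> cl M w = cl M z"
      unfolding z' w' using c by (simp add: mk_add a_minus_def M.M.a_assoc M.M.l_neg)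
    then have "cl M (frag_of (?x \<ominus>\<^bsub>M\<^esub> ?u, fr \<one>\<^bsub>R\<^esub> ?s) + w) = cl M z"
      unfolding mk_def pure_def T_mult .
    then have "z - (frag_of (?x \<ominus>\<^bsub>M\<^esub> ?u, fr \<one>\<^bsub>R\<^esub> ?s) + w) \<in> K M"
      using cl_eq_iff by metis
    then have "(z - w) - frag_of (?x \<ominus>\<^bsub>M\<^esub> ?u, fr \<one>\<^bsub>R\<^esub> ?s) \<in> K M" by (simp add: algebra_simps)
    then have "cl M (z - w) = mk M (?x \<ominus>\<^bsub>M\<^esub> ?u) ?s" unfolding mk_def pure_def cl_eq_iff .
    then show "\<exists>x\<in>carrier M. \<exists>s\<in>D. cl M (z - w) = mk M x s" using c by blast
  next
    fix a assume "a \<in> carrier M \<times> carrier B"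
    then obtain x q where a: "a = (x, q)" "x \<in> carrier M" "q \<in> carrier B" by blast
    obtain b s where "b \<in> carrier R" "s \<in> D" "q = fr b s" using frE[OF a(3)] .
    then show "\<exists>x\<in>carrier M. \<exists>s\<in>D. cl M (frag_of a) = mk M x s"
      using pure_eq_mk[OF a(2), of b s] a(1,2) unfolding pure_def
      by (intro bexI[of _ "b \<odot>\<^bsub>M\<^esub> x"] bexI[of _ s]) auto
  qed
  then obtain x s where "x \<in> carrier M" "s \<in> D" "cl M z = mk M x s" by (elim bexE)
  then show thesis using that y by simp
qed

lemma mkE2:
  assumes "y \<in> carrier (T M)" "z \<in> carrier (T M)"
  obtains x u s where "x \<in> carrier M" "u \<in> carrier M" "s \<in> D" "y = mk M x s" "z = mk M u s"
proof -
  obtain x s u t where x: "x \<in> carrier M" "s \<in> D" "y = mk M x s"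
    and u: "u \<in> carrier M" "t \<in> D" "z = mk M u t" using mkE[OF assms(1)] mkE[OF assms(2)] by metis
  have "y = mk M (t \<odot>\<^bsub>M\<^esub> x) (s \<otimes>\<^bsub>R\<^esub> t)" using mk_expand[OF x(1,2) u(2)] x(3) by simp
  moreover have "z = mk M (s \<odot>\<^bsub>M\<^esub> u) (s \<otimes>\<^bsub>R\<^esub> t)" using mk_expand[OF u(1,2) x(2)] u(3) R.m_comm[of t s] x(2) u(2) by simp
  ultimately show thesis
    using x(1,2) u(1,2) by (intro that[of "t \<odot>\<^bsub>M\<^esub> x" "s \<odot>\<^bsub>M\<^esub> u" "s \<otimes>\<^bsub>R\<^esub> t"]) simp_all
qed

text \<open>For a denominator \<open>s\<close>, sending \<open>(x, b/s)\<close> to \<open>b x\<close> (and other pairs to \<open>0\<close>) induces a homomorphism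
  from the free abelian group to \<open>M\<close>. It need not respect all tensor relations, but each relation
  is respected as soon as \<open>s\<close> is divisible by its denominators. This yields the kernel of
  \<open>M \<rightarrow> M \<otimes> B\<close> without a separate construction of \<open>M\<^sub>D\<close>.\<close>

lemma mk_eq_zero:
  assumes x: "x \<in> carrier M" and "mk M x \<one>\<^bsub>R\<^esub> = \<one>\<^bsub>T M\<^esub>"
  obtains s where "s \<in> D" "s \<odot>\<^bsub>M\<^esub> x = \<zero>\<^bsub>M\<^esub>"
proof -
  define \<beta> where "\<beta> s q = (if \<exists>b\<in>carrier R. q = fr b s then SOME b. b \<in> carrier R \<and> q = fr b s else \<zero>\<^bsub>R\<^esub>)" for s q
  have \<beta>: "\<beta> s (fr b s) = b" if "b \<in> carrier R" "s \<in> D" for b s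
  proof -
    have "(SOME c. c \<in> carrier R \<and> fr b s = fr c s) = b"
    proof (rule some_equality)
      fix c assume c: "c \<in> carrier R \<and> fr b s = fr c s"
      then have "b \<otimes>\<^bsub>R\<^esub> s = c \<otimes>\<^bsub>R\<^esub> s" using that fr_eq_iff[of b s c s] by auto
      then show "c = b" using that c R.m_rcancel[OF D_nonzero[OF that(2)]] by auto
    qed (use that in simp)
    then show ?thesis using that unfolding \<beta>_def by auto
  qed
  have \<beta>c: "\<beta> s q \<in> carrier R" for s q
    using someI_ex[of "\<lambda>b. b \<in> carrier R \<and> q = fr b s"] unfolding \<beta>_def by (auto simp: Bex_def)
  have "\<exists>h. h \<in> hom (G M) (add_monoid M) \<and> (\<forall>x\<in>carrier M. \<forall>q\<in>carrier B. h (frag_of (x, q)) = \<beta> s q \<odot>\<^bsub>M\<^esub> x)" for s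
  proof -
    have "(\<lambda>(x, q). \<beta> s q \<odot>\<^bsub>M\<^esub> x) ` (carrier M \<times> carrier B) \<subseteq> carrier (add_monoid M)" using \<beta>c by auto
    from comm_group.free_Abelian_group_universal[OF M.M.a_comm_group this] obtain h where
      "h \<in> hom (G M) (add_monoid M)"
      "\<And>p. p \<in> carrier M \<times> carrier B \<Longrightarrow> h (frag_of p) = (\<lambda>(x, q). \<beta> s q \<odot>\<^bsub>M\<^esub> x) p" by metis
    then show ?thesis by (intro exI[of _ h]) auto
  qed
  then obtain h where h: "\<And>s. h s \<in> hom (G M) (add_monoid M)"
    and hf: "\<And>s x q. x \<in> carrier M \<Longrightarrow> q \<in> carrier B \<Longrightarrow> h s (frag_of (x, q)) = \<beta> s q \<odot>\<^bsub>M\<^esub> x" by metis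
  have hh: "group_hom (G M) (add_monoid M) (h s)" for s
    using h by (simp add: group_hom_def group_hom_axioms_def M.M.a_group)
  have hc: "h s z \<in> carrier M" if "Poly_Mapping.keys z \<subseteq> carrier M \<times> carrier B" for s z
    using group_hom.hom_closed[OF hh, of z s] that by simp
  have hadd: "h s (z + w) = h s z \<oplus>\<^bsub>M\<^esub> h s w"
    if "Poly_Mapping.keys z \<subseteq> carrier M \<times> carrier B" "Poly_Mapping.keys w \<subseteq> carrier M \<times> carrier B" for s z w
    using group_hom.hom_mult[OF hh, of z w s] that by simp
  have hneg: "h s (- z) = \<ominus>\<^bsub>M\<^esub> h s z" if "Poly_Mapping.keys z \<subseteq> carrier M \<times> carrier B" for s z
    using group_hom.hom_inv[OF hh, of z s] that by (simp add: a_inv_def)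
  have hdiff: "h s (z - w) = h s z \<ominus>\<^bsub>M\<^esub> h s w"
    if "Poly_Mapping.keys z \<subseteq> carrier M \<times> carrier B" "Poly_Mapping.keys w \<subseteq> carrier M \<times> carrier B" for s z w
    using hadd[of z "- w" s] hneg[of w s] that by (simp add: a_minus_def)
  have kd: "Poly_Mapping.keys (z - w) \<subseteq> carrier M \<times> carrier B"
    if "Poly_Mapping.keys z \<subseteq> carrier M \<times> carrier B" "Poly_Mapping.keys w \<subseteq> carrier M \<times> carrier B"
    for z w :: "'m \<times> ('r \<times> 'r) set \<Rightarrow>\<^sub>0 int"
    using keys_diff[of z w] that by blast
  have h0: "h s 0 = \<zero>\<^bsub>M\<^esub>" for s using group_hom.hom_one[OF hh, of s] by simp
  have d2: "h s (frag_of p - frag_of p' - frag_of p'') = h s (frag_of p) \<ominus>\<^bsub>M\<^esub> h s (frag_of p') \<ominus>\<^bsub>M\<^esub> h s (frag_of p'')"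
    if "p \<in> carrier M \<times> carrier B" "p' \<in> carrier M \<times> carrier B" "p'' \<in> carrier M \<times> carrier B" for s p p' p''
    using that hdiff kd by simp
  have fr_mul: "fr a s = fr (a \<otimes>\<^bsub>R\<^esub> t) (s \<otimes>\<^bsub>R\<^esub> t)" if "a \<in> carrier R" "s \<in> D" "t \<in> D" for a s t
    using that by (simp add: fr_eq_iff R.m_ac)
  have cancel: "(u \<oplus>\<^bsub>M\<^esub> v) \<ominus>\<^bsub>M\<^esub> u \<ominus>\<^bsub>M\<^esub> v = \<zero>\<^bsub>M\<^esub>" if "u \<in> carrier M" "v \<in> carrier M" for u v
  proof -
    have "(u \<oplus>\<^bsub>M\<^esub> v) \<ominus>\<^bsub>M\<^esub> u \<ominus>\<^bsub>M\<^esub> v = (u \<oplus>\<^bsub>M\<^esub> \<ominus>\<^bsub>M\<^esub> u) \<oplus>\<^bsub>M\<^esub> (v \<oplus>\<^bsub>M\<^esub> \<ominus>\<^bsub>M\<^esub> v)"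
      using that by (simp add: a_minus_def M.M.a_ac)
    then show ?thesis using that by (simp add: M.M.r_neg)
  qed
  have rel: "\<exists>s\<in>D. \<forall>t\<in>D. h (s \<otimes>\<^bsub>R\<^esub> t) z = \<zero>\<^bsub>M\<^esub>" if "z \<in> tensor_relations R M B" for z
  proof -
    show ?thesis using that
    proof (rule tensor_relation_cases)
      fix x x' q
      assume 1: "z = frag_of (x \<oplus>\<^bsub>M\<^esub> x', q) - frag_of (x, q) - frag_of (x', q)"
        "x \<in> carrier M" "x' \<in> carrier M" "q \<in> carrier B"
      have "h s z = \<zero>\<^bsub>M\<^esub>" for s
        using 1 \<beta>c by (simp add: d2 hf M.smult_r_distr cancel)
      then show ?thesis using D_one by blast
    next
      fix x q q'
      assume 2: "z = frag_of (x, q \<oplus>\<^bsub>B\<^esub> q') - frag_of (x, q) - frag_of (x, q')"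
        "x \<in> carrier M" "q \<in> carrier B" "q' \<in> carrier B"
      obtain a b s where q: "a \<in> carrier R" "b \<in> carrier R" "s \<in> D" "q = fr a s" "q' = fr b s"
        using common_denominator[OF 2(3,4)] .
      have "h (s \<otimes>\<^bsub>R\<^esub> t) z = \<zero>\<^bsub>M\<^esub>" if t: "t \<in> D" for t
      proof -
        have qt: "q = fr (a \<otimes>\<^bsub>R\<^esub> t) (s \<otimes>\<^bsub>R\<^esub> t)" "q' = fr (b \<otimes>\<^bsub>R\<^esub> t) (s \<otimes>\<^bsub>R\<^esub> t)"
          using fr_mul[OF q(1,3) t] fr_mul[OF q(2,3) t] q(4,5) by simp_all
        then have "q \<oplus>\<^bsub>B\<^esub> q' = fr (a \<otimes>\<^bsub>R\<^esub> t \<oplus>\<^bsub>R\<^esub> b \<otimes>\<^bsub>R\<^esub> t) (s \<otimes>\<^bsub>R\<^esub> t)" using q t by (simp add: fr_add_same)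
        then have "\<beta> (s \<otimes>\<^bsub>R\<^esub> t) (q \<oplus>\<^bsub>B\<^esub> q') = \<beta> (s \<otimes>\<^bsub>R\<^esub> t) q \<oplus>\<^bsub>R\<^esub> \<beta> (s \<otimes>\<^bsub>R\<^esub> t) q'"
          using qt q t \<beta> by simp
        then show ?thesis using 2 \<beta>c B_closed(2)[OF 2(3,4)] by (simp add: d2 hf M.smult_l_distr cancel)
      qed
      then show ?thesis using q(3) by blast
    next
      fix r x q
      assume 3: "z = frag_of (r \<odot>\<^bsub>M\<^esub> x, q) - frag_of (x, r \<odot>\<^bsub>B\<^esub> q)"
        "r \<in> carrier R" "x \<in> carrier M" "q \<in> carrier B"
      obtain a s where q: "a \<in> carrier R" "s \<in> D" "q = fr a s" using frE[OF 3(4)] .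
      have "h (s \<otimes>\<^bsub>R\<^esub> t) z = \<zero>\<^bsub>M\<^esub>" if t: "t \<in> D" for t
      proof -
        have qt: "q = fr (a \<otimes>\<^bsub>R\<^esub> t) (s \<otimes>\<^bsub>R\<^esub> t)" using fr_mul[OF q(1,2) t] q(3) by simp
        then have "r \<odot>\<^bsub>B\<^esub> q = fr (r \<otimes>\<^bsub>R\<^esub> (a \<otimes>\<^bsub>R\<^esub> t)) (s \<otimes>\<^bsub>R\<^esub> t)" using q t 3(2) by (simp add: fr_smult)
        then have "\<beta> (s \<otimes>\<^bsub>R\<^esub> t) (r \<odot>\<^bsub>B\<^esub> q) = \<beta> (s \<otimes>\<^bsub>R\<^esub> t) q \<otimes>\<^bsub>R\<^esub> r"
          using qt q t 3(2) \<beta> by (simp add: R.m_comm)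
        then have "h (s \<otimes>\<^bsub>R\<^esub> t) (frag_of (r \<odot>\<^bsub>M\<^esub> x, q)) = h (s \<otimes>\<^bsub>R\<^esub> t) (frag_of (x, r \<odot>\<^bsub>B\<^esub> q))"
          using 3 \<beta>c B_closed(3)[OF 3(2,4)] by (simp add: hf M.smult_assoc1)
        then show ?thesis
          using 3 hdiff[of "frag_of (r \<odot>\<^bsub>M\<^esub> x, q)" "frag_of (x, r \<odot>\<^bsub>B\<^esub> q)"] B_closed(3)[OF 3(2,4)] hc[of "frag_of (x, r \<odot>\<^bsub>B\<^esub> q)"]
          by (simp add: a_minus_def M.M.r_neg)
      qed
      then show ?thesis using q(2) by blast
    qed
  qed
  have ker: "\<exists>s\<in>D. \<forall>t\<in>D. h (s \<otimes>\<^bsub>R\<^esub> t) z = \<zero>\<^bsub>M\<^esub>" if "z \<in> generate (G M) (tensor_relations R M B)" for z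
    using that
  proof (induction z rule: generate.induct)
    case one
    then show ?case using h0 by (intro bexI[OF _ D_one]) simp
  next
    case (incl z)
    then show ?case by (rule rel)
  next
    case (inv z)
    then have "Poly_Mapping.keys z \<subseteq> carrier M \<times> carrier B"
      using subsetD[OF relations_subset inv] by (simp only: carrier_free_Abelian_group_iff)
    moreover obtain s where "s \<in> D" "\<And>t. t \<in> D \<Longrightarrow> h (s \<otimes>\<^bsub>R\<^esub> t) z = \<zero>\<^bsub>M\<^esub>" using rel[OF inv] by blast
    moreover have "\<ominus>\<^bsub>M\<^esub> \<zero>\<^bsub>M\<^esub> = \<zero>\<^bsub>M\<^esub>" using M.M.minus_equality[of "\<zero>\<^bsub>M\<^esub>" "\<zero>\<^bsub>M\<^esub>"] by simp
    ultimately show ?case using hneg by (intro bexI[of _ s]) simp_all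
  next
    case (eng z w)
    then have c: "Poly_Mapping.keys z \<subseteq> carrier M \<times> carrier B" "Poly_Mapping.keys w \<subseteq> carrier M \<times> carrier B"
      using kernel_carrier unfolding tensor_kernel_def by auto
    from eng obtain s s' where s: "s \<in> D" "s' \<in> D" and z: "\<And>t. t \<in> D \<Longrightarrow> h (s \<otimes>\<^bsub>R\<^esub> t) z = \<zero>\<^bsub>M\<^esub>"
      and w: "\<And>t. t \<in> D \<Longrightarrow> h (s' \<otimes>\<^bsub>R\<^esub> t) w = \<zero>\<^bsub>M\<^esub>" by blast
    have "h (s \<otimes>\<^bsub>R\<^esub> s' \<otimes>\<^bsub>R\<^esub> t) (z + w) = \<zero>\<^bsub>M\<^esub>" if t: "t \<in> D" for t
    proof -
      have "s \<otimes>\<^bsub>R\<^esub> s' \<otimes>\<^bsub>R\<^esub> t = s \<otimes>\<^bsub>R\<^esub> (s' \<otimes>\<^bsub>R\<^esub> t)" "s \<otimes>\<^bsub>R\<^esub> s' \<otimes>\<^bsub>R\<^esub> t = s' \<otimes>\<^bsub>R\<^esub> (s \<otimes>\<^bsub>R\<^esub> t)"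
        using s t by (simp_all add: R.m_ac)
      then show ?thesis using hadd[OF c] z[of "s' \<otimes>\<^bsub>R\<^esub> t"] w[of "s \<otimes>\<^bsub>R\<^esub> t"] s t by simp
    qed
    then show ?case using s by (auto intro!: bexI[of _ "s \<otimes>\<^bsub>R\<^esub> s'"])
  qed
  have "frag_of (x, fr \<one>\<^bsub>R\<^esub> \<one>\<^bsub>R\<^esub>) - 0 \<in> K M"
    using assms(2) unfolding mk_def pure_def T_one cl_eq_iff .
  then have "\<exists>s\<in>D. \<forall>t\<in>D. h (s \<otimes>\<^bsub>R\<^esub> t) (frag_of (x, fr \<one>\<^bsub>R\<^esub> \<one>\<^bsub>R\<^esub>)) = \<zero>\<^bsub>M\<^esub>"
    unfolding tensor_kernel_def diff_zero by (rule ker)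
  then obtain s where s: "s \<in> D" "\<And>t. t \<in> D \<Longrightarrow> h (s \<otimes>\<^bsub>R\<^esub> t) (frag_of (x, fr \<one>\<^bsub>R\<^esub> \<one>\<^bsub>R\<^esub>)) = \<zero>\<^bsub>M\<^esub>"
    by blast
  have "fr \<one>\<^bsub>R\<^esub> \<one>\<^bsub>R\<^esub> = fr s s" using s(1) by (simp add: fr_eq_iff)
  then have "h s (frag_of (x, fr \<one>\<^bsub>R\<^esub> \<one>\<^bsub>R\<^esub>)) = s \<odot>\<^bsub>M\<^esub> x"
    using hf[OF x fr_closed[of "\<one>\<^bsub>R\<^esub>" "\<one>\<^bsub>R\<^esub>"]] \<beta>[of s s] s(1) by simp
  then show thesis using that[of s] s(1) s(2)[OF D_one] by simp
qed

end

end

end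

context domain_fractions
begin

context
  notes [simp] = D_carrier D_nonzero D_one D_mult
begin

lemma mult_fr_one:
  assumes "s \<in> D" "t \<in> D" shows "fr \<one>\<^bsub>R\<^esub> s \<otimes>\<^bsub>B\<^esub> fr \<one>\<^bsub>R\<^esub> t = fr \<one>\<^bsub>R\<^esub> (s \<otimes>\<^bsub>R\<^esub> t)"
  using assms by (simp add: fr_mult)

text \<open>The universal property of the tensor product, stated for kernels in the free abelian groups.\<close>

lemma frag_extend_kernel:
  assumes M: "Module.module R M" and N: "Module.module R N"
    and rel: "\<And>\<rho>. \<rho> \<in> tensor_relations R M B \<Longrightarrow> frag_extend F \<rho> \<in> K N" and z: "z \<in> K M"
  shows "frag_extend F z \<in> K N"
proof -
  from z have "z \<in> generate (G M) (tensor_relations R M B)" by (simp add: tensor_kernel_def)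
  then show ?thesis
  proof (induction z rule: generate.induct)
    case one
    then show ?case using kernel_closed(1)[OF N] by simp
  next
    case (incl \<rho>)
    then show ?case by (rule rel)
  next
    case (inv \<rho>)
    have "Poly_Mapping.keys \<rho> \<subseteq> carrier M \<times> carrier B"
      using subsetD[OF relations_subset[OF M] inv] by (simp only: carrier_free_Abelian_group_iff)
    then show ?case using kernel_closed(3)[OF N rel[OF inv]] by (simp add: frag_extend_minus)
  next
    case (eng z w)
    then show ?case using kernel_closed(2)[OF N] by (simp add: frag_extend_add)
  qed
qed

context
  fixes M1 :: "('r, 'm1, 'y1) module_scheme" and M2 :: "('r, 'm2, 'y2) module_scheme"
    and M :: "('r, 'm, 'y) module_scheme" and f :: "'m1 \<Rightarrow> 'm2 \<Rightarrow> 'm"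
  assumes M1: "Module.module R M1" and M2: "Module.module R M2" and M: "Module.module R M"
    and f_closed: "\<And>x y. x \<in> carrier M1 \<Longrightarrow> y \<in> carrier M2 \<Longrightarrow> f x y \<in> carrier M"
    and f_add1: "\<And>x x' y. x \<in> carrier M1 \<Longrightarrow> x' \<in> carrier M1 \<Longrightarrow> y \<in> carrier M2 \<Longrightarrow>
      f (x \<oplus>\<^bsub>M1\<^esub> x') y = f x y \<oplus>\<^bsub>M\<^esub> f x' y"
    and f_add2: "\<And>x y y'. x \<in> carrier M1 \<Longrightarrow> y \<in> carrier M2 \<Longrightarrow> y' \<in> carrier M2 \<Longrightarrow>
      f x (y \<oplus>\<^bsub>M2\<^esub> y') = f x y \<oplus>\<^bsub>M\<^esub> f x y'"
    and f_smult1: "\<And>r x y. r \<in> carrier R \<Longrightarrow> x \<in> carrier M1 \<Longrightarrow> y \<in> carrier M2 \<Longrightarrow>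
      f (r \<odot>\<^bsub>M1\<^esub> x) y = r \<odot>\<^bsub>M\<^esub> f x y"
    and f_smult2: "\<And>r x y. r \<in> carrier R \<Longrightarrow> x \<in> carrier M1 \<Longrightarrow> y \<in> carrier M2 \<Longrightarrow>
      f x (r \<odot>\<^bsub>M2\<^esub> y) = r \<odot>\<^bsub>M\<^esub> f x y"
begin

text \<open>The map \<open>tensor_op\<close> forms a union over all representatives. On pure tensors all of them
  give the same class, since the relations in either argument are mapped into the kernel.\<close>

lemma tensor_op_pure:
  assumes p: "p \<in> carrier M1" "p' \<in> carrier M2" and q: "q \<in> carrier B" "q' \<in> carrier B"
  shows "tensor_op R M B f (monoid.mult B) (pure M1 p q) (pure M2 p' q') = pure M (f p p') (q \<otimes>\<^bsub>B\<^esub> q')"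
proof -
  interpret M: Module.module R M by (rule M)
  define e where "e = (\<lambda>(x, y) (x', y'). frag_of (f x x', y \<otimes>\<^bsub>B\<^esub> y'))"
  note kc = kernel_closed[OF M]
  have second: "frag_extend (e (x, y)) \<rho> \<in> K M"
    if x: "x \<in> carrier M1" and y: "y \<in> carrier B" and \<rho>: "\<rho> \<in> tensor_relations R M2 B" for x y \<rho>
    using \<rho>
  proof (rule tensor_relation_cases)
    fix u u' v assume \<rho>: "\<rho> = frag_of (u \<oplus>\<^bsub>M2\<^esub> u', v) - frag_of (u, v) - frag_of (u', v)"
      and c: "u \<in> carrier M2" "u' \<in> carrier M2" "v \<in> carrier B"
    show ?thesis unfolding \<rho>
      using kernel_relations(1)[OF M f_closed[OF x c(1)] f_closed[OF x c(2)] B_closed(1)[OF y c(3)]]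
      by (simp add: frag_extend_diff e_def f_add2 x c)
  next
    fix u v v' assume \<rho>: "\<rho> = frag_of (u, v \<oplus>\<^bsub>B\<^esub> v') - frag_of (u, v) - frag_of (u, v')"
      and c: "u \<in> carrier M2" "v \<in> carrier B" "v' \<in> carrier B"
    show ?thesis unfolding \<rho>
      using kernel_relations(2)[OF M f_closed[OF x c(1)] B_closed(1)[OF y c(2)] B_closed(1)[OF y c(3)]]
      by (simp add: frag_extend_diff e_def B_bilinear(2)[OF c(2,3) y R.one_closed])
  next
    fix r u v assume \<rho>: "\<rho> = frag_of (r \<odot>\<^bsub>M2\<^esub> u, v) - frag_of (u, r \<odot>\<^bsub>B\<^esub> v)"
      and c: "r \<in> carrier R" "u \<in> carrier M2" "v \<in> carrier B"
    show ?thesis unfolding \<rho>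
      using kernel_relations(3)[OF M c(1) f_closed[OF x c(2)] B_closed(1)[OF y c(3)]]
      by (simp add: frag_extend_diff e_def f_smult2 x c B_bilinear(4)[OF c(3) c(3) y c(1)])
  qed
  have first_gen: "frag_extend (\<lambda>a. e a (u, v)) \<rho> \<in> K M"
    if u: "u \<in> carrier M2" and v: "v \<in> carrier B" and \<rho>: "\<rho> \<in> tensor_relations R M1 B" for u v \<rho>
    using \<rho>
  proof (rule tensor_relation_cases)
    fix x x' y assume \<rho>: "\<rho> = frag_of (x \<oplus>\<^bsub>M1\<^esub> x', y) - frag_of (x, y) - frag_of (x', y)"
      and c: "x \<in> carrier M1" "x' \<in> carrier M1" "y \<in> carrier B"
    show ?thesis unfolding \<rho>
      using kernel_relations(1)[OF M f_closed[OF c(1) u] f_closed[OF c(2) u] B_closed(1)[OF c(3) v]]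
      by (simp add: frag_extend_diff e_def f_add1 u c)
  next
    fix x y y' assume \<rho>: "\<rho> = frag_of (x, y \<oplus>\<^bsub>B\<^esub> y') - frag_of (x, y) - frag_of (x, y')"
      and c: "x \<in> carrier M1" "y \<in> carrier B" "y' \<in> carrier B"
    show ?thesis unfolding \<rho>
      using kernel_relations(2)[OF M f_closed[OF c(1) u] B_closed(1)[OF c(2) v] B_closed(1)[OF c(3) v]]
      by (simp add: frag_extend_diff e_def B_bilinear(1)[OF c(2,3) v R.one_closed])
  next
    fix r x y assume \<rho>: "\<rho> = frag_of (r \<odot>\<^bsub>M1\<^esub> x, y) - frag_of (x, r \<odot>\<^bsub>B\<^esub> y)"
      and c: "r \<in> carrier R" "x \<in> carrier M1" "y \<in> carrier B"
    show ?thesis unfolding \<rho>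
      using kernel_relations(3)[OF M c(1) f_closed[OF c(2) u] B_closed(1)[OF c(3) v]]
      by (simp add: frag_extend_diff e_def f_smult1 u c B_bilinear(3)[OF c(3) c(3) v c(1)])
  qed
  let ?E = "\<lambda>w a. frag_extend (e a) w"
  have first: "frag_extend (?E w) \<rho> \<in> K M"
    if w: "Poly_Mapping.keys w \<subseteq> carrier M2 \<times> carrier B" and \<rho>: "\<rho> \<in> tensor_relations R M1 B" for w \<rho>
  proof (rule free_Abelian_group_induct[OF w])
    show "frag_extend (?E 0) \<rho> \<in> K M" by (simp add: frag_extend_eq_0 kc(1))
  next
    fix z w assume zw: "frag_extend (?E z) \<rho> \<in> K M" "frag_extend (?E w) \<rho> \<in> K M"
    have "frag_extend (?E (z - w)) \<rho> = frag_extend (?E z) \<rho> - frag_extend (?E w) \<rho>"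
      using \<rho> by (rule tensor_relation_cases) (simp_all add: frag_extend_diff)
    then show "frag_extend (?E (z - w)) \<rho> \<in> K M" using kc(4)[OF zw] by simp
  next
    fix a assume "a \<in> carrier M2 \<times> carrier B"
    then show "frag_extend (?E (frag_of a)) \<rho> \<in> K M"
      using first_gen[OF _ _ \<rho>] by (cases a) simp
  qed
  have eq: "cl M (frag_extend (?E w) z) = pure M (f p p') (q \<otimes>\<^bsub>B\<^esub> q')"
    if z: "z \<in> pure M1 p q" and w: "w \<in> pure M2 p' q'" for z w
  proof -
    obtain k where k: "k \<in> K M1" "z = k + frag_of (p, q)" using z unfolding pure_def cl_eq[OF M1] by blast
    obtain l where l: "l \<in> K M2" "w = l + frag_of (p', q')" using w unfolding pure_def cl_eq[OF M2] by blast
    have "Poly_Mapping.keys w \<subseteq> carrier M2 \<times> carrier B"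
      using keys_add[of l "frag_of (p', q')"] kernel_carrier[OF M2 l(1)] p q unfolding l(2) by auto
    then have "frag_extend (?E w) k \<in> K M" by (intro frag_extend_kernel[OF M1 M first k(1)])
    moreover have "frag_extend (e (p, q)) l \<in> K M"
      by (intro frag_extend_kernel[OF M2 M second l(1)] p q)
    ultimately have "frag_extend (?E w) k + frag_extend (e (p, q)) l \<in> K M" by (rule kc(2))
    moreover have "frag_extend (?E w) z - frag_of (f p p', q \<otimes>\<^bsub>B\<^esub> q') = frag_extend (?E w) k + frag_extend (e (p, q)) l"
      unfolding k(2) frag_extend_add frag_extend_of by (simp add: l(2) frag_extend_add) (simp add: e_def)
    ultimately show ?thesis unfolding pure_def cl_eq_iff[OF M] by simp
  qed
  have "frag_of (p, q) \<in> pure M1 p q"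
    unfolding pure_def cl_eq[OF M1] using kernel_closed(1)[OF M1] by (metis add_0 imageI)
  moreover have "frag_of (p', q') \<in> pure M2 p' q'"
    unfolding pure_def cl_eq[OF M2] using kernel_closed(1)[OF M2] by (metis add_0 imageI)
  moreover have "tensor_op R M B f (monoid.mult B) (pure M1 p q) (pure M2 p' q') =
      (\<Union>z\<in>pure M1 p q. \<Union>w\<in>pure M2 p' q'. cl M (frag_extend (?E w) z))"
    unfolding tensor_op_def e_def by (simp add: case_prod_beta')
  ultimately show ?thesis using eq by auto
qed

lemma tensor_op_mk:
  assumes "p \<in> carrier M1" "p' \<in> carrier M2" "s \<in> D" "t \<in> D"
  shows "tensor_op R M B f (monoid.mult B) (mk M1 p s) (mk M2 p' t) = mk M (f p p') (s \<otimes>\<^bsub>R\<^esub> t)"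
  using assms unfolding mk_def by (simp add: tensor_op_pure mult_fr_one)

end

subsection \<open>The localized algebra and its modules\<close>

context
  fixes \<Lambda> :: "('r, 'a, 'y) module_scheme"
  assumes alg: "assoc_algebra R \<Lambda>"
begin

lemma algebra_module: "Module.module R \<Lambda>" and algebra_ring: "ring \<Lambda>"
  using alg by (auto simp: assoc_algebra_def)

interpretation A: Module.module R \<Lambda> by (rule algebra_module)
interpretation \<Lambda>: ring \<Lambda> by (rule algebra_ring)

lemma algebra_smult:
  assumes "r \<in> carrier R" "x \<in> carrier \<Lambda>" "y \<in> carrier \<Lambda>"
  shows "(r \<odot>\<^bsub>\<Lambda>\<^esub> x) \<otimes>\<^bsub>\<Lambda>\<^esub> y = r \<odot>\<^bsub>\<Lambda>\<^esub> (x \<otimes>\<^bsub>\<Lambda>\<^esub> y)" "x \<otimes>\<^bsub>\<Lambda>\<^esub> (r \<odot>\<^bsub>\<Lambda>\<^esub> y) = r \<odot>\<^bsub>\<Lambda>\<^esub> (x \<otimes>\<^bsub>\<Lambda>\<^esub> y)"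
  using alg assms unfolding assoc_algebra_def by metis+

abbreviation \<Lambda>D :: "('a \<times> ('r \<times> 'r) set \<Rightarrow>\<^sub>0 int) set ring"
  where "\<Lambda>D \<equiv> tensor_ring R \<Lambda> B"

lemma tensor_ring_simps:
  "carrier \<Lambda>D = carrier (T \<Lambda>)" "\<zero>\<^bsub>\<Lambda>D\<^esub> = \<one>\<^bsub>T \<Lambda>\<^esub>" "x \<oplus>\<^bsub>\<Lambda>D\<^esub> y = x \<otimes>\<^bsub>T \<Lambda>\<^esub> y" "\<one>\<^bsub>\<Lambda>D\<^esub> = mk \<Lambda> \<one>\<^bsub>\<Lambda>\<^esub> \<one>\<^bsub>R\<^esub>"
  by (simp_all add: tensor_ring_def mk_def pure_def B_one)

lemma tensor_ring_mult:
  assumes "a \<in> carrier \<Lambda>" "b \<in> carrier \<Lambda>" "s \<in> D" "t \<in> D"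
  shows "mk \<Lambda> a s \<otimes>\<^bsub>\<Lambda>D\<^esub> mk \<Lambda> b t = mk \<Lambda> (a \<otimes>\<^bsub>\<Lambda>\<^esub> b) (s \<otimes>\<^bsub>R\<^esub> t)"
proof -
  have "tensor_op R \<Lambda> B (monoid.mult \<Lambda>) (monoid.mult B) (mk \<Lambda> a s) (mk \<Lambda> b t) = mk \<Lambda> (a \<otimes>\<^bsub>\<Lambda>\<^esub> b) (s \<otimes>\<^bsub>R\<^esub> t)"
    by (rule tensor_op_mk) (use assms in \<open>auto simp: algebra_module algebra_smult \<Lambda>.l_distr \<Lambda>.r_distr\<close>)
  then show ?thesis by (simp add: tensor_ring_def)
qed

lemma mk_self:
  assumes M: "Module.module R M" and "x \<in> carrier M" "s \<in> D"
  shows "mk M (s \<odot>\<^bsub>M\<^esub> x) s = mk M x \<one>\<^bsub>R\<^esub>"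
  using mk_expand[OF M assms(2) D_one assms(3)] assms(3) by simp

text \<open>The inverse of \<open>s \<odot> 1 \<otimes> 1\<close> is \<open>1 \<otimes> 1/s\<close>. Injectivity follows from \<open>mk_eq_zero\<close>
  and torsion-freeness.\<close>

theorem tensor_ring_localization:
  assumes tf: "torsion_free R \<Lambda>" and ring: "ring \<Lambda>D"
  shows "central_localization \<Lambda> \<Lambda>D ((\<lambda>s. s \<odot>\<^bsub>\<Lambda>\<^esub> \<one>\<^bsub>\<Lambda>\<^esub>) ` D) (\<lambda>a. mk \<Lambda> a \<one>\<^bsub>R\<^esub>)"
proof -
  interpret LD: ring \<Lambda>D by (rule ring)
  note M = algebra_module
  have mc: "mk \<Lambda> a s \<in> carrier \<Lambda>D" if "a \<in> carrier \<Lambda>" "s \<in> D" for a s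
    using mk_closed[OF M that] by (simp add: tensor_ring_simps)
  have inverse: "mk \<Lambda> (s \<odot>\<^bsub>\<Lambda>\<^esub> \<one>\<^bsub>\<Lambda>\<^esub>) \<one>\<^bsub>R\<^esub> \<otimes>\<^bsub>\<Lambda>D\<^esub> mk \<Lambda> \<one>\<^bsub>\<Lambda>\<^esub> s = \<one>\<^bsub>\<Lambda>D\<^esub>"
      "mk \<Lambda> \<one>\<^bsub>\<Lambda>\<^esub> s \<otimes>\<^bsub>\<Lambda>D\<^esub> mk \<Lambda> (s \<odot>\<^bsub>\<Lambda>\<^esub> \<one>\<^bsub>\<Lambda>\<^esub>) \<one>\<^bsub>R\<^esub> = \<one>\<^bsub>\<Lambda>D\<^esub>" if "s \<in> D" for s
    using that mk_self[OF M \<Lambda>.one_closed that] by (simp_all add: tensor_ring_mult tensor_ring_simps)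
  show ?thesis
  proof (rule central_localization.intro[OF algebra_ring ring central_localization_axioms.intro])
    show "(\<lambda>a. mk \<Lambda> a \<one>\<^bsub>R\<^esub>) \<in> ring_hom \<Lambda> \<Lambda>D"
      by (rule ring_hom_memI) (auto simp: mk_closed[OF M] tensor_ring_mult mk_add[OF M] tensor_ring_simps)
    show "(\<lambda>s. s \<odot>\<^bsub>\<Lambda>\<^esub> \<one>\<^bsub>\<Lambda>\<^esub>) ` D \<subseteq> carrier \<Lambda>" by auto
    show "\<one>\<^bsub>\<Lambda>\<^esub> \<in> (\<lambda>s. s \<odot>\<^bsub>\<Lambda>\<^esub> \<one>\<^bsub>\<Lambda>\<^esub>) ` D" by (intro image_eqI[of _ _ "\<one>\<^bsub>R\<^esub>"]) auto
  next
    fix s t assume "s \<in> (\<lambda>s. s \<odot>\<^bsub>\<Lambda>\<^esub> \<one>\<^bsub>\<Lambda>\<^esub>) ` D" "t \<in> (\<lambda>s. s \<odot>\<^bsub>\<Lambda>\<^esub> \<one>\<^bsub>\<Lambda>\<^esub>) ` D"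
    then obtain u v where *: "u \<in> D" "v \<in> D" "s = u \<odot>\<^bsub>\<Lambda>\<^esub> \<one>\<^bsub>\<Lambda>\<^esub>" "t = v \<odot>\<^bsub>\<Lambda>\<^esub> \<one>\<^bsub>\<Lambda>\<^esub>" by blast
    then have "s \<otimes>\<^bsub>\<Lambda>\<^esub> t = (u \<otimes>\<^bsub>R\<^esub> v) \<odot>\<^bsub>\<Lambda>\<^esub> \<one>\<^bsub>\<Lambda>\<^esub>"
      by (simp add: algebra_smult(1) A.smult_assoc1)
    then show "s \<otimes>\<^bsub>\<Lambda>\<^esub> t \<in> (\<lambda>s. s \<odot>\<^bsub>\<Lambda>\<^esub> \<one>\<^bsub>\<Lambda>\<^esub>) ` D" using * by auto
  next
    fix s a assume "s \<in> (\<lambda>s. s \<odot>\<^bsub>\<Lambda>\<^esub> \<one>\<^bsub>\<Lambda>\<^esub>) ` D" "a \<in> carrier \<Lambda>"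
    then show "a \<otimes>\<^bsub>\<Lambda>\<^esub> s = s \<otimes>\<^bsub>\<Lambda>\<^esub> a" by (auto simp: algebra_smult)
  next
    fix s assume "s \<in> (\<lambda>s. s \<odot>\<^bsub>\<Lambda>\<^esub> \<one>\<^bsub>\<Lambda>\<^esub>) ` D"
    then show "mk \<Lambda> s \<one>\<^bsub>R\<^esub> \<in> Units \<Lambda>D"
      using inverse mc by (auto simp: Units_def intro!: bexI[of _ "mk \<Lambda> \<one>\<^bsub>\<Lambda>\<^esub> _"])
  next
    fix y assume "y \<in> carrier \<Lambda>D"
    then obtain x s where x: "x \<in> carrier \<Lambda>" "s \<in> D" "y = mk \<Lambda> x s"
      using mkE[OF M] unfolding tensor_ring_simps by metis
    have "y \<otimes>\<^bsub>\<Lambda>D\<^esub> mk \<Lambda> (s \<odot>\<^bsub>\<Lambda>\<^esub> \<one>\<^bsub>\<Lambda>\<^esub>) \<one>\<^bsub>R\<^esub> = mk \<Lambda> x \<one>\<^bsub>R\<^esub>"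
      using x mk_self[OF M x(1,2)] by (simp add: tensor_ring_mult algebra_smult)
    then show "\<exists>s\<in>(\<lambda>s. s \<odot>\<^bsub>\<Lambda>\<^esub> \<one>\<^bsub>\<Lambda>\<^esub>) ` D. \<exists>a\<in>carrier \<Lambda>. y \<otimes>\<^bsub>\<Lambda>D\<^esub> mk \<Lambda> s \<one>\<^bsub>R\<^esub> = mk \<Lambda> a \<one>\<^bsub>R\<^esub>"
      using x by blast
  next
    fix a assume a: "a \<in> carrier \<Lambda>" "mk \<Lambda> a \<one>\<^bsub>R\<^esub> = \<zero>\<^bsub>\<Lambda>D\<^esub>"
    then obtain s where "s \<in> D" "s \<odot>\<^bsub>\<Lambda>\<^esub> a = \<zero>\<^bsub>\<Lambda>\<^esub>"
      using mk_eq_zero[OF M] unfolding tensor_ring_simps by metis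
    then show "a = \<zero>\<^bsub>\<Lambda>\<^esub>" using tf a D_nonzero D_carrier unfolding torsion_free_def by blast
  qed
qed

lemma restrict_scalars_simps:
  "carrier (restrict_scalars \<Lambda> P) = carrier P" "\<zero>\<^bsub>restrict_scalars \<Lambda> P\<^esub> = \<zero>\<^bsub>P\<^esub>"
  "x \<oplus>\<^bsub>restrict_scalars \<Lambda> P\<^esub> y = x \<oplus>\<^bsub>P\<^esub> y" "r \<odot>\<^bsub>restrict_scalars \<Lambda> P\<^esub> x = x \<triangleleft>\<^bsub>P\<^esub> (r \<odot>\<^bsub>\<Lambda>\<^esub> \<one>\<^bsub>\<Lambda>\<^esub>)"
  by (simp_all add: restrict_scalars_def)

lemma module_restrict_scalars:
  assumes "right_module \<Lambda> P" shows "Module.module R (restrict_scalars \<Lambda> P)"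
proof -
  interpret P: right_module \<Lambda> P by fact
  have ag: "abelian_group (restrict_scalars \<Lambda> P)"
  proof (rule abelian_groupI)
    fix x assume "x \<in> carrier (restrict_scalars \<Lambda> P)"
    then show "\<exists>y\<in>carrier (restrict_scalars \<Lambda> P). y \<oplus>\<^bsub>restrict_scalars \<Lambda> P\<^esub> x = \<zero>\<^bsub>restrict_scalars \<Lambda> P\<^esub>"
      by (intro bexI[of _ "\<ominus>\<^bsub>P\<^esub> x"]) (auto simp: restrict_scalars_simps P.M.l_neg)
  qed (auto simp: restrict_scalars_simps P.M.a_ac)
  show ?thesis
  proof (rule moduleI[OF R.is_cring ag])
    fix a b x assume *: "a \<in> carrier R" "b \<in> carrier R" "x \<in> carrier (restrict_scalars \<Lambda> P)"
    have "(a \<otimes>\<^bsub>R\<^esub> b) \<odot>\<^bsub>\<Lambda>\<^esub> \<one>\<^bsub>\<Lambda>\<^esub> = (b \<odot>\<^bsub>\<Lambda>\<^esub> \<one>\<^bsub>\<Lambda>\<^esub>) \<otimes>\<^bsub>\<Lambda>\<^esub> (a \<odot>\<^bsub>\<Lambda>\<^esub> \<one>\<^bsub>\<Lambda>\<^esub>)"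
      using * by (simp add: algebra_smult A.smult_assoc1)
    then show "(a \<otimes>\<^bsub>R\<^esub> b) \<odot>\<^bsub>restrict_scalars \<Lambda> P\<^esub> x = a \<odot>\<^bsub>restrict_scalars \<Lambda> P\<^esub> (b \<odot>\<^bsub>restrict_scalars \<Lambda> P\<^esub> x)"
      using * by (simp add: restrict_scalars_simps P.ract_mult)
  qed (auto simp: restrict_scalars_simps P.ract_closed P.ract_add_left P.ract_add_right P.ract_one A.smult_l_distr)
qed

lemma tensor_module_simps:
  "carrier (tensor_module R \<Lambda> B P) = carrier (T (restrict_scalars \<Lambda> P))"
  "\<zero>\<^bsub>tensor_module R \<Lambda> B P\<^esub> = \<one>\<^bsub>T (restrict_scalars \<Lambda> P)\<^esub>"
  "x \<oplus>\<^bsub>tensor_module R \<Lambda> B P\<^esub> y = x \<otimes>\<^bsub>T (restrict_scalars \<Lambda> P)\<^esub> y"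
  by (simp_all add: tensor_module_def)

lemma tensor_module_ract:
  assumes P: "right_module \<Lambda> P" and "p \<in> carrier P" "a \<in> carrier \<Lambda>" "s \<in> D" "t \<in> D"
  shows "mk (restrict_scalars \<Lambda> P) p s \<triangleleft>\<^bsub>tensor_module R \<Lambda> B P\<^esub> mk \<Lambda> a t
    = mk (restrict_scalars \<Lambda> P) (p \<triangleleft>\<^bsub>P\<^esub> a) (s \<otimes>\<^bsub>R\<^esub> t)"
proof -
  interpret P: right_module \<Lambda> P by fact
  have comm: "(r \<odot>\<^bsub>\<Lambda>\<^esub> \<one>\<^bsub>\<Lambda>\<^esub>) \<otimes>\<^bsub>\<Lambda>\<^esub> b = r \<odot>\<^bsub>\<Lambda>\<^esub> b" "b \<otimes>\<^bsub>\<Lambda>\<^esub> (r \<odot>\<^bsub>\<Lambda>\<^esub> \<one>\<^bsub>\<Lambda>\<^esub>) = r \<odot>\<^bsub>\<Lambda>\<^esub> b"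
    if "r \<in> carrier R" "b \<in> carrier \<Lambda>" for r b
    using that by (simp_all add: algebra_smult)
  have "tensor_op R (restrict_scalars \<Lambda> P) B (ract P) (monoid.mult B)
      (mk (restrict_scalars \<Lambda> P) p s) (mk \<Lambda> a t) = mk (restrict_scalars \<Lambda> P) (p \<triangleleft>\<^bsub>P\<^esub> a) (s \<otimes>\<^bsub>R\<^esub> t)"
    by (rule tensor_op_mk[OF module_restrict_scalars[OF P] algebra_module module_restrict_scalars[OF P]])
      (use assms comm in \<open>auto simp: restrict_scalars_simps P.ract_closed P.ract_add_left P.ract_add_right
        P.ract_mult[symmetric]\<close>)
  then show ?thesis by (simp add: tensor_module_def)
qed

theorem tensor_module_localization:
  assumes tf: "torsion_free R \<Lambda>" and ring: "ring \<Lambda>D" and P: "right_module \<Lambda> P"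
    and tfP: "\<And>s x. s \<in> D \<Longrightarrow> x \<in> carrier P \<Longrightarrow> x \<triangleleft>\<^bsub>P\<^esub> (s \<odot>\<^bsub>\<Lambda>\<^esub> \<one>\<^bsub>\<Lambda>\<^esub>) = \<zero>\<^bsub>P\<^esub> \<Longrightarrow> x = \<zero>\<^bsub>P\<^esub>"
  shows "central_localization.loc_module \<Lambda> \<Lambda>D ((\<lambda>s. s \<odot>\<^bsub>\<Lambda>\<^esub> \<one>\<^bsub>\<Lambda>\<^esub>) ` D) (\<lambda>a. mk \<Lambda> a \<one>\<^bsub>R\<^esub>)
    P (tensor_module R \<Lambda> B P) (\<lambda>x. mk (restrict_scalars \<Lambda> P) x \<one>\<^bsub>R\<^esub>)"
proof -
  interpret L: central_localization \<Lambda> \<Lambda>D "(\<lambda>s. s \<odot>\<^bsub>\<Lambda>\<^esub> \<one>\<^bsub>\<Lambda>\<^esub>) ` D" "\<lambda>a. mk \<Lambda> a \<one>\<^bsub>R\<^esub>"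
    by (rule tensor_ring_localization[OF tf ring])
  interpret P: right_module \<Lambda> P by fact
  let ?P = "restrict_scalars \<Lambda> P" and ?T = "tensor_module R \<Lambda> B P"
  note M = module_restrict_scalars[OF P] and A = algebra_module
  interpret TP: comm_group "T ?P" by (rule T_comm_group[OF M])
  note pc = restrict_scalars_simps(1)[of P]
  have mc: "mk ?P x s \<in> carrier ?T" if "x \<in> carrier P" "s \<in> D" for x s
    using mk_closed[OF M, of x s] that by (simp add: tensor_module_simps pc)
  have ag: "abelian_group ?T"
  proof (rule abelian_groupI)
    fix x assume "x \<in> carrier ?T"
    then show "\<exists>y\<in>carrier ?T. y \<oplus>\<^bsub>?T\<^esub> x = \<zero>\<^bsub>?T\<^esub>"
      by (intro bexI[of _ "inv\<^bsub>T ?P\<^esub> x"]) (auto simp: tensor_module_simps)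
  qed (auto simp: tensor_module_simps TP.m_ac)
  note ract = tensor_module_ract[OF P]
  have add: "mk ?P x s \<oplus>\<^bsub>?T\<^esub> mk ?P y s = mk ?P (x \<oplus>\<^bsub>P\<^esub> y) s" if "x \<in> carrier P" "y \<in> carrier P" "s \<in> D" for x y s
    using mk_add[OF M, of x y s] that by (simp add: tensor_module_simps restrict_scalars_simps)
  have addL: "mk \<Lambda> a s \<oplus>\<^bsub>\<Lambda>D\<^esub> mk \<Lambda> b s = mk \<Lambda> (a \<oplus>\<^bsub>\<Lambda>\<^esub> b) s" if "a \<in> carrier \<Lambda>" "b \<in> carrier \<Lambda>" "s \<in> D" for a b s
    using mk_add[OF A that] by (simp add: tensor_ring_simps)
  have exP: "\<exists>x s. x \<in> carrier P \<and> s \<in> D \<and> y = mk ?P x s" if "y \<in> carrier ?T" for y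
    using mkE[OF M, of y] that unfolding tensor_module_simps pc by metis
  have exP2: "\<exists>x u s. x \<in> carrier P \<and> u \<in> carrier P \<and> s \<in> D \<and> y = mk ?P x s \<and> z = mk ?P u s"
    if "y \<in> carrier ?T" "z \<in> carrier ?T" for y z
    using mkE2[OF M, of y z] that unfolding tensor_module_simps pc by metis
  have exL: "\<exists>x s. x \<in> carrier \<Lambda> \<and> s \<in> D \<and> y = mk \<Lambda> x s" if "y \<in> carrier \<Lambda>D" for y
    using mkE[OF A, of y] that unfolding tensor_ring_simps by metis
  have exL2: "\<exists>x u s. x \<in> carrier \<Lambda> \<and> u \<in> carrier \<Lambda> \<and> s \<in> D \<and> y = mk \<Lambda> x s \<and> z = mk \<Lambda> u s"
    if "y \<in> carrier \<Lambda>D" "z \<in> carrier \<Lambda>D" for y z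
    using mkE2[OF A, of y z] that unfolding tensor_ring_simps by metis
  have rm: "right_module \<Lambda>D ?T"
  proof (rule right_moduleI[OF ring ag])
    fix x a assume "x \<in> carrier ?T" "a \<in> carrier \<Lambda>D"
    then show "x \<triangleleft>\<^bsub>?T\<^esub> a \<in> carrier ?T" using exP exL ract mc P.ract_closed D_mult by metis
  next
    fix x y a assume "x \<in> carrier ?T" "y \<in> carrier ?T" "a \<in> carrier \<Lambda>D"
    then obtain u v s b t where "u \<in> carrier P" "v \<in> carrier P" "s \<in> D" "b \<in> carrier \<Lambda>" "t \<in> D"
      "x = mk ?P u s" "y = mk ?P v s" "a = mk \<Lambda> b t" using exP2 exL by metis
    then show "(x \<oplus>\<^bsub>?T\<^esub> y) \<triangleleft>\<^bsub>?T\<^esub> a = x \<triangleleft>\<^bsub>?T\<^esub> a \<oplus>\<^bsub>?T\<^esub> y \<triangleleft>\<^bsub>?T\<^esub> a"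
      by (simp add: add ract P.ract_add_left P.ract_closed)
  next
    fix x a b assume "x \<in> carrier ?T" "a \<in> carrier \<Lambda>D" "b \<in> carrier \<Lambda>D"
    then obtain u s c d t where "u \<in> carrier P" "s \<in> D" "c \<in> carrier \<Lambda>" "d \<in> carrier \<Lambda>" "t \<in> D"
      "x = mk ?P u s" "a = mk \<Lambda> c t" "b = mk \<Lambda> d t" using exP exL2 by metis
    then show "x \<triangleleft>\<^bsub>?T\<^esub> (a \<oplus>\<^bsub>\<Lambda>D\<^esub> b) = x \<triangleleft>\<^bsub>?T\<^esub> a \<oplus>\<^bsub>?T\<^esub> x \<triangleleft>\<^bsub>?T\<^esub> b"
      by (simp add: add addL ract P.ract_add_right P.ract_closed)
  next
    fix x a b assume "x \<in> carrier ?T" "a \<in> carrier \<Lambda>D" "b \<in> carrier \<Lambda>D"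
    then obtain u s c d t where "u \<in> carrier P" "s \<in> D" "c \<in> carrier \<Lambda>" "d \<in> carrier \<Lambda>" "t \<in> D"
      "x = mk ?P u s" "a = mk \<Lambda> c t" "b = mk \<Lambda> d t" using exP exL2 by metis
    then show "x \<triangleleft>\<^bsub>?T\<^esub> (a \<otimes>\<^bsub>\<Lambda>D\<^esub> b) = x \<triangleleft>\<^bsub>?T\<^esub> a \<triangleleft>\<^bsub>?T\<^esub> b"
      by (simp add: tensor_ring_mult ract P.ract_mult P.ract_closed R.m_assoc)
  next
    fix x assume "x \<in> carrier ?T"
    then obtain u s where "u \<in> carrier P" "s \<in> D" "x = mk ?P u s" using exP by metis
    then show "x \<triangleleft>\<^bsub>?T\<^esub> \<one>\<^bsub>\<Lambda>D\<^esub> = x" by (simp add: tensor_ring_simps ract P.ract_one)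
  qed
  show ?thesis
    unfolding L.loc_module_def
  proof (intro conjI ballI impI)
    fix x assume x: "x \<in> carrier P" "mk ?P x \<one>\<^bsub>R\<^esub> = \<zero>\<^bsub>?T\<^esub>"
    then obtain s where "s \<in> D" "s \<odot>\<^bsub>?P\<^esub> x = \<zero>\<^bsub>?P\<^esub>"
      using mk_eq_zero[OF M, of x] unfolding tensor_module_simps pc by metis
    then show "x = \<zero>\<^bsub>P\<^esub>" using tfP x(1) by (simp add: restrict_scalars_simps)
  next
    fix y assume "y \<in> carrier ?T"
    then obtain u s where u: "u \<in> carrier P" "s \<in> D" "y = mk ?P u s" using exP by metis
    have "y \<triangleleft>\<^bsub>?T\<^esub> mk \<Lambda> (s \<odot>\<^bsub>\<Lambda>\<^esub> \<one>\<^bsub>\<Lambda>\<^esub>) \<one>\<^bsub>R\<^esub> = mk ?P u \<one>\<^bsub>R\<^esub>"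
      using u mk_self[OF M, of u s] by (simp add: ract restrict_scalars_simps)
    then show "\<exists>s\<in>(\<lambda>s. s \<odot>\<^bsub>\<Lambda>\<^esub> \<one>\<^bsub>\<Lambda>\<^esub>) ` D. \<exists>x\<in>carrier P. y \<triangleleft>\<^bsub>?T\<^esub> mk \<Lambda> s \<one>\<^bsub>R\<^esub> = mk ?P x \<one>\<^bsub>R\<^esub>"
      using u by blast
  qed (use rm P mc add ract in auto)
qed

end

end

end

section \<open>Maximal ideals of \<open>h\<close>-local domains\<close>

lemma (in ring) right_ideal_imp_ideal:
  assumes I: "right_ideal R I" and left: "\<And>a x. a \<in> I \<Longrightarrow> x \<in> carrier R \<Longrightarrow> x \<otimes> a \<in> I"
  shows "ideal I R"
proof (rule idealI[OF ring_axioms])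
  note i = rsubmoduleD[OF I]
  have neg: "\<ominus> a \<in> I" if "a \<in> I" for a
    using i(4)[OF that, of "\<ominus> \<one>"] i(1) that by (auto simp: r_minus)
  show "subgroup I (add_monoid R)"
    by (rule add.subgroupI) (use i neg in auto)
qed (use left rsubmoduleD(4)[OF I] in auto)

text \<open>Zorn's lemma, in a form that yields primes avoiding a multiplicative set as well as
  maximal ideals, which avoid \<open>{1}\<close>.\<close>

lemma (in cring) exists_maximal_avoiding:
  assumes I: "ideal I R" and S: "I \<inter> S = {}"
  obtains J where "ideal J R" "I \<subseteq> J" "J \<inter> S = {}"
    "\<And>J'. ideal J' R \<Longrightarrow> J \<subseteq> J' \<Longrightarrow> J' \<inter> S = {} \<Longrightarrow> J' = J"
proof -
  let ?A = "{J. ideal J R \<and> I \<subseteq> J \<and> J \<inter> S = {}}"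
  have "\<exists>J\<in>?A. \<forall>J'\<in>?A. J \<subseteq> J' \<longrightarrow> J' = J"
  proof (rule subset_Zorn_nonempty)
    show "?A \<noteq> {}" using I S by blast
    fix C assume C: "C \<noteq> {}" "subset.chain ?A C"
    then have "subset.chain {J. ideal J R} C" unfolding subset.chain_def by blast
    then have "ideal (\<Union>C) R" using chain_Union_is_ideal[of C] C(1) by simp
    moreover have "C \<subseteq> ?A" using C(2) unfolding subset.chain_def by blast
    ultimately show "\<Union>C \<in> ?A" using C(1) by blast
  qed
  then obtain J where J: "J \<in> ?A" "\<forall>J'\<in>?A. J \<subseteq> J' \<longrightarrow> J' = J" by (elim bexE)
  show thesis
  proof (rule that[of J])
    fix J' assume "ideal J' R" "J \<subseteq> J'" "J' \<inter> S = {}"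
    moreover have "I \<subseteq> J'" using J(1) \<open>J \<subseteq> J'\<close> by blast
    ultimately show "J' = J" using J(2) by simp
  qed (use J(1) in auto)
qed

lemma (in domain) exists_prime_avoiding:
  assumes I: "ideal I R" and IS: "I \<inter> S = {}" and S: "S \<subseteq> carrier R" "\<one> \<in> S"
    and mult: "\<And>s t. s \<in> S \<Longrightarrow> t \<in> S \<Longrightarrow> s \<otimes> t \<in> S"
  obtains \<pp> where "primeideal \<pp> R" "I \<subseteq> \<pp>" "\<pp> \<inter> S = {}"
proof -
  obtain J where J: "ideal J R" "I \<subseteq> J" "J \<inter> S = {}"
    and max: "\<And>J'. ideal J' R \<Longrightarrow> J \<subseteq> J' \<Longrightarrow> J' \<inter> S = {} \<Longrightarrow> J' = J"
    using exists_maximal_avoiding[OF I IS] by metis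
  interpret J: ideal J R by (rule J(1))
  have meets: "\<exists>x\<in>J. \<exists>y\<in>carrier R. x \<oplus> y \<otimes> a \<in> S" if a: "a \<in> carrier R" "a \<notin> J" for a
  proof (rule ccontr)
    assume no: "\<not> ?thesis"
    let ?K = "set_add R J (PIdl a)"
    have mem: "z \<in> ?K \<longleftrightarrow> (\<exists>x\<in>J. \<exists>y\<in>carrier R. z = x \<oplus> y \<otimes> a)" for z
      unfolding set_add_def' cgenideal_def by blast
    have "ideal ?K R" by (rule add_ideals[OF J(1) cgenideal_ideal[OF a(1)]])
    moreover have "J \<subseteq> ?K"
    proof
      fix x assume "x \<in> J"
      then show "x \<in> ?K" unfolding mem using a by (intro bexI[of _ x] bexI[of _ \<zero>]) auto
    qed
    moreover have "?K \<inter> S = {}" using no unfolding disjoint_iff mem by blast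
    ultimately have "?K = J" by (rule max)
    moreover have "a \<in> ?K" unfolding mem using a by (intro bexI[of _ \<zero>] bexI[of _ \<one>]) auto
    ultimately show False using a by simp
  qed
  have "primeideal J R"
  proof (rule primeidealI[OF J(1) is_cring])
    show "carrier R \<noteq> J" using J(3) S by auto
    fix a b assume ab: "a \<in> carrier R" "b \<in> carrier R" "a \<otimes> b \<in> J"
    show "a \<in> J \<or> b \<in> J"
    proof (rule ccontr)
      assume "\<not> (a \<in> J \<or> b \<in> J)"
      then obtain x y u v where x: "x \<in> J" "y \<in> carrier R" "x \<oplus> y \<otimes> a \<in> S"
        and u: "u \<in> J" "v \<in> carrier R" "u \<oplus> v \<otimes> b \<in> S" using meets ab by meson
      have c: "x \<in> carrier R" "u \<in> carrier R" using x u by auto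
      have "(x \<oplus> y \<otimes> a) \<otimes> (u \<oplus> v \<otimes> b) = x \<otimes> (u \<oplus> v \<otimes> b) \<oplus> ((y \<otimes> a) \<otimes> u \<oplus> (y \<otimes> v) \<otimes> (a \<otimes> b))"
        using c x u ab by (simp add: l_distr r_distr m_ac)
      moreover have "\<dots> \<in> J"
        using c x u ab J.I_r_closed J.I_l_closed by simp
      ultimately show False using mult[OF x(3) u(3)] J(3) by auto
    qed
  qed
  then show thesis by (rule that[OF _ J(2,3)])
qed

lemma (in domain) exists_maximal_ideal:
  assumes I: "ideal I R" and "\<one> \<notin> I"
  obtains \<mm> where "maximalideal \<mm> R" "I \<subseteq> \<mm>"
proof -
  obtain J where J: "ideal J R" "I \<subseteq> J" "J \<inter> {\<one>} = {}"
    and max: "\<And>J'. ideal J' R \<Longrightarrow> J \<subseteq> J' \<Longrightarrow> J' \<inter> {\<one>} = {} \<Longrightarrow> J' = J"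
    using exists_maximal_avoiding[OF I, of "{\<one>}"] assms(2) by auto
  have "maximalideal J R"
  proof (rule maximalidealI[OF J(1)])
    show "carrier R \<noteq> J" using J(3) by auto
    fix J' assume "ideal J' R" "J \<subseteq> J'" "J' \<subseteq> carrier R"
    then show "J' = J \<or> J' = carrier R"
      using max[of J'] ideal.one_imp_carrier[of J' R] by blast
  qed
  then show thesis by (rule that[OF _ J(2)])
qed

text \<open>A proper ideal of \<open>R\<close> is contained in some maximal ideal.\<close>

lemma (in domain) one_in_ideal_locally:
  assumes "ideal I R" "\<And>\<mm>. \<mm> \<in> max_spec R \<Longrightarrow> \<exists>s\<in>I. s \<notin> \<mm>"
  shows "\<one> \<in> I"
proof (rule ccontr)
  assume "\<one> \<notin> I"
  then obtain \<mm> where "maximalideal \<mm> R" "I \<subseteq> \<mm>" by (rule exists_maximal_ideal[OF assms(1)])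
  then show False using assms(2)[of \<mm>] by (auto simp: max_spec_def)
qed

locale h_local = domain +
  assumes finite_max: "\<lbrakk>r \<in> carrier R; r \<noteq> \<zero>\<rbrakk> \<Longrightarrow> finite {\<mm> \<in> max_spec R. r \<in> \<mm>}"
    and unique_max: "\<lbrakk>primeideal \<pp> R; \<pp> \<noteq> {\<zero>}\<rbrakk> \<Longrightarrow> \<exists>!\<mm>. \<mm> \<in> max_spec R \<and> \<pp> \<subseteq> \<mm>"
begin

lemma max_prime: "\<mm> \<in> max_spec R \<Longrightarrow> primeideal \<mm> R"
  using maximalideal_prime by (simp add: max_spec_def)

lemma max_ideal: "\<mm> \<in> max_spec R \<Longrightarrow> ideal \<mm> R"
  using primeideal.axioms(1)[OF max_prime] .

lemma max_one: "\<mm> \<in> max_spec R \<Longrightarrow> \<one> \<notin> \<mm>"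
  using primeideal.I_notcarr[OF max_prime] ideal.one_imp_carrier[OF max_ideal] by blast

lemma max_mult:
  "\<mm> \<in> max_spec R \<Longrightarrow> s \<in> carrier R - \<mm> \<Longrightarrow> t \<in> carrier R - \<mm> \<Longrightarrow> s \<otimes> t \<in> carrier R - \<mm>"
  using primeideal.I_prime[OF max_prime] by blast

lemma max_zero: "\<mm> \<in> max_spec R \<Longrightarrow> \<zero> \<in> \<mm>"
  using additive_subgroup.zero_closed[OF ideal.axioms(1)[OF max_ideal]] .

text \<open>The products \<open>s t\<close> form a multiplicative set. If it missed \<open>r R\<close>, some prime ideal containing \<open>r\<close>
  would miss it, too; this prime would be non-zero and lie in both \<open>\<mm>\<close> and \<open>\<nn>\<close>.\<close>

lemma max_separate:
  assumes m: "\<mm> \<in> max_spec R" and n: "\<nn> \<in> max_spec R" and ne: "\<mm> \<noteq> \<nn>" and r: "r \<in> carrier R" "r \<noteq> \<zero>"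
  obtains s t c where "s \<in> carrier R - \<mm>" "t \<in> carrier R - \<nn>" "c \<in> carrier R" "s \<otimes> t = c \<otimes> r"
proof -
  define S where "S = {s \<otimes> t |s t. s \<in> carrier R - \<mm> \<and> t \<in> carrier R - \<nn>}"
  have mem: "x \<in> S \<longleftrightarrow> (\<exists>s\<in>carrier R - \<mm>. \<exists>t\<in>carrier R - \<nn>. x = s \<otimes> t)" for x
    unfolding S_def by blast
  have "PIdl r \<inter> S \<noteq> {}"
  proof
    assume empty: "PIdl r \<inter> S = {}"
    have sub1: "s \<in> S" if "s \<in> carrier R - \<mm>" for s
      unfolding mem using that max_one[OF n] by (intro bexI[of _ s] bexI[of _ \<one>]) auto
    have sub2: "s \<in> S" if "s \<in> carrier R - \<nn>" for s
      unfolding mem using that max_one[OF m] by (intro bexI[of _ \<one>] bexI[of _ s]) auto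
    have closed: "x \<otimes> y \<in> S" if xy: "x \<in> S" "y \<in> S" for x y
    proof -
      obtain a b where ab: "a \<in> carrier R - \<mm>" "b \<in> carrier R - \<nn>" "x = a \<otimes> b"
        using xy(1) unfolding mem by (elim bexE)
      obtain c d where cd: "c \<in> carrier R - \<mm>" "d \<in> carrier R - \<nn>" "y = c \<otimes> d"
        using xy(2) unfolding mem by (elim bexE)
      have "x \<otimes> y = (a \<otimes> c) \<otimes> (b \<otimes> d)" using ab cd by (simp add: m_ac)
      then show ?thesis unfolding mem using max_mult[OF m ab(1) cd(1)] max_mult[OF n ab(2) cd(2)]
        by (intro bexI[of _ "a \<otimes> c"] bexI[of _ "b \<otimes> d"])
    qed
    have Sc: "S \<subseteq> carrier R" by (auto simp: mem)
    have S1: "\<one> \<in> S" using sub1[of \<one>] max_one[OF m] by simp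
    obtain \<pp> where p: "primeideal \<pp> R" "PIdl r \<subseteq> \<pp>" "\<pp> \<inter> S = {}"
      by (rule exists_prime_avoiding[OF cgenideal_ideal[OF r(1)] empty Sc S1 closed])
    have pc: "\<pp> \<subseteq> carrier R"
      using additive_subgroup.a_subset[OF ideal.axioms(1)[OF primeideal.axioms(1)[OF p(1)]]] .
    have "\<pp> \<noteq> {\<zero>}" using cgenideal_self[OF r(1)] p(2) r(2) by blast
    moreover have "\<pp> \<subseteq> \<mm>" using sub1 p(3) pc by auto
    moreover have "\<pp> \<subseteq> \<nn>" using sub2 p(3) pc by auto
    ultimately show False using unique_max[OF p(1)] m n ne by metis
  qed
  then obtain x where x: "x \<in> PIdl r" "x \<in> S" by blast
  obtain s t where st: "s \<in> carrier R - \<mm>" "t \<in> carrier R - \<nn>" "x = s \<otimes> t"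
    using x(2) unfolding mem by (elim bexE)
  obtain c where "c \<in> carrier R" "x = c \<otimes> r" using x(1) unfolding cgenideal_def by auto
  then show thesis using that[OF st(1,2)] st(3) by simp
qed

text \<open>The next two lemmas are the decomposition \<open>R/rR \<cong> \<Prod> R\<^sub>\<mm>/rR\<^sub>\<mm>\<close> in terms of
  elements: every denominator prime to \<open>\<mm>\<close> is already invertible in \<open>R\<close> modulo \<open>rR\<^sub>\<mm>\<close>, and some
  denominator prime to \<open>\<mm>\<close> vanishes in the other factors.\<close>

lemma local_inverse:
  assumes m: "\<mm> \<in> max_spec R" and s: "s \<in> carrier R - \<mm>" and r: "r \<in> carrier R" "r \<noteq> \<zero>"
  obtains t u c where "t \<in> carrier R" "u \<in> carrier R - \<mm>" "c \<in> carrier R" "u \<otimes> (\<one> \<ominus> s \<otimes> t) = c \<otimes> r"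
proof -
  \<comment> \<open>\<open>I = (r R\<^sub>\<mm> \<inter> R) + s R\<close>; by \<open>max_separate\<close>, only \<open>\<mm>\<close> could contain it, but \<open>s\<close> is not in \<open>\<mm>\<close>.\<close>
  let ?I = "{x \<oplus> y \<otimes> s |x y. x \<in> carrier R \<and> y \<in> carrier R \<and> (\<exists>u\<in>carrier R - \<mm>. \<exists>c\<in>carrier R. u \<otimes> x = c \<otimes> r)}"
  have Ax: "x \<in> ?I" if "x \<in> carrier R" "u \<in> carrier R - \<mm>" "c \<in> carrier R" "u \<otimes> x = c \<otimes> r" for x u c
    using that s by (intro CollectI exI[of _ x] exI[of _ \<zero>]) auto
    have sub: "right_ideal R ?I"
    proof -
      interpret M: right_module R "regular_module R" by (rule right_module_regular[OF ring_axioms])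
      show ?thesis
      proof (rule M.rsubmoduleI)
        show "?I \<subseteq> carrier (regular_module R)" using s by auto
        show "\<zero>\<^bsub>regular_module R\<^esub> \<in> ?I"
          using Ax[of \<zero> \<one> \<zero>] max_one[OF m] r(1) by simp
      next
        fix a b assume "a \<in> ?I" "b \<in> ?I"
        then obtain x y u c x' y' u' c' where
          1: "x \<in> carrier R" "y \<in> carrier R" "u \<in> carrier R - \<mm>" "c \<in> carrier R" "u \<otimes> x = c \<otimes> r" "a = x \<oplus> y \<otimes> s"
          and 2: "x' \<in> carrier R" "y' \<in> carrier R" "u' \<in> carrier R - \<mm>" "c' \<in> carrier R" "u' \<otimes> x' = c' \<otimes> r" "b = x' \<oplus> y' \<otimes> s"
          by blast
        have "(u \<otimes> u') \<otimes> (x \<oplus> x') = u' \<otimes> (u \<otimes> x) \<oplus> u \<otimes> (u' \<otimes> x')"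
          using 1(1,3) 2(1,3) by (simp add: r_distr m_ac)
        also have "\<dots> = (u' \<otimes> c \<oplus> u \<otimes> c') \<otimes> r" unfolding 1(5) 2(5) using 1(3,4) 2(3,4) r by (simp add: l_distr r_distr m_ac)
        finally have "\<exists>u\<in>carrier R - \<mm>. \<exists>c\<in>carrier R. u \<otimes> (x \<oplus> x') = c \<otimes> r"
          using max_mult[OF m 1(3) 2(3)] 1 2 by blast
        moreover have "a \<oplus> b = (x \<oplus> x') \<oplus> (y \<oplus> y') \<otimes> s" using 1 2 s by (simp add: l_distr a_ac)
        ultimately show "a \<oplus>\<^bsub>regular_module R\<^esub> b \<in> ?I" using 1 2 by auto
      next
        fix a z assume "a \<in> ?I" and z: "z \<in> carrier R"
        then obtain x y u c where
          1: "x \<in> carrier R" "y \<in> carrier R" "u \<in> carrier R - \<mm>" "c \<in> carrier R" "u \<otimes> x = c \<otimes> r" "a = x \<oplus> y \<otimes> s"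
          by blast
        have "u \<otimes> (x \<otimes> z) = (u \<otimes> x) \<otimes> z" using 1(1,3) z by (simp add: m_assoc)
        also have "\<dots> = (c \<otimes> z) \<otimes> r" unfolding 1(5) using 1 r z by (simp add: m_ac)
        finally have "\<exists>u\<in>carrier R - \<mm>. \<exists>c\<in>carrier R. u \<otimes> (x \<otimes> z) = c \<otimes> r" using 1 z by blast
        moreover have "a \<otimes> z = x \<otimes> z \<oplus> (y \<otimes> z) \<otimes> s" using 1 s z by (simp add: l_distr r_distr m_ac)
        ultimately show "a \<triangleleft>\<^bsub>regular_module R\<^esub> z \<in> ?I" using 1 z by auto
      qed
    qed
  have "ideal ?I R"
  proof (rule right_ideal_imp_ideal[OF sub])
    fix a x assume ax: "a \<in> ?I" "x \<in> carrier R"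
    have "a \<in> carrier R" using subsetD[OF rsubmoduleD(1)[OF sub] ax(1)] by (simp only: regular_module_simps)
    then have "x \<otimes> a = a \<otimes> x" using ax(2) by (rule m_comm[symmetric])
    also have "\<dots> \<in> ?I" using rsubmoduleD(4)[OF sub ax] by simp
    finally show "x \<otimes> a \<in> ?I" .
  qed
  note I = this
  have "\<one> \<in> ?I"
  proof (rule one_in_ideal_locally[OF I])
    fix \<nn> assume n: "\<nn> \<in> max_spec R"
    show "\<exists>x\<in>?I. x \<notin> \<nn>"
    proof (cases "\<nn> = \<mm>")
      case True
      have "s \<in> ?I"
        using s r(1) max_one[OF m]
        by (intro CollectI exI[of _ \<zero>] exI[of _ \<one>] conjI bexI[of _ \<one>] bexI[of _ \<zero>]) auto
      then show ?thesis using True s by blast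
    next
      case False
      obtain u v c where "u \<in> carrier R - \<mm>" "v \<in> carrier R - \<nn>" "c \<in> carrier R" "u \<otimes> v = c \<otimes> r"
        using max_separate[OF m n _ r] False by metis
      then show ?thesis using Ax[of v u c] by blast
    qed
  qed
  then obtain x y u c where *: "\<one> = x \<oplus> y \<otimes> s" "x \<in> carrier R" "y \<in> carrier R" "u \<in> carrier R - \<mm>"
    "c \<in> carrier R" "u \<otimes> x = c \<otimes> r" by blast
  have "\<one> \<ominus> s \<otimes> y = x"
    unfolding *(1) using *(2,3) s by (simp add: a_minus_def a_assoc m_comm r_neg)
  then show thesis using that[of y u c] * by simp
qed

lemma local_idempotent:
  assumes m: "\<mm> \<in> max_spec R" and F: "finite F" "F \<subseteq> max_spec R" "\<mm> \<notin> F" and r: "r \<in> carrier R" "r \<noteq> \<zero>"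
  shows "\<exists>s\<in>carrier R - \<mm>. \<forall>\<nn>\<in>F. \<exists>u\<in>carrier R - \<nn>. \<exists>c\<in>carrier R. s \<otimes> u = c \<otimes> r"
  using F
proof (induction F rule: finite_induct)
  case empty
  then show ?case using max_one[OF m] by auto
next
  case (insert \<nn> F)
  then obtain s where s: "s \<in> carrier R - \<mm>" and sF: "\<forall>\<nn>\<in>F. \<exists>u\<in>carrier R - \<nn>. \<exists>c\<in>carrier R. s \<otimes> u = c \<otimes> r"
    by auto
  obtain t v c where t: "t \<in> carrier R - \<mm>" "v \<in> carrier R - \<nn>" "c \<in> carrier R" "t \<otimes> v = c \<otimes> r"
    using max_separate[OF m, of \<nn> r] insert r by auto
  have "\<exists>u\<in>carrier R - \<nn>'. \<exists>c\<in>carrier R. (s \<otimes> t) \<otimes> u = c \<otimes> r" if n: "\<nn>' \<in> insert \<nn> F" for \<nn>'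
  proof (cases "\<nn>' = \<nn>")
    case True
    have "(s \<otimes> t) \<otimes> v = (s \<otimes> c) \<otimes> r" using s t r by (simp add: m_assoc)
    then show ?thesis using True t s by blast
  next
    case False
    then obtain u d where u: "u \<in> carrier R - \<nn>'" "d \<in> carrier R" "s \<otimes> u = d \<otimes> r" using sF n by blast
    have "(s \<otimes> t) \<otimes> u = t \<otimes> (s \<otimes> u)" using s t(1) u(1) by (simp add: m_ac)
    also have "\<dots> = (t \<otimes> d) \<otimes> r" unfolding u(3) using t u r by (simp add: m_assoc)
    finally show ?thesis using u t by blast
  qed
  then show ?case using max_mult[OF m s t(1)] by blast
qed

lemma domain_fractions_max: "\<mm> \<in> max_spec R \<Longrightarrow> domain_fractions R (carrier R - \<mm>)"
  by (rule domain_fractions.intro[OF domain_axioms domain_fractions_axioms.intro])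
    (use max_one max_mult max_zero in auto)

end

lemma h_localI: "h_local_domain R \<Longrightarrow> h_local R"
  unfolding h_local_domain_def h_local_def h_local_axioms_def by blast

section \<open>Relatively big modules over the algebra\<close>

locale local_algebra = h_local R for R :: "('r, 'x) ring_scheme" (structure) +
  fixes \<Lambda> :: "('r, 'a, 'y) module_scheme"
  assumes alg: "assoc_algebra R \<Lambda>" and tf: "torsion_free R \<Lambda>"
    and local_ring: "\<And>\<mm>. \<mm> \<in> max_spec R \<Longrightarrow> ring (localize_ring R \<Lambda> \<mm>)"
begin

sublocale A: Module.module R \<Lambda> using alg by (simp add: assoc_algebra_def)
sublocale \<Lambda>: ring \<Lambda> using alg by (simp add: assoc_algebra_def)

definition scal :: "'r \<Rightarrow> 'a" where "scal r = r \<odot>\<^bsub>\<Lambda>\<^esub> \<one>\<^bsub>\<Lambda>\<^esub>"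

lemma scal_closed [simp]: "r \<in> carrier R \<Longrightarrow> scal r \<in> carrier \<Lambda>" by (simp add: scal_def)

lemma scal_mult_left: "r \<in> carrier R \<Longrightarrow> a \<in> carrier \<Lambda> \<Longrightarrow> scal r \<otimes>\<^bsub>\<Lambda>\<^esub> a = r \<odot>\<^bsub>\<Lambda>\<^esub> a"
  using alg unfolding scal_def assoc_algebra_def by (metis \<Lambda>.l_one \<Lambda>.one_closed)

lemma scal_mult_right: "r \<in> carrier R \<Longrightarrow> a \<in> carrier \<Lambda> \<Longrightarrow> a \<otimes>\<^bsub>\<Lambda>\<^esub> scal r = r \<odot>\<^bsub>\<Lambda>\<^esub> a"
  using alg unfolding scal_def assoc_algebra_def by (metis \<Lambda>.r_one \<Lambda>.one_closed)

lemma scal_one [simp]: "scal \<one> = \<one>\<^bsub>\<Lambda>\<^esub>" by (simp add: scal_def)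

lemma scal_zero [simp]: "scal \<zero> = \<zero>\<^bsub>\<Lambda>\<^esub>" by (simp add: scal_def)

lemma scal_add: "r \<in> carrier R \<Longrightarrow> s \<in> carrier R \<Longrightarrow> scal (r \<oplus> s) = scal r \<oplus>\<^bsub>\<Lambda>\<^esub> scal s"
  by (simp add: scal_def A.smult_l_distr)

lemma scal_mult: "r \<in> carrier R \<Longrightarrow> s \<in> carrier R \<Longrightarrow> scal (r \<otimes> s) = scal r \<otimes>\<^bsub>\<Lambda>\<^esub> scal s"
  by (simp add: scal_mult_left) (simp add: scal_def A.smult_assoc1)

lemma scal_minus: "r \<in> carrier R \<Longrightarrow> s \<in> carrier R \<Longrightarrow> scal (r \<ominus> s) = scal r \<ominus>\<^bsub>\<Lambda>\<^esub> scal s"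
  by (simp add: a_minus_def scal_def A.smult_l_distr A.smult_l_minus)

text \<open>The coordinates in a free module have no torsion since \<open>\<Lambda>\<close> has none.\<close>

lemma projective_torsion_free:
  fixes P :: "('a, 'm, 'z) rmodule_scheme"
  assumes P: "projective \<Lambda> P" and s: "s \<in> carrier R" "s \<noteq> \<zero>" and x: "x \<in> carrier P" "x \<triangleleft>\<^bsub>P\<^esub> scal s = \<zero>\<^bsub>P\<^esub>"
  shows "x = \<zero>\<^bsub>P\<^esub>"
proof -
  have Pm: "right_module \<Lambda> P" using P by (rule projective_right_module)
  obtain X :: "'m set" where "retract_of \<Lambda> P (free_module \<Lambda> X)" by (rule projective_imp_retract[OF P])
  then obtain \<sigma> \<rho> where sg: "\<sigma> \<in> rmod_hom \<Lambda> P (free_module \<Lambda> X)" and r: "\<rho> \<in> rmod_hom \<Lambda> (free_module \<Lambda> X) P"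
    and rs: "\<And>p. p \<in> carrier P \<Longrightarrow> \<rho> (\<sigma> p) = p"
    unfolding retract_of_def by blast
  have F: "right_module \<Lambda> (free_module \<Lambda> X)" by (rule right_module_free[OF \<Lambda>.ring_axioms])
  have "\<sigma> x \<triangleleft>\<^bsub>free_module \<Lambda> X\<^esub> scal s = \<sigma> \<zero>\<^bsub>P\<^esub>"
    using rmod_homD(3)[OF sg x(1), of "scal s"] s x(2) by (simp only: scal_closed)
  then have eq: "\<sigma> x \<triangleleft>\<^bsub>free_module \<Lambda> X\<^esub> scal s = \<zero>\<^bsub>free_module \<Lambda> X\<^esub>"
    using rmod_hom_zero[OF Pm F sg] by (simp only:)
  have c: "\<sigma> x \<in> carrier (free_module \<Lambda> X)" using rmod_homD(1)[OF sg x(1)] .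
  have "\<sigma> x i = \<zero>\<^bsub>\<Lambda>\<^esub>" if i: "i \<in> X" for i
  proof -
    have "\<sigma> x i \<otimes>\<^bsub>\<Lambda>\<^esub> scal s = \<zero>\<^bsub>\<Lambda>\<^esub>" using fun_cong[OF eq, of i] i by simp
    moreover have "\<sigma> x i \<in> carrier \<Lambda>" using c i by (auto simp: direct_sum_carrier)
    ultimately show ?thesis using tf s unfolding torsion_free_def by (auto simp: scal_mult_right)
  qed
  then have "\<sigma> x = \<zero>\<^bsub>free_module \<Lambda> X\<^esub>"
    using c by (auto simp: direct_sum_carrier PiE_iff extensional_def fun_eq_iff)
  then show ?thesis using rs[OF x(1)] rmod_hom_zero[OF F Pm r] by simp
qed

text \<open>The constants that multiply \<open>x\<close> into \<open>U\<close> form an ideal of \<open>R\<close> that is in no maximal ideal.\<close>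

lemma submodule_local_check:
  assumes M: "right_module \<Lambda> M" and U: "rsubmodule \<Lambda> M U" and x: "x \<in> carrier M"
    and loc: "\<And>\<mm>. \<mm> \<in> max_spec R \<Longrightarrow> \<exists>t\<in>carrier R - \<mm>. x \<triangleleft>\<^bsub>M\<^esub> scal t \<in> U"
  shows "x \<in> U"
proof -
  interpret M: right_module \<Lambda> M by fact
  note u = rsubmoduleD[OF U]
  let ?I = "{t \<in> carrier R. x \<triangleleft>\<^bsub>M\<^esub> scal t \<in> U}"
  interpret RR: right_module R "regular_module R" by (rule right_module_regular[OF ring_axioms])
  have act: "x \<triangleleft>\<^bsub>M\<^esub> scal (t \<otimes> r) \<in> U" if "t \<in> carrier R" "r \<in> carrier R" "x \<triangleleft>\<^bsub>M\<^esub> scal t \<in> U" for t r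
    using that x u(4) by (simp add: scal_mult M.ract_mult)
  have I: "right_ideal R ?I"
    by (rule RR.rsubmoduleI) (use u x act in \<open>auto simp: M.ract_zero scal_add M.ract_add_right\<close>)
  have "ideal ?I R"
    by (rule right_ideal_imp_ideal[OF I]) (use act in \<open>auto simp: m_comm\<close>)
  then have "\<one> \<in> ?I" by (rule one_in_ideal_locally) (use loc in blast)
  then show ?thesis using x by (simp add: M.ract_one)
qed

abbreviation dens :: "'r set \<Rightarrow> 'a set" where "dens \<mm> \<equiv> scal ` (carrier R - \<mm>)"

abbreviation jm :: "'r set \<Rightarrow> 'a \<Rightarrow> ('a \<times> ('r \<times> 'r) set \<Rightarrow>\<^sub>0 int) set"
  where "jm \<mm> \<equiv> (\<lambda>a. domain_fractions.mk R (carrier R - \<mm>) \<Lambda> a \<one>)"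

abbreviation im :: "'r set \<Rightarrow> ('a, 'm, 'z) rmodule_scheme \<Rightarrow> 'm \<Rightarrow> ('m \<times> ('r \<times> 'r) set \<Rightarrow>\<^sub>0 int) set"
  where "im \<mm> P \<equiv> (\<lambda>x. domain_fractions.mk R (carrier R - \<mm>) (restrict_scalars \<Lambda> P) x \<one>)"

lemma ring_localization:
  assumes m: "\<mm> \<in> max_spec R"
  shows "central_localization \<Lambda> (localize_ring R \<Lambda> \<mm>) (dens \<mm>) (jm \<mm>)"
proof -
  interpret D: domain_fractions R "carrier R - \<mm>" by (rule domain_fractions_max[OF m])
  show ?thesis
    using D.tensor_ring_localization[OF alg tf] local_ring[OF m]
    unfolding scal_def[abs_def] local_ring_at_def by blast
qed

lemma module_localization:
  assumes m: "\<mm> \<in> max_spec R" and P: "projective \<Lambda> P"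
  shows "central_localization.loc_module \<Lambda> (localize_ring R \<Lambda> \<mm>) (dens \<mm>) (jm \<mm>) P
    (localize_module R \<Lambda> \<mm> P) (im \<mm> P)"
proof -
  interpret D: domain_fractions R "carrier R - \<mm>" by (rule domain_fractions_max[OF m])
  have "x = \<zero>\<^bsub>P\<^esub>" if "s \<in> carrier R - \<mm>" "x \<in> carrier P" "x \<triangleleft>\<^bsub>P\<^esub> (s \<odot>\<^bsub>\<Lambda>\<^esub> \<one>\<^bsub>\<Lambda>\<^esub>) = \<zero>\<^bsub>P\<^esub>" for s x
    using projective_torsion_free[OF P, of s x] that max_zero[OF m] by (auto simp: scal_def)
  then show ?thesis
    using D.tensor_module_localization[OF alg tf _ projective_right_module[OF P]] local_ring[OF m]
    unfolding scal_def[abs_def] local_ring_at_def by blast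
qed

text \<open>The ideal \<open>J\<^sub>Q\<close> of the simple ring \<open>\<Lambda>\<^sub>Q\<close> is non-zero because \<open>\<Lambda>\<close> is torsion-free. So it contains
  \<open>1\<close>, and clearing the denominator gives a constant in \<open>J\<close>.\<close>

lemma ideal_contains_constant:
  assumes simple: "simple_artinian (tensor_ring R \<Lambda> (fraction_field R))"
    and J: "right_ideal \<Lambda> J" and left: "\<And>a x. a \<in> carrier \<Lambda> \<Longrightarrow> x \<in> J \<Longrightarrow> a \<otimes>\<^bsub>\<Lambda>\<^esub> x \<in> J"
    and x: "x \<in> J" "x \<noteq> \<zero>\<^bsub>\<Lambda>\<^esub>"
  obtains r where "r \<in> carrier R" "r \<noteq> \<zero>" "scal r \<in> J"
proof -
  let ?Q = "tensor_ring R \<Lambda> (fraction_field R)" and ?D = "carrier R - {\<zero>}"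
  let ?j = "\<lambda>a. domain_fractions.mk R ?D \<Lambda> a \<one>"
  interpret D: domain_fractions R ?D
    by (rule domain_fractions.intro[OF domain_axioms domain_fractions_axioms.intro]) (auto simp: integral_iff)
  have ring: "ring ?Q" using simple by (simp add: simple_artinian_def)
  interpret Q: central_localization \<Lambda> ?Q "scal ` ?D" ?j
    using D.tensor_ring_localization[OF alg tf] ring
    unfolding scal_def[abs_def] fraction_field_def by blast
  let ?I = "Q.loc_sub (regular_module ?Q) ?j J"
  have I: "right_ideal ?Q ?I" by (rule Q.loc_sub_submodule[OF Q.loc_module_regular J])
  have Jc: "J \<subseteq> carrier \<Lambda>" using rsubmoduleD(1)[OF J] by simp
  have "ideal ?I ?Q"
    by (rule Q.L'.right_ideal_imp_ideal[OF I]) (rule Q.loc_sub_left_ideal[OF J left])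
  then have "?I = {\<zero>\<^bsub>?Q\<^esub>} \<or> ?I = carrier ?Q" using simple unfolding simple_artinian_def by blast
  moreover have "?j x \<in> ?I"
    by (rule Q.loc_sub_image[OF Q.loc_module_regular J x(1)])
  moreover have "?j x \<noteq> \<zero>\<^bsub>?Q\<^esub>"
  proof
    assume "?j x = \<zero>\<^bsub>?Q\<^esub>"
    then show False using Q.j_inj[OF subsetD[OF Jc x(1)]] x(2) by simp
  qed
  ultimately have "?I = carrier ?Q" by blast
  then have "\<one>\<^bsub>?Q\<^esub> \<in> ?I" using Q.L'.one_closed by (simp only:)
  then obtain d z where d: "d \<in> scal ` ?D" and z: "z \<in> J"
    and eq': "\<one>\<^bsub>?Q\<^esub> \<triangleleft>\<^bsub>regular_module ?Q\<^esub> ?j d = ?j z" by (rule Q.loc_subE)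
  from d obtain s where ds: "d = scal s" and s: "s \<in> ?D" by (rule imageE)
  have eq: "\<one>\<^bsub>?Q\<^esub> \<otimes>\<^bsub>?Q\<^esub> ?j (scal s) = ?j z" using eq' unfolding ds regular_module_simps .
  have sc: "scal s \<in> carrier \<Lambda>" using s by simp
  have "?j (scal s) = ?j z" using eq Q.L'.l_one[OF Q.j_closed[OF sc]] by (simp only:)
  then have "scal s = z"
    using Q.loc_module_eq[OF Q.loc_module_regular, of "scal s" z] sc subsetD[OF Jc z] by (simp only: regular_module_simps)
  then show thesis using s z by (intro that[of s]) auto
qed

subsection \<open>The trace ideal is determined locally\<close>

text \<open>At each \<open>\<mm>\<close> the module \<open>P2\<^sub>\<mm> \<cong> P\<^sub>\<mm>\<close> absorbs countably many copies of \<open>A\<^sub>\<mm>\<close> and is finitely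
  generated modulo \<open>J\<^sub>\<mm>\<close>. Hence \<open>A\<^sub>\<mm> = A\<^sub>\<mm> J\<^sub>\<mm>\<close> for all \<open>\<mm>\<close>, so \<open>A = A J\<close>. Used in both directions, this
  shows that locally isomorphic relatively big modules have the same trace ideal.\<close>

lemma trace_ideal_le_locally:
  assumes P: "cg_projective \<Lambda> P" and A: "cg_projective \<Lambda> A" and PA: "rmod_iso \<Lambda> (binary_sum P (omega_sum A)) P"
    and P2: "cg_projective \<Lambda> P2" and J: "right_ideal \<Lambda> J"
    and left: "\<And>a x. a \<in> carrier \<Lambda> \<Longrightarrow> x \<in> J \<Longrightarrow> a \<otimes>\<^bsub>\<Lambda>\<^esub> x \<in> J"
    and fg: "finitely_generated \<Lambda> (rquot P2 (module_ideal_mult \<Lambda> P2 J))"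
    and iso: "\<And>\<mm>. \<mm> \<in> max_spec R \<Longrightarrow>
      rmod_iso (localize_ring R \<Lambda> \<mm>) (localize_module R \<Lambda> \<mm> P) (localize_module R \<Lambda> \<mm> P2)"
  shows "trace_ideal \<Lambda> A \<subseteq> J"
proof -
  have pr: "projective \<Lambda> P" "projective \<Lambda> A" "projective \<Lambda> P2" using P A P2 by (auto simp: cg_projective_def)
  have Am: "right_module \<Lambda> A" and P2m: "right_module \<Lambda> P2" using pr projective_right_module by auto
  have Jc: "J \<subseteq> carrier \<Lambda>" using rsubmoduleD(1)[OF J] by simp
  have AJ: "rsubmodule \<Lambda> A (module_ideal_mult \<Lambda> A J)" by (rule module_ideal_mult_submodule[OF Am Jc])
  have PJ: "rsubmodule \<Lambda> P2 (module_ideal_mult \<Lambda> P2 J)" by (rule module_ideal_mult_submodule[OF P2m Jc])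
  obtain X where X: "finite X" "X \<subseteq> carrier P2"
    and gen: "\<And>K. rsubmodule \<Lambda> P2 K \<Longrightarrow> X \<subseteq> K \<Longrightarrow> module_ideal_mult \<Lambda> P2 J \<subseteq> K \<Longrightarrow> K = carrier P2"
    using fg unfolding finitely_generated_rquot_iff[OF P2m PJ] by blast
  have "a \<in> module_ideal_mult \<Lambda> A J" if a: "a \<in> carrier A" for a
  proof (rule submodule_local_check[OF Am AJ a])
    fix \<mm> assume m: "\<mm> \<in> max_spec R"
    let ?L = "localize_ring R \<Lambda> \<mm>" and ?P = "localize_module R \<Lambda> \<mm> P"
      and ?A = "localize_module R \<Lambda> \<mm> A" and ?P2 = "localize_module R \<Lambda> \<mm> P2"
    interpret C: central_localization \<Lambda> ?L "dens \<mm>" "jm \<mm>" by (rule ring_localization[OF m])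
    note lP = module_localization[OF m pr(1)] and lA = module_localization[OF m pr(2)]
      and lP2 = module_localization[OF m pr(3)]
    note mP = C.loc_moduleD[OF lP] and mA = C.loc_moduleD[OF lA] and mP2 = C.loc_moduleD[OF lP2]
    have mAw: "right_module ?L (omega_sum ?A)" by (rule right_module_omega_sum[OF mA(2)])
    have "rmod_iso ?L (binary_sum ?P (omega_sum ?A)) ?P"
      by (rule C.loc_module_iso[OF C.loc_module_binary_sum[OF lP C.loc_module_omega_sum[OF lA]] lP PA])
    then have "rmod_iso ?L (binary_sum ?P (omega_sum ?A)) ?P2" using iso[OF m] by (rule rmod_iso_trans)
    with binary_sum_cong[OF rmod_iso_sym[OF iso[OF m] mP(2)] rmod_iso_refl mP2(2) mAw]
    have iso2: "rmod_iso ?L (binary_sum ?P2 (omega_sum ?A)) ?P2" by (rule rmod_iso_trans)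
    let ?J = "C.loc_sub (regular_module ?L) (jm \<mm>) J"
    have J'c: "?J \<subseteq> carrier ?L" by (auto simp: C.loc_sub_def)
    have jJ: "jm \<mm> l \<in> ?J" if "l \<in> J" for l
      by (rule C.loc_sub_image[OF C.loc_module_regular J that])
    have "K = carrier ?P2" if K: "rsubmodule ?L ?P2 K" "im \<mm> P2 ` X \<subseteq> K" "module_ideal_mult ?L ?P2 ?J \<subseteq> K" for K
    proof (rule C.loc_module_generate_modulo[OF lP2 K(1) Jc X(2) gen K(2)])
      fix x l assume "x \<in> carrier P2" "l \<in> J"
      then show "im \<mm> P2 x \<triangleleft>\<^bsub>?P2\<^esub> jm \<mm> l \<in> K"
        by (intro subsetD[OF K(3)] module_ideal_multI mP2(3) jJ)
    qed
    note genK = this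
    have "finite (im \<mm> P2 ` X)" "im \<mm> P2 ` X \<subseteq> carrier ?P2" using X mP2(3) by auto
    then have "im \<mm> A a \<in> module_ideal_mult ?L ?A ?J"
      by (rule absorbed_eq_ideal_mult[OF mP2(2) mA(2) iso2 J'c _ _ genK mA(3)[OF a]])
    then have "im \<mm> A a \<in> C.loc_sub ?A (im \<mm> A) (module_ideal_mult \<Lambda> A J)"
      using C.loc_sub_ideal_mult[OF lA J] by simp
    then show "\<exists>t\<in>carrier R - \<mm>. a \<triangleleft>\<^bsub>A\<^esub> scal t \<in> module_ideal_mult \<Lambda> A J"
      using C.loc_sub_iff[OF lA rsubmoduleD(1)[OF AJ] a] by simp
  qed
  from trace_ideal_subset_ideal[OF Am J left this] show ?thesis .
qed

end

context local_algebra
begin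

abbreviation lsub :: "'r set \<Rightarrow> ('a, 'm, 'z) rmodule_scheme \<Rightarrow> 'm set \<Rightarrow> ('m \<times> ('r \<times> 'r) set \<Rightarrow>\<^sub>0 int) set set"
  where "lsub \<mm> P N \<equiv> central_localization.loc_sub (dens \<mm>) (jm \<mm>) (localize_module R \<Lambda> \<mm> P) (im \<mm> P) N"

lemma lsub_iff:
  assumes m: "\<mm> \<in> max_spec R" and P: "projective \<Lambda> P" and N: "rsubmodule \<Lambda> P N" and x: "x \<in> carrier P"
  shows "im \<mm> P x \<in> lsub \<mm> P N \<longleftrightarrow> (\<exists>t\<in>carrier R - \<mm>. x \<triangleleft>\<^bsub>P\<^esub> scal t \<in> N)"
proof -
  interpret C: central_localization \<Lambda> "localize_ring R \<Lambda> \<mm>" "dens \<mm>" "jm \<mm>" by (rule ring_localization[OF m])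
  show ?thesis using C.loc_sub_iff[OF module_localization[OF m P] rsubmoduleD(1)[OF N] x] by blast
qed

lemma ract_multiple_in_ideal_mult:
  assumes P: "right_module \<Lambda> P" and "x \<in> carrier P" "a \<in> carrier R" "r \<in> carrier R" "scal r \<in> J"
  shows "x \<triangleleft>\<^bsub>P\<^esub> scal (a \<otimes> r) \<in> module_ideal_mult \<Lambda> P J"
proof -
  interpret P: right_module \<Lambda> P by fact
  have "x \<triangleleft>\<^bsub>P\<^esub> scal (a \<otimes> r) = (x \<triangleleft>\<^bsub>P\<^esub> scal a) \<triangleleft>\<^bsub>P\<^esub> scal r"
    using assms by (simp add: scal_mult P.ract_mult)
  also have "\<dots> \<in> module_ideal_mult \<Lambda> P J"
    by (rule module_ideal_multI) (use assms P.ract_closed in auto)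
  finally show ?thesis .
qed

text \<open>The approximation is built up one maximal ideal at a time. To correct it at a further \<open>\<mm>\<close>, multiply
  the error \<open>x/v\<close> by an element \<open>s t\<close> that is \<open>1/v\<close> at \<open>\<mm>\<close> and \<open>0\<close> at the other maximal ideals, both
  modulo the constant \<open>r\<close> of \<open>J\<close>. Then the old approximations are not disturbed.\<close>

lemma simultaneous_approximation:
  assumes P: "projective \<Lambda> P" and J: "J \<subseteq> carrier \<Lambda>" and r: "r \<in> carrier R" "r \<noteq> \<zero>" "scal r \<in> J"
    and F: "finite F" "F \<subseteq> max_spec R" and z: "\<And>\<mm>. \<mm> \<in> F \<Longrightarrow> z \<mm> \<in> carrier (localize_module R \<Lambda> \<mm> P)"
  shows "\<exists>y\<in>carrier P. \<forall>\<mm>\<in>F. z \<mm> \<ominus>\<^bsub>localize_module R \<Lambda> \<mm> P\<^esub> im \<mm> P y \<in> lsub \<mm> P (module_ideal_mult \<Lambda> P J)"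
  using F z
proof (induction F rule: finite_induct)
  case empty
  have "\<zero>\<^bsub>P\<^esub> \<in> carrier P"
    using rsubmoduleD(2)[OF rsubmodule_carrier[OF projective_right_module[OF P]]] .
  then show ?case by blast
next
  case (insert \<mm> F)
  have Pm: "right_module \<Lambda> P" by (rule projective_right_module[OF P])
  interpret P: right_module \<Lambda> P by (rule Pm)
  let ?N = "module_ideal_mult \<Lambda> P J"
  have N: "rsubmodule \<Lambda> P ?N" by (rule module_ideal_mult_submodule[OF Pm J])
  obtain y0 where y0: "y0 \<in> carrier P"
    and y0F: "\<And>\<nn>. \<nn> \<in> F \<Longrightarrow> z \<nn> \<ominus>\<^bsub>localize_module R \<Lambda> \<nn> P\<^esub> im \<nn> P y0 \<in> lsub \<nn> P ?N"
    using insert by auto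
  have m: "\<mm> \<in> max_spec R" and Fm: "F \<subseteq> max_spec R" using insert by auto
  interpret C: central_localization \<Lambda> "localize_ring R \<Lambda> \<mm>" "dens \<mm>" "jm \<mm>" by (rule ring_localization[OF m])
  let ?P = "localize_module R \<Lambda> \<mm> P"
  note lP = module_localization[OF m P]
  note mP = C.loc_moduleD[OF lP]
  interpret P': right_module "localize_ring R \<Lambda> \<mm>" ?P by (rule mP(2))
  define w where "w = z \<mm> \<ominus>\<^bsub>?P\<^esub> im \<mm> P y0"
  have zm: "z \<mm> \<in> carrier ?P" using insert by blast
  have w: "w \<in> carrier ?P" unfolding w_def using zm mP(3)[OF y0] by (rule P'.M.minus_closed)
  obtain d x where d: "d \<in> dens \<mm>" and x: "x \<in> carrier P" and wx: "w \<triangleleft>\<^bsub>?P\<^esub> jm \<mm> d = im \<mm> P x"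
    by (rule C.loc_moduleE[OF lP w])
  from d obtain v where dv: "d = scal v" and v: "v \<in> carrier R - \<mm>" by (rule imageE)
  have vc: "v \<in> carrier R" using v by blast
  obtain s where s: "s \<in> carrier R - \<mm>" and sF: "\<And>\<nn>. \<nn> \<in> F \<Longrightarrow> \<exists>u\<in>carrier R - \<nn>. \<exists>c\<in>carrier R. s \<otimes> u = c \<otimes> r"
    using local_idempotent[OF m insert(1) Fm insert(2) r(1,2)] by blast
  have sc: "s \<in> carrier R" using s by blast
  obtain t u c where t: "t \<in> carrier R" and u: "u \<in> carrier R - \<mm>" and c: "c \<in> carrier R"
    and uc: "u \<otimes> (\<one> \<ominus> (v \<otimes> s) \<otimes> t) = c \<otimes> r"
    by (rule local_inverse[OF m max_mult[OF m v s] r(1,2)])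
  have uc': "u \<in> carrier R" using u by blast
  \<comment> \<open>Modulo \<open>r\<close>, the constant \<open>q\<close> is \<open>1/v\<close> at \<open>\<mm>\<close> and \<open>0\<close> at every member of \<open>F\<close>.\<close>
  define q where "q = s \<otimes> t"
  have q: "q \<in> carrier R" using sc t by (simp add: q_def)
  define e where "e = x \<triangleleft>\<^bsub>P\<^esub> scal q"
  have e: "e \<in> carrier P" unfolding e_def using x q by (simp add: P.ract_closed)
  have other: "z \<nn> \<ominus>\<^bsub>localize_module R \<Lambda> \<nn> P\<^esub> im \<nn> P (y0 \<oplus>\<^bsub>P\<^esub> e) \<in> lsub \<nn> P ?N" if n: "\<nn> \<in> F" for \<nn>
  proof -
    have nm: "\<nn> \<in> max_spec R" using n Fm by blast
    interpret D: central_localization \<Lambda> "localize_ring R \<Lambda> \<nn>" "dens \<nn>" "jm \<nn>" by (rule ring_localization[OF nm])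
    note lPn = module_localization[OF nm P]
    note mPn = D.loc_moduleD[OF lPn]
    obtain u' c' where u': "u' \<in> carrier R - \<nn>" and c': "c' \<in> carrier R" and su: "s \<otimes> u' = c' \<otimes> r"
      using sF[OF n] by blast
    have u'c: "u' \<in> carrier R" using u' by blast
    have "e \<triangleleft>\<^bsub>P\<^esub> scal u' = x \<triangleleft>\<^bsub>P\<^esub> scal (q \<otimes> u')"
      unfolding e_def using x q u'c by (simp add: scal_mult P.ract_mult)
    also have "q \<otimes> u' = t \<otimes> (s \<otimes> u')" unfolding q_def using sc t u'c by (simp add: m_ac)
    also have "\<dots> = (t \<otimes> c') \<otimes> r" unfolding su using t c' r(1) by (simp add: m_assoc)
    also have "x \<triangleleft>\<^bsub>P\<^esub> scal ((t \<otimes> c') \<otimes> r) \<in> ?N"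
      by (rule ract_multiple_in_ideal_mult[OF Pm x _ r(1,3)]) (use t c' in simp)
    finally have "im \<nn> P e \<in> lsub \<nn> P ?N" using lsub_iff[OF nm P N e] u' by blast
    then have "(z \<nn> \<ominus>\<^bsub>localize_module R \<Lambda> \<nn> P\<^esub> im \<nn> P y0) \<ominus>\<^bsub>localize_module R \<Lambda> \<nn> P\<^esub> im \<nn> P e \<in> lsub \<nn> P ?N"
      by (rule rsubmodule_minus[OF mPn(2) D.loc_sub_submodule[OF lPn N] y0F[OF n]])
    moreover have "z \<nn> \<in> carrier (localize_module R \<Lambda> \<nn> P)" using insert.prems(2) n by blast
    ultimately show ?thesis
      using right_module.minus_add_right[OF mPn(2) _ mPn(3)[OF y0] mPn(3)[OF e]] mPn(4)[OF y0 e] by simp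
  qed
  have "(w \<ominus>\<^bsub>?P\<^esub> im \<mm> P e) \<triangleleft>\<^bsub>?P\<^esub> jm \<mm> d = im \<mm> P x \<ominus>\<^bsub>?P\<^esub> im \<mm> P e \<triangleleft>\<^bsub>?P\<^esub> jm \<mm> d"
    using P'.ract_minus_left[OF w mP(3)[OF e] C.j_closed[OF C.S_carrier[OF d]]] wx by simp
  also have "\<dots> = im \<mm> P (x \<ominus>\<^bsub>P\<^esub> e \<triangleleft>\<^bsub>P\<^esub> d)"
    using C.loc_module_minus[OF lP x P.ract_closed[OF e C.S_carrier[OF d]]] mP(5)[OF e C.S_carrier[OF d]] by simp
  also have "x \<ominus>\<^bsub>P\<^esub> e \<triangleleft>\<^bsub>P\<^esub> d = x \<triangleleft>\<^bsub>P\<^esub> scal (\<one> \<ominus> (v \<otimes> s) \<otimes> t)"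
  proof -
    have "e \<triangleleft>\<^bsub>P\<^esub> d = x \<triangleleft>\<^bsub>P\<^esub> scal (q \<otimes> v)" unfolding e_def dv using x q vc by (simp add: scal_mult P.ract_mult)
    also have "q \<otimes> v = (v \<otimes> s) \<otimes> t" unfolding q_def using sc t vc by (simp add: m_ac)
    finally show ?thesis using x sc t vc by (simp add: scal_minus P.ract_minus_right P.ract_one)
  qed
  also have "im \<mm> P (x \<triangleleft>\<^bsub>P\<^esub> scal (\<one> \<ominus> (v \<otimes> s) \<otimes> t)) \<in> lsub \<mm> P ?N"
  proof -
    have k: "\<one> \<ominus> (v \<otimes> s) \<otimes> t \<in> carrier R" using sc t vc by simp
    have "(x \<triangleleft>\<^bsub>P\<^esub> scal (\<one> \<ominus> (v \<otimes> s) \<otimes> t)) \<triangleleft>\<^bsub>P\<^esub> scal u = x \<triangleleft>\<^bsub>P\<^esub> scal (u \<otimes> (\<one> \<ominus> (v \<otimes> s) \<otimes> t))"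
      using x k uc' by (simp add: m_comm[OF uc' k] scal_mult P.ract_mult)
    also have "\<dots> \<in> ?N" unfolding uc by (rule ract_multiple_in_ideal_mult[OF Pm x c r(1,3)])
    finally show ?thesis using lsub_iff[OF m P N P.ract_closed[OF x scal_closed[OF k]]] u by blast
  qed
  finally have "(w \<ominus>\<^bsub>?P\<^esub> im \<mm> P e) \<triangleleft>\<^bsub>?P\<^esub> jm \<mm> d \<in> lsub \<mm> P ?N" .
  then have "w \<ominus>\<^bsub>?P\<^esub> im \<mm> P e \<in> lsub \<mm> P ?N"
    by (rule C.loc_sub_divide[OF lP N P'.M.minus_closed[OF w mP(3)[OF e]] d])
  then have "z \<mm> \<ominus>\<^bsub>?P\<^esub> im \<mm> P (y0 \<oplus>\<^bsub>P\<^esub> e) \<in> lsub \<mm> P ?N"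
    unfolding w_def mP(4)[OF y0 e] P'.minus_add_right[OF zm mP(3)[OF y0] mP(3)[OF e]] .
  moreover have "y0 \<oplus>\<^bsub>P\<^esub> e \<in> carrier P" using y0 e by simp
  ultimately show ?case using other by (intro bexI[of _ "y0 \<oplus>\<^bsub>P\<^esub> e"] ballI) auto
qed

text \<open>The local isomorphisms need not come from a map \<open>P \<rightarrow> Q\<close>, but modulo the common trace ideal \<open>J\<close> they
  do: \<open>J\<close> contains a constant \<open>r \<noteq> 0\<close>, so only the finitely many \<open>\<mm>\<close> containing \<open>r\<close> matter, and for
  these the isomorphisms can be approximated simultaneously.\<close>

theorem iso_of_locally_iso:
  assumes simple: "simple_artinian (tensor_ring R \<Lambda> (fraction_field R))"
    and P: "cg_projective \<Lambda> P" and A: "cg_projective \<Lambda> A" and PA: "rmod_iso \<Lambda> (binary_sum P (omega_sum A)) P"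
    and fgP: "finitely_generated \<Lambda> (rquot P (module_ideal_mult \<Lambda> P (trace_ideal \<Lambda> A)))"
    and nfg: "\<not> finitely_generated \<Lambda> P"
    and Q: "cg_projective \<Lambda> Q" and B: "cg_projective \<Lambda> B" and QB: "rmod_iso \<Lambda> (binary_sum Q (omega_sum B)) Q"
    and fgQ: "finitely_generated \<Lambda> (rquot Q (module_ideal_mult \<Lambda> Q (trace_ideal \<Lambda> B)))"
    and iso: "\<And>\<mm>. \<mm> \<in> max_spec R \<Longrightarrow>
      rmod_iso (localize_ring R \<Lambda> \<mm>) (localize_module R \<Lambda> \<mm> P) (localize_module R \<Lambda> \<mm> Q)"
  shows "rmod_iso \<Lambda> P Q"
proof -
  have prP: "projective \<Lambda> P" and prA: "projective \<Lambda> A" and prQ: "projective \<Lambda> Q" and prB: "projective \<Lambda> B"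
    using P A Q B by (auto simp: cg_projective_def)
  note Pm = projective_right_module[OF prP] and Qm = projective_right_module[OF prQ]
    and Am = projective_right_module[OF prA] and Bm = projective_right_module[OF prB]
  interpret P: right_module \<Lambda> P by (rule Pm)
  interpret Q: right_module \<Lambda> Q by (rule Qm)
  let ?J = "trace_ideal \<Lambda> A"
  have iso': "rmod_iso (localize_ring R \<Lambda> \<mm>) (localize_module R \<Lambda> \<mm> Q) (localize_module R \<Lambda> \<mm> P)"
    if m: "\<mm> \<in> max_spec R" for \<mm>
  proof -
    interpret C: central_localization \<Lambda> "localize_ring R \<Lambda> \<mm>" "dens \<mm>" "jm \<mm>" by (rule ring_localization[OF m])
    show ?thesis by (rule rmod_iso_sym[OF iso[OF m] C.loc_moduleD(2)[OF module_localization[OF m prP]]])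
  qed
  have J: "right_ideal \<Lambda> ?J" by (rule trace_ideal_submodule[OF \<Lambda>.ring_axioms])
  have Jc: "?J \<subseteq> carrier \<Lambda>" by (rule trace_ideal_subset[OF \<Lambda>.ring_axioms])
  have "?J \<subseteq> trace_ideal \<Lambda> B"
    by (rule trace_ideal_le_locally[OF P A PA Q trace_ideal_submodule[OF \<Lambda>.ring_axioms]
          trace_ideal_left[OF \<Lambda>.ring_axioms] fgQ iso])
  moreover have "trace_ideal \<Lambda> B \<subseteq> ?J"
    by (rule trace_ideal_le_locally[OF Q B QB P J trace_ideal_left[OF \<Lambda>.ring_axioms] fgP iso'])
  ultimately have tr: "?J = trace_ideal \<Lambda> B" by (rule subset_antisym)
  have PJ: "rsubmodule \<Lambda> P (module_ideal_mult \<Lambda> P ?J)" by (rule module_ideal_mult_submodule[OF Pm Jc])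
  have QJ: "rsubmodule \<Lambda> Q (module_ideal_mult \<Lambda> Q ?J)" by (rule module_ideal_mult_submodule[OF Qm Jc])
  have "\<exists>a\<in>?J. a \<noteq> \<zero>\<^bsub>\<Lambda>\<^esub>"
  proof (rule ccontr)
    assume "\<not> ?thesis"
    then have "?J \<subseteq> {\<zero>\<^bsub>\<Lambda>\<^esub>}" by blast
    then have "module_ideal_mult \<Lambda> P ?J \<subseteq> module_ideal_mult \<Lambda> P {\<zero>\<^bsub>\<Lambda>\<^esub>}"
      by (intro module_ideal_mult_mono[OF Pm]) auto
    also have "\<dots> \<subseteq> {\<zero>\<^bsub>P\<^esub>}" by (rule module_ideal_mult_zero[OF Pm])
    finally have sub: "module_ideal_mult \<Lambda> P ?J \<subseteq> {\<zero>\<^bsub>P\<^esub>}" .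
    obtain X where X: "finite X" "X \<subseteq> carrier P"
      and gen: "\<And>K. rsubmodule \<Lambda> P K \<Longrightarrow> X \<subseteq> K \<Longrightarrow> module_ideal_mult \<Lambda> P ?J \<subseteq> K \<Longrightarrow> K = carrier P"
      using fgP unfolding finitely_generated_rquot_iff[OF Pm PJ] by blast
    have "K = carrier P" if "rsubmodule \<Lambda> P K" "X \<subseteq> K" for K
      using gen[OF that] sub rsubmoduleD(2)[OF that(1)] by blast
    then show False using nfg X unfolding finitely_generated_iff[OF Pm] by blast
  qed
  then obtain a where a: "a \<in> ?J" "a \<noteq> \<zero>\<^bsub>\<Lambda>\<^esub>" by blast
  obtain r where r: "r \<in> carrier R" "r \<noteq> \<zero>" "scal r \<in> ?J"
    by (rule ideal_contains_constant[OF simple J trace_ideal_left[OF \<Lambda>.ring_axioms] a])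
  have const: "x \<triangleleft>\<^bsub>M\<^esub> scal r \<in> module_ideal_mult \<Lambda> M ?J" if "x \<in> carrier M"
    for M :: "('a, 'm, 'w) rmodule_scheme" and x
    by (rule module_ideal_multI[OF that r(3)])
  define F where "F = {\<mm> \<in> max_spec R. r \<in> \<mm>}"
  have F: "finite F" "F \<subseteq> max_spec R" unfolding F_def using finite_max[OF r(1,2)] by auto
  have outside: "r \<in> carrier R - \<mm>" if "\<mm> \<in> max_spec R" "\<mm> \<notin> F" for \<mm> using that r(1) by (simp add: F_def)
  have "\<forall>\<mm>\<in>F. \<exists>\<phi> \<psi>. \<phi> \<in> rmod_hom (localize_ring R \<Lambda> \<mm>) (localize_module R \<Lambda> \<mm> P) (localize_module R \<Lambda> \<mm> Q) \<and>
      \<psi> \<in> rmod_hom (localize_ring R \<Lambda> \<mm>) (localize_module R \<Lambda> \<mm> Q) (localize_module R \<Lambda> \<mm> P) \<and>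
      (\<forall>x\<in>carrier (localize_module R \<Lambda> \<mm> P). \<psi> (\<phi> x) = x) \<and>
      (\<forall>y\<in>carrier (localize_module R \<Lambda> \<mm> Q). \<phi> (\<psi> y) = y)"
  proof
    fix \<mm> assume "\<mm> \<in> F"
    then have m: "\<mm> \<in> max_spec R" using F(2) by blast
    interpret C: central_localization \<Lambda> "localize_ring R \<Lambda> \<mm>" "dens \<mm>" "jm \<mm>" by (rule ring_localization[OF m])
    show "\<exists>\<phi> \<psi>. \<phi> \<in> rmod_hom (localize_ring R \<Lambda> \<mm>) (localize_module R \<Lambda> \<mm> P) (localize_module R \<Lambda> \<mm> Q) \<and>
      \<psi> \<in> rmod_hom (localize_ring R \<Lambda> \<mm>) (localize_module R \<Lambda> \<mm> Q) (localize_module R \<Lambda> \<mm> P) \<and>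
      (\<forall>x\<in>carrier (localize_module R \<Lambda> \<mm> P). \<psi> (\<phi> x) = x) \<and>
      (\<forall>y\<in>carrier (localize_module R \<Lambda> \<mm> Q). \<phi> (\<psi> y) = y)"
      using rmod_isoE[OF iso[OF m] C.loc_moduleD(2)[OF module_localization[OF m prP]]] by metis
  qed
  then obtain \<phi> \<psi> where
    phi: "\<And>\<mm>. \<mm> \<in> F \<Longrightarrow> \<phi> \<mm> \<in> rmod_hom (localize_ring R \<Lambda> \<mm>) (localize_module R \<Lambda> \<mm> P) (localize_module R \<Lambda> \<mm> Q)"
    and psi: "\<And>\<mm>. \<mm> \<in> F \<Longrightarrow> \<psi> \<mm> \<in> rmod_hom (localize_ring R \<Lambda> \<mm>) (localize_module R \<Lambda> \<mm> Q) (localize_module R \<Lambda> \<mm> P)"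
    and psi_phi: "\<And>\<mm> x. \<mm> \<in> F \<Longrightarrow> x \<in> carrier (localize_module R \<Lambda> \<mm> P) \<Longrightarrow> \<psi> \<mm> (\<phi> \<mm> x) = x"
    and phi_psi: "\<And>\<mm> y. \<mm> \<in> F \<Longrightarrow> y \<in> carrier (localize_module R \<Lambda> \<mm> Q) \<Longrightarrow> \<phi> \<mm> (\<psi> \<mm> y) = y"
    by metis
  let ?S = "binary_sum P Q"
  have S: "right_module \<Lambda> ?S" by (rule right_module_binary_sum[OF Pm Qm])
  let ?d = "\<lambda>\<mm> w. \<phi> \<mm> (im \<mm> P (fst w)) \<ominus>\<^bsub>localize_module R \<Lambda> \<mm> Q\<^esub> im \<mm> Q (snd w)"
  let ?U = "\<lambda>\<mm>. lsub \<mm> Q (module_ideal_mult \<Lambda> Q ?J)"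
  \<comment> \<open>Pairs that correspond under all local isomorphisms modulo \<open>J\<close>; \<open>f\<close> will have its graph in \<open>W\<close>.\<close>
  define W where "W = {w \<in> carrier ?S. \<forall>\<mm>\<in>F. ?d \<mm> w \<in> ?U \<mm>}"
  have W: "rsubmodule \<Lambda> ?S W"
    unfolding W_def
  proof (rule rsubmodule_Ball[OF S])
    fix \<mm> assume mF: "\<mm> \<in> F"
    then have m: "\<mm> \<in> max_spec R" using F(2) by blast
    interpret C: central_localization \<Lambda> "localize_ring R \<Lambda> \<mm>" "dens \<mm>" "jm \<mm>" by (rule ring_localization[OF m])
    note lP = module_localization[OF m prP] and lQ = module_localization[OF m prQ]
    note Q'm = C.right_module_restrict_ring[OF C.loc_moduleD(2)[OF lQ]]
    have "(\<lambda>w. \<phi> \<mm> (im \<mm> P (fst w)) \<ominus>\<^bsub>C.restrict_ring (localize_module R \<Lambda> \<mm> Q)\<^esub> im \<mm> Q (snd w))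
        \<in> rmod_hom \<Lambda> ?S (C.restrict_ring (localize_module R \<Lambda> \<mm> Q))"
      by (rule rmod_hom_minus_fun[OF Q'm
            rmod_hom_comp[OF rmod_hom_comp[OF rmod_hom_fst C.loc_module_hom[OF lP]] C.rmod_hom_restrict_ring[OF phi[OF mF]]]
            rmod_hom_comp[OF rmod_hom_snd C.loc_module_hom[OF lQ]]])
    then have "?d \<mm> \<in> rmod_hom \<Lambda> ?S (C.restrict_ring (localize_module R \<Lambda> \<mm> Q))"
      unfolding C.restrict_ring_minus .
    then show "rsubmodule \<Lambda> ?S {w \<in> carrier ?S. ?d \<mm> w \<in> ?U \<mm>}"
      by (rule rsubmodule_vimage[OF S Q'm _ C.rsubmodule_restrict_ring[OF C.loc_moduleD(2)[OF lQ] C.loc_sub_submodule[OF lQ QJ]]])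
  qed
  have "\<exists>y. (p, y) \<in> W" if p: "p \<in> carrier P" for p
  proof -
    have "\<phi> \<mm> (im \<mm> P p) \<in> carrier (localize_module R \<Lambda> \<mm> Q)" if mF: "\<mm> \<in> F" for \<mm>
    proof -
      have m: "\<mm> \<in> max_spec R" using mF F(2) by blast
      interpret C: central_localization \<Lambda> "localize_ring R \<Lambda> \<mm>" "dens \<mm>" "jm \<mm>" by (rule ring_localization[OF m])
      show ?thesis by (rule rmod_homD(1)[OF phi[OF mF] C.loc_moduleD(3)[OF module_localization[OF m prP] p]])
    qed
    then have "\<exists>y\<in>carrier Q. \<forall>\<mm>\<in>F. \<phi> \<mm> (im \<mm> P p) \<ominus>\<^bsub>localize_module R \<Lambda> \<mm> Q\<^esub> im \<mm> Q y \<in> ?U \<mm>"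
      by (rule simultaneous_approximation[where z = "\<lambda>\<mm>. \<phi> \<mm> (im \<mm> P p)", OF prQ Jc r F])
    then obtain y where "y \<in> carrier Q"
      "\<forall>\<mm>\<in>F. \<phi> \<mm> (im \<mm> P p) \<ominus>\<^bsub>localize_module R \<Lambda> \<mm> Q\<^esub> im \<mm> Q y \<in> ?U \<mm>" by (elim bexE)
    then have "(p, y) \<in> W" unfolding W_def using p by simp
    then show ?thesis by blast
  qed
  then obtain f where f: "f \<in> rmod_hom \<Lambda> P Q" and fW: "\<And>p. p \<in> carrier P \<Longrightarrow> (p, f p) \<in> W"
    using projective_lift_relation[OF prP Qm W] by metis
  have approx: "\<phi> \<mm> (im \<mm> P p) \<ominus>\<^bsub>localize_module R \<Lambda> \<mm> Q\<^esub> im \<mm> Q (f p) \<in> ?U \<mm>"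
    if "\<mm> \<in> F" "p \<in> carrier P" for \<mm> p
    using fW[OF that(2)] that(1) unfolding W_def by simp
  show ?thesis
  proof (rule iso_of_iso_modulo_trace[OF P Q prA Bm tr PA QB f])
    fix p assume p: "p \<in> carrier P" and fp: "f p \<in> module_ideal_mult \<Lambda> Q ?J"
    show "p \<in> module_ideal_mult \<Lambda> P ?J"
    proof (rule submodule_local_check[OF Pm PJ p])
      fix \<mm> assume m: "\<mm> \<in> max_spec R"
      show "\<exists>t\<in>carrier R - \<mm>. p \<triangleleft>\<^bsub>P\<^esub> scal t \<in> module_ideal_mult \<Lambda> P ?J"
      proof (cases "\<mm> \<in> F")
        case False
        then show ?thesis using outside[OF m] const[OF p] by blast
      next
        case True
        interpret C: central_localization \<Lambda> "localize_ring R \<Lambda> \<mm>" "dens \<mm>" "jm \<mm>" by (rule ring_localization[OF m])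
        note lP = module_localization[OF m prP] and lQ = module_localization[OF m prQ]
        note mP = C.loc_moduleD[OF lP] and mQ = C.loc_moduleD[OF lQ]
        let ?Q = "localize_module R \<Lambda> \<mm> Q"
        interpret Q': right_module "localize_ring R \<Lambda> \<mm>" ?Q by (rule mQ(2))
        have U: "rsubmodule (localize_ring R \<Lambda> \<mm>) ?Q (?U \<mm>)" by (rule C.loc_sub_submodule[OF lQ QJ])
        have pc: "\<phi> \<mm> (im \<mm> P p) \<in> carrier ?Q" by (rule rmod_homD(1)[OF phi[OF True] mP(3)[OF p]])
        have fpc: "im \<mm> Q (f p) \<in> carrier ?Q" by (rule mQ(3)[OF rmod_homD(1)[OF f p]])
        have "(\<phi> \<mm> (im \<mm> P p) \<ominus>\<^bsub>?Q\<^esub> im \<mm> Q (f p)) \<oplus>\<^bsub>?Q\<^esub> im \<mm> Q (f p) \<in> ?U \<mm>"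
          by (rule rsubmoduleD(3)[OF U approx[OF True p] C.loc_sub_image[OF lQ QJ fp]])
        then have "\<phi> \<mm> (im \<mm> P p) \<in> ?U \<mm>"
          using pc fpc by (simp add: a_minus_def Q'.M.a_assoc Q'.M.l_neg)
        moreover have J': "C.loc_sub (regular_module (localize_ring R \<Lambda> \<mm>)) (jm \<mm>) ?J \<subseteq> carrier (localize_ring R \<Lambda> \<mm>)"
          using rsubmoduleD(1)[OF C.loc_sub_submodule[OF C.loc_module_regular J]] by simp
        ultimately have "\<psi> \<mm> (\<phi> \<mm> (im \<mm> P p)) \<in> lsub \<mm> P (module_ideal_mult \<Lambda> P ?J)"
          unfolding C.loc_sub_ideal_mult[OF lQ J] C.loc_sub_ideal_mult[OF lP J]
          by (intro module_ideal_mult_hom[OF mQ(2) mP(2) psi[OF True]])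
        then show ?thesis
          unfolding psi_phi[OF True mP(3)[OF p]] lsub_iff[OF m prP PJ p] .
      qed
    qed
  next
    fix y assume y: "y \<in> carrier Q"
    let ?V = "{u \<oplus>\<^bsub>Q\<^esub> v |u v. u \<in> f ` carrier P \<and> v \<in> module_ideal_mult \<Lambda> Q ?J}"
    have im: "rsubmodule \<Lambda> Q (f ` carrier P)" by (rule rsubmodule_image[OF Pm Qm f rsubmodule_carrier[OF Pm]])
    have V: "rsubmodule \<Lambda> Q ?V" by (rule rsubmodule_sum[OF Qm im QJ])
    have VJ: "v \<in> ?V" if v: "v \<in> module_ideal_mult \<Lambda> Q ?J" for v
    proof -
      have "\<zero>\<^bsub>Q\<^esub> \<oplus>\<^bsub>Q\<^esub> v = v" using v rsubmoduleD(1)[OF QJ] by auto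
      then show ?thesis using v rsubmoduleD(2)[OF im] by (intro CollectI exI[of _ "\<zero>\<^bsub>Q\<^esub>"] exI[of _ v]) simp
    qed
    have Vf: "f p \<in> ?V" if p: "p \<in> carrier P" for p
    proof -
      have "f p \<oplus>\<^bsub>Q\<^esub> \<zero>\<^bsub>Q\<^esub> = f p" using rmod_homD(1)[OF f p] by simp
      then show ?thesis using p rsubmoduleD(2)[OF QJ] by (intro CollectI exI[of _ "f p"] exI[of _ "\<zero>\<^bsub>Q\<^esub>"]) simp
    qed
    have "y \<in> ?V"
    proof (rule submodule_local_check[OF Qm V y])
      fix \<mm> assume m: "\<mm> \<in> max_spec R"
      show "\<exists>t\<in>carrier R - \<mm>. y \<triangleleft>\<^bsub>Q\<^esub> scal t \<in> ?V"
      proof (cases "\<mm> \<in> F")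
        case False
        show ?thesis by (intro bexI[of _ r] VJ const y outside m False)
      next
        case True
        interpret C: central_localization \<Lambda> "localize_ring R \<Lambda> \<mm>" "dens \<mm>" "jm \<mm>" by (rule ring_localization[OF m])
        note lP = module_localization[OF m prP] and lQ = module_localization[OF m prQ]
        note mP = C.loc_moduleD[OF lP] and mQ = C.loc_moduleD[OF lQ]
        let ?Q = "localize_module R \<Lambda> \<mm> Q"
        have wc: "\<psi> \<mm> (im \<mm> Q y) \<in> carrier (localize_module R \<Lambda> \<mm> P)"
          by (rule rmod_homD(1)[OF psi[OF True] mQ(3)[OF y]])
        obtain d x where d: "d \<in> dens \<mm>" and x: "x \<in> carrier P"
          and wx: "\<psi> \<mm> (im \<mm> Q y) \<triangleleft>\<^bsub>localize_module R \<Lambda> \<mm> P\<^esub> jm \<mm> d = im \<mm> P x"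
          by (rule C.loc_moduleE[OF lP wc])
        from d obtain s where ds: "d = scal s" and s: "s \<in> carrier R - \<mm>" by (rule imageE)
        have dc: "d \<in> carrier \<Lambda>" by (rule C.S_carrier[OF d])
        have "\<phi> \<mm> (im \<mm> P x) = \<phi> \<mm> (\<psi> \<mm> (im \<mm> Q y)) \<triangleleft>\<^bsub>?Q\<^esub> jm \<mm> d"
          unfolding wx[symmetric] by (rule rmod_homD(3)[OF phi[OF True] wc C.j_closed[OF dc]])
        also have "\<dots> = im \<mm> Q (y \<triangleleft>\<^bsub>Q\<^esub> d)"
          unfolding phi_psi[OF True mQ(3)[OF y]] by (rule mQ(5)[OF y dc, symmetric])
        finally have phix: "\<phi> \<mm> (im \<mm> P x) = im \<mm> Q (y \<triangleleft>\<^bsub>Q\<^esub> d)" .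
        have yd: "y \<triangleleft>\<^bsub>Q\<^esub> d \<in> carrier Q" and fx: "f x \<in> carrier Q"
          by (rule Q.ract_closed[OF y dc], rule rmod_homD(1)[OF f x])
        have diff: "y \<triangleleft>\<^bsub>Q\<^esub> d \<ominus>\<^bsub>Q\<^esub> f x \<in> carrier Q" using yd fx by (rule Q.M.minus_closed)
        have "im \<mm> Q (y \<triangleleft>\<^bsub>Q\<^esub> d \<ominus>\<^bsub>Q\<^esub> f x) \<in> ?U \<mm>"
          using approx[OF True x] unfolding phix C.loc_module_minus[OF lQ yd fx] .
        then obtain t where t: "t \<in> carrier R - \<mm>" and tJ: "(y \<triangleleft>\<^bsub>Q\<^esub> d \<ominus>\<^bsub>Q\<^esub> f x) \<triangleleft>\<^bsub>Q\<^esub> scal t \<in> module_ideal_mult \<Lambda> Q ?J"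
          unfolding lsub_iff[OF m prQ QJ diff] by (elim bexE)
        have tc: "t \<in> carrier R" and sc: "s \<in> carrier R" using t s by auto
        have "(y \<triangleleft>\<^bsub>Q\<^esub> d \<ominus>\<^bsub>Q\<^esub> f x) \<triangleleft>\<^bsub>Q\<^esub> scal t \<oplus>\<^bsub>Q\<^esub> f x \<triangleleft>\<^bsub>Q\<^esub> scal t \<in> ?V"
          by (rule rsubmoduleD(3)[OF V VJ[OF tJ] rsubmoduleD(4)[OF V Vf[OF x] scal_closed[OF tc]]])
        also have "(y \<triangleleft>\<^bsub>Q\<^esub> d \<ominus>\<^bsub>Q\<^esub> f x) \<triangleleft>\<^bsub>Q\<^esub> scal t \<oplus>\<^bsub>Q\<^esub> f x \<triangleleft>\<^bsub>Q\<^esub> scal t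
            = ((y \<triangleleft>\<^bsub>Q\<^esub> d \<ominus>\<^bsub>Q\<^esub> f x) \<oplus>\<^bsub>Q\<^esub> f x) \<triangleleft>\<^bsub>Q\<^esub> scal t"
          by (rule Q.ract_add_left[OF diff fx scal_closed[OF tc], symmetric])
        also have "(y \<triangleleft>\<^bsub>Q\<^esub> d \<ominus>\<^bsub>Q\<^esub> f x) \<oplus>\<^bsub>Q\<^esub> f x = y \<triangleleft>\<^bsub>Q\<^esub> d"
          using yd fx by (simp add: a_minus_def Q.M.a_assoc Q.M.l_neg)
        also have "(y \<triangleleft>\<^bsub>Q\<^esub> d) \<triangleleft>\<^bsub>Q\<^esub> scal t = y \<triangleleft>\<^bsub>Q\<^esub> scal (s \<otimes> t)"
          unfolding ds scal_mult[OF sc tc] by (rule Q.ract_mult[OF y scal_closed[OF sc] scal_closed[OF tc], symmetric])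
        finally show ?thesis using max_mult[OF m s t] by (rule bexI)
      qed
    qed
    then obtain u v where uv: "y = u \<oplus>\<^bsub>Q\<^esub> v" "u \<in> f ` carrier P" "v \<in> module_ideal_mult \<Lambda> Q ?J" by blast
    from uv(2) obtain p where p: "u = f p" "p \<in> carrier P" by (rule imageE)
    have c: "u \<in> carrier Q" "v \<in> carrier Q"
      using p rmod_homD(1)[OF f p(2)] subsetD[OF rsubmoduleD(1)[OF QJ] uv(3)] by auto
    have "y \<ominus>\<^bsub>Q\<^esub> f p = (u \<oplus>\<^bsub>Q\<^esub> \<ominus>\<^bsub>Q\<^esub> u) \<oplus>\<^bsub>Q\<^esub> v"
      unfolding uv(1) p(1)[symmetric] using c by (simp add: a_minus_def Q.M.a_ac)
    also have "\<dots> = v" using c by (simp add: Q.M.r_neg)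
    finally show "\<exists>p\<in>carrier P. y \<ominus>\<^bsub>Q\<^esub> f p \<in> module_ideal_mult \<Lambda> Q ?J"
      using uv(3) p(2) by (intro bexI[of _ p]) simp_all
  qed
qed

end

section \<open>Isomorphism classes\<close>

text \<open>The copy of \<open>P\<close> with elements of type \<open>nat \<Rightarrow> 'a\<close> makes the class of \<open>P\<close> non-empty.\<close>

lemma iso_class_eq_iff:
  fixes L :: "('a, 'x) ring_scheme"
  assumes P: "cg_projective L P" and Q: "right_module L Q"
  shows "iso_class L P = iso_class L Q \<longleftrightarrow> rmod_iso L P Q"
proof
  assume eq: "iso_class L P = iso_class L Q"
  obtain X :: "('a, nat \<Rightarrow> 'a) rmodule" where X: "cg_projective L X" "rmod_iso L P X" by (rule cg_projective_copy[OF P])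
  have "rmod_iso L X P" by (rule rmod_iso_sym[OF X(2) cg_projective_right_module[OF P]])
  then have "X \<in> iso_class L P" unfolding iso_class_def using cg_projective_right_module[OF X(1)] by simp
  then have "rmod_iso L X Q" unfolding eq by (simp add: iso_class_def)
  with X(2) show "rmod_iso L P Q" by (rule rmod_iso_trans)
next
  assume iso: "rmod_iso L P Q"
  then have "rmod_iso L Q P" by (rule rmod_iso_sym[OF _ cg_projective_right_module[OF P]])
  then show "iso_class L P = iso_class L Q"
    unfolding iso_class_def using rmod_iso_trans[OF _ iso] rmod_iso_trans[OF _ \<open>rmod_iso L Q P\<close>] by auto
qed

lemma B_setE:
  fixes L :: "('a, 'x) ring_scheme"
  assumes "b \<in> B_set L"
  obtains P A :: "('a, nat \<Rightarrow> 'a) rmodule" where "b = iso_class L P" "b \<in> carrier (V_star L)" "cg_projective L P"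
    "\<not> finitely_generated L P" "cg_projective L A" "rmod_iso L (binary_sum P (omega_sum A)) P"
    "finitely_generated L (rquot P (module_ideal_mult L P (trace_ideal L A)))"
proof -
  obtain P :: "('a, nat \<Rightarrow> 'a) rmodule" where b: "b \<in> carrier (V_star L)" and Pb: "P \<in> b"
    and big: "relatively_big L P" and nfg: "\<not> finitely_generated L P"
    using assms unfolding B_set_def by blast
  obtain P0 :: "('a, nat \<Rightarrow> 'a) rmodule" where P0: "b = iso_class L P0" "cg_projective L P0"
    using b unfolding V_star_def by auto
  have "cg_projective L P" using big by (simp add: relatively_big_def)
  moreover have "rmod_iso L P P0" using Pb unfolding P0(1) iso_class_def by simp
  ultimately have "iso_class L P = b"
    unfolding P0(1) using iso_class_eq_iff[of L P P0] cg_projective_right_module[OF P0(2)] by simp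
  then show thesis using that b nfg big unfolding relatively_big_def by metis
qed

lemma B_setI:
  fixes X A :: "('a, nat \<Rightarrow> 'a) rmodule"
  assumes "cg_projective L X" "\<not> finitely_generated L X" "cg_projective L A"
    "rmod_iso L (binary_sum X (omega_sum A)) X"
    "finitely_generated L (rquot X (module_ideal_mult L X (trace_ideal L A)))"
  shows "iso_class L X \<in> B_set L"
proof -
  have "relatively_big L X" unfolding relatively_big_def using assms by blast
  moreover have "X \<in> iso_class L X"
    using cg_projective_right_module[OF assms(1)] rmod_iso_refl by (simp add: iso_class_def)
  moreover have "iso_class L X \<in> carrier (V_star L)" unfolding V_star_def using assms(1) by auto
  ultimately show ?thesis unfolding B_set_def using assms(2) by blast
qed

context local_algebra
begin

text \<open>By functoriality, the union over representatives in the definition is a union of equal classes.\<close>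

lemma localization_map_iso_class:
  assumes m: "\<mm> \<in> max_spec R" and b: "b \<in> carrier (V_star \<Lambda>)" "b = iso_class \<Lambda> P" and P: "cg_projective \<Lambda> P"
    and "P \<in> b"
  shows "localization_map R \<Lambda> b \<mm> = iso_class (localize_ring R \<Lambda> \<mm>) (localize_module R \<Lambda> \<mm> P)"
proof -
  interpret C: central_localization \<Lambda> "localize_ring R \<Lambda> \<mm>" "dens \<mm>" "jm \<mm>" by (rule ring_localization[OF m])
  have prP: "projective \<Lambda> P" using P by (simp add: cg_projective_def)
  note lP = module_localization[OF m prP]
  have "iso_class (localize_ring R \<Lambda> \<mm>) (localize_module R \<Lambda> \<mm> X)
      = iso_class (localize_ring R \<Lambda> \<mm>) (localize_module R \<Lambda> \<mm> P)" if "X \<in> b" for X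
  proof -
    have X: "right_module \<Lambda> X" "rmod_iso \<Lambda> X P" using that unfolding b(2) iso_class_def by auto
    have cg: "cg_projective \<Lambda> X" by (rule cg_projective_iso[OF P rmod_iso_sym[OF X(2,1)] X(1)])
    then have prX: "projective \<Lambda> X" by (simp add: cg_projective_def)
    note lX = module_localization[OF m prX]
    show ?thesis
      using iso_class_eq_iff[OF C.loc_module_cg_projective[OF lX cg] C.loc_moduleD(2)[OF lP]]
        C.loc_module_iso[OF lX lP X(2)] by simp
  qed
  then have "(\<Union>X\<in>b. iso_class (localize_ring R \<Lambda> \<mm>) (localize_module R \<Lambda> \<mm> X))
      = iso_class (localize_ring R \<Lambda> \<mm>) (localize_module R \<Lambda> \<mm> P)" using assms(5) by blast
  then show ?thesis unfolding localization_map_def using m b(1) by (simp only: restrict_apply' if_True)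
qed

text \<open>The localizations of \<open>P\<close> and \<open>A\<close> are replaced by copies in the element type used for isomorphism
  classes; the copies are again localizations of \<open>P\<close> and \<open>A\<close>.\<close>

lemma localization_map_B_set:
  assumes b: "b \<in> B_set \<Lambda>"
  shows "localization_map R \<Lambda> b \<in> (\<Pi>\<^sub>E \<mm>\<in>max_spec R. B_set (localize_ring R \<Lambda> \<mm>))"
proof -
  obtain P A :: "('a, nat \<Rightarrow> 'a) rmodule" where bP: "b = iso_class \<Lambda> P" and bV: "b \<in> carrier (V_star \<Lambda>)" and P: "cg_projective \<Lambda> P"
    and nfg: "\<not> finitely_generated \<Lambda> P" and A: "cg_projective \<Lambda> A" and PA: "rmod_iso \<Lambda> (binary_sum P (omega_sum A)) P"
    and fg: "finitely_generated \<Lambda> (rquot P (module_ideal_mult \<Lambda> P (trace_ideal \<Lambda> A)))"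
    by (rule B_setE[OF b])
  have prP: "projective \<Lambda> P" and prA: "projective \<Lambda> A" using P A by (auto simp: cg_projective_def)
  have Pb: "P \<in> b" unfolding bP iso_class_def using cg_projective_right_module[OF P] rmod_iso_refl by blast
  have "localization_map R \<Lambda> b \<mm> \<in> B_set (localize_ring R \<Lambda> \<mm>)" if m: "\<mm> \<in> max_spec R" for \<mm>
  proof -
    let ?L = "localize_ring R \<Lambda> \<mm>" and ?P = "localize_module R \<Lambda> \<mm> P" and ?A = "localize_module R \<Lambda> \<mm> A"
    interpret C: central_localization \<Lambda> ?L "dens \<mm>" "jm \<mm>" by (rule ring_localization[OF m])
    note lP = module_localization[OF m prP] and lA = module_localization[OF m prA]
    have cgP: "cg_projective ?L ?P" by (rule C.loc_module_cg_projective[OF lP P])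
    have cgA: "cg_projective ?L ?A" by (rule C.loc_module_cg_projective[OF lA A])
    obtain X :: "(('a \<times> ('r \<times> 'r) set \<Rightarrow>\<^sub>0 int) set, nat \<Rightarrow> ('a \<times> ('r \<times> 'r) set \<Rightarrow>\<^sub>0 int) set) rmodule"
      where X: "cg_projective ?L X" "rmod_iso ?L ?P X" by (rule cg_projective_copy[OF cgP])
    obtain Y :: "(('a \<times> ('r \<times> 'r) set \<Rightarrow>\<^sub>0 int) set, nat \<Rightarrow> ('a \<times> ('r \<times> 'r) set \<Rightarrow>\<^sub>0 int) set) rmodule"
      where Y: "cg_projective ?L Y" "rmod_iso ?L ?A Y" by (rule cg_projective_copy[OF cgA])
    obtain \<iota> where lX: "C.loc_module P X \<iota>"
      by (rule C.loc_module_compose_iso[OF lP cg_projective_right_module[OF X(1)] X(2)])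
    obtain \<kappa> where lY: "C.loc_module A Y \<kappa>"
      by (rule C.loc_module_compose_iso[OF lA cg_projective_right_module[OF Y(1)] Y(2)])
    note big = C.loc_module_relatively_big[OF P A PA fg lX lY]
    have "iso_class ?L X \<in> B_set ?L"
      by (rule B_setI[OF big(1) _ big(2,3,4)]) (use big(5) nfg in blast)
    moreover have "iso_class ?L ?P = iso_class ?L X"
      using iso_class_eq_iff[OF cgP cg_projective_right_module[OF X(1)]] X(2) by simp
    ultimately show ?thesis unfolding localization_map_iso_class[OF m bV bP P Pb] by simp
  qed
  moreover have "localization_map R \<Lambda> b \<in> extensional (max_spec R)"
    unfolding localization_map_def using bV by (simp only: restrict_apply' restrict_extensional)
  ultimately show ?thesis by (auto simp: PiE_iff)
qed

lemma localization_map_inj_on_B_set: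
  assumes simple: "simple_artinian (tensor_ring R \<Lambda> (fraction_field R))"
    and b: "b \<in> B_set \<Lambda>" and b': "b' \<in> B_set \<Lambda>" and eq: "localization_map R \<Lambda> b = localization_map R \<Lambda> b'"
  shows "b = b'"
proof -
  obtain P A :: "('a, nat \<Rightarrow> 'a) rmodule" where bP: "b = iso_class \<Lambda> P" and bV: "b \<in> carrier (V_star \<Lambda>)" and P: "cg_projective \<Lambda> P"
    and nfg: "\<not> finitely_generated \<Lambda> P" and A: "cg_projective \<Lambda> A" and PA: "rmod_iso \<Lambda> (binary_sum P (omega_sum A)) P"
    and fgP: "finitely_generated \<Lambda> (rquot P (module_ideal_mult \<Lambda> P (trace_ideal \<Lambda> A)))"
    by (rule B_setE[OF b])
  obtain Q B :: "('a, nat \<Rightarrow> 'a) rmodule" where bQ: "b' = iso_class \<Lambda> Q" and b'V: "b' \<in> carrier (V_star \<Lambda>)" and Q: "cg_projective \<Lambda> Q"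
    and nfgQ: "\<not> finitely_generated \<Lambda> Q" and B: "cg_projective \<Lambda> B" and QB: "rmod_iso \<Lambda> (binary_sum Q (omega_sum B)) Q"
    and fgQ: "finitely_generated \<Lambda> (rquot Q (module_ideal_mult \<Lambda> Q (trace_ideal \<Lambda> B)))"
    by (rule B_setE[OF b'])
  have prP: "projective \<Lambda> P" and prQ: "projective \<Lambda> Q" using P Q by (auto simp: cg_projective_def)
  have Pb: "P \<in> b" unfolding bP iso_class_def using cg_projective_right_module[OF P] rmod_iso_refl by blast
  have Qb: "Q \<in> b'" unfolding bQ iso_class_def using cg_projective_right_module[OF Q] rmod_iso_refl by blast
  have "rmod_iso (localize_ring R \<Lambda> \<mm>) (localize_module R \<Lambda> \<mm> P) (localize_module R \<Lambda> \<mm> Q)"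
    if m: "\<mm> \<in> max_spec R" for \<mm>
  proof -
    interpret C: central_localization \<Lambda> "localize_ring R \<Lambda> \<mm>" "dens \<mm>" "jm \<mm>" by (rule ring_localization[OF m])
    have "iso_class (localize_ring R \<Lambda> \<mm>) (localize_module R \<Lambda> \<mm> P)
        = iso_class (localize_ring R \<Lambda> \<mm>) (localize_module R \<Lambda> \<mm> Q)"
      using localization_map_iso_class[OF m bV bP P Pb] localization_map_iso_class[OF m b'V bQ Q Qb] eq by simp
    then show ?thesis
      using iso_class_eq_iff[OF C.loc_module_cg_projective[OF module_localization[OF m prP] P]
          C.loc_moduleD(2)[OF module_localization[OF m prQ]]] by simp
  qed
  then have "rmod_iso \<Lambda> P Q" by (rule iso_of_locally_iso[OF simple P A PA fgP nfg Q B QB fgQ])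
  then show ?thesis
    unfolding bP bQ using iso_class_eq_iff[OF P cg_projective_right_module[OF Q]] by simp
qed

end

theorem proposition7p1:
  fixes R :: "('r, 'x) ring_scheme" and \<Lambda> :: "('r, 'a, 'y) module_scheme"
  assumes "h_local_domain R"
    and "assoc_algebra R \<Lambda>"
    and "torsion_free R \<Lambda>"
    and "locally_semiperfect R \<Lambda>"
    and "simple_artinian (tensor_ring R \<Lambda> (fraction_field R))"
  shows "localization_map R \<Lambda> ` B_set \<Lambda>
      \<subseteq> (\<Pi>\<^sub>E \<mm>\<in>max_spec R. B_set (localize_ring R \<Lambda> \<mm>)) \<and>
    (\<forall>b\<in>B_set \<Lambda>. \<forall>b'\<in>B_set \<Lambda>. localization_map R \<Lambda> b = localization_map R \<Lambda> b' \<longleftrightarrow> b = b')"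
proof -
  have "ring (localize_ring R \<Lambda> \<mm>)" if "\<mm> \<in> max_spec R" for \<mm>
    using assms(4) that unfolding locally_semiperfect_def semiperfect_ring_def by blast
  then interpret local_algebra R \<Lambda>
    by (intro local_algebra.intro local_algebra_axioms.intro h_localI assms)
  show ?thesis
    using localization_map_B_set localization_map_inj_on_B_set[OF assms(5)] by blast
qed

end
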